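(* Let $G=(V,E)$ be a bounded degree, uniformly ballistic graph such that $\|P\|_{\mathrm{bub}}<\infty$, and let $\mathrm H$ be a uniform recurrent sandpile on $G$. Then there exist constants $0<a\le A<\infty$, depending only on $G$, such that for every vertex $v$ and every $n\ge1$, $$a\,q(v)^2n^{-1}\le\mathbb P\bigl(\mathrm{diam}_{\mathrm{ext}}(\mathrm{AvC}_v(\mathrm H))\ge n\bigr)\le A n^{-1},$$ $$a\,q(v)^{5/2}n^{-1/2}\le\mathbb P\bigl(|\mathrm{AvC}_v(\mathrm H)|\ge n\bigr)\le A n^{-1/2},$$ $$a\,q(v)^{5/2}n^{-1/2}\le\mathbb P\bigl(|\mathrm{Av}_v(\mathrm H)|\ge n\bigr)\le A n^{-1/2}.$$
   Context: Graphs are connected. For simple random walk $X$ on $G$, $\mathbf E_v$ denotes expectation when started at $v$, $P$ is its Markov operator, and $p_n(x,y)$ is the probability that the walk started at $x$ is at $y$ at time $n$. Set $\|P^n\|_{1\to\infty}=\sup_{u,v\in V}p_n(u,v)$ and $\|P\|_{\mathrm{bub}}=\sum_{n\ge0}(n+1)\|P^n\|_{1\to\infty}$. With $d$ the graph distance, $G$ is uniformly ballistic if there is a constant $C$ such that $\sup_{v\in V}\mathbf E_v[\sup\{n\ge0:d(v,X_n)\le r\}]\le Cr$ for every $r\ge1$. $q(v)$ is the probability that two independent random walks $X,Y$ started at $v$ never return to $v$ or intersect each other after time zero, i.e. that $\{X_i:i>0\}$, $\{Y_i:i>0\}$ and $\{v\}$ are mutually disjoint. A sandpile on $K\subseteq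 V$ is a function $\eta:K\to\{0,1,2,\dots\}$; it is stable at $x$ if $\eta(x)<\deg(x)$, unstable at $x$ otherwise, and stable if it is stable at every $x\in K$. If $\eta$ is unstable at $x$, toppling $\eta$ at $x$ replaces $\eta(x)$ by $\eta(x)-\deg(x)$ and increases $\eta(y)$ by the number of edges between $x$ and $y$ for each $y\in K\setminus\{x\}$ (grains sent to $V\setminus K$ are lost). For finite $K\ne V$, successive topplings of unstable vertices always lead to a stable configuration that does not depend on the order. Consider the Markov chain on stable sandpiles on $K$ that at each step adds a grain at a uniformly random vertex of $K$ and stabilizes; it has a unique closed communicating class, whose elements are called recurrent configurations. If every component of the wired uniform spanning forest of $G$ is one-ended almost surely (which holds for the graphs considered here), then for any increasing sequence of finite sets $V_n$ with union $V$, the uniform measures on recurrent configurations on $V_n$ converge weakly to a probability measure on sandpiles on $V$, independent of the exhaustion; a random sandpile $\mathrm H$ with this law is called a uniform recurrent sandpile on $G$. Add one grain at $v$ to $\mathrm H$ and topple unstable vertices in order to stabilize. The avalanche $\mathrm{Av}_v(\mathrm H)$ is the multiset of vertices that topple, counted according to the number of times they topple (the number of times $u$ topples being the supremum over finite legal toppling sequences), and $|\mathrm{Av}_v(\mathrm H)|$ is the total number of topplings. The avalanche cluster $\mathrm{AvC}_v(\mathrm H)$ is the set of vertices that topple at least once. $\mathrm{diam}_{\mathrm{ext}}(K)$ is the supremal graph distance in $G$ between two vertices of $K$ (zero if $K=\emptyset$). *)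

theory Defs
  imports "HOL-Probability.Probability"
begin

section \<open>Graphs\<close>

text \<open>
  A locally finite multigraph on the vertex type is given by its adjacency multisets: the number
  of edges between \<open>x\<close> and \<open>y\<close> is \<open>count (G x) y\<close>. Multiple edges are allowed, loops are not
  (toppling a vertex with a loop, with the loop counted in its degree, would destroy grains).
\<close>

type_synonym 'a mgraph = "'a \<Rightarrow> 'a multiset"

definition edge_rel :: "'a mgraph \<Rightarrow> ('a \<times> 'a) set" where
  "edge_rel G = {(x, y). y \<in># G x}"

definition connected_graph :: "'a mgraph \<Rightarrow> bool" where
  "connected_graph G \<longleftrightarrow>
     (\<forall>x y. count (G x) y = count (G y) x) \<and>
     (\<forall>x. x \<notin># G x) \<and>
     (\<forall>x y. (x, y) \<in> (edge_rel G)\<^sup>*)"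

definition deg :: "'a mgraph \<Rightarrow> 'a \<Rightarrow> nat" where
  "deg G x = size (G x)"

definition bounded_degree :: "'a mgraph \<Rightarrow> bool" where
  "bounded_degree G \<longleftrightarrow> (\<exists>D. \<forall>x. deg G x \<le> D)"

definition gdist :: "'a mgraph \<Rightarrow> 'a \<Rightarrow> 'a \<Rightarrow> nat" where
  "gdist G x y = (LEAST n. (x, y) \<in> edge_rel G ^^ n)"

definition diam_ext :: "'a mgraph \<Rightarrow> 'a set \<Rightarrow> enat" where
  "diam_ext G K = (SUP x\<in>K. SUP y\<in>K. enat (gdist G x y))"

section \<open>Simple random walk\<close>

text \<open>
  The law of the trajectory \<open>(X\<^sub>0, X\<^sub>1, \<dots>)\<close> of the walk started at \<open>v\<close> is the Ionescu-Tulcea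
  measure of the kernels \<open>srw_kernel G v i\<close>, which give the law of \<open>X\<^sub>i\<close> given \<open>X\<^sub>0, \<dots>, X\<^bsub>i-1\<^esub>\<close>.
\<close>

definition srw_kernel :: "'a mgraph \<Rightarrow> 'a \<Rightarrow> nat \<Rightarrow> (nat \<Rightarrow> 'a) \<Rightarrow> 'a measure" where
  "srw_kernel G v i \<omega> =
     measure_pmf (if i = 0 then return_pmf v else pmf_of_multiset (G (\<omega> (i - 1))))"

definition srw :: "'a mgraph \<Rightarrow> 'a \<Rightarrow> (nat \<Rightarrow> 'a) measure" where
  "srw G v = projective_family.lim UNIV
     (Ionescu_Tulcea.CI (srw_kernel G v) (\<lambda>_. count_space UNIV)) (\<lambda>_. count_space UNIV)"

definition trans_prob :: "'a mgraph \<Rightarrow> nat \<Rightarrow> 'a \<Rightarrow> 'a \<Rightarrow> real" where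
  "trans_prob G n x y = measure (srw G x) {X \<in> space (srw G x). X n = y}"

definition norm_1_inf :: "'a mgraph \<Rightarrow> nat \<Rightarrow> ennreal" where
  "norm_1_inf G n = (SUP u. SUP v. ennreal (trans_prob G n u v))"

definition bubble_norm :: "'a mgraph \<Rightarrow> ennreal" where
  "bubble_norm G = (\<Sum>n. of_nat (n + 1) * norm_1_inf G n)"

definition last_visit :: "'a mgraph \<Rightarrow> 'a \<Rightarrow> real \<Rightarrow> (nat \<Rightarrow> 'a) \<Rightarrow> enat" where
  "last_visit G v r X = (SUP n\<in>{n. real (gdist G v (X n)) \<le> r}. enat n)"

definition uniformly_ballistic :: "'a mgraph \<Rightarrow> bool" where
  "uniformly_ballistic G \<longleftrightarrow>
     (\<exists>C::real. \<forall>r\<ge>1. (SUP v. \<integral>\<^sup>+X. ennreal_of_enat (last_visit G v r X) \<partial>srw G v)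
                       \<le> ennreal (C * r))"

text \<open>The quantity usually denoted \<open>q(v)\<close>.\<close>

definition nonint_prob :: "'a mgraph \<Rightarrow> 'a \<Rightarrow> real" where
  "nonint_prob G v = measure (srw G v \<Otimes>\<^sub>M srw G v)
     {(X, Y) \<in> space (srw G v \<Otimes>\<^sub>M srw G v).
        X ` {0<..} \<inter> Y ` {0<..} = {} \<and> v \<notin> X ` {0<..} \<and> v \<notin> Y ` {0<..}}"

section \<open>Sandpiles\<close>

text \<open>
  A sandpile on \<open>K\<close> is represented by a function on all vertices that vanishes outside \<open>K\<close>.
\<close>

definition stable :: "'a mgraph \<Rightarrow> 'a set \<Rightarrow> ('a \<Rightarrow> nat) \<Rightarrow> bool" where
  "stable G K \<eta> \<longleftrightarrow> (\<forall>x\<in>K. \<eta> x < deg G x)"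

definition stable_sandpiles :: "'a mgraph \<Rightarrow> 'a set \<Rightarrow> ('a \<Rightarrow> nat) set" where
  "stable_sandpiles G K = {\<eta>. (\<forall>x. x \<notin> K \<longrightarrow> \<eta> x = 0) \<and> stable G K \<eta>}"

definition topple :: "'a mgraph \<Rightarrow> 'a set \<Rightarrow> 'a \<Rightarrow> ('a \<Rightarrow> nat) \<Rightarrow> ('a \<Rightarrow> nat)" where
  "topple G K x \<eta> = (\<lambda>y. if y = x then \<eta> x - deg G x
                         else if y \<in> K then \<eta> y + count (G x) y else \<eta> y)"

fun legal :: "'a mgraph \<Rightarrow> 'a set \<Rightarrow> ('a \<Rightarrow> nat) \<Rightarrow> 'a list \<Rightarrow> bool" where
  "legal G K \<eta> [] \<longleftrightarrow> True"
| "legal G K \<eta> (x # xs) \<longleftrightarrow> x \<in> K \<and> deg G x \<le> \<eta> x \<and> legal G K (topple G K x \<eta>) xs"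

definition stabilization :: "'a mgraph \<Rightarrow> 'a set \<Rightarrow> ('a \<Rightarrow> nat) \<Rightarrow> ('a \<Rightarrow> nat)" where
  "stabilization G K \<eta> =
     (THE \<eta>'. \<exists>xs. legal G K \<eta> xs \<and> \<eta>' = fold (topple G K) xs \<eta> \<and> stable G K \<eta>')"

definition add_grain :: "'a \<Rightarrow> ('a \<Rightarrow> nat) \<Rightarrow> ('a \<Rightarrow> nat)" where
  "add_grain v \<eta> = \<eta>(v := \<eta> v + 1)"

definition sandpile_chain :: "'a mgraph \<Rightarrow> 'a set \<Rightarrow> ('a \<Rightarrow> nat) \<Rightarrow> ('a \<Rightarrow> nat) pmf" where
  "sandpile_chain G K \<eta> = map_pmf (\<lambda>v. stabilization G K (add_grain v \<eta>)) (pmf_of_set K)"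

definition accessible :: "'a mgraph \<Rightarrow> 'a set \<Rightarrow> (('a \<Rightarrow> nat) \<times> ('a \<Rightarrow> nat)) set" where
  "accessible G K = {(\<eta>, \<eta>'). \<eta>' \<in> set_pmf (sandpile_chain G K \<eta>)}\<^sup>*"

text \<open>
  Reading the equivalence from right to left, the elements of \<open>C\<close> communicate; from left to right,
  \<open>C\<close> is closed.
\<close>

definition closed_communicating_class :: "'a mgraph \<Rightarrow> 'a set \<Rightarrow> ('a \<Rightarrow> nat) set \<Rightarrow> bool" where
  "closed_communicating_class G K C \<longleftrightarrow> C \<noteq> {} \<and> C \<subseteq> stable_sandpiles G K \<and>
     (\<forall>\<eta>\<in>C. \<forall>\<eta>'. (\<eta>, \<eta>') \<in> accessible G K \<longleftrightarrow> \<eta>' \<in> C)"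

definition recurrent :: "'a mgraph \<Rightarrow> 'a set \<Rightarrow> ('a \<Rightarrow> nat) set" where
  "recurrent G K = \<Union>{C. closed_communicating_class G K C}"

section \<open>The uniform recurrent sandpile\<close>

definition uniform_recurrent :: "'a mgraph \<Rightarrow> 'a set \<Rightarrow> ('a \<Rightarrow> nat) measure" where
  "uniform_recurrent G K = distr (measure_pmf (pmf_of_set (recurrent G K))) borel (\<lambda>\<eta>. \<eta>)"

definition converges_weakly ::
    "(nat \<Rightarrow> 'b::topological_space measure) \<Rightarrow> 'b measure \<Rightarrow> bool" where
  "converges_weakly \<nu> \<mu> \<longleftrightarrow>
     (\<forall>f::'b \<Rightarrow> real. continuous_on UNIV f \<and> bounded (range f) \<longrightarrow>
        (\<lambda>n. \<integral>x. f x \<partial>\<nu> n) \<longlonglongrightarrow> (\<integral>x. f x \<partial>\<mu>))"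

text \<open>
  The topology on \<open>'a \<Rightarrow> nat\<close> is the product topology. Since the sets \<open>V n\<close> exhaust the vertices,
  the values given to sandpiles on \<open>V n\<close> outside \<open>V n\<close> do not affect the limit.
\<close>

definition uniform_recurrent_sandpile_law :: "'a mgraph \<Rightarrow> ('a \<Rightarrow> nat) measure \<Rightarrow> bool" where
  "uniform_recurrent_sandpile_law G \<mu> \<longleftrightarrow> prob_space \<mu> \<and> sets \<mu> = sets borel \<and>
     (\<forall>V. incseq V \<and> (\<forall>n. finite (V n)) \<and> (\<Union>n. V n) = UNIV \<longrightarrow>
        converges_weakly (\<lambda>n. uniform_recurrent G (V n)) \<mu>)"

section \<open>Avalanches\<close>

text \<open>The avalanche is a multiset with possibly infinite multiplicities.\<close>

definition Av :: "'a mgraph \<Rightarrow> 'a \<Rightarrow> ('a \<Rightarrow> nat) \<Rightarrow> 'a \<Rightarrow> enat" where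
  "Av G v \<eta> u = (SUP xs\<in>{xs. legal G UNIV (add_grain v \<eta>) xs}. enat (count_list xs u))"

definition Av_size :: "'a mgraph \<Rightarrow> 'a \<Rightarrow> ('a \<Rightarrow> nat) \<Rightarrow> ennreal" where
  "Av_size G v \<eta> = (\<Sum>\<^sub>\<infinity>u. ennreal_of_enat (Av G v \<eta> u))"

definition AvC :: "'a mgraph \<Rightarrow> 'a \<Rightarrow> ('a \<Rightarrow> nat) \<Rightarrow> 'a set" where
  "AvC G v \<eta> = {u. Av G v \<eta> u \<ge> 1}"

definition AvC_size :: "'a mgraph \<Rightarrow> 'a \<Rightarrow> ('a \<Rightarrow> nat) \<Rightarrow> ennreal" where
  "AvC_size G v \<eta> = emeasure (count_space UNIV) (AvC G v \<eta>)"

section \<open>The trajectory law is well defined\<close>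

lemma Ionescu_Tulcea_srw: "Ionescu_Tulcea (srw_kernel G v) (\<lambda>_. count_space UNIV)"
proof (rule Ionescu_Tulcea.intro)
  fix i
  show "srw_kernel G v i \<in> measurable (PiM {0..<i} (\<lambda>_. count_space UNIV))
          (subprob_algebra (count_space UNIV))"
  proof (cases "i = 0")
    case True
    then have "srw_kernel G v i = (\<lambda>\<omega>. measure_pmf (return_pmf v))"
      by (simp add: srw_kernel_def fun_eq_iff)
    moreover have "measure_pmf (return_pmf v) \<in> space (subprob_algebra (count_space UNIV))"
      by (simp add: space_subprob_algebra measure_pmf.subprob_space_axioms)
    ultimately show ?thesis
      using measurable_const by metis
  next
    case False
    have 1: "i - 1 \<in> {0..<i}"
      using False by simp
    have 2: "(\<lambda>x. measure_pmf (pmf_of_multiset (G x))) \<in>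
        measurable (count_space UNIV) (subprob_algebra (count_space UNIV))"
      by (simp add: space_subprob_algebra measure_pmf.subprob_space_axioms)
    have "(\<lambda>\<omega>. measure_pmf (pmf_of_multiset (G (\<omega> (i - 1))))) \<in>
        measurable (PiM {0..<i} (\<lambda>_. count_space UNIV)) (subprob_algebra (count_space UNIV))"
      by (rule measurable_compose[OF measurable_component_singleton[OF 1] 2])
    moreover have "srw_kernel G v i = (\<lambda>\<omega>. measure_pmf (pmf_of_multiset (G (\<omega> (i - 1)))))"
      using False by (simp add: srw_kernel_def fun_eq_iff)
    ultimately show ?thesis by simp
  qed
next
  fix i x
  show "prob_space (srw_kernel G v i x)"
    by (auto simp: srw_kernel_def intro: measure_pmf.prob_space_axioms)
qed

lemma sets_srw: "sets (srw G v) = sets (PiM UNIV (\<lambda>_. count_space UNIV))"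
proof -
  interpret Ionescu_Tulcea "srw_kernel G v" "\<lambda>_. count_space UNIV"
    by (rule Ionescu_Tulcea_srw)
  show ?thesis by (simp add: srw_def)
qed

lemma space_srw: "space (srw G v) = UNIV"
  using sets_eq_imp_space_eq[OF sets_srw[of G v]] by (simp add: space_PiM)

lemma prob_space_srw: "prob_space (srw G v)"
proof -
  interpret Ionescu_Tulcea "srw_kernel G v" "\<lambda>_. count_space UNIV"
    by (rule Ionescu_Tulcea_srw)
  let ?E = "PiM {} (\<lambda>_. count_space UNIV) :: (nat \<Rightarrow> 'a) measure"
  have "emeasure (srw G v) (prod_emb UNIV (\<lambda>_. count_space UNIV) {} (space ?E)) =
      emeasure (CI {}) (space ?E)"
    unfolding srw_def by (rule lim) auto
  also have "\<dots> = 1"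
    using prob_space.emeasure_space_1[OF PF.prob_space_P[of "{}"]] by (simp add: CI_def)
  also have "prod_emb UNIV (\<lambda>_. count_space UNIV) {} (space ?E) = space (srw G v)"
    by (auto simp: space_srw prod_emb_def space_PiM)
  finally show ?thesis
    by (rule prob_spaceI)
qed

text \<open>The finite-dimensional distributions are those of the Markov chain.\<close>

lemma emeasure_srw_cylinder:
  "emeasure (srw G v) {X. \<forall>i\<le>n. X i = x i} =
     ennreal (indicator {v} (x 0) * (\<Prod>i<n. pmf (pmf_of_multiset (G (x i))) (x (Suc i))))"
proof -
  interpret Ionescu_Tulcea "srw_kernel G v" "\<lambda>_. count_space UNIV"
    by (rule Ionescu_Tulcea_srw)
  let ?M = "\<lambda>_::nat. count_space (UNIV :: 'a set)"
  define B where "B n = PiE {0..<n} (\<lambda>i. {x i})" for n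
  have B: "B n \<in> sets (PiM {0..<n} ?M)" for n
    unfolding B_def by (intro sets_PiM_I_finite) auto
  have B_iff: "\<omega> \<in> B n \<longleftrightarrow> (\<forall>i<n. \<omega> i = x i)" if "\<omega> \<in> space (PiM {0..<n} ?M)" for n \<omega>
    using that by (simp add: B_def space_PiM PiE_iff) (metis atLeastLessThan_iff le0)
  have step: "emeasure (eP n \<omega>) (B (Suc n)) =
      (if n = 0 then indicator {v} (x 0) else ennreal (pmf (pmf_of_multiset (G (x (n - 1)))) (x n)))
      * indicator (B n) \<omega>" (is "_ = ?k n * _")
    if \<omega>: "\<omega> \<in> space (PiM {0..<n} ?M)" for n \<omega>
  proof -
    have upd: "fun_upd \<omega> n y \<in> space (PiM {0..<Suc n} ?M)" for y
      using \<omega> by (auto simp: space_PiM PiE_iff extensional_def)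
    have "fun_upd \<omega> n y \<in> B (Suc n) \<longleftrightarrow> \<omega> \<in> B n \<and> y = x n" for y
      by (simp only: B_iff[OF upd] B_iff[OF \<omega>] less_Suc_eq) auto
    then have "(\<lambda>y. fun_upd \<omega> n y) -` B (Suc n) \<inter> space (count_space UNIV) = (if \<omega> \<in> B n then {x n} else {})"
      by auto
    then have "emeasure (eP n \<omega>) (B (Suc n)) =
        (if \<omega> \<in> B n then emeasure (srw_kernel G v n \<omega>) {x n} else 0)"
      using emeasure_eP[OF \<omega> B] by simp
    moreover have "emeasure (srw_kernel G v n \<omega>) {x n} = ?k n" if "\<omega> \<in> B n"
    proof (cases "n = 0")
      case True
      then show ?thesis
        by (simp add: srw_kernel_def emeasure_pmf_single indicator_def)
    next
      case False
      then have "\<omega> (n - 1) = x (n - 1)"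
        using \<open>\<omega> \<in> B n\<close> B_iff[OF \<omega>] by simp
      then show ?thesis
        using False by (simp add: srw_kernel_def emeasure_pmf_single)
    qed
    ultimately show ?thesis
      by simp
  qed
  have undef: "(\<lambda>_. undefined) \<in> space (PiM {0..<0} ?M)"
    by (simp add: space_PiM)
  have sets_C0: "sets (C 0 n (\<lambda>_. undefined)) = sets (PiM {0..<n} ?M)" for n
    using sets_C[OF undef, of n] by simp
  have rec: "emeasure (C 0 (Suc n) (\<lambda>_. undefined)) (B (Suc n)) =
      ?k n * emeasure (C 0 n (\<lambda>_. undefined)) (B n)" for n
  proof -
    have "emeasure (C 0 (Suc n) (\<lambda>_. undefined)) (B (Suc n)) =
        (\<integral>\<^sup>+\<omega>. emeasure (eP n \<omega>) (B (Suc n)) \<partial>C 0 n (\<lambda>_. undefined))"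
      unfolding C.simps add_0_left
      by (rule emeasure_bind[OF _ _ B])
        (use space_C[OF undef, of n] measurable_eP[of n] in
          \<open>auto simp: measurable_cong_sets[OF sets_C0 refl] space_PiM\<close>)
    also have "\<dots> = (\<integral>\<^sup>+\<omega>. ?k n * indicator (B n) \<omega> \<partial>C 0 n (\<lambda>_. undefined))"
      by (intro nn_integral_cong step) (use space_C[OF undef, of n] in simp)
    also have "\<dots> = ?k n * emeasure (C 0 n (\<lambda>_. undefined)) (B n)"
      by (intro nn_integral_cmult_indicator) (simp add: sets_C0 B)
    finally show ?thesis .
  qed
  have "emeasure (C 0 0 (\<lambda>_. undefined)) (B 0) = 1"
    using emeasure_return[OF B[of 0], of "\<lambda>_. undefined"] by (simp add: B_def)
  then have "emeasure (C 0 (Suc n) (\<lambda>_. undefined)) (B (Suc n)) =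
      ennreal (indicator {v} (x 0) * (\<Prod>i<n. pmf (pmf_of_multiset (G (x i))) (x (Suc i))))"
  proof (induction n)
    case 0
    then show ?case
      using rec[of 0] by (simp add: indicator_def)
  next
    case (Suc n)
    then show ?case
      using rec[of "Suc n"]
      by (simp add: ennreal_mult[symmetric] prod_nonneg mult_ac del: C.simps pmf_of_multiset)
  qed
  moreover have "emeasure (srw G v) (prod_emb UNIV ?M {0..<Suc n} (B (Suc n))) =
      emeasure (C 0 (Suc n) (\<lambda>_. undefined)) (B (Suc n))"
  proof -
    have "prod_emb {0..<Suc n} ?M {0..<Suc n} (B (Suc n)) = B (Suc n)"
      by (rule prod_emb_id) (auto simp: B_def)
    then show ?thesis
      using lim[OF _ B[of "Suc n"]] emeasure_CI[OF order_refl B[of "Suc n"]] by (simp add: srw_def)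
  qed
  moreover have "prod_emb UNIV ?M {0..<Suc n} (B (Suc n)) = {X. \<forall>i\<le>n. X i = x i}"
    by (auto simp: prod_emb_def B_def PiE_iff space_PiM less_Suc_eq_le)
  ultimately show ?thesis
    by simp
qed

end

theory Submission
  imports Defs
begin

text \<open>
  All estimates are made in finite sets \<open>K\<close> of vertices, uniformly in \<open>K\<close>, and passed to the limit;
  this is possible since the events are increasing limits of events that depend on finitely many
  vertices. By burning, recurrent configurations correspond to rooted spanning forests, and an
  avalanche at \<open>v\<close> decomposes into waves, each of which topples the vertices of the component of \<open>v\<close> in the
  forest of \<open>K - {v}\<close>. Counted over all recurrent configurations, the waves are distributed as this
  component up to a factor between two positive constants, and a wave is the last one if and only if some
  neighbour of \<open>v\<close> is not in the component.

  The probability that the component of \<open>v\<close> reaches distance \<open>n\<close> is of order at most \<open>1 / n\<close>: running random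
  walk excursions that rewrite the edges of the forest preserves its law. If the number of excursions
  is of order \<open>1 / n\<close> times the total rate, an excursion ends at \<open>v\<close> only with probability of order
  \<open>1 / n\<close>, whereas every long path to \<open>v\<close> has capacity of order \<open>n\<close> and is likely to be hit; this gives a
  recursion in \<open>n\<close>. The volume within distance \<open>r\<close> has mean of order at most \<open>r\<close>, and taking \<open>r\<close> of order
  the square root of \<open>n\<close> bounds the tail of the volume.

  For the lower bounds, the first moment of the number of vertices at distance of order \<open>r\<close> in the component,
  on the event that the component misses a neighbour of \<open>v\<close>, is of order at least \<open>q r\<close>: by reversibility the
  path from such a vertex is the path of a walk from \<open>v\<close>, and a second walk has to avoid it. The
  second moment is of order at most the cube of \<open>r\<close>, and the Cauchy--Schwarz inequality yields the
  order \<open>q\<^sup>2 / r\<close>.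
\<close>

text \<open>The obstacle: the component of \<open>v\<close> has a bounded mean number of vertices
  per sphere, so a first moment bounds the arm probability by a constant only. The missing factor is
  gained by feeding the bound at scale \<open>n\<close> into the estimate at scale
  \<open>3 n\<close>, with a coefficient small enough to make up for the change of scale; hence a
  typical path of length \<open>n\<close> must be destroyed with high probability. The bubble norm
  makes this possible: it keeps the mean energy of a path linear in \<open>n\<close>, so that its
  capacity is of order \<open>n\<close> too.

  Random forests are finite sums over functions, weighted by transition probabilities. Instead of
  running Wilson's algorithm, the law of a root is shown to be harmonic by induction on
  \<open>K\<close>, and the rest follows from a Markov property for the complement of a path.
  Likewise the burning bijection is replaced with two counts that obey the same deletion-contraction
  recursion.

  The exponent 5/2: a first moment of order \<open>q r\<close>, carried by an event of probability
  at most of order \<open>1 / r\<close>, yields a volume of order \<open>q\<close> times the square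
  of \<open>r\<close>. Volume \<open>n\<close> thus needs \<open>r\<close> of order sqrt(n / q),
  where the lower bound is of order \<open>q\<^sup>2 / r\<close>.\<close>

lemma sum_of_bool_eq:
  fixes f :: "'b \<Rightarrow> 'c::semiring_1"
  assumes "finite S" shows "(\<Sum>z\<in>S. of_bool (x = z) * f z) = (if x \<in> S then f x else 0)"
proof -
  have "(\<Sum>z\<in>S. of_bool (x = z) * f z) = (\<Sum>z\<in>S. if x = z then f z else 0)" by (rule sum.cong) auto
  then show ?thesis using assms by simp
qed

section \<open>The transition operator of a reversible walk\<close>

locale sgraph =
  fixes G :: "'a mgraph"
  assumes count_sym: "count (G x) y = count (G y) x"
    and no_loop: "x \<notin># G x"
    and no_isolated: "S \<noteq> {} \<Longrightarrow> S \<noteq> UNIV \<Longrightarrow> \<exists>x\<in>S. \<exists>y. y \<notin> S \<and> y \<in># G x"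
    and infinite_vertices: "infinite (UNIV :: 'a set)"
begin

abbreviation N :: "'a \<Rightarrow> 'a set" where "N x \<equiv> set_mset (G x)"
abbreviation dg :: "'a \<Rightarrow> real" where "dg x \<equiv> real (deg G x)"

definition p :: "'a \<Rightarrow> 'a \<Rightarrow> real" where "p x y = real (count (G x) y) / dg x"

definition PP :: "('a \<Rightarrow> real) \<Rightarrow> 'a \<Rightarrow> real" where "PP u x = (\<Sum>y\<in>N x. p x y * u y)"

primrec pn :: "nat \<Rightarrow> 'a \<Rightarrow> 'a \<Rightarrow> real" where
  "pn 0 x y = of_bool (x = y)"
| "pn (Suc n) x y = PP (\<lambda>z. pn n z y) x"

lemma N_ne: "N x \<noteq> {}"
proof -
  have "UNIV \<noteq> {x}" using infinite_vertices by (metis finite.simps)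
  then show ?thesis using no_isolated[of "{x}"] by auto
qed

lemma N_sym: "y \<in> N x \<longleftrightarrow> x \<in> N y"
  by (metis count_sym count_greater_zero_iff)

lemma deg_pos: "deg G x > 0" using N_ne[of x] by (auto simp: deg_def simp flip: nonempty_has_size)

lemma dg_ge1: "dg x \<ge> 1" using deg_pos[of x] by linarith

lemma deg_sum: "dg x = (\<Sum>y\<in>N x. real (count (G x) y))"
  unfolding deg_def size_multiset_overloaded_eq by simp

lemma p_nonneg: "p x y \<ge> 0" by (simp add: p_def)

lemma p_sum: "(\<Sum>y\<in>N x. p x y) = 1"
  using deg_pos[of x] by (simp add: p_def sum_divide_distrib[symmetric] deg_sum[symmetric])

lemma p_zero: "y \<notin> N x \<Longrightarrow> p x y = 0" by (simp add: p_def not_in_iff)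

lemma p_rev: "dg x * p x y = dg y * p y x"
  using deg_pos[of x] deg_pos[of y] by (simp add: p_def count_sym[of x y])

lemma dg_p: "dg x * p x y = real (count (G x) y)"
  using deg_pos[of x] by (simp add: p_def)

lemma p_pmf: "pmf (pmf_of_multiset (G x)) y = p x y"
  using N_ne[of x] by (simp add: p_def deg_def pmf_of_multiset)

lemma PP_eq: "finite A \<Longrightarrow> N x \<subseteq> A \<Longrightarrow> PP u x = (\<Sum>y\<in>A. p x y * u y)"
  unfolding PP_def by (rule sum.mono_neutral_left) (auto simp: p_zero)

lemma PP_mono: "(\<And>y. y \<in> N x \<Longrightarrow> u y \<le> v y) \<Longrightarrow> PP u x \<le> PP v x"
  unfolding PP_def by (intro sum_mono mult_left_mono) (auto simp: p_nonneg)

lemma PP_cong: "(\<And>y. y \<in> N x \<Longrightarrow> u y = v y) \<Longrightarrow> PP u x = PP v x"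
  unfolding PP_def by (intro sum.cong) auto

lemma PP_add: "PP (\<lambda>y. u y + v y) x = PP u x + PP v x"
  unfolding PP_def by (simp add: distrib_left sum.distrib)

lemma PP_diff: "PP (\<lambda>y. u y - v y) x = PP u x - PP v x"
  unfolding PP_def by (simp add: right_diff_distrib sum_subtractf)

lemma PP_cmult: "PP (\<lambda>y. c * u y) x = c * PP u x"
  unfolding PP_def by (simp add: sum_distrib_left mult.left_commute)

lemma PP_cmult2: "PP (\<lambda>y. u y * c) x = PP u x * c"
  unfolding PP_def by (simp add: sum_distrib_right mult.assoc)

lemma PP_const: "PP (\<lambda>y. c) x = c"
  unfolding PP_def by (simp add: sum_distrib_right[symmetric] p_sum)

lemma PP_sum: "PP (\<lambda>y. \<Sum>i\<in>I. f i y) x = (\<Sum>i\<in>I. PP (f i) x)"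
  unfolding PP_def by (simp add: sum_distrib_left sum.swap[of _ I])

lemma PP_nonneg: "(\<And>y. y \<in> N x \<Longrightarrow> 0 \<le> u y) \<Longrightarrow> 0 \<le> PP u x"
  unfolding PP_def by (intro sum_nonneg mult_nonneg_nonneg) (auto simp: p_nonneg)

lemma PP_abs: "\<bar>PP u x\<bar> \<le> PP (\<lambda>y. \<bar>u y\<bar>) x"
  unfolding PP_def by (rule order_trans[OF sum_abs]) (simp add: abs_mult p_nonneg)

lemma PP_le1: "(\<And>y. u y \<le> 1) \<Longrightarrow> PP u x \<le> 1"
  using PP_mono[of x u "\<lambda>_. 1"] by (simp add: PP_const)

lemma pn_nonneg: "pn n x y \<ge> 0"
  by (induction n arbitrary: x) (auto intro: PP_nonneg)

text \<open>The recursion defining \<open>pn\<close> splits off the first step; reversibility by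
  induction calls for splitting off the last one as well.\<close>

lemma pn_Suc_right: "pn (Suc n) x y = (\<Sum>z\<in>N y. pn n x z * p z y)"
proof (induction n arbitrary: x)
  case 0
  have "PP (\<lambda>z. of_bool (z = y)) x = p x y"
    by (cases "y \<in> N x") (auto simp: PP_def of_bool_def if_distrib p_zero cong: if_cong)
  moreover have "(\<Sum>z\<in>N y. of_bool (x = z) * p z y) = p x y"
    unfolding sum_of_bool_eq[OF finite_set_mset] by (simp add: p_zero N_sym[of x y])
  ultimately show ?case by simp
next
  case (Suc n)
  have "pn (Suc (Suc n)) x y = PP (\<lambda>z. \<Sum>w\<in>N y. pn n z w * p w y) x"
    unfolding pn.simps(2)[of "Suc n"] Suc.IH ..
  also have "\<dots> = (\<Sum>w\<in>N y. pn (Suc n) x w * p w y)"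
    by (simp add: PP_sum PP_cmult2)
  finally show ?case .
qed

lemma pn_rev: "dg x * pn n x y = dg y * pn n y x"
proof (induction n arbitrary: x y)
  case (Suc n)
  have "dg x * pn (Suc n) x y = (\<Sum>z\<in>N y. (dg x * pn n x z) * p z y)"
    unfolding pn_Suc_right sum_distrib_left by (simp add: mult_ac)
  also have "\<dots> = (\<Sum>z\<in>N y. (dg z * p z y) * pn n z x)"
    unfolding Suc.IH by (simp add: mult_ac)
  also have "\<dots> = dg y * PP (\<lambda>z. pn n z x) y"
    unfolding p_rev[of _ y] PP_def sum_distrib_left by (simp add: mult_ac)
  finally show ?case by simp
qed auto

text \<open>The upper half of the Chapman-Kolmogorov equation, over finite sets, so that no sum over
  all vertices arises.\<close>

lemma pn_add_ge: "finite S \<Longrightarrow> (\<Sum>z\<in>S. pn m x z * pn n z y) \<le> pn (m + n) x y"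
proof (induction m arbitrary: x)
  case 0
  then show ?case unfolding pn.simps(1) sum_of_bool_eq[OF 0] by (simp add: pn_nonneg)
next
  case (Suc m)
  have "(\<Sum>z\<in>S. pn (Suc m) x z * pn n z y) = PP (\<lambda>w. \<Sum>z\<in>S. pn m w z * pn n z y) x"
    by (simp add: PP_sum PP_cmult2)
  also have "\<dots> \<le> PP (\<lambda>w. pn (m + n) w y) x" using Suc by (intro PP_mono) auto
  finally show ?case by simp
qed

end

text \<open>The sequence \<open>nb\<close> dominates the operator norms of the powers of the transition matrix.\<close>

locale tgraph = sgraph +
  fixes nb :: "nat \<Rightarrow> real" and D :: real
  assumes pn_le_nb: "pn n x y \<le> nb n"
    and bubble: "summable (\<lambda>n. real (n + 1) * nb n)"
    and dg_le: "dg x \<le> D"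
begin

lemma D_ge1: "D \<ge> 1" using dg_ge1 dg_le order_trans by blast

lemma nb_nonneg: "nb n \<ge> 0" using pn_nonneg pn_le_nb order_trans by blast

lemma summable_nb: "summable nb"
proof (rule summable_comparison_test'[OF bubble, of 0])
  show "norm (nb n) \<le> real (n + 1) * nb n" for n
    using mult_right_mono[of 1 "real (n + 1)" "nb n"] nb_nonneg[of n] by simp
qed

lemma nb_tendsto: "nb \<longlonglongrightarrow> 0" using summable_nb by (rule summable_LIMSEQ_zero)

text \<open>Iterating the hypothesis \<open>n\<close> times, with vertices outside \<open>K\<close>
  contributing at most 0, bounds \<open>u x\<close> by a sum over \<open>K\<close> weighted with
  \<open>pn n x y\<close>. This tends to 0 with \<open>nb\<close>: transience takes the place of a
  path to the boundary.\<close>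

lemma maximum_principle:
  assumes K: "finite K" and sub: "\<And>x. x \<in> K \<Longrightarrow> u x \<le> PP u x" and off: "\<And>x. x \<notin> K \<Longrightarrow> u x \<le> 0"
  shows "u x \<le> 0"
proof -
  have main: "u x \<le> (\<Sum>y\<in>K. pn n x y * \<bar>u y\<bar>)" for n x
  proof (induction n arbitrary: x)
    case 0
    show ?case
    proof (cases "x \<in> K")
      case True
      then show ?thesis using K by (simp add: sum_of_bool_eq)
    qed (auto intro!: order_trans[OF off] sum_nonneg)
  next
    case (Suc n)
    show ?case
    proof (cases "x \<in> K")
      case True
      have "u x \<le> PP u x" using sub True .
      also have "\<dots> \<le> PP (\<lambda>z. \<Sum>y\<in>K. pn n z y * \<bar>u y\<bar>) x" using Suc by (intro PP_mono)
      also have "\<dots> = (\<Sum>y\<in>K. pn (Suc n) x y * \<bar>u y\<bar>)" by (simp add: PP_sum PP_cmult2)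
      finally show ?thesis .
    qed (auto intro!: order_trans[OF off] sum_nonneg mult_nonneg_nonneg pn_nonneg simp del: pn.simps)
  qed
  have "u x \<le> nb n * (\<Sum>y\<in>K. \<bar>u y\<bar>)" for n
    using main[of x n] unfolding sum_distrib_left
    by (rule order_trans) (intro sum_mono mult_right_mono pn_le_nb, auto)
  moreover have "(\<lambda>n. nb n * (\<Sum>y\<in>K. \<bar>u y\<bar>)) \<longlonglongrightarrow> 0"
    using tendsto_mult_right[OF nb_tendsto, of "\<Sum>y\<in>K. \<bar>u y\<bar>"] by simp
  ultimately show ?thesis by (intro LIMSEQ_le_const) auto
qed

lemma comparison:
  assumes K: "finite K" and "\<And>x. x \<in> K \<Longrightarrow> u x - PP u x \<le> v x - PP v x" and "\<And>x. x \<notin> K \<Longrightarrow> u x \<le> v x"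
  shows "u x \<le> v x"
  using maximum_principle[OF K, of "\<lambda>x. u x - v x" x] assms(2,3) by (force simp: PP_diff)

lemma comparison_eq:
  assumes K: "finite K" and "\<And>x. x \<in> K \<Longrightarrow> u x - PP u x = v x - PP v x" and "\<And>x. x \<notin> K \<Longrightarrow> u x = v x"
  shows "u x = v x"
  using comparison[OF K, of u v x] comparison[OF K, of v u x] assms(2,3) by force

section \<open>Potentials and harmonic extensions\<close>

text \<open>The transition operator killed outside \<open>K\<close>; \<open>pot K\<close> is its
  Neumann series, that is, the Green operator with zero boundary values.\<close>

definition PK :: "'a set \<Rightarrow> ('a \<Rightarrow> real) \<Rightarrow> 'a \<Rightarrow> real" where
  "PK K u x = (if x \<in> K then PP u x else 0)"

definition pot :: "'a set \<Rightarrow> ('a \<Rightarrow> real) \<Rightarrow> 'a \<Rightarrow> real" where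
  "pot K f x = (\<Sum>n. (PK K ^^ n) (\<lambda>y. if y \<in> K then f y else 0) x)"

lemma PK_pow_bound:
  assumes "finite K"
  shows "\<bar>(PK K ^^ n) (\<lambda>y. if y \<in> K then f y else 0) x\<bar> \<le> (\<Sum>y\<in>K. pn n x y * \<bar>f y\<bar>)"
proof (induction n arbitrary: x)
  case 0
  then show ?case using assms by (simp add: sum_of_bool_eq)
next
  case (Suc n)
  let ?u = "(PK K ^^ n) (\<lambda>y. if y \<in> K then f y else 0)"
  have "\<bar>PK K ?u x\<bar> \<le> PP (\<lambda>z. \<bar>?u z\<bar>) x"
    using PP_abs[of ?u x] by (auto simp: PK_def intro: PP_nonneg)
  also have "\<dots> \<le> PP (\<lambda>z. \<Sum>y\<in>K. pn n z y * \<bar>f y\<bar>) x" using Suc by (intro PP_mono)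
  also have "\<dots> = (\<Sum>y\<in>K. pn (Suc n) x y * \<bar>f y\<bar>)" by (simp add: PP_sum PP_cmult2)
  finally show ?case by simp
qed

lemma summable_PK:
  assumes "finite K" shows "summable (\<lambda>n. (PK K ^^ n) (\<lambda>y. if y \<in> K then f y else 0) x)"
proof (rule summable_comparison_test'[where N = 0])
  show "summable (\<lambda>n. nb n * (\<Sum>y\<in>K. \<bar>f y\<bar>))" using summable_nb by (rule summable_mult2)
  show "norm ((PK K ^^ n) (\<lambda>y. if y \<in> K then f y else 0) x) \<le> nb n * (\<Sum>y\<in>K. \<bar>f y\<bar>)" for n
    using PK_pow_bound[OF assms, of n f x] unfolding sum_distrib_left real_norm_def
    by (rule order_trans) (intro sum_mono mult_right_mono pn_le_nb, auto)
qed

lemma PP_suminf: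
  assumes "\<And>y. summable (\<lambda>n. u n y)"
  shows "PP (\<lambda>y. \<Sum>n. u n y) x = (\<Sum>n. PP (u n) x)"
  unfolding PP_def using assms by (simp add: suminf_sum summable_mult suminf_mult)

lemma pot_off: "x \<notin> K \<Longrightarrow> pot K f x = 0"
proof -
  assume x: "x \<notin> K"
  have "(PK K ^^ n) (\<lambda>y. if y \<in> K then f y else 0) x = 0" for n
    by (cases n) (auto simp: PK_def x)
  then show ?thesis by (simp add: pot_def)
qed

lemma pot_eq:
  assumes K: "finite K" and x: "x \<in> K" shows "pot K f x = f x + PP (pot K f) x"
proof -
  let ?u = "\<lambda>n. (PK K ^^ n) (\<lambda>y. if y \<in> K then f y else 0)"
  have "pot K f x = ?u 0 x + (\<Sum>n. ?u (Suc n) x)"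
    unfolding pot_def using suminf_split_head[OF summable_PK[OF K, of f x]] by simp
  also have "(\<Sum>n. ?u (Suc n) x) = (\<Sum>n. PP (?u n) x)" using x by (simp add: PK_def)
  also have "\<dots> = PP (pot K f) x"
    unfolding pot_def[abs_def] by (rule PP_suminf[symmetric]) (rule summable_PK[OF K])
  finally show ?thesis using x by simp
qed

lemma pot_unique:
  assumes "finite K" "\<And>x. x \<in> K \<Longrightarrow> u x = f x + PP u x" "\<And>x. x \<notin> K \<Longrightarrow> u x = 0"
  shows "pot K f x = u x"
proof (rule comparison_eq[OF assms(1), where u = "pot K f" and v = u])
  fix x assume "x \<in> K"
  then show "pot K f x - PP (pot K f) x = u x - PP u x" using pot_eq[OF assms(1)] assms(2)[of x] by simp
qed (simp add: pot_off assms(3))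

lemma pot_nonneg:
  assumes "finite K" "\<And>x. x \<in> K \<Longrightarrow> 0 \<le> f x" shows "0 \<le> pot K f x"
proof (rule comparison[OF assms(1), where v = "pot K f" and u = "\<lambda>_. 0"])
  fix x assume "x \<in> K"
  then show "0 - PP (\<lambda>_. 0) x \<le> pot K f x - PP (pot K f) x" using pot_eq[OF assms(1), of x f] assms(2)[of x] by (simp add: PP_const)
qed (simp add: pot_off)

lemma pot_mono:
  assumes "finite K" "\<And>x. x \<in> K \<Longrightarrow> f x \<le> g x" shows "pot K f x \<le> pot K g x"
proof (rule comparison[OF assms(1), where u = "pot K f" and v = "pot K g"])
  fix x assume "x \<in> K"
  then show "pot K f x - PP (pot K f) x \<le> pot K g x - PP (pot K g) x"
    using pot_eq[OF assms(1), of x f] pot_eq[OF assms(1), of x g] assms(2)[of x] by simp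
qed (simp add: pot_off)

lemma pot_sum:
  assumes "finite K" shows "pot K (\<lambda>x. \<Sum>i\<in>I. c i * f i x) x = (\<Sum>i\<in>I. c i * pot K (f i) x)"
proof (rule pot_unique[OF assms, where u = "\<lambda>x. \<Sum>i\<in>I. c i * pot K (f i) x"])
  fix x assume x: "x \<in> K"
  show "(\<Sum>i\<in>I. c i * pot K (f i) x) = (\<Sum>i\<in>I. c i * f i x) + PP (\<lambda>x. \<Sum>i\<in>I. c i * pot K (f i) x) x"
    unfolding PP_sum PP_cmult sum.distrib[symmetric] distrib_left[symmetric]
    by (rule sum.cong) (simp_all add: pot_eq[OF assms x, symmetric])
qed (simp add: pot_off)

lemma sum_PP_sym:
  assumes K: "finite K" and "\<And>x. x \<notin> K \<Longrightarrow> u x = 0" and "\<And>x. x \<notin> K \<Longrightarrow> v x = 0"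
  shows "(\<Sum>x\<in>K. dg x * u x * PP v x) = (\<Sum>x\<in>K. dg x * v x * PP u x)"
proof -
  have *: "PP w x = (\<Sum>y\<in>K. p x y * w y)" if "\<And>x. x \<notin> K \<Longrightarrow> w x = 0" for w x
  proof -
    have "PP w x = (\<Sum>y\<in>N x \<union> K. p x y * w y)" by (rule PP_eq) (auto simp: K)
    also have "\<dots> = (\<Sum>y\<in>K. p x y * w y)"
      by (rule sum.mono_neutral_right) (auto simp: K that)
    finally show ?thesis .
  qed
  have "(\<Sum>x\<in>K. dg x * u x * PP v x) = (\<Sum>x\<in>K. \<Sum>y\<in>K. (dg x * p x y) * u x * v y)"
    using *[of v] assms(3) by (simp add: sum_distrib_left mult_ac)
  also have "\<dots> = (\<Sum>y\<in>K. \<Sum>x\<in>K. (dg y * p y x) * u x * v y)"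
    by (subst sum.swap) (simp only: p_rev)
  also have "\<dots> = (\<Sum>x\<in>K. dg x * v x * PP u x)"
    using *[of u] assms(2) by (simp add: sum_distrib_left mult_ac)
  finally show ?thesis .
qed

text \<open>Each density is the Laplacian of its own potential, so that self-adjointness of the
  Green operator with respect to the degrees is inherited from \<open>PP\<close>.\<close>

lemma pot_sym:
  assumes K: "finite K"
  shows "(\<Sum>x\<in>K. dg x * f x * pot K g x) = (\<Sum>x\<in>K. dg x * g x * pot K f x)"
proof -
  have *: "(\<Sum>x\<in>K. dg x * a x * pot K b x) =
    (\<Sum>x\<in>K. dg x * pot K a x * pot K b x) - (\<Sum>x\<in>K. dg x * pot K b x * PP (pot K a) x)" for a b
    unfolding sum_subtractf[symmetric]
  proof (rule sum.cong[OF refl])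
    fix x assume "x \<in> K"
    then have a: "a x = pot K a x - PP (pot K a) x" using pot_eq[OF K] by simp
    show "dg x * a x * pot K b x = dg x * pot K a x * pot K b x - dg x * pot K b x * PP (pot K a) x"
      unfolding a by (simp only: right_diff_distrib left_diff_distrib mult_ac)
  qed
  show ?thesis unfolding *[of f g] *[of g f]
    using sum_PP_sym[OF K, of "pot K g" "pot K f"] by (simp add: pot_off mult_ac)
qed

text \<open>The mean of \<open>\<phi>\<close> at the first exit of the walk from \<open>K\<close>:
  the solution of the Dirichlet problem, written as the Green operator applied to the mean of the
  boundary values over one step.\<close>

definition HK :: "'a set \<Rightarrow> ('a \<Rightarrow> real) \<Rightarrow> 'a \<Rightarrow> real" where
  "HK K \<phi> x = (if x \<in> K then pot K (\<lambda>y. PP (\<lambda>z. if z \<in> K then 0 else \<phi> z) y) x else \<phi> x)"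

lemma HK_off: "x \<notin> K \<Longrightarrow> HK K \<phi> x = \<phi> x" by (simp add: HK_def)

lemma HK_eq:
  assumes K: "finite K" and x: "x \<in> K" shows "HK K \<phi> x = PP (HK K \<phi>) x"
proof -
  let ?f = "\<lambda>y. PP (\<lambda>z. if z \<in> K then 0 else \<phi> z) y"
  have "HK K \<phi> x = PP (\<lambda>z. (if z \<in> K then 0 else \<phi> z) + pot K ?f z) x"
    using x pot_eq[OF K x, of ?f] by (simp add: HK_def PP_add)
  also have "\<dots> = PP (HK K \<phi>) x" by (rule PP_cong) (auto simp: HK_def pot_off)
  finally show ?thesis .
qed

lemma HK_unique:
  assumes "finite K" "\<And>x. x \<in> K \<Longrightarrow> u x = PP u x" "\<And>x. x \<notin> K \<Longrightarrow> u x = \<phi> x"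
  shows "HK K \<phi> x = u x"
  by (rule comparison_eq[OF assms(1), where u = "HK K \<phi>" and v = u])
    (simp_all add: HK_off HK_eq[OF assms(1), symmetric] assms(2)[symmetric] assms(3))

lemma HK_le:
  assumes "finite K" "\<And>x. x \<in> K \<Longrightarrow> PP u x \<le> u x" "\<And>x. x \<notin> K \<Longrightarrow> \<phi> x \<le> u x"
  shows "HK K \<phi> x \<le> u x"
  by (rule comparison[OF assms(1), where u = "HK K \<phi>" and v = u]) (simp_all add: HK_off HK_eq[OF assms(1), symmetric] assms(2,3))

lemma HK_ge:
  assumes "finite K" "\<And>x. x \<in> K \<Longrightarrow> u x \<le> PP u x" "\<And>x. x \<notin> K \<Longrightarrow> u x \<le> \<phi> x"
  shows "u x \<le> HK K \<phi> x"
  by (rule comparison[OF assms(1), where u = u and v = "HK K \<phi>"]) (simp_all add: HK_off HK_eq[OF assms(1), symmetric] assms(2,3))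

lemma HK_const: "finite K \<Longrightarrow> HK K (\<lambda>_. c) x = c" by (rule HK_unique[where u = "\<lambda>_. c"]) (auto simp: PP_const)

lemma HK_cmult: "finite K \<Longrightarrow> HK K (\<lambda>x. c * \<phi> x) x = c * HK K \<phi> x"
  by (rule HK_unique[where u = "\<lambda>x. c * HK K \<phi> x"]) (simp_all add: PP_cmult HK_off flip: HK_eq)

lemma HK_add: "finite K \<Longrightarrow> HK K (\<lambda>x. \<phi> x + \<psi> x) x = HK K \<phi> x + HK K \<psi> x"
  by (rule HK_unique[where u = "\<lambda>x. HK K \<phi> x + HK K \<psi> x"]) (simp_all add: PP_add HK_off flip: HK_eq)

lemma HK_diff: "finite K \<Longrightarrow> HK K (\<lambda>x. \<phi> x - \<psi> x) x = HK K \<phi> x - HK K \<psi> x"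
  by (rule HK_unique[where u = "\<lambda>x. HK K \<phi> x - HK K \<psi> x"]) (simp_all add: PP_diff HK_off flip: HK_eq)

lemma HK_nonneg: "finite K \<Longrightarrow> (\<And>x. x \<notin> K \<Longrightarrow> 0 \<le> \<phi> x) \<Longrightarrow> 0 \<le> HK K \<phi> x"
  by (rule HK_ge[where u = "\<lambda>_. 0"]) (auto simp: PP_const)

lemma HK_le1: "finite K \<Longrightarrow> (\<And>x. x \<notin> K \<Longrightarrow> \<phi> x \<le> 1) \<Longrightarrow> HK K \<phi> x \<le> 1"
  by (rule HK_le[where u = "\<lambda>_. 1"]) (auto simp: PP_const)

lemma HK_indicator_eq_pot:
  assumes K: "finite K" and x: "x \<in> K" and v: "v \<notin> K"
  shows "HK K (\<lambda>z. of_bool (z = v)) x = pot K (\<lambda>y. p y v) x"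
proof -
  have "PP (\<lambda>z. if z \<in> K then 0 else of_bool (z = v)) y = p y v" for y
  proof -
    have "PP (\<lambda>z. if z \<in> K then 0 else of_bool (z = v)) y = PP (\<lambda>z. if z = v then 1 else 0) y"
      by (rule PP_cong) (auto simp: v)
    also have "\<dots> = p y v" by (cases "v \<in> N y") (auto simp: PP_def if_distrib p_zero cong: if_cong)
    finally show ?thesis .
  qed
  then have "PP (\<lambda>z. if z \<in> K then 0 else of_bool (z = v)) = (\<lambda>y. p y v)" by auto
  then show ?thesis using x by (simp add: HK_def)
qed

section \<open>The Green function\<close>

definition g :: "'a \<Rightarrow> 'a \<Rightarrow> real" where "g x y = (\<Sum>n. pn n x y)"

lemma summable_pn: "summable (\<lambda>n. pn n x y)"
  by (rule summable_comparison_test'[OF summable_nb, of 0]) (auto simp: pn_nonneg pn_le_nb)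

lemma g_eq: "g x y = of_bool (x = y) + PP (\<lambda>z. g z y) x"
proof -
  have "g x y = pn 0 x y + (\<Sum>n. pn (Suc n) x y)"
    unfolding g_def using suminf_split_head[OF summable_pn[of x y]] by simp
  also have "(\<Sum>n. pn (Suc n) x y) = PP (\<lambda>z. g z y) x"
    unfolding g_def by (subst PP_suminf) (auto simp: summable_pn)
  finally show ?thesis by simp
qed

lemma g_nonneg: "g x y \<ge> 0" unfolding g_def by (intro suminf_nonneg summable_pn pn_nonneg)

lemma g_self: "g x x \<ge> 1"
  using g_eq[of x x] PP_nonneg[of x "\<lambda>z. g z x"] by (simp add: g_nonneg)

lemma g_rev: "dg x * g x y = dg y * g y x"
  unfolding g_def using suminf_mult[OF summable_pn, of "dg x" x y] suminf_mult[OF summable_pn, of "dg y" y x]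
  by (simp add: pn_rev)

lemma g_rev_le: "g x y \<le> D * g y x"
proof -
  have "g x y \<le> dg x * g x y" using dg_ge1[of x] g_nonneg[of x y] by (simp add: mult_le_cancel_right1)
  also have "\<dots> = dg y * g y x" by (rule g_rev)
  also have "\<dots> \<le> D * g y x" by (intro mult_right_mono dg_le g_nonneg)
  finally show ?thesis .
qed

definition gmax :: real where "gmax = suminf nb"

lemma g_le: "g x y \<le> gmax"
  unfolding g_def gmax_def by (intro suminf_le summable_pn summable_nb pn_le_nb)

lemma gmax_ge1: "gmax \<ge> 1" using g_self g_le order_trans by blast

lemma HK_le_g: "finite K \<Longrightarrow> HK K (\<lambda>z. of_bool (z = v)) x \<le> g x v"
proof (rule HK_le[where u = "\<lambda>x. g x v"])
  fix x show "PP (\<lambda>z. g z v) x \<le> g x v" using g_eq[of x v] by simp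
  show "of_bool (x = v) \<le> g x v" using g_self[of x] g_nonneg[of x v] by auto
qed

lemma pot_le_g: "finite K \<Longrightarrow> pot K (\<lambda>z. of_bool (z = y)) x \<le> g x y"
proof (rule comparison[where K = K and u = "pot K (\<lambda>z. of_bool (z = y))" and v = "\<lambda>x. g x y"])
  fix x assume "finite K" "x \<in> K"
  then show "pot K (\<lambda>z. of_bool (z = y)) x - PP (pot K (\<lambda>z. of_bool (z = y))) x \<le> g x y - PP (\<lambda>z. g z y) x"
    using pot_eq[of K x] g_eq[of x y] by simp
qed (simp_all add: pot_off g_nonneg)

lemma pot_mono_set:
  assumes "finite K" "L \<subseteq> K" "\<And>x. x \<in> K \<Longrightarrow> 0 \<le> f x" shows "pot L f x \<le> pot K f x"
proof (rule comparison[where K = L and u = "pot L f" and v = "pot K f"])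
  show L: "finite L" using assms finite_subset by blast
  show "pot L f x - PP (pot L f) x \<le> pot K f x - PP (pot K f) x" if "x \<in> L" for x
    using that assms(2) pot_eq[OF L, of x f] pot_eq[OF assms(1), of x f] by auto
  show "pot L f x \<le> pot K f x" if "x \<notin> L" for x
    using that by (simp add: pot_off pot_nonneg assms)
qed

end

section \<open>Functional graphs and rooted forests\<close>

text \<open>
  A rooted spanning forest of \<open>K\<close> is an acyclic choice of an outgoing neighbour for each vertex of
  \<open>K\<close>; its roots are the vertices outside \<open>K\<close>.
\<close>

definition frel :: "'a set \<Rightarrow> ('a \<Rightarrow> 'a) \<Rightarrow> ('a \<times> 'a) set" where
  "frel K F = {(y, F y) | y. y \<in> K}"

abbreviation leads :: "'a set \<Rightarrow> ('a \<Rightarrow> 'a) \<Rightarrow> 'a \<Rightarrow> 'a \<Rightarrow> bool" where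
  "leads K F x y \<equiv> (x, y) \<in> (frel K F)\<^sup>*"

definition acyc :: "'a set \<Rightarrow> ('a \<Rightarrow> 'a) \<Rightarrow> bool" where
  "acyc K F \<longleftrightarrow> (\<forall>x\<in>K. \<exists>r. r \<notin> K \<and> leads K F x r)"

definition root :: "'a set \<Rightarrow> ('a \<Rightarrow> 'a) \<Rightarrow> 'a \<Rightarrow> 'a" where
  "root K F x = (THE r. r \<notin> K \<and> leads K F x r)"

text \<open>The path from \<open>x\<close> without its root; it is empty if \<open>x\<close> is
  outside \<open>K\<close>.\<close>

definition gam :: "'a set \<Rightarrow> ('a \<Rightarrow> 'a) \<Rightarrow> 'a \<Rightarrow> 'a set" where
  "gam K F x = {y \<in> K. leads K F x y}"

lemma frel_iff: "(x, y) \<in> frel K F \<longleftrightarrow> x \<in> K \<and> y = F x" by (auto simp: frel_def)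

lemma leads_mono: "leads K F x y \<Longrightarrow> K \<subseteq> L \<Longrightarrow> leads L F x y"
  by (erule rtrancl_mono[THEN subsetD, rotated]) (auto simp: frel_def)

lemma frel_cong: "(\<And>y. y \<in> K \<Longrightarrow> F y = F' y) \<Longrightarrow> frel K F = frel K F'"
  by (auto simp: frel_def)

lemma leads_linear: "leads K F x a \<Longrightarrow> leads K F x b \<Longrightarrow> leads K F a b \<or> leads K F b a"
  by (rule single_valued_confluent) (auto simp: single_valued_def frel_def)

lemma leads_off: "leads K F x y \<Longrightarrow> x \<notin> K \<Longrightarrow> y = x"
  by (induction rule: converse_rtrancl_induct) (auto simp: frel_iff)

lemma leads_unique: "leads K F x a \<Longrightarrow> leads K F x b \<Longrightarrow> a \<notin> K \<Longrightarrow> b \<notin> K \<Longrightarrow> a = b"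
  using leads_linear leads_off by metis

lemma leads_step: "x \<in> K \<Longrightarrow> leads K F (F x) y \<Longrightarrow> leads K F x y"
  by (rule converse_rtrancl_into_rtrancl) (auto simp: frel_iff)

lemma leads_stepD: "leads K F x y \<Longrightarrow> x = y \<or> x \<in> K \<and> leads K F (F x) y"
  by (erule converse_rtranclE) (auto simp: frel_iff)

lemma leads_snoc: "leads K F x y \<Longrightarrow> y \<in> K \<Longrightarrow> leads K F x (F y)"
  by (erule rtrancl_into_rtrancl) (auto simp: frel_iff)

lemma leads_pred: "leads K F x y \<Longrightarrow> x = y \<or> (\<exists>t\<in>K. leads K F x t \<and> y = F t)"
  by (erule rtranclE) (auto simp: frel_iff)

lemma leads_in: "leads K F x y \<Longrightarrow> y \<in> K \<Longrightarrow> x \<in> K"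
  using leads_off by metis

text \<open>The path is cut at its first visit to \<open>C\<close>.\<close>

lemma leads_cut:
  "leads K F a b \<Longrightarrow> leads (K - C) F a b \<or> (\<exists>x\<in>C \<inter> K. leads (K - C) F a x \<and> leads K F x b)"
proof (induction rule: converse_rtrancl_induct)
  case (step y z)
  show ?case
  proof (cases "y \<in> C")
    case True
    moreover have "leads K F y b" using step by (auto intro: converse_rtrancl_into_rtrancl)
    ultimately show ?thesis using step by (auto simp: frel_iff)
  next
    case False
    then have "(y, z) \<in> frel (K - C) F" using step by (auto simp: frel_iff)
    then show ?thesis using step.IH by (meson converse_rtrancl_into_rtrancl)
  qed
qed auto

lemma leads_cut1: "leads K F a b \<Longrightarrow> leads (K - {x}) F a b \<or> leads (K - {x}) F a x \<and> leads K F x b"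
  using leads_cut[of a b K F "{x}"] by auto

lemma leads_to_cut: "leads K F a x \<Longrightarrow> leads (K - {x}) F a x"
  using leads_cut1[of a x K F x] by auto

lemma root_eqI: "leads K F x r \<Longrightarrow> r \<notin> K \<Longrightarrow> root K F x = r"
  unfolding root_def using leads_unique by (metis (no_types, lifting) the_equality)

lemma root_off: "x \<notin> K \<Longrightarrow> root K F x = x" by (rule root_eqI) auto

lemma acyc_root: "acyc K F \<Longrightarrow> root K F x \<notin> K \<and> leads K F x (root K F x)"
proof -
  assume "acyc K F"
  then obtain r where "leads K F x r" "r \<notin> K" by (cases "x \<in> K") (auto simp: acyc_def)
  then show ?thesis using root_eqI by metis
qed

lemma root_eq_iff: "acyc K F \<Longrightarrow> r \<notin> K \<Longrightarrow> root K F x = r \<longleftrightarrow> leads K F x r"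
  using acyc_root root_eqI by metis

text \<open>Following the edges from a vertex of a cycle, one never leaves the cycle.\<close>

lemma cycle_leads_back:
  assumes "leads K F (F y) y" "leads K F y t" shows "leads K F t y"
  using assms(2)
proof (induction rule: rtrancl_induct)
  case (step a b)
  then show ?case using leads_stepD[of a y K F] assms(1) by (auto simp: frel_iff)
qed auto

lemma acyc_no_cycle: "acyc K F \<Longrightarrow> y \<in> K \<Longrightarrow> \<not> leads K F (F y) y"
  using cycle_leads_back leads_off acyc_def by metis

lemma acyc_minus_iff:
  assumes "x \<in> K"
  shows "acyc (K - {x}) F \<longleftrightarrow> (\<forall>y\<in>K. leads K F y x \<or> (\<exists>r. r \<notin> K \<and> leads K F y r))"
proof
  assume *: "acyc (K - {x}) F"
  show "\<forall>y\<in>K. leads K F y x \<or> (\<exists>r. r \<notin> K \<and> leads K F y r)"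
  proof
    fix y assume "y \<in> K"
    then obtain r where "r \<notin> K - {x}" "leads (K - {x}) F y r"
      using * by (cases "y = x") (auto simp: acyc_def)
    then show "leads K F y x \<or> (\<exists>r. r \<notin> K \<and> leads K F y r)"
      using leads_mono[of y r "K - {x}" F K] by (cases "r = x") auto
  qed
next
  assume *: "\<forall>y\<in>K. leads K F y x \<or> (\<exists>r. r \<notin> K \<and> leads K F y r)"
  show "acyc (K - {x}) F"
    unfolding acyc_def using * leads_cut1[of _ _ K F x] leads_to_cut by (metis DiffD1 DiffE singletonI)
qed

text \<open>The only cycle that the edge of \<open>y\<close> can close is one through
  \<open>y\<close>.\<close>

lemma acyc_iff_minus:
  assumes "y \<in> K" shows "acyc K F \<longleftrightarrow> acyc (K - {y}) F \<and> \<not> leads (K - {y}) F (F y) y"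
proof
  assume *: "acyc K F"
  then have "acyc (K - {y}) F" using acyc_minus_iff[OF assms] by (auto simp: acyc_def)
  moreover have "\<not> leads (K - {y}) F (F y) y"
    using acyc_no_cycle[OF * assms] leads_mono[of "F y" y "K - {y}" F K] by auto
  ultimately show "acyc (K - {y}) F \<and> \<not> leads (K - {y}) F (F y) y" ..
next
  assume *: "acyc (K - {y}) F \<and> \<not> leads (K - {y}) F (F y) y"
  let ?r = "root (K - {y}) F (F y)"
  have "?r \<notin> K - {y}" "leads (K - {y}) F (F y) ?r" using acyc_root[of "K - {y}" F "F y"] * by blast+
  then have r: "?r \<notin> K" "leads K F (F y) ?r" using * leads_mono[of _ _ "K - {y}" F K] by auto
  have y: "leads K F y ?r" by (rule leads_step[OF assms r(2)])
  show "acyc K F"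
    unfolding acyc_def
  proof
    fix x assume "x \<in> K"
    then consider "leads K F x y" | t where "t \<notin> K" "leads K F x t"
      using * acyc_minus_iff[OF assms, of F] by blast
    then show "\<exists>t. t \<notin> K \<and> leads K F x t"
      by cases (use r(1) rtrancl_trans[OF _ y] in blast)+
  qed
qed

lemma root_fun_upd:
  assumes "acyc (K - {y}) F" "y \<in> K" "F y = z" "root (K - {y}) F z \<noteq> y"
  shows "root K F y = root (K - {y}) F z"
proof (rule root_eqI)
  show "root (K - {y}) F z \<notin> K" using acyc_root[OF assms(1), of z] assms(4) by auto
  have "leads K F z (root (K - {y}) F z)" using acyc_root[OF assms(1), of z] leads_mono[of _ _ "K - {y}" F K] by blast
  then show "leads K F y (root (K - {y}) F z)" using leads_step[OF assms(2)] assms(3) by simp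
qed

lemma gam_closed: "t \<in> gam K F x \<Longrightarrow> F t \<in> K \<Longrightarrow> F t \<in> gam K F x"
  by (auto simp: gam_def intro: leads_snoc)

text \<open>A set that the edges leave only towards the roots determines the paths that start in
  it.\<close>

lemma leads_agree:
  assumes "leads K F t y" "t \<in> C" "\<And>s. s \<in> C \<Longrightarrow> s \<in> K \<Longrightarrow> F s \<in> K \<Longrightarrow> F s \<in> C" "\<And>s. s \<in> C \<Longrightarrow> F s = F' s"
  shows "leads K F' t y"
  using assms(1,2)
proof (induction rule: converse_rtrancl_induct)
  case (step a b)
  show ?case
  proof (cases "b \<in> K")
    case True
    then show ?thesis using step assms(3,4) by (metis frel_iff leads_step)
  next
    case False
    then show ?thesis using step leads_off assms(4) by (metis frel_iff leads_step rtrancl.rtrancl_refl)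
  qed
qed auto

definition merge :: "'a set \<Rightarrow> ('a \<Rightarrow> 'b) \<Rightarrow> ('a \<Rightarrow> 'b) \<Rightarrow> 'a \<Rightarrow> 'b" where
  "merge C F F' y = (if y \<in> C then F y else F' y)"

lemma gam_sub: "gam K F x \<subseteq> K" by (auto simp: gam_def)

lemma leads_merge:
  assumes "t \<in> gam K F x" shows "leads K (merge (gam K F x) F F') t y \<longleftrightarrow> leads K F t y"
proof
  assume "leads K F t y"
  then show "leads K (merge (gam K F x) F F') t y"
    by (rule leads_agree[OF _ assms]) (auto simp: merge_def intro: gam_closed)
next
  assume "leads K (merge (gam K F x) F F') t y"
  then show "leads K F t y"
    by (rule leads_agree[OF _ assms]) (auto simp: merge_def intro: gam_closed)
qed

lemma gam_merge: "x \<in> K \<Longrightarrow> gam K (merge (gam K F x) F F') x = gam K F x"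
  using leads_merge[where t = x and K = K and F = F and x = x and F' = F'] by (auto simp: gam_def)

lemma leads_merge_off:
  "leads (K - C) (merge C F F') t y \<longleftrightarrow> leads (K - C) F' t y"
proof -
  have "frel (K - C) (merge C F F') = frel (K - C) F'" by (rule frel_cong) (auto simp: merge_def)
  then show ?thesis by simp
qed

lemma gam_leads_root: "acyc K F \<Longrightarrow> t \<in> gam K F x \<Longrightarrow> leads K F t (root K F x)"
proof -
  assume *: "acyc K F" "t \<in> gam K F x"
  then have t: "t \<in> K" "leads K F x t" by (auto simp: gam_def)
  have r: "leads K F t (root K F t)" "root K F t \<notin> K" using acyc_root[OF *(1)] by auto
  have "root K F x = root K F t" using t r by (intro root_eqI) auto
  then show ?thesis using r by simp
qed

text \<open>In the merged forest a vertex either enters the path of \<open>x\<close> first and then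
  follows it to the root of \<open>x\<close>, or reaches a root of \<open>F'\<close> that lies
  outside \<open>K\<close>.\<close>

lemma root_merge:
  assumes "acyc K F" "acyc (K - gam K F x) F'"
  shows "acyc K (merge (gam K F x) F F')"
    and "root K (merge (gam K F x) F F') u = (if root (K - gam K F x) F' u \<in> gam K F x then root K F x else root (K - gam K F x) F' u)"
proof -
  let ?C = "gam K F x" and ?M = "merge (gam K F x) F F'"
  have 1: "leads K ?M t (root K F x)" if "t \<in> ?C" for t
    using leads_merge[OF that] gam_leads_root[OF assms(1) that] by auto
  have rF: "root K F x \<notin> K" using acyc_root[OF assms(1)] by auto
  have 2: "leads K ?M t (root (K - ?C) F' t)" "root (K - ?C) F' t \<notin> K - ?C" for t
  proof -
    have "leads (K - ?C) F' t (root (K - ?C) F' t)" using acyc_root[OF assms(2)] by auto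
    then have "leads (K - ?C) ?M t (root (K - ?C) F' t)" by (simp add: leads_merge_off)
    then show "leads K ?M t (root (K - ?C) F' t)" by (rule leads_mono) auto
    show "root (K - ?C) F' t \<notin> K - ?C" using acyc_root[OF assms(2)] by auto
  qed
  have 3: "leads K ?M u (if root (K - ?C) F' u \<in> ?C then root K F x else root (K - ?C) F' u)" for u
    using 1 2(1)[of u] by (auto intro: rtrancl_trans)
  have 4: "(if root (K - ?C) F' u \<in> ?C then root K F x else root (K - ?C) F' u) \<notin> K" for u
    using 2(2)[of u] rF by auto
  show "acyc K ?M" unfolding acyc_def using 3 4 by blast
  show "root K ?M u = (if root (K - ?C) F' u \<in> ?C then root K F x else root (K - ?C) F' u)"
    by (rule root_eqI[OF 3 4])
qed

lemma acyc_minus_gam: "acyc K F \<Longrightarrow> acyc (K - C) F"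
  unfolding acyc_def using leads_cut[of _ _ K F C] by (metis Diff_iff IntD1)

lemma merge_leads_to:
  assumes "acyc (K - gam K F x) F'" "leads K (merge (gam K F x) F F') u x" "x \<in> K"
  shows "root (K - gam K F x) F' u \<in> gam K F x"
proof -
  let ?C = "gam K F x"
  have x: "x \<in> ?C" using assms by (auto simp: gam_def)
  from leads_cut[OF assms(2), of ?C] x obtain y where "y \<in> ?C" "leads (K - ?C) F' u y"
    by (auto simp: leads_merge_off)
  then show ?thesis using root_eqI[of u y "K - ?C" F'] by auto
qed

text \<open>A vertex that leads to \<open>x\<close> must enter the path of \<open>x\<close> at its
  start: from any later vertex of the path, acyclicity forbids a return to \<open>x\<close>.\<close>

lemma merge_leads_to_eq:
  assumes "acyc K F" "acyc (K - gam K F x) F'" "leads K (merge (gam K F x) F F') u x" "x \<in> K"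
  shows "root (K - gam K F x) F' u = x"
proof -
  let ?C = "gam K F x" and ?M = "merge (gam K F x) F F'"
  have x: "x \<in> ?C" using assms by (auto simp: gam_def)
  let ?y = "root (K - ?C) F' u"
  have y: "?y \<in> ?C" using merge_leads_to assms by metis
  have uy: "leads K ?M u ?y"
    using acyc_root[OF assms(2), of u] by (metis Diff_subset leads_merge_off leads_mono)
  have xy: "leads K ?M x ?y" using leads_merge[OF x] y by (auto simp: gam_def)
  have M: "acyc K ?M" using root_merge(1)[OF assms(1,2)] .
  show ?thesis
  proof (rule ccontr)
    assume ne: "?y \<noteq> x"
    have "\<not> leads K ?M ?y x"
    proof
      assume "leads K ?M ?y x"
      then have "leads K ?M x ?y \<and> leads K ?M (?M ?y) x" using leads_stepD[OF \<open>leads K ?M ?y x\<close>] ne xy by auto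
      then have "leads K ?M (?M ?y) ?y" by (auto intro: rtrancl_trans)
      then show False using acyc_no_cycle[OF M] y by (auto simp: gam_def)
    qed
    moreover have "leads K ?M u x \<Longrightarrow> leads K ?M u ?y \<Longrightarrow> leads (K - ?C) F' u ?y \<Longrightarrow> leads K ?M ?y x"
    proof -
      assume a: "leads K ?M u x" "leads (K - ?C) F' u ?y"
      from leads_cut[OF a(1), of ?C] x obtain t where t: "t \<in> ?C" "leads (K - ?C) F' u t" "leads K ?M t x"
        by (auto simp: leads_merge_off)
      then have "?y = t" using root_eqI[of u t "K - ?C" F'] by auto
      then show ?thesis using t by simp
    qed
    ultimately show False using assms(3) uy acyc_root[OF assms(2), of u] by blast
  qed
qed

section \<open>Weighted rooted forests\<close>

context sgraph
begin

definition forests :: "'a set \<Rightarrow> ('a \<Rightarrow> 'a) set" where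
  "forests K = {F \<in> PiE K N. acyc K F}"

text \<open>Up to the product of the degrees, this is the number of ways of choosing parallel edges
  for \<open>F\<close>. The normalised weights are therefore the law of the uniform spanning tree of
  \<open>K\<close> with its complement wired, oriented towards the roots.\<close>

definition wt :: "'a set \<Rightarrow> ('a \<Rightarrow> 'a) \<Rightarrow> real" where "wt K F = (\<Prod>x\<in>K. p x (F x))"

definition Z :: "'a set \<Rightarrow> real" where "Z K = (\<Sum>F\<in>forests K. wt K F)"

definition EF :: "'a set \<Rightarrow> (('a \<Rightarrow> 'a) \<Rightarrow> real) \<Rightarrow> real" where
  "EF K \<psi> = (\<Sum>F\<in>forests K. wt K F * \<psi> F) / Z K"

lemma forestsD: "F \<in> forests K \<Longrightarrow> acyc K F" "F \<in> forests K \<Longrightarrow> F \<in> PiE K N"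
  by (auto simp: forests_def)

lemma finite_PiE_N: "finite K \<Longrightarrow> finite (PiE K N)" by (intro finite_PiE) auto

lemma finite_forests: "finite K \<Longrightarrow> finite (forests K)"
  using finite_PiE_N by (auto simp: forests_def)

lemma wt_nonneg: "wt K F \<ge> 0" unfolding wt_def by (intro prod_nonneg) (auto simp: p_nonneg)

lemma wt_upd: "finite K \<Longrightarrow> y \<in> K \<Longrightarrow> wt K (F(y := z)) = wt (K - {y}) F * p y z"
  unfolding wt_def by (subst prod.remove[of K y]) (auto intro!: arg_cong2[where f = "(*)"] prod.cong)

lemma sum_PiE_split:
  fixes h :: "('a \<Rightarrow> 'a) \<Rightarrow> real"
  assumes "finite K" "y \<in> K"
  shows "(\<Sum>\<Phi>\<in>PiE K N. h \<Phi>) = (\<Sum>F\<in>PiE (K - {y}) N. \<Sum>z\<in>N y. h (F(y := z)))"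
proof -
  have K: "K = insert y (K - {y})" using assms by auto
  have "(\<Sum>\<Phi>\<in>PiE K N. h \<Phi>) = (\<Sum>(z, F)\<in>N y \<times> PiE (K - {y}) N. h (F(y := z)))"
    by (subst K, subst PiE_insert_eq, subst sum.reindex)
       (use inj_combinator[of y "K - {y}" N] in \<open>auto simp: case_prod_unfold\<close>)
  also have "\<dots> = (\<Sum>z\<in>N y. \<Sum>F\<in>PiE (K - {y}) N. h (F(y := z)))"
    by (rule sum.cartesian_product[symmetric])
  finally show ?thesis by (subst (asm) sum.swap)
qed

lemma acyc_upd: "acyc (K - {y}) (F(y := z)) \<longleftrightarrow> acyc (K - {y}) F"
proof -
  have "frel (K - {y}) (F(y := z)) = frel (K - {y}) F" by (rule frel_cong) auto
  then show ?thesis by (simp add: acyc_def)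
qed

lemma leads_upd: "leads (K - {y}) (F(y := z)) a b \<longleftrightarrow> leads (K - {y}) F a b"
proof -
  have "frel (K - {y}) (F(y := z)) = frel (K - {y}) F" by (rule frel_cong) auto
  then show ?thesis by simp
qed

lemma root_upd: "root (K - {y}) (F(y := z)) a = root (K - {y}) F a"
  by (simp add: root_def leads_upd)

text \<open>Given the other edges, the edge of \<open>y\<close> is a step of the walk, rejected if
  its endpoint leads back to \<open>y\<close>.\<close>

lemma sum_forests_split:
  assumes K: "finite K" and y: "y \<in> K"
  shows "(\<Sum>F\<in>forests K. wt K F * h F) =
    (\<Sum>F\<in>forests (K - {y}). wt (K - {y}) F * PP (\<lambda>z. of_bool (root (K - {y}) F z \<noteq> y) * h (F(y := z))) y)"
proof -
  have "(\<Sum>F\<in>forests K. wt K F * h F) = (\<Sum>\<Phi>\<in>PiE K N. of_bool (acyc K \<Phi>) * (wt K \<Phi> * h \<Phi>))"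
    unfolding forests_def by (rule sum.mono_neutral_cong_left) (auto simp: finite_PiE_N K)
  also have "\<dots> = (\<Sum>F\<in>PiE (K - {y}) N. \<Sum>z\<in>N y. of_bool (acyc K (F(y := z))) * (wt K (F(y := z)) * h (F(y := z))))"
    by (rule sum_PiE_split[OF K y])
  also have "\<dots> = (\<Sum>F\<in>PiE (K - {y}) N. of_bool (acyc (K - {y}) F) * (wt (K - {y}) F * PP (\<lambda>z. of_bool (root (K - {y}) F z \<noteq> y) * h (F(y := z))) y))"
  proof (rule sum.cong[OF refl])
    fix F
    have "acyc K (F(y := z)) \<longleftrightarrow> acyc (K - {y}) F \<and> root (K - {y}) F z \<noteq> y" for z
      using acyc_iff_minus[OF y, of "F(y := z)"] root_eq_iff[of "K - {y}" F y z]
      by (auto simp: acyc_upd leads_upd)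
    then show "(\<Sum>z\<in>N y. of_bool (acyc K (F(y := z))) * (wt K (F(y := z)) * h (F(y := z)))) =
      of_bool (acyc (K - {y}) F) * (wt (K - {y}) F * PP (\<lambda>z. of_bool (root (K - {y}) F z \<noteq> y) * h (F(y := z))) y)"
      unfolding PP_def sum_distrib_left by (intro sum.cong) (auto simp: wt_upd K y)
  qed
  also have "\<dots> = (\<Sum>F\<in>forests (K - {y}). wt (K - {y}) F * PP (\<lambda>z. of_bool (root (K - {y}) F z \<noteq> y) * h (F(y := z))) y)"
    unfolding forests_def by (rule sum.mono_neutral_cong_right) (auto simp: finite_PiE_N K)
  finally show ?thesis .
qed

end

section \<open>The law of the root and the Markov property of the forest\<close>

context tgraph
begin

text \<open>The Green function at \<open>x\<close> is the reciprocal of the probability of leaving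
  \<open>K\<close> without returning to \<open>x\<close>, and the exit law from \<open>x\<close> is
  that of an excursion conditioned not to return. Both follow by writing a function on
  \<open>K\<close> as its boundary part on \<open>K - {x}\<close> plus its value at \<open>x\<close>
  times the probability of hitting \<open>x\<close>.\<close>

lemma escape:
  assumes K: "finite K" and x: "x \<in> K"
  shows "pot K (\<lambda>z. of_bool (z = x)) x * PP (HK (K - {x}) (\<lambda>z. of_bool (z \<noteq> x))) x = 1"
    and "HK K \<phi> x * PP (HK (K - {x}) (\<lambda>z. of_bool (z \<noteq> x))) x = PP (HK (K - {x}) (\<lambda>z. of_bool (z \<noteq> x) * \<phi> z)) x"
proof -
  let ?L = "K - {x}" and ?c = "pot K (\<lambda>z. of_bool (z = x)) x" and ?a = "HK K \<phi> x"
  let ?ret = "PP (HK (K - {x}) (\<lambda>z. of_bool (z = x))) x"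
  have L: "finite ?L" using K by auto
  have "of_bool (z \<noteq> x) = 1 - (of_bool (z = x) :: real)" for z by auto
  then have e: "PP (HK ?L (\<lambda>z. of_bool (z \<noteq> x))) x = 1 - ?ret"
    by (simp add: HK_diff[OF L, of "\<lambda>_. 1", abs_def] HK_const[OF L] PP_diff PP_const)
  have c: "pot K (\<lambda>z. of_bool (z = x)) y = ?c * HK ?L (\<lambda>z. of_bool (z = x)) y" for y
    by (subst HK_cmult[OF L, symmetric], rule HK_unique[OF L, symmetric])
       (use pot_eq[OF K] in \<open>auto simp: pot_off\<close>)
  have "?c = 1 + PP (\<lambda>y. ?c * HK ?L (\<lambda>z. of_bool (z = x)) y) x"
    using pot_eq[OF K x, of "\<lambda>z. of_bool (z = x)"] unfolding c[symmetric] by simp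
  then show "?c * PP (HK ?L (\<lambda>z. of_bool (z \<noteq> x))) x = 1"
    by (simp add: e PP_cmult right_diff_distrib)
  have a: "HK K \<phi> y = HK ?L (\<lambda>z. of_bool (z \<noteq> x) * \<phi> z + ?a * of_bool (z = x)) y" for y
    by (rule HK_unique[OF L, symmetric]) (use HK_eq[OF K] in \<open>auto simp: HK_off\<close>)
  have "?a = PP (HK ?L (\<lambda>z. of_bool (z \<noteq> x) * \<phi> z + ?a * of_bool (z = x))) x"
    using HK_eq[OF K x, of \<phi>] PP_cong[where x = x, OF a] by simp
  also have "\<dots> = PP (HK ?L (\<lambda>z. of_bool (z \<noteq> x) * \<phi> z)) x + ?a * ?ret"
    by (simp add: HK_add[OF L, abs_def] HK_cmult[OF L, abs_def] PP_add PP_cmult)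
  finally show "?a * PP (HK ?L (\<lambda>z. of_bool (z \<noteq> x))) x = PP (HK ?L (\<lambda>z. of_bool (z \<noteq> x) * \<phi> z)) x"
    by (simp add: e algebra_simps)
qed

lemma pot_diag_pos: "finite K \<Longrightarrow> x \<in> K \<Longrightarrow> pot K (\<lambda>z. of_bool (z = x)) x > 0"
  using pot_eq[of K x "\<lambda>z. of_bool (z = x)"] PP_nonneg[of x "pot K (\<lambda>z. of_bool (z = x))"]
  by (simp add: pot_nonneg)

text \<open>The three claims need each other in one induction on the size of \<open>K\<close>. The
  edge of \<open>x\<close> is chosen on top of a forest of \<open>K - {x}\<close>, in which roots
  follow the exit law of the walk by induction, and is rejected if it leads back to
  \<open>x\<close>. So the root of \<open>x\<close> has the law of an excursion conditioned not to
  return, which \<open>escape\<close> identifies with the exit law from \<open>K\<close>; the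
  acceptance probability gives the ratio of the two values of \<open>Z\<close>.\<close>

lemma forest_law_aux:
  "finite K \<Longrightarrow> Z K > 0 \<and> (\<forall>x \<rho>. EF K (\<lambda>F. of_bool (root K F x \<in> \<rho>)) = HK K (\<lambda>z. of_bool (z \<in> \<rho>)) x)
     \<and> (\<forall>x\<in>K. Z (K - {x}) = Z K * pot K (\<lambda>z. of_bool (z = x)) x)"
proof (induction "card K" arbitrary: K rule: less_induct)
  case less
  note K = less.prems
  show ?case
  proof (cases "K = {}")
    case True
    then have "forests K = {\<lambda>_. undefined}" by (auto simp: forests_def acyc_def)
    then show ?thesis by (auto simp: True Z_def wt_def EF_def root_off HK_off)
  next
    case False
    have IH: "Z (K - {x}) > 0" "EF (K - {x}) (\<lambda>F. of_bool (root (K - {x}) F y \<in> \<rho>)) = HK (K - {x}) (\<lambda>z. of_bool (z \<in> \<rho>)) y"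
      if "x \<in> K" for x y \<rho>
    proof -
      have "card (K - {x}) < card K" using that K by (meson card_Diff1_less)
      from less.hyps[OF this] K show "Z (K - {x}) > 0"
        "EF (K - {x}) (\<lambda>F. of_bool (root (K - {x}) F y \<in> \<rho>)) = HK (K - {x}) (\<lambda>z. of_bool (z \<in> \<rho>)) y" by auto
    qed
    have num: "(\<Sum>F\<in>forests K. wt K F * of_bool (root K F x \<in> \<rho>)) =
        Z (K - {x}) * PP (HK (K - {x}) (\<lambda>z. of_bool (z \<noteq> x \<and> z \<in> \<rho>))) x" if x: "x \<in> K" for x \<rho>
    proof -
      let ?L = "K - {x}"
      have "(\<Sum>F\<in>forests K. wt K F * of_bool (root K F x \<in> \<rho>)) = (\<Sum>F\<in>forests ?L. wt ?L F *
          PP (\<lambda>z. of_bool (root ?L F z \<noteq> x) * of_bool (root K (F(x := z)) x \<in> \<rho>)) x)"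
        by (rule sum_forests_split[OF K x])
      also have "\<dots> = (\<Sum>F\<in>forests ?L. wt ?L F * PP (\<lambda>z. of_bool (root ?L F z \<in> {z. z \<noteq> x \<and> z \<in> \<rho>})) x)"
      proof (intro sum.cong refl arg_cong2[where f = "(*)"] PP_cong)
        fix F z assume "F \<in> forests ?L"
        then have a: "acyc ?L (F(x := z))" using forestsD acyc_upd by metis
        show "of_bool (root ?L F z \<noteq> x) * of_bool (root K (F(x := z)) x \<in> \<rho>) = (of_bool (root ?L F z \<in> {z. z \<noteq> x \<and> z \<in> \<rho>}) :: real)"
          using root_fun_upd[OF a x, of z] by (auto simp: root_upd)
      qed
      also have "\<dots> = PP (\<lambda>z. Z ?L * EF ?L (\<lambda>F. of_bool (root ?L F z \<in> {z. z \<noteq> x \<and> z \<in> \<rho>}))) x"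
      proof -
        have "Z ?L * EF ?L \<psi> = (\<Sum>F\<in>forests ?L. wt ?L F * \<psi> F)" for \<psi>
          using IH(1)[OF x] by (simp add: EF_def)
        then show ?thesis by (simp only: PP_sum PP_cmult)
      qed
      also have "\<dots> = Z ?L * PP (HK ?L (\<lambda>z. of_bool (z \<noteq> x \<and> z \<in> \<rho>))) x"
        unfolding IH(2)[OF x] by (simp add: PP_cmult)
      finally show ?thesis .
    qed
    have ZK: "Z K = Z (K - {x}) * PP (HK (K - {x}) (\<lambda>z. of_bool (z \<noteq> x))) x" if "x \<in> K" for x
      using num[OF that, of UNIV] by (simp add: Z_def)
    have pos: "PP (HK (K - {x}) (\<lambda>z. of_bool (z \<noteq> x))) x > 0" if "x \<in> K" for x
      using escape(1)[OF K that] pot_diag_pos[OF K that] by (metis zero_less_mult_pos zero_less_one)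
    have Zpos: "Z K > 0" using False ZK IH(1) pos by (metis equals0I mult_pos_pos)
    have "EF K (\<lambda>F. of_bool (root K F x \<in> \<rho>)) = HK K (\<lambda>z. of_bool (z \<in> \<rho>)) x" for x \<rho>
    proof (cases "x \<in> K")
      case True
      have "EF K (\<lambda>F. of_bool (root K F x \<in> \<rho>)) = PP (HK (K - {x}) (\<lambda>z. of_bool (z \<noteq> x \<and> z \<in> \<rho>))) x / PP (HK (K - {x}) (\<lambda>z. of_bool (z \<noteq> x))) x"
        unfolding EF_def num[OF True] using ZK[OF True] IH(1)[OF True] by simp
      also have "\<dots> = HK K (\<lambda>z. of_bool (z \<in> \<rho>)) x"
      proof -
        have "(\<lambda>z. of_bool (z \<noteq> x) * of_bool (z \<in> \<rho>)) = (\<lambda>z. of_bool (z \<noteq> x \<and> z \<in> \<rho>) :: real)"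
          by (simp only: of_bool_conj)
        then have *: "PP (HK (K - {x}) (\<lambda>z. of_bool (z \<noteq> x \<and> z \<in> \<rho>))) x =
            HK K (\<lambda>z. of_bool (z \<in> \<rho>)) x * PP (HK (K - {x}) (\<lambda>z. of_bool (z \<noteq> x))) x"
          using escape(2)[OF K True, of "\<lambda>z. of_bool (z \<in> \<rho>)"] by simp
        show ?thesis unfolding * using pos[OF True] by simp
      qed
      finally show ?thesis .
    next
      case False
      then show ?thesis using Zpos by (simp add: EF_def root_off HK_off sum_distrib_right[symmetric] Z_def)
    qed
    moreover have "Z (K - {x}) = Z K * pot K (\<lambda>z. of_bool (z = x)) x" if "x \<in> K" for x
      using ZK[OF that] escape(1)[OF K that] by (simp add: mult_ac)
    ultimately show ?thesis using Zpos by auto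
  qed
qed

lemma Z_pos: "finite K \<Longrightarrow> Z K > 0"
  and root_law: "finite K \<Longrightarrow> EF K (\<lambda>F. of_bool (root K F x \<in> \<rho>)) = HK K (\<lambda>z. of_bool (z \<in> \<rho>)) x"
  and Z_minus: "finite K \<Longrightarrow> x \<in> K \<Longrightarrow> Z (K - {x}) = Z K * pot K (\<lambda>z. of_bool (z = x)) x"
  using forest_law_aux by blast+

lemma root_law1: "finite K \<Longrightarrow> EF K (\<lambda>F. of_bool (root K F x = v)) = HK K (\<lambda>z. of_bool (z = v)) x"
  using root_law[of K x "{v}"] by simp

lemma EF_mono: "finite K \<Longrightarrow> (\<And>F. F \<in> forests K \<Longrightarrow> \<psi> F \<le> \<upsilon> F) \<Longrightarrow> EF K \<psi> \<le> EF K \<upsilon>"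
  unfolding EF_def by (intro divide_right_mono sum_mono mult_left_mono) (auto simp: wt_nonneg less_imp_le Z_pos)

lemma EF_cong: "(\<And>F. F \<in> forests K \<Longrightarrow> \<psi> F = \<upsilon> F) \<Longrightarrow> EF K \<psi> = EF K \<upsilon>"
  unfolding EF_def by (intro arg_cong2[where f = "(/)"] sum.cong) auto

lemma EF_const: "finite K \<Longrightarrow> EF K (\<lambda>_. c) = c"
  using Z_pos[of K] by (simp add: EF_def Z_def sum_distrib_right[symmetric])

lemma EF_cmult: "EF K (\<lambda>F. c * \<psi> F) = c * EF K \<psi>"
  unfolding EF_def by (simp add: sum_distrib_left mult_ac)

lemma EF_cmult2: "EF K (\<lambda>F. \<psi> F * c) = EF K \<psi> * c"
  using EF_cmult[of K c \<psi>] by (simp add: mult_ac)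

lemma EF_add: "EF K (\<lambda>F. \<psi> F + \<upsilon> F) = EF K \<psi> + EF K \<upsilon>"
  unfolding EF_def by (simp add: distrib_left sum.distrib add_divide_distrib)

lemma EF_sum: "EF K (\<lambda>F. \<Sum>i\<in>I. \<psi> i F) = (\<Sum>i\<in>I. EF K (\<psi> i))"
  unfolding EF_def by (simp add: sum_distrib_left sum.swap[of _ I] sum_divide_distrib)

lemma EF_nonneg: "finite K \<Longrightarrow> (\<And>F. F \<in> forests K \<Longrightarrow> 0 \<le> \<psi> F) \<Longrightarrow> 0 \<le> EF K \<psi>"
  using EF_mono[of K "\<lambda>_. 0" \<psi>] by (simp add: EF_const)

text \<open>
  Conditionally on the path from \<open>x\<close>, the rest of the forest is a random forest of the complement
  of the path. The identity holds since exchanging the parts off the path preserves the weight.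
\<close>

lemma tower:
  assumes K: "finite K" and x: "x \<in> K"
  shows "EF K \<psi> = EF K (\<lambda>F. EF (K - gam K F x) (\<lambda>F'. \<psi> (merge (gam K F x) F F')))"
proof -
  let ?C = "\<lambda>F. gam K F x"
  let ?A = "SIGMA F:forests K. forests (K - ?C F)"
  \<comment> \<open>An involution: the merged forest has the same path from \<open>x\<close>, so a
    second exchange restores both parts.\<close>
  let ?h = "\<lambda>(F, F'). (merge (?C F) F F', restrict F (K - ?C F))"
  have h: "?h q \<in> ?A" "?h (?h q) = q" "?C (fst (?h q)) = ?C (fst q)"
     "wt K (fst (?h q)) * wt (K - ?C (fst q)) (snd (?h q)) = wt K (fst q) * wt (K - ?C (fst q)) (snd q)"
    if qA: "q \<in> ?A" for q
  proof -
    obtain F F' where q: "q = (F, F')" by (cases q)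
    let ?C = "gam K F x" and ?M = "merge (gam K F x) F F'" and ?R = "restrict F (K - gam K F x)"
    have F: "acyc K F" "F \<in> PiE K N" "acyc (K - ?C) F'" "F' \<in> PiE (K - ?C) N"
      using qA q by (auto simp: forests_def)
    have M: "?M \<in> PiE K N" using F gam_sub[of K F x] by (auto simp: merge_def PiE_def Pi_def extensional_def)
    have "frel (K - ?C) ?R = frel (K - ?C) F" by (rule frel_cong) auto
    then have "acyc (K - ?C) ?R" using acyc_minus_gam[OF F(1), of ?C] by (simp add: acyc_def)
    then have R: "?R \<in> forests (K - ?C)" using F by (auto simp: forests_def)
    have gM: "gam K ?M x = ?C" using x by (rule gam_merge)
    show "?h q \<in> ?A" using M R root_merge(1)[OF F(1,3)] gM by (auto simp: q forests_def)
    show "gam K (fst (?h q)) x = gam K (fst q) x" using gM q by simp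
    have "merge ?C ?M ?R = F"
      using F(2) by (auto simp: merge_def fun_eq_iff PiE_def extensional_def)
    moreover have "restrict ?M (K - ?C) = F'"
      using F(4) by (auto simp: merge_def fun_eq_iff PiE_def extensional_def)
    ultimately show "?h (?h q) = q" using gM by (simp add: q)
    have split: "wt K H = wt ?C H * wt (K - ?C) H" for H
      unfolding wt_def using prod.subset_diff[OF gam_sub K] by (simp add: mult.commute)
    have "wt ?C ?M = wt ?C F" "wt (K - ?C) ?M = wt (K - ?C) F'" "wt (K - ?C) ?R = wt (K - ?C) F"
      unfolding wt_def by (auto simp: merge_def intro!: prod.cong)
    then show "wt K (fst (?h q)) * wt (K - gam K (fst q) x) (snd (?h q)) = wt K (fst q) * wt (K - gam K (fst q) x) (snd q)"
      using split[of ?M] split[of F] by (simp add: q mult_ac)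
  qed
  have fin: "finite (forests L)" if "L \<subseteq> K" for L using finite_forests finite_subset[OF that K] by blast
  have Sig: "(\<Sum>F\<in>forests K. \<Sum>F'\<in>forests (K - ?C F). f F F') = (\<Sum>(F, F')\<in>?A. f F F')" for f :: "_ \<Rightarrow> _ \<Rightarrow> real"
    by (rule sum.Sigma) (auto intro!: fin)
  have "(\<Sum>F\<in>forests K. wt K F * EF (K - ?C F) (\<lambda>F'. \<psi> (merge (?C F) F F')))
      = (\<Sum>F\<in>forests K. \<Sum>F'\<in>forests (K - ?C F). wt K F * wt (K - ?C F) F' / Z (K - ?C F) * \<psi> (merge (?C F) F F'))"
    unfolding EF_def by (simp add: sum_distrib_left sum_divide_distrib mult_ac)
  also have "\<dots> = (\<Sum>(F, F')\<in>?A. wt K F * wt (K - ?C F) F' / Z (K - ?C F) * \<psi> (merge (?C F) F F'))"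
    by (rule Sig)
  also have "\<dots> = (\<Sum>(F, F')\<in>?A. wt K F * wt (K - ?C F) F' / Z (K - ?C F) * \<psi> F)"
  proof (rule sum.reindex_bij_witness[where i = ?h and j = ?h])
    fix q assume q: "q \<in> ?A"
    show "?h (?h q) = q" by (rule h(2)[OF q])
    show "?h (?h q) = q" by (rule h(2)[OF q])
    show "?h q \<in> ?A" by (rule h(1)[OF q])
    show "?h q \<in> ?A" by (rule h(1)[OF q])
    show "(case ?h q of (F, F') \<Rightarrow> wt K F * wt (K - ?C F) F' / Z (K - ?C F) * \<psi> F) =
       (case q of (F, F') \<Rightarrow> wt K F * wt (K - ?C F) F' / Z (K - ?C F) * \<psi> (merge (?C F) F F'))"
      using h(3,4)[OF q] by (cases q) (simp add: case_prod_unfold)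
  qed
  also have "\<dots> = (\<Sum>F\<in>forests K. \<Sum>F'\<in>forests (K - ?C F). wt K F * wt (K - ?C F) F' / Z (K - ?C F) * \<psi> F)"
    by (rule Sig[symmetric])
  also have "\<dots> = (\<Sum>F\<in>forests K. wt K F * \<psi> F)"
  proof (rule sum.cong[OF refl])
    fix F
    have "Z (K - ?C F) > 0" using K by (intro Z_pos) auto
    then have "(\<Sum>F'\<in>forests (K - ?C F). wt (K - ?C F) F') / Z (K - ?C F) = 1" by (simp add: Z_def)
    moreover have "(\<Sum>F'\<in>forests (K - ?C F). wt K F * wt (K - ?C F) F' / Z (K - ?C F) * \<psi> F) =
        (wt K F * \<psi> F) * ((\<Sum>F'\<in>forests (K - ?C F). wt (K - ?C F) F') / Z (K - ?C F))"
      unfolding sum_divide_distrib sum_distrib_left by (intro sum.cong) (auto simp: mult_ac)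
    ultimately show "(\<Sum>F'\<in>forests (K - ?C F). wt K F * wt (K - ?C F) F' / Z (K - ?C F) * \<psi> F) = wt K F * \<psi> F"
      by simp
  qed
  finally show ?thesis unfolding EF_def[of K] by simp
qed

end

context tgraph
begin

section \<open>Connection probabilities in the forest\<close>

lemma prob_root_le: "finite K \<Longrightarrow> EF K (\<lambda>F. of_bool (root K F u = v)) \<le> g u v"
  by (simp add: root_law1 HK_le_g)

lemma g_le_mult: "g u v \<le> g u x * g x x" "g u v \<le> g v v * g u v"
  if "x = v" using g_self[of v] g_nonneg[of u v] that
  by (auto simp: mult_le_cancel_left1 mult_le_cancel_right1)

text \<open>With the path of \<open>x\<close> revealed first, \<open>u\<close> must have
  \<open>x\<close> as its root in the forest of the complement of this path, while \<open>x\<close>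
  itself has root \<open>v\<close>. The root law, applied twice, gives the two factors.\<close>

lemma prob_root_via_le:
  assumes K: "finite K" and v: "v \<notin> K"
  shows "EF K (\<lambda>F. of_bool (root K F u = v \<and> x \<in> gam K F u)) \<le> g u x * g x v"
proof (cases "x \<in> K")
  case x: True
  have "EF K (\<lambda>F. of_bool (root K F u = v \<and> x \<in> gam K F u)) =
    EF K (\<lambda>F. EF (K - gam K F x) (\<lambda>F'. of_bool (root K (merge (gam K F x) F F') u = v \<and> x \<in> gam K (merge (gam K F x) F F') u)))"
    by (rule tower[OF K x])
  also have "\<dots> \<le> EF K (\<lambda>F. g u x * of_bool (root K F x = v))"
  proof (rule EF_mono[OF K])
    fix F assume F: "F \<in> forests K"
    let ?C = "gam K F x"
    have L: "finite (K - ?C)" using K by auto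
    have "EF (K - ?C) (\<lambda>F'. of_bool (root K (merge ?C F F') u = v \<and> x \<in> gam K (merge ?C F F') u))
      \<le> EF (K - ?C) (\<lambda>F'. of_bool (root (K - ?C) F' u = x) * of_bool (root K F x = v))"
    proof (rule EF_mono[OF L])
      fix F' assume F': "F' \<in> forests (K - ?C)"
      note a = forestsD(1)[OF F] forestsD(1)[OF F']
      show "of_bool (root K (merge ?C F F') u = v \<and> x \<in> gam K (merge ?C F F') u) \<le>
         of_bool (root (K - ?C) F' u = x) * (of_bool (root K F x = v) :: real)"
        using merge_leads_to_eq[OF a, of u] merge_leads_to[OF a(2), of u] root_merge(2)[OF a, of u] x
        by (auto simp: gam_def)
    qed
    also have "\<dots> \<le> g u x * of_bool (root K F x = v)"
      unfolding EF_cmult2 by (intro mult_right_mono prob_root_le L) auto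
    finally show "EF (K - ?C) (\<lambda>F'. of_bool (root K (merge ?C F F') u = v \<and> x \<in> gam K (merge ?C F F') u)) \<le> \<dots>" .
  qed
  also have "\<dots> \<le> g u x * g x v"
    unfolding EF_cmult by (intro mult_left_mono prob_root_le K g_nonneg)
  finally show ?thesis .
next
  case False
  then have "EF K (\<lambda>F. of_bool (root K F u = v \<and> x \<in> gam K F u)) = EF K (\<lambda>F. 0)"
    by (intro EF_cong) (auto simp: gam_def)
  then show ?thesis by (simp add: EF_const K g_nonneg)
qed

text \<open>The path of \<open>y\<close>, the vertex nearest to the root, is revealed first. In its
  complement \<open>u\<close> has root \<open>y\<close> and passes through \<open>x\<close>, which
  is the case of one intermediate vertex.\<close>

lemma prob_root_via2_le:
  assumes K: "finite K" and v: "v \<notin> K"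
  shows "EF K (\<lambda>F. of_bool (root K F u = v \<and> x \<in> gam K F u \<and> y \<in> gam K F x)) \<le> g u x * g x y * g y v"
proof -
  consider "y \<notin> K" | "x = y" | "y \<in> K" "x \<noteq> y" by blast
  then show ?thesis
  proof cases
    case 1
    then have "EF K (\<lambda>F. of_bool (root K F u = v \<and> x \<in> gam K F u \<and> y \<in> gam K F x)) = EF K (\<lambda>F. 0)"
      by (intro EF_cong) (auto simp: gam_def)
    then show ?thesis by (simp add: EF_const K g_nonneg)
  next
    \<comment> \<open>The additional factor \<open>g x x\<close> is at least 1.\<close>
    case 2
    have "EF K (\<lambda>F. of_bool (root K F u = v \<and> x \<in> gam K F u \<and> y \<in> gam K F x)) \<le> g u x * g x v"
      by (rule order_trans[OF EF_mono[OF K] prob_root_via_le[OF K v]]) auto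
    also have "\<dots> \<le> g u x * g x x * g x v"
      using mult_right_mono[OF g_le_mult(1)[of x x u], of "g x v"] g_nonneg by simp
    finally show ?thesis using 2 by simp
  next
    case 3
    have "EF K (\<lambda>F. of_bool (root K F u = v \<and> x \<in> gam K F u \<and> y \<in> gam K F x)) =
      EF K (\<lambda>F. EF (K - gam K F y) (\<lambda>F'. of_bool (root K (merge (gam K F y) F F') u = v
         \<and> x \<in> gam K (merge (gam K F y) F F') u \<and> y \<in> gam K (merge (gam K F y) F F') x)))"
      by (rule tower[OF K 3(1)])
    also have "\<dots> \<le> EF K (\<lambda>F. g u x * g x y * of_bool (root K F y = v))"
    proof (rule EF_mono[OF K])
      fix F assume F: "F \<in> forests K"
      let ?C = "gam K F y"
      have L: "finite (K - ?C)" using K by auto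
      have "EF (K - ?C) (\<lambda>F'. of_bool (root K (merge ?C F F') u = v
         \<and> x \<in> gam K (merge ?C F F') u \<and> y \<in> gam K (merge ?C F F') x))
        \<le> EF (K - ?C) (\<lambda>F'. of_bool (root (K - ?C) F' u = y \<and> x \<in> gam (K - ?C) F' u) * of_bool (root K F y = v))"
      proof (rule EF_mono[OF L])
        fix F' assume F': "F' \<in> forests (K - ?C)"
        let ?M = "merge ?C F F'"
        note a = forestsD(1)[OF F] forestsD(1)[OF F']
        {
          assume *: "root K ?M u = v" "leads K ?M u x" "leads K ?M x y" "x \<in> K"
          have uy: "leads K ?M u y" using * by auto
          note b = merge_leads_to_eq[OF a uy 3(1)] merge_leads_to_eq[OF a *(3) 3(1)]
          have xC: "x \<notin> ?C" using b(2) 3(2) root_off[of x "K - ?C" F'] by auto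
          from leads_cut[OF *(2), of ?C] have "leads (K - ?C) F' u x"
          proof
            assume "\<exists>t\<in>?C \<inter> K. leads (K - ?C) ?M u t \<and> leads K ?M t x"
            then obtain t where t: "t \<in> ?C" "leads K ?M t x" by auto
            then have "leads K F t x" using leads_merge[OF t(1)] by auto
            then have "x \<in> ?C" using t \<open>x \<in> K\<close> by (auto simp: gam_def)
            then show ?thesis using xC by auto
          qed (simp add: leads_merge_off)
          moreover have "root K F y = v"
            using root_merge(2)[OF a, of u] b(1) * 3 by (auto simp: gam_def)
          ultimately have "root (K - ?C) F' u = y \<and> x \<in> gam (K - ?C) F' u \<and> root K F y = v"
            using b(1) xC * by (auto simp: gam_def)
        }
        then show "of_bool (root K ?M u = v \<and> x \<in> gam K ?M u \<and> y \<in> gam K ?M x) \<le>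
           of_bool (root (K - ?C) F' u = y \<and> x \<in> gam (K - ?C) F' u) * (of_bool (root K F y = v) :: real)"
          by (auto simp: gam_def)
      qed
      also have "\<dots> \<le> g u x * g x y * of_bool (root K F y = v)"
        unfolding EF_cmult2 by (intro mult_right_mono prob_root_via_le L) (auto simp: gam_def 3)
      finally show "EF (K - ?C) (\<lambda>F'. of_bool (root K (merge ?C F F') u = v
         \<and> x \<in> gam K (merge ?C F F') u \<and> y \<in> gam K (merge ?C F F') x)) \<le> \<dots>" .
    qed
    also have "\<dots> \<le> g u x * g x y * g y v"
      unfolding EF_cmult by (intro mult_left_mono prob_root_le K mult_nonneg_nonneg g_nonneg)
    finally show ?thesis .
  qed
qed

text \<open>The summation variable is the vertex at which the path of \<open>w\<close> meets that of
  \<open>u\<close>; it is the root of \<open>w\<close> in the forest of the complement of the path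
  of \<open>u\<close>. The value \<open>v\<close> stands for paths that meet only at the
  root.\<close>

lemma prob_two_roots_le:
  assumes K: "finite K" and v: "v \<notin> K" and u: "u \<in> K"
  shows "EF K (\<lambda>F. of_bool (root K F u = v \<and> root K F w = v)) \<le> (\<Sum>x\<in>insert v K. g w x * (g u x * g x v))"
proof -
  have "EF K (\<lambda>F. of_bool (root K F u = v \<and> root K F w = v)) =
    EF K (\<lambda>F. EF (K - gam K F u) (\<lambda>F'. of_bool (root K (merge (gam K F u) F F') u = v \<and> root K (merge (gam K F u) F F') w = v)))"
    by (rule tower[OF K u])
  also have "\<dots> \<le> EF K (\<lambda>F. \<Sum>x\<in>insert v K. g w x * of_bool (root K F u = v \<and> (x = v \<or> x \<in> gam K F u)))"
  proof (rule EF_mono[OF K])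
    fix F assume F: "F \<in> forests K"
    let ?C = "gam K F u"
    have L: "finite (K - ?C)" using K by auto
    have "EF (K - ?C) (\<lambda>F'. of_bool (root K (merge ?C F F') u = v \<and> root K (merge ?C F F') w = v))
      \<le> EF (K - ?C) (\<lambda>F'. \<Sum>x\<in>insert v K. of_bool (root (K - ?C) F' w = x) * of_bool (root K F u = v \<and> (x = v \<or> x \<in> ?C)))"
    proof (rule EF_mono[OF L])
      fix F' assume F': "F' \<in> forests (K - ?C)"
      note a = forestsD(1)[OF F] forestsD(1)[OF F']
      let ?x = "root (K - ?C) F' w"
      have uC: "u \<in> ?C" using u by (auto simp: gam_def)
      have "root (K - ?C) F' u = u" by (rule root_off) (auto simp: uC)
      then have 1: "root K (merge ?C F F') u = root K F u" using root_merge(2)[OF a, of u] uC by simp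
      have 2: "?x \<in> ?C \<or> ?x = v" if "root K (merge ?C F F') w = v"
        using root_merge(2)[OF a, of w] that by (auto split: if_splits)
      have "of_bool (root K (merge ?C F F') u = v \<and> root K (merge ?C F F') w = v) \<le>
         (\<Sum>x\<in>insert v K. if x = ?x then of_bool (root K F u = v \<and> (?x = v \<or> ?x \<in> ?C)) else (0::real))"
        using 1 2 K gam_sub[of K F u] by (auto simp: sum.delta)
      also have "\<dots> = (\<Sum>x\<in>insert v K. of_bool (root (K - ?C) F' w = x) * of_bool (root K F u = v \<and> (x = v \<or> x \<in> ?C)))"
        by (intro sum.cong) auto
      finally show "of_bool (root K (merge ?C F F') u = v \<and> root K (merge ?C F F') w = v) \<le> \<dots>" .
    qed
    also have "\<dots> \<le> (\<Sum>x\<in>insert v K. g w x * of_bool (root K F u = v \<and> (x = v \<or> x \<in> ?C)))"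
      unfolding EF_sum EF_cmult2 by (intro sum_mono mult_right_mono prob_root_le L) auto
    finally show "EF (K - ?C) (\<lambda>F'. of_bool (root K (merge ?C F F') u = v \<and> root K (merge ?C F F') w = v)) \<le> \<dots>" .
  qed
  also have "\<dots> \<le> (\<Sum>x\<in>insert v K. g w x * (g u x * g x v))"
    unfolding EF_sum EF_cmult
  proof (intro sum_mono mult_left_mono g_nonneg)
    fix x assume "x \<in> insert v K"
    show "EF K (\<lambda>F. of_bool (root K F u = v \<and> (x = v \<or> x \<in> gam K F u))) \<le> g u x * g x v"
    proof (cases "x = v")
      case True
      then show ?thesis using prob_root_le[OF K, of u v] g_le_mult(1)[of x v u] by simp
    next
      case False
      then show ?thesis using prob_root_via_le[OF K v, of u x] by simp
    qed
  qed
  finally show ?thesis .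
qed

definition arm :: "'a set \<Rightarrow> ('a \<Rightarrow> 'a) \<Rightarrow> 'a \<Rightarrow> nat \<Rightarrow> bool" where
  "arm K F v n \<longleftrightarrow> (\<exists>y\<in>K. root K F y = v \<and> n \<le> gdist G v y)"

text \<open>While \<open>arm\<close> is about the component of a root, this is about the part of the
  tree whose paths run through the interior vertex \<open>u\<close>.\<close>

definition subarm :: "'a set \<Rightarrow> ('a \<Rightarrow> 'a) \<Rightarrow> 'a \<Rightarrow> nat \<Rightarrow> bool" where
  "subarm K F u n \<longleftrightarrow> (\<exists>y. leads K F y u \<and> n \<le> gdist G u y)"

lemma gdist_self[simp]: "gdist G x x = 0" by (simp add: gdist_def Least_eq_0)

text \<open>Given the path of \<open>u\<close>, the tree above \<open>u\<close> is the component of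
  the root \<open>u\<close> in a random forest of the complement of the path. Its depth thus obeys
  an arm bound in a smaller set, which is why \<open>Q\<close> is required for all finite sets and
  all roots. The weight \<open>c\<close> will be the probability that the path survives.\<close>

lemma subarm_bound:
  assumes K: "finite K" and u: "u \<in> K" and n: "n \<ge> 1" and c: "\<And>C. 0 \<le> c C" and q: "0 \<le> q"
    and Q: "\<And>L w. finite L \<Longrightarrow> w \<notin> L \<Longrightarrow> EF L (\<lambda>F. of_bool (arm L F w n)) \<le> q"
  shows "EF K (\<lambda>F. of_bool (root K F u = v \<and> subarm K F u n) * c (gam K F u)) \<le>
    q * EF K (\<lambda>F. of_bool (root K F u = v) * c (gam K F u))"
proof -
  let ?M = "\<lambda>F F'. merge (gam K F u) F F'"
  have "EF K (\<lambda>F. of_bool (root K F u = v \<and> subarm K F u n) * c (gam K F u)) =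
    EF K (\<lambda>F. EF (K - gam K F u) (\<lambda>F'. of_bool (root K (?M F F') u = v \<and> subarm K (?M F F') u n) * c (gam K (?M F F') u)))"
    by (rule tower[OF K u])
  also have "\<dots> \<le> EF K (\<lambda>F. q * (of_bool (root K F u = v) * c (gam K F u)))"
  proof (rule EF_mono[OF K])
    fix F assume F: "F \<in> forests K"
    let ?C = "gam K F u"
    have L: "finite (K - ?C)" using K by auto
    have uC: "u \<in> ?C" using u by (auto simp: gam_def)
    have "EF (K - ?C) (\<lambda>F'. of_bool (root K (?M F F') u = v \<and> subarm K (?M F F') u n) * c (gam K (?M F F') u))
      \<le> EF (K - ?C) (\<lambda>F'. of_bool (arm (K - ?C) F' u n) * (of_bool (root K F u = v) * c ?C))"
    proof (rule EF_mono[OF L])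
      fix F' assume F': "F' \<in> forests (K - ?C)"
      note a = forestsD(1)[OF F] forestsD(1)[OF F']
      have "root (K - ?C) F' u = u" by (rule root_off) (auto simp: uC)
      then have 1: "root K (?M F F') u = root K F u" using root_merge(2)[OF a, of u] uC by simp
      have 2: "arm (K - ?C) F' u n" if sa: "subarm K (?M F F') u n"
      proof -
        obtain y where y: "leads K (?M F F') y u" "n \<le> gdist G u y" using sa by (auto simp: subarm_def)
        have "y \<noteq> u" using y n by auto
        moreover have "root (K - ?C) F' y = u" by (rule merge_leads_to_eq[OF a y(1) u])
        ultimately have "y \<in> K - ?C" using root_off[of y "K - ?C" F'] by auto
        then show ?thesis using y \<open>root (K - ?C) F' y = u\<close> by (auto simp: arm_def)
      qed
      show "of_bool (root K (?M F F') u = v \<and> subarm K (?M F F') u n) * c (gam K (?M F F') u) \<le>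
        of_bool (arm (K - ?C) F' u n) * (of_bool (root K F u = v) * c ?C)"
        using 1 2 c[of ?C] gam_merge[OF u, of F F'] by auto
    qed
    also have "\<dots> \<le> q * (of_bool (root K F u = v) * c ?C)"
      unfolding EF_cmult2 using uC c[of ?C] by (intro mult_right_mono Q L) auto
    finally show "EF (K - ?C) (\<lambda>F'. of_bool (root K (?M F F') u = v \<and> subarm K (?M F F') u n) * c (gam K (?M F F') u)) \<le> \<dots>" .
  qed
  also have "\<dots> = q * EF K (\<lambda>F. of_bool (root K F u = v) * c (gam K F u))" by (rule EF_cmult)
  finally show ?thesis .
qed

lemma gam_step_sub:
  assumes "w \<in> K" "acyc (K - {w}) F" "F w = z" "root (K - {w}) F z \<noteq> w"
  shows "gam K F w \<subseteq> insert w (gam (K - {w}) F z)"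
proof
  fix y assume "y \<in> gam K F w"
  then have y: "y \<in> K" "leads K F w y" by (auto simp: gam_def)
  show "y \<in> insert w (gam (K - {w}) F z)"
  proof (cases "y = w")
    case False
    then have "leads K F z y" using leads_stepD[OF y(2)] assms(3) by auto
    moreover have "\<not> leads (K - {w}) F z w" using root_eq_iff[OF assms(2), of w z] assms(4) by auto
    ultimately have "leads (K - {w}) F z y" using leads_cut1 by metis
    then show ?thesis using y False by (auto simp: gam_def)
  qed auto
qed

text \<open>
  The path of \<open>w\<close> is a loop erasure of the walk, and therefore avoids \<open>A\<close> more easily than the walk.
\<close>

lemma prob_path_avoids_ge:
  assumes "finite K" and "\<rho> \<inter> (K \<union> A) = {}"
  shows "HK (K - A) (\<lambda>z. of_bool (z \<in> \<rho>)) w \<le> EF K (\<lambda>F. of_bool (root K F w \<in> \<rho> \<and> gam K F w \<inter> A = {}))"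
  using assms
proof (induction "card K" arbitrary: K w rule: less_induct)
  case less
  note K = less.prems(1)
  have nn: "0 \<le> EF K (\<lambda>F. of_bool (root K F w \<in> \<rho> \<and> gam K F w \<inter> A = {}))" by (rule EF_nonneg[OF K]) auto
  consider "w \<in> A" | "w \<notin> K" "w \<notin> A" | "w \<in> K" "w \<notin> A" by blast
  then show ?case
  proof cases
    case 1
    then have "w \<notin> \<rho>" using less.prems by auto
    then show ?thesis using 1 nn by (simp add: HK_off)
  next
    case 2
    then have "gam K F w = {}" for F using leads_in[of w _ K F] by (auto simp: gam_def)
    then show ?thesis using 2 by (simp add: HK_off root_off EF_const K)
  next
    case 3
    let ?L = "K - {w}" and ?a = "\<lambda>K z. EF K (\<lambda>F. of_bool (root K F z \<in> \<rho> \<and> gam K F z \<inter> A = {}))"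
    have L: "finite ?L" "card ?L < card K" using K card_Diff1_less[OF K 3(1)] by auto
    have "Z ?L * PP (?a ?L) w = (\<Sum>F\<in>forests ?L. wt ?L F * PP (\<lambda>z. of_bool (root ?L F z \<in> \<rho> \<and> gam ?L F z \<inter> A = {})) w)"
    proof -
      have "Z ?L * EF ?L \<psi> = (\<Sum>F\<in>forests ?L. wt ?L F * \<psi> F)" for \<psi>
        using Z_pos[OF L(1)] by (simp add: EF_def)
      then show ?thesis by (simp only: PP_sum PP_cmult flip: PP_cmult)
    qed
    also have "\<dots> \<le> (\<Sum>F\<in>forests ?L. wt ?L F * PP (\<lambda>z. of_bool (root ?L F z \<noteq> w) *
        of_bool (root K (F(w := z)) w \<in> \<rho> \<and> gam K (F(w := z)) w \<inter> A = {})) w)"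
    proof (intro sum_mono mult_left_mono PP_mono wt_nonneg)
      fix F z assume F: "F \<in> forests ?L"
      have a: "acyc ?L (F(w := z))" using F forestsD acyc_upd by metis
      have w: "w \<notin> \<rho>" using less.prems 3 by auto
      have gL: "gam ?L (F(w := z)) z = gam ?L F z" by (simp add: gam_def leads_upd)
      show "of_bool (root ?L F z \<in> \<rho> \<and> gam ?L F z \<inter> A = {}) \<le> of_bool (root ?L F z \<noteq> w) *
        (of_bool (root K (F(w := z)) w \<in> \<rho> \<and> gam K (F(w := z)) w \<inter> A = {}) :: real)"
        using root_fun_upd[OF a 3(1), of z] gam_step_sub[OF 3(1) a, of z] w 3(2)
        by (auto simp: root_upd gL)
    qed
    also have "\<dots> = (\<Sum>F\<in>forests K. wt K F * of_bool (root K F w \<in> \<rho> \<and> gam K F w \<inter> A = {}))"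
      by (rule sum_forests_split[OF K 3(1), symmetric])
    also have "\<dots> = Z K * ?a K w" using Z_pos[OF K] by (simp add: EF_def)
    finally have "pot K (\<lambda>z. of_bool (z = w)) w * PP (?a ?L) w \<le> ?a K w"
      using Z_pos[OF K] by (simp add: Z_minus[OF K 3(1)] mult.assoc)
    moreover have "HK (K - A) (\<lambda>z. of_bool (z \<in> \<rho>)) w \<le> pot K (\<lambda>z. of_bool (z = w)) w * PP (?a ?L) w"
    proof -
      have KA: "finite (K - A)" "w \<in> K - A" using K 3 by auto
      have "(\<lambda>z. of_bool (z \<noteq> w) * of_bool (z \<in> \<rho>)) = (\<lambda>z. of_bool (z \<in> \<rho>) :: real)"
        by (rule ext) (use less.prems 3 in auto)
      note zr = this
      have "HK (K - A) (\<lambda>z. of_bool (z \<in> \<rho>)) w * 1 = pot (K - A) (\<lambda>z. of_bool (z = w)) w *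
          (HK (K - A) (\<lambda>z. of_bool (z \<in> \<rho>)) w * PP (HK (K - A - {w}) (\<lambda>z. of_bool (z \<noteq> w))) w)"
        unfolding escape(1)[OF KA, symmetric] by (simp only: mult_ac)
      also have "\<dots> = pot (K - A) (\<lambda>z. of_bool (z = w)) w * PP (HK (K - A - {w}) (\<lambda>z. of_bool (z \<in> \<rho>))) w"
        unfolding escape(2)[OF KA] zr ..
      \<comment> \<open>The gain from loop erasure: the Green function in \<open>K\<close> also
        counts returns to \<open>w\<close> along loops that hit \<open>A\<close>.\<close>
      also have "\<dots> \<le> pot K (\<lambda>z. of_bool (z = w)) w * PP (?a ?L) w"
      proof (intro mult_mono PP_mono)
        show "pot (K - A) (\<lambda>z. of_bool (z = w)) w \<le> pot K (\<lambda>z. of_bool (z = w)) w"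
          by (rule pot_mono_set[OF K]) auto
        show "HK (K - A - {w}) (\<lambda>z. of_bool (z \<in> \<rho>)) z \<le> ?a ?L z" for z
        proof -
          have "K - A - {w} = ?L - A" by auto
          then show ?thesis using less.hyps[OF L(2,1)] less.prems by auto
        qed
      qed (use KA in \<open>auto intro!: pot_nonneg K PP_nonneg HK_nonneg\<close>)
      finally show ?thesis by simp
    qed
    ultimately show ?thesis by simp
  qed
qed

section \<open>Invariance under random walk updates\<close>

text \<open>
  If a random walk is run from \<open>z\<close> until it leaves \<open>K\<close>, and each vertex it visits is given the edge
  of its last exit, the law of the forest is preserved. While the walk is at \<open>x\<close> the current
  configuration is a forest of \<open>K - {x}\<close> in which \<open>z\<close> leads to \<open>x\<close>.
\<close>

definition Xs :: "'a set \<Rightarrow> 'a \<Rightarrow> ('a \<Rightarrow> 'a) \<Rightarrow> 'a set" where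
  "Xs K z \<Phi> = {x \<in> K. acyc (K - {x}) \<Phi> \<and> leads (K - {x}) \<Phi> z x}"

text \<open>If \<open>\<Phi>\<close> is acyclic, these are the vertices on the path of
  \<open>z\<close>. Otherwise there are none unless \<open>\<Phi>\<close> has a single cycle and
  \<open>z\<close> leads to it, and then they are the vertices of the cycle.\<close>

lemma Xs_iff: "x \<in> Xs K z \<Phi> \<longleftrightarrow> x \<in> K \<and> leads K \<Phi> z x \<and> (\<forall>y\<in>K. leads K \<Phi> y x \<or> (\<exists>r. r \<notin> K \<and> leads K \<Phi> y r))"
proof -
  have "leads (K - {x}) \<Phi> z x \<longleftrightarrow> leads K \<Phi> z x"
    using leads_to_cut[of z x K \<Phi>] leads_mono[of z x "K - {x}" \<Phi> K] by auto
  then show ?thesis using acyc_minus_iff[of x K \<Phi>] unfolding Xs_def mem_Collect_eq by metis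
qed

lemma Xs_in: "x \<in> Xs K z \<Phi> \<Longrightarrow> x \<in> K" and Xs_leads: "x \<in> Xs K z \<Phi> \<Longrightarrow> leads K \<Phi> z x"
  unfolding Xs_iff by auto

lemma cycle_pred_unique_aux:
  assumes "x1 \<in> K" "\<Phi> x1 = t" "leads K \<Phi> t x2" "leads (K - {x2}) \<Phi> t x1"
  shows "x1 = x2"
proof (rule ccontr)
  assume ne: "x1 \<noteq> x2"
  have "leads (K - {x2}) \<Phi> t x2" by (rule leads_to_cut[OF assms(3)])
  then have "leads (K - {x2}) \<Phi> x1 x2" using assms ne leads_step[of x1 "K - {x2}" \<Phi>] by auto
  then have "leads (K - {x2}) \<Phi> x2 x1" using cycle_leads_back[where K = "K - {x2}" and F = \<Phi> and y = x1 and t = x2] assms by auto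
  then show False using leads_off ne by (metis Diff_iff singletonI)
qed

lemma cycle_pred_unique:
  assumes "x1 \<in> K" "x2 \<in> K" "\<Phi> x1 = t" "\<Phi> x2 = t" "leads K \<Phi> t x1" "leads K \<Phi> t x2"
  shows "x1 = x2"
proof -
  have "\<exists>x\<in>{x1, x2}. leads (K - {x1, x2}) \<Phi> t x"
    using leads_cut[OF assms(5), of "{x1, x2}"] leads_off[of x1 _ "K - {x1, x2}"] by auto
  then consider "leads (K - {x2}) \<Phi> t x1" | "leads (K - {x1}) \<Phi> t x2"
    using leads_mono[of t _ "K - {x1, x2}" \<Phi>] by (metis Diff_mono insertE insert_subset order_refl singletonD subset_insertI)
  then show ?thesis
    using cycle_pred_unique_aux[OF assms(1,3,6)] cycle_pred_unique_aux[OF assms(2,4,5)] by cases auto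
qed

lemma Xs_inj: "inj_on \<Phi> {x \<in> Xs K z \<Phi>. \<Phi> x \<in> K}"
proof (rule inj_onI)
  have main: "x1 = x2" if "x1 \<in> Xs K z \<Phi>" "x2 \<in> K" "\<Phi> x1 \<in> K" "\<Phi> x1 = \<Phi> x2" "leads K \<Phi> x1 x2" for x1 x2
  proof (rule ccontr)
    assume ne: "x1 \<noteq> x2"
    let ?t = "\<Phi> x1"
    have t2: "leads K \<Phi> ?t x2" using leads_stepD[OF that(5)] ne by auto
    have "leads K \<Phi> ?t x1"
    proof -
      have "\<not> leads K \<Phi> ?t r" if "r \<notin> K" for r
      proof
        assume "leads K \<Phi> ?t r"
        then have "leads K \<Phi> x2 r" using \<open>x2 \<in> K\<close> \<open>\<Phi> x1 = \<Phi> x2\<close> leads_step by metis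
        then have "leads K \<Phi> r x2" using cycle_leads_back t2 \<open>\<Phi> x1 = \<Phi> x2\<close> by metis
        then show False using leads_off[of r x2 K \<Phi>] \<open>r \<notin> K\<close> \<open>x2 \<in> K\<close> by auto
      qed
      then show ?thesis using that(1,3) unfolding Xs_iff by blast
    qed
    from cycle_pred_unique[OF Xs_in[OF that(1)] that(2) refl that(4)[symmetric] this t2] show False using ne by simp
  qed
  fix x1 x2 assume *: "x1 \<in> {x \<in> Xs K z \<Phi>. \<Phi> x \<in> K}" "x2 \<in> {x \<in> Xs K z \<Phi>. \<Phi> x \<in> K}" "\<Phi> x1 = \<Phi> x2"
  then have "leads K \<Phi> x1 x2 \<or> leads K \<Phi> x2 x1" using leads_linear[OF Xs_leads Xs_leads] by blast
  moreover have "x1 \<in> Xs K z \<Phi>" "x2 \<in> Xs K z \<Phi>" "\<Phi> x1 \<in> K" "\<Phi> x2 \<in> K" "\<Phi> x2 = \<Phi> x1" using * by auto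
  moreover note Xs_in[OF this(1)] Xs_in[OF this(2)]
  ultimately show "x1 = x2" using main[OF _ _ _ *(3)] main[OF _ _ _ *(3)[symmetric]] by metis
qed

text \<open>The conservation law behind invariance: \<open>\<Phi>\<close> permutes the cycle, and in
  the acyclic case it shifts the path of \<open>z\<close>, missing only its start.\<close>

lemma Xs_image:
  assumes z: "z \<in> K"
  shows "\<Phi> ` {x \<in> Xs K z \<Phi>. \<Phi> x \<in> K} = Xs K z \<Phi> - (if acyc K \<Phi> then {z} else {})"
proof (intro equalityI subsetI)
  fix y assume "y \<in> \<Phi> ` {x \<in> Xs K z \<Phi>. \<Phi> x \<in> K}"
  then obtain x where x: "x \<in> Xs K z \<Phi>" "\<Phi> x \<in> K" "y = \<Phi> x" by auto
  then have "y \<in> Xs K z \<Phi>" unfolding Xs_iff using leads_snoc by metis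
  moreover have "y \<noteq> z" if "acyc K \<Phi>"
    using acyc_no_cycle[OF that, of x] x Xs_in[OF x(1)] Xs_leads[OF x(1)] by auto
  ultimately show "y \<in> Xs K z \<Phi> - (if acyc K \<Phi> then {z} else {})" by auto
next
  fix x assume "x \<in> Xs K z \<Phi> - (if acyc K \<Phi> then {z} else {})"
  then have xX: "x \<in> Xs K z \<Phi>" and xz: "acyc K \<Phi> \<Longrightarrow> x \<noteq> z" by (auto split: if_splits)
  have x: "x \<in> K" "leads K \<Phi> z x" "\<And>y. y \<in> K \<Longrightarrow> leads K \<Phi> y x \<or> (\<exists>r. r \<notin> K \<and> leads K \<Phi> y r)"
    using xX unfolding Xs_iff by blast+
  have "\<exists>t\<in>K. leads K \<Phi> z t \<and> \<Phi> t = x \<and> (\<forall>y\<in>K. leads K \<Phi> y t \<or> (\<exists>r. r \<notin> K \<and> leads K \<Phi> y r))"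
  proof (cases "acyc K \<Phi>")
    case True
    then show ?thesis using leads_pred[OF x(2)] xz by (auto simp: acyc_def)
  next
    case False
    then obtain y0 where y0: "y0 \<in> K" "\<And>r. r \<notin> K \<Longrightarrow> \<not> leads K \<Phi> y0 r" by (auto simp: acyc_def)
    have x_in: "\<not> leads K \<Phi> x r" if "r \<notin> K" for r
      using x(3)[OF y0(1)] y0(2) that rtrancl_trans by metis
    have Px: "\<Phi> x \<in> K" using x_in[of "\<Phi> x"] leads_snoc[of x x K \<Phi>] x(1) by auto
    have xx: "leads K \<Phi> x (\<Phi> x)" using leads_snoc[of x x K \<Phi>] x(1) by auto
    have bk: "leads K \<Phi> (\<Phi> x) x" using x(3)[OF Px] x_in xx rtrancl_trans by metis
    obtain t where t: "t \<in> K" "leads K \<Phi> (\<Phi> x) t" "x = \<Phi> t"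
      using leads_pred[OF bk] x(1) by auto
    have "leads K \<Phi> y t" if "leads K \<Phi> y x" for y using that xx t(2) by (meson rtrancl_trans)
    then show ?thesis using t x by blast
  qed
  then obtain t where "t \<in> Xs K z \<Phi>" "\<Phi> t = x" unfolding Xs_iff by blast
  then show "x \<in> \<Phi> ` {x \<in> Xs K z \<Phi>. \<Phi> x \<in> K}" using x(1) by auto
qed

lemma Xs_exit:
  assumes z: "z \<in> K"
  shows "acyc K \<Phi> \<Longrightarrow> \<exists>t. {x \<in> Xs K z \<Phi>. \<Phi> x \<notin> K} = {t}"
    and "\<not> acyc K \<Phi> \<Longrightarrow> {x \<in> Xs K z \<Phi>. \<Phi> x \<notin> K} = {}"
proof -
  assume a: "acyc K \<Phi>"
  have X: "x \<in> Xs K z \<Phi> \<longleftrightarrow> x \<in> K \<and> leads K \<Phi> z x" for x using a by (auto simp: Xs_iff acyc_def)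
  obtain t where t: "t \<in> K" "leads K \<Phi> z t" "root K \<Phi> z = \<Phi> t"
    using leads_pred[of z "root K \<Phi> z" K \<Phi>] acyc_root[OF a, of z] z by metis
  have "\<Phi> t \<notin> K" using t acyc_root[OF a, of z] by auto
  moreover have "x1 = x2" if "x1 \<in> K" "\<Phi> x1 \<notin> K" "leads K \<Phi> x1 x2" "x2 \<in> K" for x1 x2
    using leads_stepD[OF that(3)] leads_off[of "\<Phi> x1" x2 K \<Phi>] that by auto
  ultimately have "{x \<in> Xs K z \<Phi>. \<Phi> x \<notin> K} = {t}"
    using t X leads_linear[of z _ K \<Phi> t] by (auto, metis)
  then show "\<exists>t. {x \<in> Xs K z \<Phi>. \<Phi> x \<notin> K} = {t}" by blast
next
  assume a: "\<not> acyc K \<Phi>"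
  then obtain y0 where y0: "y0 \<in> K" "\<And>r. r \<notin> K \<Longrightarrow> \<not> leads K \<Phi> y0 r" by (auto simp: acyc_def)
  have "\<Phi> x \<in> K" if "x \<in> Xs K z \<Phi>" for x
    using that y0 leads_snoc[of y0 x K \<Phi>] unfolding Xs_iff by metis
  then show "{x \<in> Xs K z \<Phi>. \<Phi> x \<notin> K} = {}" by auto
qed

text \<open>Think of \<open>h x \<Phi>\<close> as a bound for the final value of \<open>f\<close>
  when the walk is at \<open>x\<close>; it ignores the edge of \<open>x\<close>, which is about to
  be rewritten. All pairs of a position and a configuration are summed with weight
  \<open>wt\<close>. Averaging over the edge of \<open>x\<close> is a step of the walk, which by
  \<open>super\<close> does not increase the sum; since \<open>\<Phi>\<close> shifts the positions,
  everything cancels except the start at \<open>z\<close> and the exit from \<open>K\<close>.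
  Trajectories of the walk never have to be constructed.\<close>

lemma update_supersolution:
  fixes f :: "('a \<Rightarrow> 'a) \<Rightarrow> real"
  assumes K: "finite K" and z: "z \<in> K"
    and inv: "\<And>x \<Phi> y. x \<in> K \<Longrightarrow> h x (\<Phi>(x := y)) = h x \<Phi>"
    and super: "\<And>x F. x \<in> K \<Longrightarrow> acyc (K - {x}) F \<Longrightarrow>
      PP (\<lambda>y. if y \<in> K then h y (F(x := y)) else f (F(x := y))) x \<le> h x F"
  shows "EF K f \<le> EF K (h z)"
proof -
  let ?s = "\<lambda>x \<Phi>. if \<Phi> x \<in> K then h (\<Phi> x) \<Phi> else f \<Phi>"
  have fin: "finite (Xs K z \<Phi>)" for \<Phi> using K by (auto simp: Xs_def)
  \<comment> \<open>Moving each position along its edge cancels all terms but two, and those two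
    occur for acyclic configurations only.\<close>
  have pt: "(\<Sum>x\<in>Xs K z \<Phi>. h x \<Phi>) - (\<Sum>x\<in>Xs K z \<Phi>. ?s x \<Phi>) = of_bool (acyc K \<Phi>) * (h z \<Phi> - f \<Phi>)" for \<Phi>
  proof -
    have "(\<Sum>x\<in>Xs K z \<Phi>. ?s x \<Phi>) = (\<Sum>x\<in>{x \<in> Xs K z \<Phi>. \<Phi> x \<in> K}. h (\<Phi> x) \<Phi>) + (\<Sum>x\<in>{x \<in> Xs K z \<Phi>. \<Phi> x \<notin> K}. f \<Phi>)"
      by (subst sum.If_cases[OF fin]) (simp add: Int_def)
    also have "(\<Sum>x\<in>{x \<in> Xs K z \<Phi>. \<Phi> x \<in> K}. h (\<Phi> x) \<Phi>) = (\<Sum>x\<in>\<Phi> ` {x \<in> Xs K z \<Phi>. \<Phi> x \<in> K}. h x \<Phi>)"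
      by (subst sum.reindex[OF Xs_inj]) simp
    also have "\<dots> = (\<Sum>x\<in>Xs K z \<Phi>. h x \<Phi>) - of_bool (acyc K \<Phi>) * h z \<Phi>"
    proof -
      have "z \<in> Xs K z \<Phi>" if "acyc K \<Phi>" using that z by (auto simp: Xs_iff acyc_def)
      then show ?thesis unfolding Xs_image[OF z] using fin[of \<Phi>] by (auto simp: sum_diff1)
    qed
    also have "(\<Sum>x\<in>{x \<in> Xs K z \<Phi>. \<Phi> x \<notin> K}. f \<Phi>) = of_bool (acyc K \<Phi>) * f \<Phi>"
    proof (cases "acyc K \<Phi>")
      case True
      then obtain t where "{x \<in> Xs K z \<Phi>. \<Phi> x \<notin> K} = {t}" using Xs_exit(1)[OF z] by metis
      then show ?thesis using True by simp
    next
      case False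
      then show ?thesis unfolding Xs_exit(2)[OF z False] by simp
    qed
    finally show ?thesis by (simp add: algebra_simps)
  qed
  have Xs_upd: "x \<in> Xs K z (F(x := y)) \<longleftrightarrow> x \<in> Xs K z F" for x y F
    by (simp add: Xs_def acyc_upd leads_upd)
  \<comment> \<open>Being a possible position at \<open>x\<close> does not depend on the edge of
    \<open>x\<close>, so that this edge can be averaged separately.\<close>
  have one: "(\<Sum>\<Phi>\<in>PiE K N. wt K \<Phi> * (of_bool (x \<in> Xs K z \<Phi>) * ?s x \<Phi>)) \<le>
      (\<Sum>\<Phi>\<in>PiE K N. wt K \<Phi> * (of_bool (x \<in> Xs K z \<Phi>) * h x \<Phi>))" if x: "x \<in> K" for x
    unfolding sum_PiE_split[OF K x]
  proof (rule sum_mono)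
    fix F
    have "(\<Sum>y\<in>N x. wt K (F(x := y)) * (of_bool (x \<in> Xs K z (F(x := y))) * ?s x (F(x := y)))) =
      wt (K - {x}) F * (of_bool (x \<in> Xs K z F) * PP (\<lambda>y. if y \<in> K then h y (F(x := y)) else f (F(x := y))) x)"
      unfolding PP_def sum_distrib_left by (intro sum.cong) (auto simp: wt_upd[OF K x] Xs_upd)
    also have "\<dots> \<le> wt (K - {x}) F * (of_bool (x \<in> Xs K z F) * h x F)"
    proof (cases "x \<in> Xs K z F")
      case True
      then have "acyc (K - {x}) F" by (auto simp: Xs_def)
      then show ?thesis using super[OF x, of F] by (intro mult_left_mono wt_nonneg) auto
    qed auto
    also have "\<dots> = (\<Sum>y\<in>N x. p x y) * (wt (K - {x}) F * (of_bool (x \<in> Xs K z F) * h x F))"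
      by (simp add: p_sum)
    also have "\<dots> = (\<Sum>y\<in>N x. wt K (F(x := y)) * (of_bool (x \<in> Xs K z (F(x := y))) * h x (F(x := y))))"
      unfolding sum_distrib_right by (intro sum.cong) (auto simp: wt_upd[OF K x] Xs_upd inv[OF x])
    finally show "(\<Sum>y\<in>N x. wt K (F(x := y)) * (of_bool (x \<in> Xs K z (F(x := y))) * ?s x (F(x := y)))) \<le> \<dots>" .
  qed
  have sw: "(\<Sum>\<Phi>\<in>PiE K N. wt K \<Phi> * (\<Sum>x\<in>Xs K z \<Phi>. k x \<Phi>)) = (\<Sum>x\<in>K. \<Sum>\<Phi>\<in>PiE K N. wt K \<Phi> * (of_bool (x \<in> Xs K z \<Phi>) * k x \<Phi>))" for k :: "_ \<Rightarrow> _ \<Rightarrow> real"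
  proof -
    have "(\<Sum>x\<in>Xs K z \<Phi>. k x \<Phi>) = (\<Sum>x\<in>K. of_bool (x \<in> Xs K z \<Phi>) * k x \<Phi>)" for \<Phi>
      by (rule sum.mono_neutral_cong_left) (auto simp: K Xs_def)
    then show ?thesis by (simp add: sum_distrib_left sum.swap[of _ K])
  qed
  have le: "(\<Sum>\<Phi>\<in>PiE K N. wt K \<Phi> * (\<Sum>x\<in>Xs K z \<Phi>. ?s x \<Phi>)) \<le> (\<Sum>\<Phi>\<in>PiE K N. wt K \<Phi> * (\<Sum>x\<in>Xs K z \<Phi>. h x \<Phi>))"
    unfolding sw by (rule sum_mono[OF one])
  have "(\<Sum>F\<in>forests K. wt K F * (h z F - f F)) = (\<Sum>\<Phi>\<in>PiE K N. wt K \<Phi> * (of_bool (acyc K \<Phi>) * (h z \<Phi> - f \<Phi>)))"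
    unfolding forests_def by (rule sum.mono_neutral_cong_left) (auto simp: finite_PiE_N K)
  also have "\<dots> = (\<Sum>\<Phi>\<in>PiE K N. wt K \<Phi> * (\<Sum>x\<in>Xs K z \<Phi>. h x \<Phi>)) - (\<Sum>\<Phi>\<in>PiE K N. wt K \<Phi> * (\<Sum>x\<in>Xs K z \<Phi>. ?s x \<Phi>))"
    by (simp only: pt[symmetric] right_diff_distrib[of "wt K _"] sum_subtractf)
  also have "\<dots> \<ge> 0" using le by simp
  finally have "(\<Sum>F\<in>forests K. wt K F * f F) \<le> (\<Sum>F\<in>forests K. wt K F * h z F)"
    by (simp add: right_diff_distrib sum_subtractf)
  then show ?thesis unfolding EF_def by (intro divide_right_mono) (auto simp: less_imp_le Z_pos K)
qed

end

section \<open>Graph distance\<close>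

context sgraph
begin

lemma edge_rel_iff: "(x, y) \<in> edge_rel G \<longleftrightarrow> y \<in> N x" by (simp add: edge_rel_def)

lemma edge_connected: "(x, y) \<in> (edge_rel G)\<^sup>*"
proof -
  let ?S = "{y. (x, y) \<in> (edge_rel G)\<^sup>*}"
  have "?S = UNIV"
  proof (rule ccontr)
    assume "?S \<noteq> UNIV"
    moreover have "?S \<noteq> {}" by auto
    ultimately obtain a b where "a \<in> ?S" "b \<notin> ?S" "b \<in> N a" using no_isolated[of ?S] by blast
    then show False by (auto simp: edge_rel_iff[symmetric] intro: rtrancl_into_rtrancl)
  qed
  then show ?thesis by blast
qed

lemma gdist_relpow: "(x, y) \<in> edge_rel G ^^ gdist G x y"
  unfolding gdist_def using rtrancl_imp_relpow[OF edge_connected[of x y]] by (auto intro: LeastI)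

lemma gdist_le: "(x, y) \<in> edge_rel G ^^ n \<Longrightarrow> gdist G x y \<le> n"
  unfolding gdist_def by (rule Least_le)

lemma gdist_triangle: "gdist G x z \<le> gdist G x y + gdist G y z"
  by (rule gdist_le) (use gdist_relpow[of x y] gdist_relpow[of y z] in \<open>auto simp: relpow_add\<close>)

lemma gdist_sym: "gdist G x y = gdist G y x"
proof -
  have "(y, x) \<in> edge_rel G ^^ n" if "(x, y) \<in> edge_rel G ^^ n" for x y n
    using that
  proof (induction n arbitrary: y)
    case (Suc n)
    then obtain z where z: "(x, z) \<in> edge_rel G ^^ n" "(z, y) \<in> edge_rel G" by auto
    then have "(y, z) \<in> edge_rel G" using N_sym[of y z] by (simp add: edge_rel_iff)
    then show ?case using Suc.IH[OF z(1)] by (rule relpow_Suc_I2)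
  qed auto
  then show ?thesis by (meson gdist_le gdist_relpow order_antisym)
qed

lemma gdist_edge: "y \<in> N x \<Longrightarrow> gdist G v x \<le> Suc (gdist G v y)"
  using gdist_triangle[of v x y] gdist_le[of y x 1] N_sym[of x y] by (auto simp: edge_rel_iff)

definition gball :: "'a \<Rightarrow> nat \<Rightarrow> 'a set" where "gball v r = {y. gdist G v y \<le> r}"

lemma finite_gball: "finite (gball v r)"
proof (induction r)
  case 0
  have "gball v 0 \<subseteq> {v}"
  proof
    fix y assume "y \<in> gball v 0"
    then show "y \<in> {v}" using gdist_relpow[of v y] by (simp add: gball_def)
  qed
  then show ?case by (rule finite_subset) auto
next
  case (Suc r)
  have "gball v (Suc r) \<subseteq> gball v r \<union> (\<Union>x\<in>gball v r. N x)"
  proof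
    fix y assume y: "y \<in> gball v (Suc r)"
    show "y \<in> gball v r \<union> (\<Union>x\<in>gball v r. N x)"
    proof (cases "gdist G v y = Suc r")
      case True
      then obtain x where "(v, x) \<in> edge_rel G ^^ r" "(x, y) \<in> edge_rel G"
        using gdist_relpow[of v y] by auto
      then show ?thesis using gdist_le by (auto simp: gball_def edge_rel_iff)
    qed (use y in \<open>auto simp: gball_def\<close>)
  qed
  then show ?case by (rule finite_subset) (use Suc in auto)
qed

text \<open>Along the path the distance to \<open>v\<close> drops by at most one per edge, so it
  attains every value on its way to 0.\<close>

lemma leads_distances:
  assumes "leads K F y v" and "v \<notin> K" and F: "F \<in> PiE K N" and "1 \<le> m" "m \<le> gdist G v y"
  shows "\<exists>u\<in>K. leads K F y u \<and> leads K F u v \<and> gdist G v u = m"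
  using assms(1,4,5)
proof (induction rule: converse_rtrancl_induct)
  case base
  then show ?case using gdist_relpow[of v v] gdist_le[of v v 0] by auto
next
  case (step a b)
  have ab: "a \<in> K" "b = F a" using step.hyps(1) by (auto simp: frel_iff)
  then have "b \<in> N a" using F by auto
  then have d: "gdist G v a \<le> Suc (gdist G v b)" by (rule gdist_edge)
  show ?case
  proof (cases "gdist G v a = m")
    case True
    moreover have "leads K F a v" using step.hyps by (rule converse_rtrancl_into_rtrancl)
    ultimately show ?thesis using ab by blast
  next
    case False
    then have "m \<le> gdist G v b" using step.prems d by linarith
    then obtain u where "u \<in> K" "leads K F b u" "leads K F u v" "gdist G v u = m"
      using step.IH step.prems by blast
    then show ?thesis using converse_rtrancl_into_rtrancl[OF step.hyps(1)] by blast
  qed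
qed

section \<open>Hitting probabilities\<close>

text \<open>The probability of hitting \<open>B\<close> within \<open>n\<close> steps, time 0
  included. The finite horizon keeps it a finite sum; all bounds are uniform in it.\<close>

primrec hitB :: "'a set \<Rightarrow> nat \<Rightarrow> 'a \<Rightarrow> real" where
  "hitB B 0 x = of_bool (x \<in> B)"
| "hitB B (Suc n) x = (if x \<in> B then 1 else PP (hitB B n) x)"

lemma hitB_bounds: "0 \<le> hitB B n x" "hitB B n x \<le> 1"
  by (induction n arbitrary: x) (auto intro: PP_nonneg PP_le1)

lemma sum_pn_le_PP:
  assumes S: "finite S" and h: "\<And>x. 0 \<le> h x"
  shows "(\<Sum>x\<in>S. pn n v x * h x) \<le> (PP ^^ n) h v"
proof (induction n arbitrary: v)
  case 0
  then show ?case unfolding pn.simps(1) sum_of_bool_eq[OF S] using h by simp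
next
  case (Suc n)
  have "(\<Sum>x\<in>S. pn (Suc n) v x * h x) = PP (\<lambda>z. \<Sum>x\<in>S. pn n z x * h x) v"
    by (simp add: PP_sum PP_cmult2)
  also have "\<dots> \<le> PP ((PP ^^ n) h) v" using Suc by (intro PP_mono)
  finally show ?case by simp
qed

end

section \<open>Sums of Green functions under ballisticity and the bubble condition\<close>

locale bgraph = tgraph +
  fixes C :: real
  assumes ballistic: "r \<ge> 1 \<Longrightarrow> (\<Sum>n<L. (PP ^^ n) (hitB (gball v r) n') v) \<le> C * real r"
begin

definition gT :: "nat \<Rightarrow> 'a \<Rightarrow> 'a \<Rightarrow> real" where "gT L x y = (\<Sum>n<L. pn n x y)"

lemma gT_tendsto: "(\<lambda>L. gT L x y) \<longlonglongrightarrow> g x y"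
  unfolding gT_def g_def using summable_LIMSEQ[OF summable_pn] .

lemma gT_nonneg: "0 \<le> gT L x y" unfolding gT_def by (intro sum_nonneg pn_nonneg)

lemma gT_le: "gT L x y \<le> g x y"
  unfolding gT_def g_def by (intro sum_le_suminf summable_pn) (auto simp: pn_nonneg)

lemma C_nonneg: "0 \<le> C"
  using ballistic[where r = 1 and L = 0] order_trans by fastforce

definition bub :: real where "bub = (\<Sum>n. real (n + 1) * nb n)"

lemma bub_nonneg: "0 \<le> bub"
  unfolding bub_def by (intro suminf_nonneg bubble) (simp add: nb_nonneg)

text \<open>The summand in \<open>ballistic\<close> is the probability of a visit to the ball
  between times \<open>k\<close> and \<open>k + n\<close>, so the sum over \<open>k\<close>
  truncates the expected time of the last visit. A walk at \<open>x\<close> that will still hit the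
  ball has not made this visit yet.\<close>

lemma sum_g_hit_le:
  assumes S: "finite S" and r: "r \<ge> 1"
  shows "(\<Sum>x\<in>S. g v x * hitB (gball v r) n x) \<le> C * real r"
proof (rule LIMSEQ_le_const2)
  show "(\<lambda>L. \<Sum>x\<in>S. gT L v x * hitB (gball v r) n x) \<longlonglongrightarrow> (\<Sum>x\<in>S. g v x * hitB (gball v r) n x)"
    by (intro tendsto_intros gT_tendsto)
  have "(\<Sum>x\<in>S. gT L v x * hitB (gball v r) n x) \<le> C * real r" for L
  proof -
    have "(\<Sum>x\<in>S. gT L v x * hitB (gball v r) n x) = (\<Sum>k<L. \<Sum>x\<in>S. pn k v x * hitB (gball v r) n x)"
      unfolding gT_def sum_distrib_right by (rule sum.swap)
    also have "\<dots> \<le> (\<Sum>k<L. (PP ^^ k) (hitB (gball v r) n) v)"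
      by (intro sum_mono sum_pn_le_PP S hitB_bounds)
    also have "\<dots> \<le> C * real r" by (rule ballistic[OF r])
    finally show ?thesis .
  qed
  then show "\<exists>M. \<forall>L\<ge>M. (\<Sum>x\<in>S. gT L v x * hitB (gball v r) n x) \<le> C * real r" by blast
qed

lemma sum_g_ball:
  assumes S: "finite S" "S \<subseteq> gball v r" and r: "r \<ge> 1"
  shows "(\<Sum>u\<in>S. g v u) \<le> C * real r"
proof -
  have "(\<Sum>u\<in>S. g v u) = (\<Sum>u\<in>S. g v u * hitB (gball v r) 0 u)" using S by (intro sum.cong) auto
  then show ?thesis using sum_g_hit_le[OF S(1) r, of v 0] by simp
qed

text \<open>Outside the ball nothing is collected until it is hit. From a vertex of the ball,
  \<open>S\<close> lies within distance \<open>2 * r\<close>, whence the factor 2.\<close>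

lemma sum_g_ball_hit:
  assumes S: "finite S" "S \<subseteq> gball v r" and r: "r \<ge> 1"
  shows "(\<Sum>u\<in>S. gT L x u) \<le> 2 * C * real r * hitB (gball v r) L x"
proof (induction L arbitrary: x)
  case 0
  then show ?case using C_nonneg by (simp add: gT_def)
next
  case (Suc L)
  show ?case
  proof (cases "x \<in> gball v r")
    case True
    have "S \<subseteq> gball x (2 * r)"
    proof
      fix u assume "u \<in> S"
      then show "u \<in> gball x (2 * r)"
        using S(2) True gdist_triangle[of x u v] gdist_sym[of x v] by (auto simp: gball_def)
    qed
    then have "(\<Sum>u\<in>S. g x u) \<le> C * real (2 * r)" using r S by (intro sum_g_ball) auto
    moreover have "(\<Sum>u\<in>S. gT (Suc L) x u) \<le> (\<Sum>u\<in>S. g x u)" by (intro sum_mono gT_le)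
    ultimately show ?thesis using True by simp
  next
    case False
    then have "pn 0 x u = 0" if "u \<in> S" for u using S that by auto
    then have "(\<Sum>u\<in>S. gT (Suc L) x u) = (\<Sum>u\<in>S. PP (\<lambda>z. gT L z u) x)"
      unfolding gT_def sum.lessThan_Suc_shift by (intro sum.cong) (auto simp: PP_sum)
    also have "\<dots> \<le> PP (\<lambda>z. 2 * C * real r * hitB (gball v r) L z) x"
      unfolding PP_sum[symmetric] using Suc by (intro PP_mono)
    finally show ?thesis using False by (simp add: PP_cmult)
  qed
qed

text \<open>Each inner sum is at most \<open>2 * C * r\<close> times the probability of hitting the
  ball from \<open>x\<close>. One such probability makes the ballistic bound applicable to the sum
  over \<open>x\<close>, a second one is bounded by 1.\<close>

lemma sum_g_g:
  assumes S: "finite S" "S \<subseteq> gball v r" and T: "finite T" and r: "r \<ge> 1"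
  shows "(\<Sum>x\<in>T. g v x * (\<Sum>u\<in>S. g x u)) \<le> 2 * C\<^sup>2 * (real r)\<^sup>2" (is ?thesis1)
    and "(\<Sum>x\<in>T. g v x * (\<Sum>u\<in>S. g x u)\<^sup>2) \<le> 4 * C ^ 3 * (real r) ^ 3" (is ?thesis2)
proof -
  let ?h = "\<lambda>L x. hitB (gball v r) L x"
  have 1: "(\<Sum>u\<in>S. gT L x u) \<le> 2 * C * real r * ?h L x" for L x by (rule sum_g_ball_hit[OF S r])
  have "(\<Sum>x\<in>T. g v x * (\<Sum>u\<in>S. gT L x u)) \<le> 2 * C\<^sup>2 * (real r)\<^sup>2" for L
  proof -
    have "(\<Sum>x\<in>T. g v x * (\<Sum>u\<in>S. gT L x u)) \<le> (\<Sum>x\<in>T. g v x * (2 * C * real r * ?h L x))"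
      by (intro sum_mono mult_left_mono 1 g_nonneg)
    also have "\<dots> = 2 * C * real r * (\<Sum>x\<in>T. g v x * ?h L x)" by (simp add: sum_distrib_left mult_ac)
    also have "\<dots> \<le> 2 * C * real r * (C * real r)"
      by (intro mult_left_mono sum_g_hit_le T r) (simp add: C_nonneg)
    finally show ?thesis by (simp add: power2_eq_square mult_ac)
  qed
  then show ?thesis1
    by (intro LIMSEQ_le_const2[of "\<lambda>L. \<Sum>x\<in>T. g v x * (\<Sum>u\<in>S. gT L x u)"] tendsto_intros gT_tendsto) auto
  have "(\<Sum>x\<in>T. g v x * (\<Sum>u\<in>S. gT L x u)\<^sup>2) \<le> 4 * C ^ 3 * (real r) ^ 3" for L
  proof -
    have "(\<Sum>x\<in>T. g v x * (\<Sum>u\<in>S. gT L x u)\<^sup>2) \<le> (\<Sum>x\<in>T. g v x * ((2 * C * real r)\<^sup>2 * ?h L x))"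
    proof (intro sum_mono mult_left_mono g_nonneg)
      fix x
      have "(\<Sum>u\<in>S. gT L x u)\<^sup>2 \<le> (2 * C * real r * ?h L x)\<^sup>2"
        by (intro power_mono 1 sum_nonneg gT_nonneg)
      also have "\<dots> = (2 * C * real r)\<^sup>2 * (?h L x * ?h L x)" by (simp add: power2_eq_square mult_ac)
      also have "\<dots> \<le> (2 * C * real r)\<^sup>2 * ?h L x"
        using hitB_bounds[of "gball v r" L x] by (intro mult_left_mono) (auto simp: mult_left_le)
      finally show "(\<Sum>u\<in>S. gT L x u)\<^sup>2 \<le> (2 * C * real r)\<^sup>2 * ?h L x" .
    qed
    also have "\<dots> = (2 * C * real r)\<^sup>2 * (\<Sum>x\<in>T. g v x * ?h L x)" by (simp add: sum_distrib_left mult_ac)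
    also have "\<dots> \<le> (2 * C * real r)\<^sup>2 * (C * real r)"
      by (intro mult_left_mono sum_g_hit_le T r) simp
    finally show ?thesis by (simp add: power2_eq_square power3_eq_cube mult_ac)
  qed
  then show ?thesis2
    by (intro LIMSEQ_le_const2[of "\<lambda>L. \<Sum>x\<in>T. g v x * (\<Sum>u\<in>S. gT L x u)\<^sup>2"] tendsto_intros gT_tendsto) auto
qed

text \<open>
  The square of the Green function is a double sum over times, which is bounded by replacing the
  transition probability at the larger time with its norm. This is where the bubble norm enters.
\<close>

lemma gT_square: "(gT L x y)\<^sup>2 \<le> 2 * (\<Sum>i<L. pn i x y * (\<Sum>j\<in>{i..<L}. nb j))"
proof (induction L)
  case (Suc L)
  have "(gT (Suc L) x y)\<^sup>2 = (gT L x y)\<^sup>2 + 2 * (gT L x y * pn L x y) + pn L x y * pn L x y"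
    by (simp add: gT_def power2_eq_square algebra_simps)
  also have "\<dots> \<le> 2 * (\<Sum>i<L. pn i x y * (\<Sum>j\<in>{i..<L}. nb j)) + 2 * (\<Sum>i<L. pn i x y * nb L) + 2 * (pn L x y * nb L)"
  proof (intro add_mono Suc mult_left_mono)
    show "gT L x y * pn L x y \<le> (\<Sum>i<L. pn i x y * nb L)"
      unfolding gT_def sum_distrib_right by (intro sum_mono mult_left_mono pn_le_nb pn_nonneg)
    have "pn L x y * pn L x y \<le> pn L x y * nb L" by (intro mult_left_mono pn_le_nb pn_nonneg)
    also have "\<dots> \<le> 2 * (pn L x y * nb L)" using pn_nonneg nb_nonneg by simp
    finally show "pn L x y * pn L x y \<le> 2 * (pn L x y * nb L)" .
  qed simp
  also have "\<dots> = 2 * (\<Sum>i<Suc L. pn i x y * (\<Sum>j\<in>{i..<Suc L}. nb j))"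
  proof -
    have "(\<Sum>i<L. pn i x y * (\<Sum>j\<in>{i..<Suc L}. nb j)) = (\<Sum>i<L. pn i x y * (\<Sum>j\<in>{i..<L}. nb j)) + (\<Sum>i<L. pn i x y * nb L)"
      unfolding sum.distrib[symmetric] by (intro sum.cong) (auto simp: distrib_left)
    then show ?thesis by simp
  qed
  finally show ?case .
qed (simp add: gT_def)

text \<open>The term \<open>nb j\<close> occurs once for each \<open>i \<le> j\<close>: this is the
  factor \<open>n + 1\<close> in the bubble norm.\<close>

lemma sum_nb_triangle: "(\<Sum>i<L. \<Sum>j\<in>{i..<L}. nb j) \<le> bub"
proof -
  have "(\<Sum>i<L. \<Sum>j\<in>{i..<L}. nb j) = (\<Sum>n<L. real (n + 1) * nb n)"
    by (induction L) (simp_all add: sum.distrib algebra_simps)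
  also have "\<dots> \<le> bub" unfolding bub_def by (intro sum_le_suminf bubble) (auto simp: nb_nonneg)
  finally show ?thesis .
qed

lemma sum_g_pn: "finite S \<Longrightarrow> (\<Sum>x\<in>S. g v x * pn i x y) \<le> g v y"
  and sum_pn_g: "finite S \<Longrightarrow> (\<Sum>x\<in>S. pn i v x * g x y) \<le> g v y"
proof -
  assume S: "finite S"
  have sh: "(\<Sum>n<L. pn (n + i) v y) \<le> g v y" for L
  proof -
    have "(\<Sum>n<L. pn (n + i) v y) = (\<Sum>n\<in>{i..<L + i}. pn n v y)"
      using sum.shift_bounds_nat_ivl[of "\<lambda>n. pn n v y" 0 i L] by (simp add: lessThan_atLeast0)
    also have "\<dots> \<le> g v y" unfolding g_def by (intro sum_le_suminf summable_pn) (auto simp: pn_nonneg)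
    finally show ?thesis .
  qed
  have "(\<Sum>x\<in>S. gT L v x * pn i x y) \<le> g v y" for L
  proof -
    have "(\<Sum>x\<in>S. gT L v x * pn i x y) = (\<Sum>n<L. \<Sum>x\<in>S. pn n v x * pn i x y)"
      unfolding gT_def sum_distrib_right by (rule sum.swap)
    also have "\<dots> \<le> (\<Sum>n<L. pn (n + i) v y)" by (intro sum_mono pn_add_ge S)
    finally show ?thesis using sh[of L] by simp
  qed
  then show "(\<Sum>x\<in>S. g v x * pn i x y) \<le> g v y"
    by (intro LIMSEQ_le_const2[of "\<lambda>L. \<Sum>x\<in>S. gT L v x * pn i x y"] tendsto_intros gT_tendsto) auto
  have "(\<Sum>x\<in>S. pn i v x * gT L x y) \<le> g v y" for L
  proof -
    have "(\<Sum>x\<in>S. pn i v x * gT L x y) = (\<Sum>n<L. \<Sum>x\<in>S. pn i v x * pn n x y)"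
      unfolding gT_def sum_distrib_left by (rule sum.swap)
    also have "\<dots> \<le> (\<Sum>n<L. pn (i + n) v y)" by (intro sum_mono pn_add_ge S)
    finally show ?thesis using sh[of L] by (simp add: add.commute)
  qed
  then show "(\<Sum>x\<in>S. pn i v x * g x y) \<le> g v y"
    by (intro LIMSEQ_le_const2[of "\<lambda>L. \<Sum>x\<in>S. pn i v x * gT L x y"] tendsto_intros gT_tendsto) auto
qed

text \<open>In the double sum over times the larger time is replaced with its norm; what remains is
  a convolution of \<open>g\<close> with a power of the walk, which is at most \<open>g v y\<close>.
  Doubling an edge of a diagram therefore costs a constant factor.\<close>

lemma sum_g_g2: "finite S \<Longrightarrow> (\<Sum>x\<in>S. g v x * (g x y)\<^sup>2) \<le> 2 * bub * g v y"
  and sum_g2_g: "finite S \<Longrightarrow> (\<Sum>x\<in>S. (g v x)\<^sup>2 * g x y) \<le> 2 * bub * g v y"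
proof -
  assume S: "finite S"
  have fin: "2 * (\<Sum>i<L. s i * (\<Sum>j\<in>{i..<L}. nb j)) \<le> 2 * bub * g v y" if s: "\<And>i. s i \<le> g v y" for L s
  proof -
    have "(\<Sum>i<L. s i * (\<Sum>j\<in>{i..<L}. nb j)) \<le> (\<Sum>i<L. g v y * (\<Sum>j\<in>{i..<L}. nb j))"
      by (intro sum_mono mult_right_mono s sum_nonneg nb_nonneg)
    also have "\<dots> = g v y * (\<Sum>i<L. \<Sum>j\<in>{i..<L}. nb j)" by (simp add: sum_distrib_left)
    also have "\<dots> \<le> g v y * bub" by (intro mult_left_mono sum_nb_triangle g_nonneg)
    finally show ?thesis by (simp add: mult_ac)
  qed
  have "(\<Sum>x\<in>S. g v x * (gT L x y)\<^sup>2) \<le> 2 * bub * g v y" for L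
  proof -
    have "(\<Sum>x\<in>S. g v x * (gT L x y)\<^sup>2) \<le> (\<Sum>x\<in>S. g v x * (2 * (\<Sum>i<L. pn i x y * (\<Sum>j\<in>{i..<L}. nb j))))"
      by (intro sum_mono mult_left_mono gT_square g_nonneg)
    also have "\<dots> = 2 * (\<Sum>x\<in>S. \<Sum>i<L. g v x * pn i x y * (\<Sum>j\<in>{i..<L}. nb j))"
      by (simp add: sum_distrib_left mult_ac)
    also have "\<dots> = 2 * (\<Sum>i<L. (\<Sum>x\<in>S. g v x * pn i x y) * (\<Sum>j\<in>{i..<L}. nb j))"
      by (subst sum.swap) (simp add: sum_distrib_right)
    also have "\<dots> \<le> 2 * bub * g v y" by (intro fin sum_g_pn S)
    finally show ?thesis .
  qed
  then show "(\<Sum>x\<in>S. g v x * (g x y)\<^sup>2) \<le> 2 * bub * g v y"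
    by (intro LIMSEQ_le_const2[of "\<lambda>L. \<Sum>x\<in>S. g v x * (gT L x y)\<^sup>2"] tendsto_intros gT_tendsto) auto
  have "(\<Sum>x\<in>S. (gT L v x)\<^sup>2 * g x y) \<le> 2 * bub * g v y" for L
  proof -
    have "(\<Sum>x\<in>S. (gT L v x)\<^sup>2 * g x y) \<le> (\<Sum>x\<in>S. (2 * (\<Sum>i<L. pn i v x * (\<Sum>j\<in>{i..<L}. nb j))) * g x y)"
      by (intro sum_mono mult_right_mono gT_square g_nonneg)
    also have "\<dots> = 2 * (\<Sum>x\<in>S. \<Sum>i<L. pn i v x * g x y * (\<Sum>j\<in>{i..<L}. nb j))"
      by (simp add: sum_distrib_left sum_distrib_right mult_ac)
    also have "\<dots> = 2 * (\<Sum>i<L. (\<Sum>x\<in>S. pn i v x * g x y) * (\<Sum>j\<in>{i..<L}. nb j))"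
      by (subst sum.swap) (simp add: sum_distrib_right)
    also have "\<dots> \<le> 2 * bub * g v y" by (intro fin sum_pn_g S)
    finally show ?thesis .
  qed
  then show "(\<Sum>x\<in>S. (g v x)\<^sup>2 * g x y) \<le> 2 * bub * g v y"
    by (intro LIMSEQ_le_const2[of "\<lambda>L. \<Sum>x\<in>S. (gT L v x)\<^sup>2 * g x y"] tendsto_intros gT_tendsto) auto
qed

section \<open>Energy bounds\<close>

lemma energy1:
  assumes "finite S" "S \<subseteq> gball v r" "r \<ge> 1"
  shows "(\<Sum>u\<in>S. g u v) \<le> D * C * real r"
proof -
  have "(\<Sum>u\<in>S. g u v) \<le> (\<Sum>u\<in>S. D * g v u)" by (intro sum_mono g_rev_le)
  also have "\<dots> = D * (\<Sum>u\<in>S. g v u)" by (simp add: sum_distrib_left)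
  also have "\<dots> \<le> D * (C * real r)" using D_ge1 by (intro mult_left_mono sum_g_ball assms) auto
  finally show ?thesis by simp
qed

text \<open>Reversing the Green functions orients the diagram away from \<open>v\<close>: an edge to
  \<open>y\<close>, a double edge to \<open>x\<close>, an edge to \<open>u\<close>. The double edge
  is contracted by summing over \<open>y\<close>, and two edges remain, giving the square of
  \<open>r\<close>.\<close>

lemma energy2:
  assumes S: "finite S" "S \<subseteq> gball v r" and r: "r \<ge> 1" and K: "finite K"
  shows "(\<Sum>u\<in>S. \<Sum>x\<in>K. \<Sum>y\<in>K. g u x * g x y * g y v * (g x y + g y x)) \<le> 8 * D ^ 4 * bub * C\<^sup>2 * (real r)\<^sup>2"
proof -
  have D: "D \<ge> 1" by (rule D_ge1)
  have "(\<Sum>u\<in>S. \<Sum>x\<in>K. \<Sum>y\<in>K. g u x * g x y * g y v * (g x y + g y x))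
      \<le> (\<Sum>u\<in>S. \<Sum>x\<in>K. \<Sum>y\<in>K. 2 * D ^ 4 * (g x u * (g v y * (g y x)\<^sup>2)))"
  proof (intro sum_mono)
    fix u x y
    have s: "g x y + g y x \<le> 2 * D * g y x"
      using g_rev_le[of x y] mult_right_mono[OF D g_nonneg[of y x]] by simp
    have "g u x * g x y * g y v * (g x y + g y x) \<le> (D * g x u) * (D * g y x) * (D * g v y) * (2 * D * g y x)"
      using D by (intro mult_mono g_rev_le s) (auto intro!: mult_nonneg_nonneg add_nonneg_nonneg g_nonneg)
    also have "\<dots> = 2 * D ^ 4 * (g x u * (g v y * (g y x)\<^sup>2))"
      by (simp add: power2_eq_square power4_eq_xxxx mult_ac)
    finally show "g u x * g x y * g y v * (g x y + g y x) \<le> \<dots>" .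
  qed
  also have "\<dots> = 2 * D ^ 4 * (\<Sum>u\<in>S. \<Sum>x\<in>K. g x u * (\<Sum>y\<in>K. g v y * (g y x)\<^sup>2))"
    by (simp add: sum_distrib_left)
  also have "\<dots> \<le> 2 * D ^ 4 * (\<Sum>u\<in>S. \<Sum>x\<in>K. g x u * (2 * bub * g v x))"
    using D by (intro mult_left_mono sum_mono sum_g_g2 K g_nonneg) auto
  also have "\<dots> = 4 * D ^ 4 * bub * (\<Sum>x\<in>K. g v x * (\<Sum>u\<in>S. g x u))"
    by (subst sum.swap) (simp add: sum_distrib_left mult_ac)
  also have "\<dots> \<le> 4 * D ^ 4 * bub * (2 * C\<^sup>2 * (real r)\<^sup>2)"
    using bub_nonneg D by (intro mult_left_mono sum_g_g S K r) auto
  finally show ?thesis by simp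
qed

text \<open>Here the double edge is attached to \<open>v\<close>; once it is contracted a single
  edge is left, so the bound is linear in \<open>r\<close>.\<close>

lemma energy3:
  assumes S: "finite S" "S \<subseteq> gball v r" and r: "r \<ge> 1" and K: "finite K"
  shows "(\<Sum>u\<in>S. \<Sum>y\<in>K. g u y * g y v * g y v) \<le> 2 * D ^ 3 * bub * C * real r"
proof -
  have D: "D \<ge> 1" by (rule D_ge1)
  have "(\<Sum>u\<in>S. \<Sum>y\<in>K. g u y * g y v * g y v) \<le> (\<Sum>u\<in>S. \<Sum>y\<in>K. D ^ 3 * ((g v y)\<^sup>2 * g y u))"
  proof (intro sum_mono)
    fix u y
    have "g u y * g y v * g y v \<le> (D * g y u) * (D * g v y) * (D * g v y)"
      using D by (intro mult_mono g_rev_le) (auto intro!: mult_nonneg_nonneg g_nonneg)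
    also have "\<dots> = D ^ 3 * ((g v y)\<^sup>2 * g y u)" by (simp add: power2_eq_square power3_eq_cube mult_ac)
    finally show "g u y * g y v * g y v \<le> \<dots>" .
  qed
  also have "\<dots> = D ^ 3 * (\<Sum>u\<in>S. \<Sum>y\<in>K. (g v y)\<^sup>2 * g y u)" by (simp add: sum_distrib_left)
  also have "\<dots> \<le> D ^ 3 * (\<Sum>u\<in>S. 2 * bub * g v u)" using D by (intro mult_left_mono sum_mono sum_g2_g K) auto
  also have "\<dots> = D ^ 3 * (2 * bub * (\<Sum>u\<in>S. g v u))" by (simp add: sum_distrib_left)
  also have "\<dots> \<le> D ^ 3 * (2 * bub * (C * real r))"
    using D bub_nonneg by (intro mult_left_mono sum_g_ball S r) auto
  finally show ?thesis by (simp add: mult_ac)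
qed

end

context tgraph
begin

section \<open>Thinning\<close>

definition good :: "'a \<Rightarrow> nat \<Rightarrow> 'a set \<Rightarrow> ('a \<Rightarrow> 'a) \<Rightarrow> 'a \<Rightarrow> bool" where
  "good v n K F u \<longleftrightarrow> leads K F u v \<and> subarm K F u n"

text \<open>The probability that the walk from \<open>x\<close> leaves \<open>K\<close> before hitting \<open>A\<close>, and not at \<open>v\<close>.\<close>

definition esc :: "'a set \<Rightarrow> 'a \<Rightarrow> 'a set \<Rightarrow> 'a \<Rightarrow> real" where
  "esc K v A x = HK (K - A) (\<lambda>z. of_bool (z \<notin> A \<and> z \<noteq> v)) x"

lemma esc_bounds: "finite K \<Longrightarrow> 0 \<le> esc K v A x" "finite K \<Longrightarrow> esc K v A x \<le> 1"
  unfolding esc_def by (auto intro: HK_nonneg HK_le1)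

lemma gam_eq_of_leads:
  assumes "leads K F u v" "v \<notin> L" "K \<subseteq> L" shows "gam K F u = gam L F u"
proof -
  have "y \<in> K \<and> leads K F u y" if "leads L F u y" "y \<in> L" for y
    using assms(1) that
  proof (induction rule: converse_rtrancl_induct)
    case base
    then show ?case using leads_off[of v y L F] assms(2) by auto
  next
    case (step a b)
    have ab: "a \<in> K" "b = F a" using step.hyps(1) by (auto simp: frel_iff)
    show ?case
    proof (cases "y = a")
      case False
      then have "leads L F b y" using leads_stepD[OF step.prems(1)] ab by auto
      then show ?thesis using step.IH step.prems(2) converse_rtrancl_into_rtrancl[OF step.hyps(1)] by blast
    qed (use ab in auto)
  qed
  then show ?thesis using leads_mono[OF _ assms(3)] assms(3) unfolding gam_def by blast
qed

lemma leads_avoid: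
  assumes "leads L F a w" "F x \<notin> L" "w \<noteq> F x" "w \<noteq> x" shows "leads (L - {x}) F a w"
proof -
  have "\<not> leads L F x w" using leads_stepD[of x w L F] leads_off[of "F x" w L F] assms by auto
  then show ?thesis using leads_cut1[OF assms(1)] by auto
qed

text \<open>A path through \<open>x\<close> ends at \<open>F x\<close>, which is neither
  \<open>u\<close> nor \<open>v\<close>. So \<open>x\<close> is neither on the path from
  \<open>u\<close> to \<open>v\<close> nor in the tree above \<open>u\<close>.\<close>

lemma good_minus:
  assumes g: "good v n L F u" and v: "v \<notin> L" "v \<noteq> x" "v \<noteq> F x" and x: "F x \<notin> L" and u: "u \<noteq> F x"
  shows "good v n (L - {x}) F u" "gam (L - {x}) F u = gam L F u"
proof -
  have l: "leads L F u v" using g by (simp add: good_def)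
  have lx: "leads (L - {x}) F u v" using leads_avoid[where F = F and x = x and L = L, OF l x] v by auto
  have "u \<noteq> x"
  proof
    assume "u = x"
    then have "leads L F x v" using l by simp
    then show False using leads_stepD[of x v L F] leads_off[of "F x" v L F] x v by auto
  qed
  then have "subarm (L - {x}) F u n" using g leads_avoid[where F = F and x = x and L = L and w = u, OF _ x] u by (auto simp: good_def subarm_def)
  then show "good v n (L - {x}) F u" using lx by (simp add: good_def)
  show "gam (L - {x}) F u = gam L F u" by (rule gam_eq_of_leads[OF lx v(1)]) auto
qed

lemma good_upd: "good v n (K - {x}) (F(x := y)) u \<longleftrightarrow> good v n (K - {x}) F u"
  by (simp add: good_def subarm_def leads_upd)

lemma gam_upd: "gam (K - {x}) (F(x := y)) u = gam (K - {x}) F u"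
  by (simp add: gam_def leads_upd)

lemma good_mono: "good v n K F u \<Longrightarrow> K \<subseteq> L \<Longrightarrow> good v n L F u"
  unfolding good_def subarm_def using leads_mono by meson

text \<open>One excursion from \<open>z\<close>; the constant \<open>b\<close> collects earlier
  failures. If the excursion ends at \<open>v\<close> the bound is given up, at the cost of the
  harmonic measure of \<open>v\<close>. If it ends elsewhere, the vertices it hits no longer lead to
  \<open>v\<close>; so a good path seen afterwards was there before and was avoided by the walk,
  which has probability \<open>esc\<close>. The truncated union bound, evaluated at the current
  position, is the supersolution.\<close>

lemma thin_step:
  assumes K: "finite K" and v: "v \<notin> K" and S: "S \<subseteq> K" and z: "z \<in> K" and b: "0 \<le> b" and c: "\<And>A. 0 \<le> c A"
  shows "EF K (\<lambda>F. min 1 (b + (\<Sum>u\<in>S. of_bool (good v n K F u) * c (gam K F u)))) \<le>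
    EF K (\<lambda>F. min 1 (b + HK K (\<lambda>t. of_bool (t = v)) z +
      (\<Sum>u\<in>S. of_bool (good v n K F u) * (c (gam K F u) * esc K v (gam K F u) z))))"
proof -
  let ?H = "HK K (\<lambda>t. of_bool (t = v))"
  let ?h = "\<lambda>x F. min 1 (b + ?H x + (\<Sum>u\<in>S. of_bool (good v n (K - {x}) F u) *
      (c (gam (K - {x}) F u) * esc K v (gam (K - {x}) F u) x)))"
  let ?f = "\<lambda>F. min 1 (b + (\<Sum>u\<in>S. of_bool (good v n K F u) * c (gam K F u)))"
  note e = esc_bounds[OF K, of v]
  have "EF K ?f \<le> EF K (?h z)"
  proof (rule update_supersolution[OF K z])
    fix x :: 'a and F y show "?h x (F(x := y)) = ?h x F" by (simp add: good_upd gam_upd)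
  next
    fix x F assume x: "x \<in> K" and a: "acyc (K - {x}) F"
    let ?T = "\<lambda>u. of_bool (good v n (K - {x}) F u) * c (gam (K - {x}) F u)"
    let ?\<gamma> = "\<lambda>u. gam (K - {x}) F u"
    let ?s = "\<lambda>y. b + ?H y + (\<Sum>u\<in>S. ?T u * esc K v (?\<gamma> u) y)"
    have T: "0 \<le> ?T u" for u using c by simp
    let ?k = "\<lambda>y. if y \<in> K then ?h y (F(x := y)) else ?f (F(x := y))"
    have "?k y \<le> ?s y" for y
    proof -
      let ?\<Phi> = "F(x := y)"
      \<comment> \<open>The excursion ends at \<open>v\<close>, ends elsewhere, or goes on.\<close>
      consider "y = v" | "y \<notin> K" "y \<noteq> v" | "y \<in> K" by blast
      then show ?thesis
      proof cases
        case 1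
        have "0 \<le> (\<Sum>u\<in>S. ?T u * esc K v (?\<gamma> u) y)" by (intro sum_nonneg mult_nonneg_nonneg T e)
        then show ?thesis using 1 v b by (simp add: HK_off)
      next
        case 2
        have "of_bool (good v n K ?\<Phi> u) * c (gam K ?\<Phi> u) \<le> ?T u * esc K v (?\<gamma> u) y" if u: "u \<in> S" for u
        proof (cases "good v n K ?\<Phi> u")
          case True
          have "y \<notin> ?\<gamma> u" using 2 by (auto simp: gam_def)
          then have "esc K v (?\<gamma> u) y = 1" using 2 by (simp add: esc_def HK_off)
          moreover have "good v n (K - {x}) ?\<Phi> u" "gam (K - {x}) ?\<Phi> u = gam K ?\<Phi> u"
            using good_minus[OF True v, of x] x v 2 u S by auto
          ultimately show ?thesis using True by (simp add: good_upd gam_upd)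
        qed (use T e in auto)
        then have "(\<Sum>u\<in>S. of_bool (good v n K ?\<Phi> u) * c (gam K ?\<Phi> u)) \<le> (\<Sum>u\<in>S. ?T u * esc K v (?\<gamma> u) y)"
          by (rule sum_mono)
        then show ?thesis using 2 by (simp add: HK_off)
      next
        case 3
        have "of_bool (good v n (K - {y}) ?\<Phi> u) * (c (gam (K - {y}) ?\<Phi> u) * esc K v (gam (K - {y}) ?\<Phi> u) y)
          \<le> ?T u * esc K v (?\<gamma> u) y" if u: "u \<in> S" for u
        proof (cases "good v n (K - {y}) ?\<Phi> u")
          case True
          have uy: "u \<noteq> y"
            using True leads_off[of y v "K - {y}" ?\<Phi>] v 3 by (auto simp: good_def)
          have "good v n (K - {y} - {x}) ?\<Phi> u" "gam (K - {y} - {x}) ?\<Phi> u = gam (K - {y}) ?\<Phi> u"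
            using good_minus[OF True, of x] x v 3 uy by auto
          then have "good v n (K - {x}) ?\<Phi> u" using good_mono[of v n "K - {y} - {x}" ?\<Phi> u "K - {x}"] by auto
          moreover have "gam (K - {y}) ?\<Phi> u = gam (K - {x}) ?\<Phi> u"
          proof -
            have "leads (K - {x}) ?\<Phi> u v" using calculation by (simp add: good_def)
            then have "gam (K - {x}) ?\<Phi> u = gam K ?\<Phi> u" by (rule gam_eq_of_leads[where v = v]) (use v in auto)
            moreover have "gam (K - {y}) ?\<Phi> u = gam K ?\<Phi> u"
              by (rule gam_eq_of_leads[where v = v]) (use v True in \<open>auto simp: good_def\<close>)
            ultimately show ?thesis by simp
          qed
          ultimately show ?thesis using c[of "?\<gamma> u"] e by (simp add: good_upd gam_upd mult_ac)
        qed (use T e in auto)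
        then have "(\<Sum>u\<in>S. of_bool (good v n (K - {y}) ?\<Phi> u) * (c (gam (K - {y}) ?\<Phi> u) * esc K v (gam (K - {y}) ?\<Phi> u) y))
           \<le> (\<Sum>u\<in>S. ?T u * esc K v (?\<gamma> u) y)"
          by (rule sum_mono)
        then show ?thesis using 3 by simp
      qed
    qed
    then have "PP ?k x \<le> PP ?s x" by (intro PP_mono)
    also have "PP ?s x = b + ?H x + (\<Sum>u\<in>S. ?T u * esc K v (?\<gamma> u) x)"
    proof -
      have "PP (\<lambda>y. esc K v (?\<gamma> u) y) x = esc K v (?\<gamma> u) x" for u
        unfolding esc_def by (rule HK_eq[symmetric]) (use K x in \<open>auto simp: gam_def\<close>)
      then show ?thesis by (simp add: PP_add PP_sum PP_cmult PP_const HK_eq[OF K x, symmetric])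
    qed
    finally have 1: "PP ?k x \<le> b + ?H x + (\<Sum>u\<in>S. ?T u * esc K v (?\<gamma> u) x)" .
    have "PP ?k x \<le> 1" by (rule PP_le1) auto
    then show "PP ?k x \<le> ?h x F" using 1 by (simp add: mult.assoc)
  qed
  also have "\<dots> \<le> EF K (\<lambda>F. min 1 (b + ?H z + (\<Sum>u\<in>S. of_bool (good v n K F u) * (c (gam K F u) * esc K v (gam K F u) z))))"
  proof (rule EF_mono[OF K])
    fix F
    have "of_bool (good v n (K - {z}) F u) * (c (gam (K - {z}) F u) * esc K v (gam (K - {z}) F u) z)
      \<le> of_bool (good v n K F u) * (c (gam K F u) * esc K v (gam K F u) z)" for u
    proof (cases "good v n (K - {z}) F u")
      case True
      then have "gam (K - {z}) F u = gam K F u" by (intro gam_eq_of_leads[where v = v]) (use v in \<open>auto simp: good_def\<close>)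
      moreover have "good v n K F u" using True good_mono by blast
      ultimately show ?thesis using True by simp
    qed (use c e in auto)
    then have "(\<Sum>u\<in>S. of_bool (good v n (K - {z}) F u) * (c (gam (K - {z}) F u) * esc K v (gam (K - {z}) F u) z))
      \<le> (\<Sum>u\<in>S. of_bool (good v n K F u) * (c (gam K F u) * esc K v (gam K F u) z))" by (rule sum_mono)
    then show "?h z F \<le> min 1 (b + ?H z + (\<Sum>u\<in>S. of_bool (good v n K F u) * (c (gam K F u) * esc K v (gam K F u) z)))"
      by linarith
  qed
  finally show ?thesis .
qed

text \<open>The starting point is drawn from \<open>\<nu>\<close>, and with the remaining
  probability no excursion is run. The average can be moved inside the truncation because
  \<open>min 1\<close> is concave.\<close>

lemma thin_avg:
  assumes K: "finite K" and v: "v \<notin> K" and S: "S \<subseteq> K" and b: "0 \<le> b" and c: "\<And>A. 0 \<le> c A"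
    and nu: "\<And>z. z \<in> K \<Longrightarrow> 0 \<le> \<nu> z" and nu1: "(\<Sum>z\<in>K. \<nu> z) \<le> 1"
  shows "EF K (\<lambda>F. min 1 (b + (\<Sum>u\<in>S. of_bool (good v n K F u) * c (gam K F u)))) \<le>
    EF K (\<lambda>F. min 1 (b + (\<Sum>z\<in>K. \<nu> z * HK K (\<lambda>t. of_bool (t = v)) z) +
      (\<Sum>u\<in>S. of_bool (good v n K F u) * (c (gam K F u) * (1 - (\<Sum>z\<in>K. \<nu> z * (1 - esc K v (gam K F u) z)))))))"
    (is "EF K ?A \<le> EF K ?R")
proof -
  let ?H = "HK K (\<lambda>t. of_bool (t = v))"
  let ?a = "\<lambda>F. b + (\<Sum>u\<in>S. of_bool (good v n K F u) * c (gam K F u))"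
  let ?az = "\<lambda>z F. b + ?H z + (\<Sum>u\<in>S. of_bool (good v n K F u) * (c (gam K F u) * esc K v (gam K F u) z))"
  let ?w = "1 - (\<Sum>z\<in>K. \<nu> z)"
  have "EF K ?A = ?w * EF K ?A + (\<Sum>z\<in>K. \<nu> z * EF K ?A)" by (simp add: sum_distrib_right[symmetric] algebra_simps)
  also have "\<dots> \<le> ?w * EF K ?A + (\<Sum>z\<in>K. \<nu> z * EF K (\<lambda>F. min 1 (?az z F)))"
    by (intro add_left_mono sum_mono mult_left_mono thin_step K v S b c nu)
  also have "\<dots> = EF K (\<lambda>F. ?w * ?A F + (\<Sum>z\<in>K. \<nu> z * min 1 (?az z F)))"
    by (simp add: EF_add EF_sum EF_cmult)
  also have "\<dots> \<le> EF K ?R"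
  proof (rule EF_mono[OF K])
    fix F
    have "?w * ?A F + (\<Sum>z\<in>K. \<nu> z * min 1 (?az z F)) \<le> ?w * 1 + (\<Sum>z\<in>K. \<nu> z * 1)"
      using nu1 by (intro add_mono mult_left_mono sum_mono nu) auto
    then have 1: "?w * ?A F + (\<Sum>z\<in>K. \<nu> z * min 1 (?az z F)) \<le> 1" by simp
    have "?w * ?A F + (\<Sum>z\<in>K. \<nu> z * min 1 (?az z F)) \<le> ?w * ?a F + (\<Sum>z\<in>K. \<nu> z * ?az z F)"
      using nu1 by (intro add_mono mult_left_mono sum_mono nu) auto
    also have "(\<Sum>z\<in>K. \<nu> z * ?az z F) = (\<Sum>z\<in>K. \<nu> z) * b + (\<Sum>z\<in>K. \<nu> z * ?H z) +
       (\<Sum>u\<in>S. of_bool (good v n K F u) * (c (gam K F u) * (\<Sum>z\<in>K. \<nu> z * esc K v (gam K F u) z)))"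
      by (simp add: distrib_left sum.distrib sum_distrib_left sum_distrib_right sum.swap[of _ S] mult_ac)
    also have "?w * ?a F + \<dots> = b + (\<Sum>z\<in>K. \<nu> z * ?H z) +
      (\<Sum>u\<in>S. of_bool (good v n K F u) * (c (gam K F u) * (1 - (\<Sum>z\<in>K. \<nu> z * (1 - esc K v (gam K F u) z)))))"
      by (simp add: right_diff_distrib sum_subtractf sum.distrib distrib_left sum_distrib_left[symmetric] algebra_simps)
    finally show "?w * ?A F + (\<Sum>z\<in>K. \<nu> z * min 1 (?az z F)) \<le> ?R F" using 1 by linarith
  qed
  finally show ?thesis .
qed

text \<open>Failures add up, whereas survival probabilities multiply: each round turns the weight
  \<open>c\<close> of a path into \<open>c\<close> times the probability of being avoided once more.
  The truncation is kept until the last round, as each round is an estimate for a truncated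
  sum.\<close>

lemma thin_iterate:
  assumes K: "finite K" and v: "v \<notin> K" and S: "S \<subseteq> K"
    and nu: "\<And>z. z \<in> K \<Longrightarrow> 0 \<le> \<nu> z" and nu1: "(\<Sum>z\<in>K. \<nu> z) \<le> 1"
    and bad: "(\<Sum>z\<in>K. \<nu> z * HK K (\<lambda>t. of_bool (t = v)) z) \<le> \<beta>"
  shows "EF K (\<lambda>F. min 1 (\<Sum>u\<in>S. of_bool (good v n K F u))) \<le>
    real k * \<beta> + EF K (\<lambda>F. \<Sum>u\<in>S. of_bool (good v n K F u) * (1 - (\<Sum>z\<in>K. \<nu> z * (1 - esc K v (gam K F u) z))) ^ k)"
proof -
  let ?\<theta> = "\<lambda>A. 1 - (\<Sum>z\<in>K. \<nu> z * (1 - esc K v A z))"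
  let ?b = "\<Sum>z\<in>K. \<nu> z * HK K (\<lambda>t. of_bool (t = v)) z"
  have b0: "0 \<le> ?b" by (intro sum_nonneg mult_nonneg_nonneg nu HK_nonneg K) auto
  have th: "0 \<le> ?\<theta> A" for A
  proof -
    have "(\<Sum>z\<in>K. \<nu> z * (1 - esc K v A z)) \<le> (\<Sum>z\<in>K. \<nu> z * 1)"
      using esc_bounds[OF K, of v A] by (intro sum_mono mult_left_mono nu) auto
    then show ?thesis using nu1 by simp
  qed
  have "EF K (\<lambda>F. min 1 (\<Sum>u\<in>S. of_bool (good v n K F u))) \<le>
    EF K (\<lambda>F. min 1 (real k * ?b + (\<Sum>u\<in>S. of_bool (good v n K F u) * ?\<theta> (gam K F u) ^ k)))"
  proof (induction k)
    case (Suc k)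
    also have "EF K (\<lambda>F. min 1 (real k * ?b + (\<Sum>u\<in>S. of_bool (good v n K F u) * ?\<theta> (gam K F u) ^ k))) \<le>
      EF K (\<lambda>F. min 1 (real k * ?b + ?b + (\<Sum>u\<in>S. of_bool (good v n K F u) * (?\<theta> (gam K F u) ^ k * ?\<theta> (gam K F u)))))"
      using b0 by (intro thin_avg[where c = "\<lambda>A. ?\<theta> A ^ k"] K v S nu nu1 zero_le_power th) auto
    finally show ?case by (simp add: algebra_simps)
  qed simp
  also have "\<dots> \<le> EF K (\<lambda>F. real k * \<beta> + (\<Sum>u\<in>S. of_bool (good v n K F u) * ?\<theta> (gam K F u) ^ k))"
    using bad by (intro EF_mono K min.coboundedI2 add_right_mono mult_left_mono) auto
  finally show ?thesis by (simp add: EF_add EF_const K)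
qed

section \<open>Capacity of paths\<close>

text \<open>The excursions start at the edges from the roots into \<open>K\<close>; \<open>out K z\<close> is the rate at \<open>z\<close>.\<close>

definition out :: "'a set \<Rightarrow> 'a \<Rightarrow> real" where "out K z = PP (\<lambda>y. of_bool (y \<notin> K)) z"

lemma out_nonneg: "0 \<le> out K z" unfolding out_def by (rule PP_nonneg) auto

lemma pot_out: "finite K \<Longrightarrow> x \<in> K \<Longrightarrow> pot K (out K) x = 1"
proof -
  assume K: "finite K" "x \<in> K"
  have "(\<lambda>z. if z \<in> K then 0 else 1) = (\<lambda>z. of_bool (z \<notin> K) :: real)" by auto
  then show ?thesis using HK_const[OF K(1), of 1 x] K(2) by (simp add: HK_def out_def[abs_def])
qed

text \<open>By reversibility, excursions that end at \<open>v\<close> are excursions that start at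
  \<open>v\<close>, run backwards, and at most \<open>dg v\<close> edges are available to start
  from.\<close>

lemma exit_rate_le:
  assumes K: "finite K" and v: "v \<notin> K"
  shows "(\<Sum>z\<in>K. dg z * out K z * HK K (\<lambda>t. of_bool (t = v)) z) \<le> dg v"
proof -
  have "(\<Sum>z\<in>K. dg z * out K z * HK K (\<lambda>t. of_bool (t = v)) z) = (\<Sum>z\<in>K. dg z * out K z * pot K (\<lambda>y. p y v) z)"
    by (intro sum.cong refl) (simp add: HK_indicator_eq_pot[OF K _ v])
  also have "\<dots> = (\<Sum>z\<in>K. dg z * p z v * pot K (out K) z)" by (rule pot_sym[OF K])
  also have "\<dots> = (\<Sum>z\<in>K. dg z * p z v)" by (intro sum.cong) (auto simp: pot_out K)
  also have "\<dots> = (\<Sum>z\<in>K. dg v * p v z)" by (simp add: p_rev)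
  also have "\<dots> \<le> dg v * (\<Sum>z\<in>K \<union> N v. p v z)"
    unfolding sum_distrib_left by (rule sum_mono2) (auto simp: K p_nonneg)
  also have "(\<Sum>z\<in>K \<union> N v. p v z) = (\<Sum>z\<in>N v. p v z)"
    by (rule sum.mono_neutral_right) (auto simp: K p_zero)
  finally show ?thesis by (simp add: p_sum)
qed

text \<open>\<open>e\<close> is the probability of hitting \<open>Y\<close> or leaving at
  \<open>v\<close>; it is the potential of a charge \<open>f\<close> on \<open>Y\<close> plus the
  harmonic measure of \<open>v\<close>. On \<open>Y\<close> it equals 1, and \<open>half\<close>
  leaves at least 1/2 to the potential. Summing this over \<open>Y\<close> and bounding the
  potential by \<open>J\<close> gives total charge at least \<open>card Y / (2 * J)\<close>. Since
  \<open>pot K (out K)\<close> is 1 on \<open>K\<close>, symmetry of the Green operator converts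
  charge into a rate of excursions.\<close>

lemma capacity_ge:
  assumes K: "finite K" and v: "v \<notin> K" and A: "A \<subseteq> K" and Y: "Y \<subseteq> A" and J: "J > 0"
    and half: "\<And>y. y \<in> Y \<Longrightarrow> g y v \<le> 1 / 2"
    and en: "\<And>x. x \<in> Y \<Longrightarrow> (\<Sum>y\<in>Y. g y x) \<le> J"
  shows "real (card Y) / (2 * J) \<le> (\<Sum>z\<in>K. dg z * out K z * (1 - esc K v A z))"
proof -
  have YK: "Y \<subseteq> K" "finite Y" using A Y finite_subset[OF _ K] by auto
  define e where "e z = 1 - esc K v Y z" for z
  define f where "f z = (if z \<in> Y then 1 - PP e z else 0)" for z
  have e_bounds: "0 \<le> e z" "e z \<le> 1" for z using esc_bounds[OF K, of v Y z] by (auto simp: e_def)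
  have f0: "0 \<le> f z" for z using PP_le1[of e z] e_bounds by (simp add: f_def)
  have e_off: "e z = of_bool (z = v)" if "z \<notin> K" for z using that YK by (auto simp: e_def esc_def HK_off)
  have e_Y: "e z = 1" if "z \<in> Y" for z using that by (simp add: e_def esc_def HK_off)
  have e_in: "e z = PP e z" if "z \<in> K - Y" for z
    using HK_eq[of "K - Y" z "\<lambda>z. of_bool (z \<notin> Y \<and> z \<noteq> v)"] that K
    by (simp add: e_def[abs_def] esc_def PP_diff PP_const)
  have eq: "e z = pot K f z + HK K (\<lambda>t. of_bool (t = v)) z" for z
  proof (rule comparison_eq[OF K, where u = e])
    fix x assume x: "x \<in> K"
    have "e x - PP e x = f x" using e_Y[of x] e_in[of x] x by (auto simp: f_def)
    also have "\<dots> = pot K f x + HK K (\<lambda>t. of_bool (t = v)) x - PP (\<lambda>z. pot K f z + HK K (\<lambda>t. of_bool (t = v)) z) x"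
      using pot_eq[OF K x, of f] HK_eq[OF K x, of "\<lambda>t. of_bool (t = v)"] by (simp add: PP_add)
    finally show "e x - PP e x = \<dots>" .
  qed (simp add: e_off pot_off HK_off)
  have potf: "pot K f x \<le> (\<Sum>y\<in>Y. f y * g x y)" for x
  proof -
    have "f = (\<lambda>z. \<Sum>y\<in>Y. f y * of_bool (z = y))"
    proof
      fix z
      have "(\<Sum>y\<in>Y. f y * of_bool (z = y)) = (\<Sum>y\<in>Y. of_bool (z = y) * f y)" by (simp only: mult.commute)
      then show "f z = (\<Sum>y\<in>Y. f y * of_bool (z = y))"
        using sum_of_bool_eq[OF YK(2), of z f] by (simp only:) (simp add: f_def)
    qed
    then have "pot K f x = pot K (\<lambda>z. \<Sum>y\<in>Y. f y * of_bool (z = y)) x" by simp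
    also have "\<dots> = (\<Sum>y\<in>Y. f y * pot K (\<lambda>z. of_bool (z = y)) x)" by (rule pot_sum[OF K])
    also have "\<dots> \<le> (\<Sum>y\<in>Y. f y * g x y)" by (intro sum_mono mult_left_mono pot_le_g K f0)
    finally show ?thesis .
  qed
  have "real (card Y) / 2 = (\<Sum>y\<in>Y. 1 / 2)" by simp
  also have "\<dots> \<le> (\<Sum>y\<in>Y. \<Sum>x\<in>Y. f x * g y x)"
  proof (rule sum_mono)
    fix y assume y: "y \<in> Y"
    have "1 = pot K f y + HK K (\<lambda>t. of_bool (t = v)) y" using eq[of y] e_Y[OF y] by simp
    also have "\<dots> \<le> (\<Sum>x\<in>Y. f x * g y x) + 1 / 2"
      using half[OF y] HK_le_g[OF K, of v y] potf[of y] by linarith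
    finally show "1 / 2 \<le> (\<Sum>x\<in>Y. f x * g y x)" by simp
  qed
  also have "\<dots> = (\<Sum>x\<in>Y. f x * (\<Sum>y\<in>Y. g y x))" by (subst sum.swap) (simp add: sum_distrib_left)
  also have "\<dots> \<le> (\<Sum>x\<in>Y. f x * J)" by (intro sum_mono mult_left_mono en f0)
  finally have 1: "real (card Y) / (2 * J) \<le> (\<Sum>x\<in>Y. f x)"
    unfolding sum_distrib_right[symmetric] using J by (simp add: field_simps)
  also have "\<dots> \<le> (\<Sum>x\<in>K. f x)" using YK K f0 by (intro sum_mono2) auto
  also have "\<dots> \<le> (\<Sum>x\<in>K. dg x * f x * pot K (out K) x)"
  proof (rule sum_mono)
    fix x assume "x \<in> K"
    then show "f x \<le> dg x * f x * pot K (out K) x"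
      using mult_right_mono[OF dg_ge1[of x] f0[of x]] by (simp add: pot_out K)
  qed
  also have "\<dots> = (\<Sum>x\<in>K. dg x * out K x * pot K f x)" by (rule pot_sym[OF K])
  also have "\<dots> \<le> (\<Sum>z\<in>K. dg z * out K z * (1 - esc K v A z))"
  proof (intro sum_mono mult_left_mono)
    fix z assume "z \<in> K"
    have "pot K f z \<le> e z" using eq[of z] HK_nonneg[OF K, of "\<lambda>t. of_bool (t = v)" z] by simp
    also have "\<dots> \<le> 1 - esc K v A z"
    proof -
      have KA: "finite (K - A)" "finite (K - Y)" using K by auto
      have "esc K v A z \<le> esc K v Y z" unfolding esc_def
      proof (rule HK_le[OF KA(1)])
        fix x assume "x \<in> K - A"
        then have "x \<in> K - Y" using Y by auto
        then show "PP (HK (K - Y) (\<lambda>z. of_bool (z \<notin> Y \<and> z \<noteq> v))) x \<le> HK (K - Y) (\<lambda>z. of_bool (z \<notin> Y \<and> z \<noteq> v)) x"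
          by (simp add: HK_eq[OF KA(2), symmetric])
      next
        fix x assume x: "x \<notin> K - A"
        show "of_bool (x \<notin> A \<and> x \<noteq> v) \<le> HK (K - Y) (\<lambda>z. of_bool (z \<notin> Y \<and> z \<noteq> v)) x"
        proof (cases "x \<in> A")
          case True
          then show ?thesis by (simp add: HK_nonneg KA(2))
        next
          case False
          then show ?thesis using x Y by (subst HK_off) auto
        qed
      qed
      then show ?thesis by (simp add: e_def)
    qed
    finally show "pot K f z \<le> 1 - esc K v A z" .
  qed (simp add: out_nonneg)
  finally show ?thesis .
qed

end

section \<open>Survival of paths with low energy\<close>

context tgraph
begin

text \<open>The arm is cut at distance \<open>m\<close>. Since \<open>m \<le> 2 * n\<close>, a piece
  of length \<open>n\<close> is left beyond the cut, and since \<open>m > n\<close> the piece below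
  it has at least \<open>n\<close> vertices.\<close>

lemma arm_imp_good:
  assumes F: "F \<in> forests K" and v: "v \<notin> K" and arm: "arm K F v (3 * n)" and m: "n < m" "m \<le> 2 * n"
  shows "\<exists>u\<in>K. gdist G v u = m \<and> good v n K F u"
proof -
  obtain y where y: "y \<in> K" "root K F y = v" "3 * n \<le> gdist G v y" using arm by (auto simp: arm_def)
  have l: "leads K F y v" using y root_eq_iff[OF forestsD(1)[OF F] v] by auto
  obtain u where u: "u \<in> K" "leads K F y u" "leads K F u v" "gdist G v u = m"
    using leads_distances[OF l v forestsD(2)[OF F], of m] m y by auto
  have "n \<le> gdist G u y" using gdist_triangle[of v y u] y u m by linarith
  then show ?thesis using u by (auto simp: good_def subarm_def)
qed

lemma card_gam_ge:
  assumes F: "F \<in> forests K" and K: "finite K" and v: "v \<notin> K" and l: "leads K F u v"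
  shows "gdist G v u \<le> card (gam K F u)"
proof -
  have "{1..gdist G v u} \<subseteq> gdist G v ` gam K F u"
  proof
    fix m assume "m \<in> {1..gdist G v u}"
    then obtain t where "t \<in> K" "leads K F u t" "gdist G v t = m"
      using leads_distances[OF l v forestsD(2)[OF F], of m] by auto
    then show "m \<in> gdist G v ` gam K F u" by (auto simp: gam_def)
  qed
  then have "card {1..gdist G v u} \<le> card (gdist G v ` gam K F u)"
    using K gam_sub[of K F u] by (intro card_mono finite_imageI) (auto intro: finite_subset)
  also have "\<dots> \<le> card (gam K F u)" using K gam_sub[of K F u] by (intro card_image_le) (auto intro: finite_subset)
  finally show ?thesis by simp
qed

lemma markov_card:
  assumes A: "finite A" and h: "\<And>y. y \<in> A \<Longrightarrow> 0 \<le> (h y :: real)" and t: "t > 0"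
  shows "real (card {y \<in> A. h y > t}) * t \<le> (\<Sum>y\<in>A. h y)"
proof -
  have "real (card {y \<in> A. h y > t}) * t = (\<Sum>y\<in>{y \<in> A. h y > t}. t)" by simp
  also have "\<dots> \<le> (\<Sum>y\<in>{y \<in> A. h y > t}. h y)" by (intro sum_mono) auto
  also have "\<dots> \<le> (\<Sum>y\<in>A. h y)" using A h by (intro sum_mono2) auto
  finally show ?thesis .
qed

text \<open>By Markov's inequality, at most \<open>n / 4\<close> vertices have
  \<open>g y v > 1 / 2\<close> and at most \<open>n / 4\<close> have local energy above
  \<open>4 * c\<close>. At least \<open>n / 2\<close> vertices remain, and \<open>16 * c\<close>
  arises as \<open>2 * 2 * (4 * c)\<close>.\<close>

lemma low_energy_capacity:
  assumes K: "finite K" and v: "v \<notin> K" and A: "A \<subseteq> K" and n: "n \<ge> 1" "real n \<le> real (card A)" and c: "c > 0"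
    and e1: "(\<Sum>x\<in>A. \<Sum>y\<in>A. g x y) \<le> c * real n"
    and e2: "(\<Sum>y\<in>A. g y v) \<le> real n / 8"
  shows "real n / (16 * c) \<le> (\<Sum>z\<in>K. dg z * out K z * (1 - esc K v A z))"
proof -
  have fA: "finite A" using A K finite_subset by auto
  let ?e = "\<lambda>x. \<Sum>y\<in>A. g y x"
  define B1 where "B1 = {y \<in> A. g y v > 1 / 2}"
  define B2 where "B2 = {x \<in> A. ?e x > 4 * c}"
  define Y where "Y = A - B1 - B2"
  have "real (card B1) * (1 / 2) \<le> (\<Sum>y\<in>A. g y v)"
    unfolding B1_def by (rule markov_card[OF fA]) (auto simp: g_nonneg)
  then have 1: "real (card B1) \<le> real n / 4" using e2 by simp
  have "real (card B2) * (4 * c) \<le> (\<Sum>x\<in>A. ?e x)"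
    unfolding B2_def using c by (intro markov_card[OF fA]) (auto simp: g_nonneg sum_nonneg)
  also have "\<dots> \<le> c * real n" using e1 by (subst sum.swap)
  finally have 2: "real (card B2) \<le> real n / 4" using c by (simp add: field_simps)
  have "A = Y \<union> B1 \<union> B2" by (auto simp: Y_def B1_def B2_def)
  then have "card A \<le> card Y + card B1 + card B2"
    by (metis add_le_mono1 card_Un_le order_trans)
  then have "real (card A) \<le> real (card Y) + real (card B1) + real (card B2)" by linarith
  then have Yc: "real n / 2 \<le> real (card Y)" using n 1 2 by linarith
  have "real n / (16 * c) = (real n / 2) / (2 * (4 * c))" by simp
  also have "\<dots> \<le> real (card Y) / (2 * (4 * c))" using Yc c by (intro divide_right_mono) auto
  also have "\<dots> \<le> (\<Sum>z\<in>K. dg z * out K z * (1 - esc K v A z))"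
  proof (rule capacity_ge[OF K v A])
    show "(\<Sum>y\<in>Y. g y x) \<le> 4 * c" if "x \<in> Y" for x
    proof -
      have "(\<Sum>y\<in>Y. g y x) \<le> ?e x" using fA g_nonneg by (intro sum_mono2) (auto simp: Y_def)
      also have "\<dots> \<le> 4 * c" using that by (auto simp: Y_def B2_def)
      finally show ?thesis .
    qed
  qed (use c in \<open>auto simp: Y_def B1_def\<close>)
  finally show ?thesis .
qed

text \<open>Of two vertices on the path of \<open>u\<close> one leads to the other. Ordering each
  pair this way symmetrises the energy and makes the bound for two intermediate vertices
  applicable.\<close>

lemma energy_gam_le:
  assumes K: "finite K" and v: "v \<notin> K" and u: "u \<in> K"
  shows "EF K (\<lambda>F. of_bool (root K F u = v) * (\<Sum>x\<in>gam K F u. \<Sum>y\<in>gam K F u. g x y)) \<le>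
    (\<Sum>x\<in>K. \<Sum>y\<in>K. g u x * g x y * g y v * (g x y + g y x))"
proof -
  have "EF K (\<lambda>F. of_bool (root K F u = v) * (\<Sum>x\<in>gam K F u. \<Sum>y\<in>gam K F u. g x y)) \<le>
    EF K (\<lambda>F. \<Sum>x\<in>K. \<Sum>y\<in>K. of_bool (root K F u = v \<and> x \<in> gam K F u \<and> y \<in> gam K F x) * (g x y + g y x))"
  proof (rule EF_mono[OF K])
    fix F
    let ?b = "\<lambda>x y. of_bool (root K F u = v \<and> x \<in> gam K F u \<and> y \<in> gam K F x) :: real"
    have gK: "gam K F u \<subseteq> K" by (rule gam_sub)
    have "(\<Sum>x\<in>gam K F u. \<Sum>y\<in>gam K F u. g x y) = (\<Sum>x\<in>K. \<Sum>y\<in>K. of_bool (x \<in> gam K F u \<and> y \<in> gam K F u) * g x y)"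
    proof -
      have "(\<Sum>x\<in>gam K F u. \<Sum>y\<in>gam K F u. g x y) = (\<Sum>x\<in>K. of_bool (x \<in> gam K F u) * (\<Sum>y\<in>gam K F u. g x y))"
        using gK by (intro sum.mono_neutral_cong_left K) auto
      also have "\<dots> = (\<Sum>x\<in>K. of_bool (x \<in> gam K F u) * (\<Sum>y\<in>K. of_bool (y \<in> gam K F u) * g x y))"
        using gK by (intro sum.cong refl arg_cong2[where f = "(*)"] sum.mono_neutral_cong_left K) auto
      finally show ?thesis by (simp add: sum_distrib_left of_bool_conj mult.assoc)
    qed
    then have "of_bool (root K F u = v) * (\<Sum>x\<in>gam K F u. \<Sum>y\<in>gam K F u. g x y) =
      (\<Sum>x\<in>K. \<Sum>y\<in>K. of_bool (root K F u = v \<and> x \<in> gam K F u \<and> y \<in> gam K F u) * g x y)"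
      by (simp add: sum_distrib_left of_bool_conj mult.assoc)
    also have "\<dots> \<le> (\<Sum>x\<in>K. \<Sum>y\<in>K. ?b x y * g x y + ?b y x * g x y)"
    proof (intro sum_mono)
      fix x y assume xy: "x \<in> K" "y \<in> K"
      have "y \<in> gam K F x \<or> x \<in> gam K F y" if "x \<in> gam K F u" "y \<in> gam K F u"
        using leads_linear[of u x K F y] that xy by (auto simp: gam_def)
      then show "of_bool (root K F u = v \<and> x \<in> gam K F u \<and> y \<in> gam K F u) * g x y \<le> ?b x y * g x y + ?b y x * g x y"
        using g_nonneg[of x y] by (auto simp: of_bool_def)
    qed
    also have "\<dots> = (\<Sum>x\<in>K. \<Sum>y\<in>K. ?b x y * g x y) + (\<Sum>x\<in>K. \<Sum>y\<in>K. ?b y x * g x y)"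
      by (simp add: sum.distrib)
    also have "(\<Sum>x\<in>K. \<Sum>y\<in>K. ?b y x * g x y) = (\<Sum>x\<in>K. \<Sum>y\<in>K. ?b x y * g y x)" by (rule sum.swap)
    also have "(\<Sum>x\<in>K. \<Sum>y\<in>K. ?b x y * g x y) + \<dots> = (\<Sum>x\<in>K. \<Sum>y\<in>K. ?b x y * (g x y + g y x))"
      by (simp add: sum.distrib distrib_left)
    finally show "of_bool (root K F u = v) * (\<Sum>x\<in>gam K F u. \<Sum>y\<in>gam K F u. g x y) \<le> \<dots>" .
  qed
  also have "\<dots> \<le> (\<Sum>x\<in>K. \<Sum>y\<in>K. g u x * g x y * g y v * (g x y + g y x))"
    unfolding EF_sum EF_cmult2
    by (intro sum_mono mult_right_mono prob_root_via2_le K v) (simp add: g_nonneg)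
  finally show ?thesis .
qed

lemma energy_gam_root_le:
  assumes K: "finite K" and v: "v \<notin> K"
  shows "EF K (\<lambda>F. of_bool (root K F u = v) * (\<Sum>y\<in>gam K F u. g y v)) \<le> (\<Sum>y\<in>K. g u y * g y v * g y v)"
proof -
  have "EF K (\<lambda>F. of_bool (root K F u = v) * (\<Sum>y\<in>gam K F u. g y v)) =
    EF K (\<lambda>F. \<Sum>y\<in>K. of_bool (root K F u = v \<and> y \<in> gam K F u) * g y v)"
  proof (rule EF_cong)
    fix F
    have "(\<Sum>y\<in>gam K F u. g y v) = (\<Sum>y\<in>K. of_bool (y \<in> gam K F u) * g y v)"
      using gam_sub[of K F u] by (intro sum.mono_neutral_cong_left K) auto
    then show "of_bool (root K F u = v) * (\<Sum>y\<in>gam K F u. g y v) = (\<Sum>y\<in>K. of_bool (root K F u = v \<and> y \<in> gam K F u) * g y v)"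
      by (simp add: sum_distrib_left of_bool_conj mult.assoc)
  qed
  also have "\<dots> \<le> (\<Sum>y\<in>K. g u y * g y v * g y v)"
    unfolding EF_sum EF_cmult2 by (intro sum_mono mult_right_mono prob_root_via_le K v g_nonneg)
  finally show ?thesis .
qed

text \<open>
  The forest is updated by a number of random excursions proportional to \<open>lam / n\<close> times the total rate.
  With probability of order \<open>lam / n\<close> some excursion ends at \<open>v\<close>; otherwise the component of \<open>v\<close> has
  only been thinned, and a path of length \<open>n\<close> has survived with probability exponentially small in \<open>lam\<close>.
\<close>

lemma thin_exp:
  assumes K: "finite K" "K \<noteq> {}" and v: "v \<notin> K" and S: "S \<subseteq> K" and n: "n \<ge> 1" and lam: "lam \<ge> 1"
  shows "EF K (\<lambda>F. min 1 (\<Sum>u\<in>S. of_bool (good v m K F u))) \<le>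
    real lam * dg v / real n + EF K (\<lambda>F. \<Sum>u\<in>S. of_bool (good v m K F u) *
      exp (- (real lam / real n) * (\<Sum>z\<in>K. dg z * out K z * (1 - esc K v (gam K F u) z))))"
proof -
  let ?\<kappa> = "\<lambda>A. \<Sum>z\<in>K. dg z * out K z * (1 - esc K v A z)"
  \<comment> \<open>The total rate is the number of edges that leave \<open>K\<close>. Being an
    integer, it allows for exactly \<open>lam * M\<close> rounds.\<close>
  define M where "M = (\<Sum>z\<in>K. \<Sum>y\<in>N z. count (G z) y * of_bool (y \<notin> K))"
  have rate: "dg z * out K z = real (\<Sum>y\<in>N z. count (G z) y * of_bool (y \<notin> K))" for z
    unfolding out_def PP_def sum_distrib_left of_nat_sum
    by (intro sum.cong refl) (simp add: dg_p mult.assoc[symmetric])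
  have Msum: "(\<Sum>z\<in>K. dg z * out K z) = real M" unfolding rate M_def by simp
  have M0: "M > 0"
  proof (rule ccontr)
    assume "\<not> M > 0"
    then have "(\<Sum>z\<in>K. dg z * out K z) = 0" using Msum by simp
    then have "dg z * out K z = 0" if "z \<in> K" for z
      using that K out_nonneg[of K] by (subst (asm) sum_nonneg_eq_0_iff) auto
    then have "out K z = 0" if "z \<in> K" for z using that dg_ge1[of z] by fastforce
    moreover obtain x where "x \<in> K" using K by auto
    ultimately have "pot K (out K) x = 0"
      by (intro pot_unique[OF K(1), where u = "\<lambda>_. 0"]) (auto simp: PP_const)
    then show False using pot_out[OF K(1) \<open>x \<in> K\<close>] by simp
  qed
  \<comment> \<open>The mass is \<open>1 / n\<close>: a round starts an excursion with that
    probability, at an edge chosen uniformly among those entering \<open>K\<close>.\<close>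
  define \<nu> where "\<nu> z = dg z * out K z / (real n * real M)" for z
  have pos: "real n * real M > 0" using n M0 by simp
  have nu0: "0 \<le> \<nu> z" for z using pos out_nonneg[of K z] by (auto simp: \<nu>_def intro!: divide_nonneg_nonneg mult_nonneg_nonneg)
  have "(\<Sum>z\<in>K. \<nu> z) = 1 / real n"
    unfolding \<nu>_def sum_divide_distrib[symmetric] Msum using M0 by simp
  then have nu1: "(\<Sum>z\<in>K. \<nu> z) \<le> 1" using n by simp
  have "(\<Sum>z\<in>K. \<nu> z * HK K (\<lambda>t. of_bool (t = v)) z) = (\<Sum>z\<in>K. dg z * out K z * HK K (\<lambda>t. of_bool (t = v)) z) / (real n * real M)"
    unfolding \<nu>_def sum_divide_distrib by simp
  also have "\<dots> \<le> dg v / (real n * real M)"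
    using pos by (intro divide_right_mono exit_rate_le K v) auto
  finally have bad: "(\<Sum>z\<in>K. \<nu> z * HK K (\<lambda>t. of_bool (t = v)) z) \<le> dg v / (real n * real M)" .
  have th: "(1 - (\<Sum>z\<in>K. \<nu> z * (1 - esc K v A z))) ^ (lam * M) \<le> exp (- (real lam / real n) * ?\<kappa> A)" for A
  proof -
    let ?t = "\<Sum>z\<in>K. \<nu> z * (1 - esc K v A z)"
    have t: "?t = ?\<kappa> A / (real n * real M)" unfolding \<nu>_def sum_divide_distrib by simp
    have "?t \<le> (\<Sum>z\<in>K. \<nu> z * 1)"
      using esc_bounds[OF K(1), of v A] by (intro sum_mono mult_left_mono nu0) auto
    then have "0 \<le> 1 - ?t" using nu1 by simp
    then have "(1 - ?t) ^ (lam * M) \<le> exp (- ?t) ^ (lam * M)"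
      using exp_ge_add_one_self[of "- ?t"] by (intro power_mono) auto
    also have "\<dots> = exp (- (real lam / real n) * ?\<kappa> A)"
      unfolding exp_of_nat_mult[symmetric] t using M0 by simp
    finally show ?thesis .
  qed
  have "EF K (\<lambda>F. min 1 (\<Sum>u\<in>S. of_bool (good v m K F u))) \<le> real (lam * M) * (dg v / (real n * real M)) +
     EF K (\<lambda>F. \<Sum>u\<in>S. of_bool (good v m K F u) * (1 - (\<Sum>z\<in>K. \<nu> z * (1 - esc K v (gam K F u) z))) ^ (lam * M))"
    by (intro thin_iterate K v S nu0 nu1 bad)
  also have "real (lam * M) * (dg v / (real n * real M)) = real lam * dg v / real n" using M0 by simp
  also have "EF K (\<lambda>F. \<Sum>u\<in>S. of_bool (good v m K F u) * (1 - (\<Sum>z\<in>K. \<nu> z * (1 - esc K v (gam K F u) z))) ^ (lam * M)) \<le>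
    EF K (\<lambda>F. \<Sum>u\<in>S. of_bool (good v m K F u) * exp (- (real lam / real n) * ?\<kappa> (gam K F u)))"
    by (intro EF_mono K sum_mono mult_left_mono th) auto
  finally show ?thesis by simp
qed

end

section \<open>The recursion for the arm probability\<close>

context bgraph
begin

text \<open>The constants of \<open>energy2\<close> and \<open>energy3\<close> at radius
  \<open>2 * n\<close>, with the powers of \<open>n\<close> taken out.\<close>

definition A2 :: real where "A2 = 32 * D ^ 4 * bub * C\<^sup>2"
definition A3 :: real where "A3 = 4 * D ^ 3 * bub * C"

lemma A2_nonneg: "0 \<le> A2" and A3_nonneg: "0 \<le> A3"
  using D_ge1 bub_nonneg C_nonneg by (auto simp: A2_def A3_def)

text \<open>The arm is cut at each distance \<open>m\<close> with \<open>n < m\<close> and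
  \<open>m \<le> 2 * n\<close>, and the \<open>n\<close> resulting bounds are averaged. This turns
  sums over spheres into a sum over a ball, where the energy bounds apply, and divides them by
  \<open>n\<close>. The tree beyond the cut contributes the factor \<open>q\<close>.\<close>

lemma arm_recursion:
  assumes K: "finite K" and v: "v \<notin> K" and n: "n \<ge> 1" and lam: "lam \<ge> 1" and c: "c > 0" and q: "0 \<le> q"
    and Q: "\<And>L w. finite L \<Longrightarrow> w \<notin> L \<Longrightarrow> EF L (\<lambda>F. of_bool (arm L F w n)) \<le> q"
  shows "EF K (\<lambda>F. of_bool (arm K F v (3 * n))) \<le>
    D * real lam / real n + q * (2 * D * C * exp (- real lam / (16 * c)) + A2 / c + 8 * A3 / real n)"
proof (cases "K = {}")
  case True
  have "EF K (\<lambda>F. of_bool (arm K F v (3 * n))) = 0" by (simp add: True arm_def EF_const)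
  then show ?thesis using q n c D_ge1 C_nonneg A2_nonneg A3_nonneg
    by (auto intro!: add_nonneg_nonneg mult_nonneg_nonneg divide_nonneg_nonneg)
next
  case ne: False
  define S where "S m = {u \<in> K. gdist G v u = m}" for m
  define B where "B = K \<inter> gball v (2 * n)"
  define x1 where "x1 = exp (- real lam / (16 * c))"
  let ?\<kappa> = "\<lambda>A. \<Sum>z\<in>K. dg z * out K z * (1 - esc K v A z)"
  let ?e1 = "\<lambda>A. \<Sum>x\<in>A. \<Sum>y\<in>A. g x y" and ?e2 = "\<lambda>A. \<Sum>y\<in>A. g y v"
  let ?b = "\<lambda>u. x1 * EF K (\<lambda>F. of_bool (root K F u = v))
      + EF K (\<lambda>F. of_bool (root K F u = v) * ?e1 (gam K F u)) / (c * real n)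
      + EF K (\<lambda>F. of_bool (root K F u = v) * ?e2 (gam K F u)) * (8 / real n)"
  have bn: "0 \<le> ?b u" for u
    unfolding x1_def using c
    by (intro add_nonneg_nonneg mult_nonneg_nonneg divide_nonneg_nonneg EF_nonneg K sum_nonneg g_nonneg) auto
  have step: "EF K (\<lambda>F. of_bool (arm K F v (3 * n))) \<le> D * real lam / real n + q * (\<Sum>u\<in>S m. ?b u)"
    if m: "n < m" "m \<le> 2 * n" for m
  proof -
    have SK: "S m \<subseteq> K" "finite (S m)" using K by (auto simp: S_def)
    have "EF K (\<lambda>F. of_bool (arm K F v (3 * n))) \<le> EF K (\<lambda>F. min 1 (\<Sum>u\<in>S m. of_bool (good v n K F u)))"
    proof (rule EF_mono[OF K])
      fix F assume F: "F \<in> forests K"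
      show "of_bool (arm K F v (3 * n)) \<le> min 1 (\<Sum>u\<in>S m. of_bool (good v n K F u) :: real)"
      proof (cases "arm K F v (3 * n)")
        case True
        then obtain u where u: "u \<in> S m" "good v n K F u" using arm_imp_good[OF F v _ m] by (auto simp: S_def)
        then have "(1::real) \<le> (\<Sum>u\<in>S m. of_bool (good v n K F u))"
          using member_le_sum[OF u(1), of "\<lambda>u. of_bool (good v n K F u) :: real"] SK by auto
        then show ?thesis using True by simp
      qed (simp add: sum_nonneg)
    qed
    also have "\<dots> \<le> real lam * dg v / real n + EF K (\<lambda>F. \<Sum>u\<in>S m. of_bool (good v n K F u) *
      exp (- (real lam / real n) * ?\<kappa> (gam K F u)))"
      by (rule thin_exp[OF K ne v SK(1) n lam])
    also have "\<dots> \<le> D * real lam / real n + q * (\<Sum>u\<in>S m. ?b u)"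
    proof (rule add_mono)
      show "real lam * dg v / real n \<le> D * real lam / real n"
        using dg_le[of v] by (intro divide_right_mono) (auto simp: mult.commute[of D] mult_left_mono)
      have "EF K (\<lambda>F. of_bool (good v n K F u) * exp (- (real lam / real n) * ?\<kappa> (gam K F u))) \<le> q * ?b u"
        if u: "u \<in> S m" for u
      proof -
        have uK: "u \<in> K" using u SK by auto
        have "EF K (\<lambda>F. of_bool (good v n K F u) * exp (- (real lam / real n) * ?\<kappa> (gam K F u))) =
          EF K (\<lambda>F. of_bool (root K F u = v \<and> subarm K F u n) * exp (- (real lam / real n) * ?\<kappa> (gam K F u)))"
          by (intro EF_cong) (simp add: good_def root_eq_iff[OF forestsD(1) v])
        also have "\<dots> \<le> q * EF K (\<lambda>F. of_bool (root K F u = v) * exp (- (real lam / real n) * ?\<kappa> (gam K F u)))"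
          by (rule subarm_bound[where c = "\<lambda>A. exp (- (real lam / real n) * ?\<kappa> A)", OF K uK n _ q Q]) auto
        also have "\<dots> \<le> q * EF K (\<lambda>F. x1 * of_bool (root K F u = v)
             + of_bool (root K F u = v) * ?e1 (gam K F u) / (c * real n)
             + of_bool (root K F u = v) * ?e2 (gam K F u) * (8 / real n))"
        proof (intro mult_left_mono q EF_mono K)
          fix F assume F: "F \<in> forests K"
          let ?A = "gam K F u"
          have e: "0 \<le> ?e1 ?A" "0 \<le> ?e2 ?A" by (auto intro!: sum_nonneg g_nonneg)
          have kn: "0 \<le> ?\<kappa> ?A" using esc_bounds[OF K, of v ?A]
            by (intro sum_nonneg mult_nonneg_nonneg out_nonneg) auto
          have x1p: "0 < x1" by (simp add: x1_def)
          have "exp (- (real lam / real n) * ?\<kappa> ?A) \<le> x1 + ?e1 ?A / (c * real n) + ?e2 ?A * (8 / real n)"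
            if r: "root K F u = v"
          proof -
            have le1: "exp (- (real lam / real n) * ?\<kappa> ?A) \<le> 1" using kn by simp
            have nn: "0 \<le> ?e1 ?A / (c * real n)" "0 \<le> ?e2 ?A * (8 / real n)" using e c by auto
            \<comment> \<open>If an energy exceeds its threshold, its ratio to the threshold
              dominates the trivial bound 1 for the survival probability; otherwise the capacity
              bound applies.\<close>
            consider "?e1 ?A > c * real n" | "?e2 ?A > real n / 8" | "?e1 ?A \<le> c * real n" "?e2 ?A \<le> real n / 8" by linarith
            then show ?thesis
            proof cases
              case 1
              then have "1 \<le> ?e1 ?A / (c * real n)" using c n by (simp add: field_simps)
              then show ?thesis using le1 nn x1p by linarith
            next
              case 2
              then have "1 \<le> ?e2 ?A * (8 / real n)" using n by (simp add: field_simps)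
              then show ?thesis using le1 nn x1p by linarith
            next
              case 3
              have l: "leads K F u v" using r root_eq_iff[OF forestsD(1)[OF F] v] by auto
              have "m \<le> card ?A" using card_gam_ge[OF F K v l] u by (simp add: S_def)
              then have "real n \<le> real (card ?A)" using m by simp
              from low_energy_capacity[OF K v gam_sub n this c 3]
              have "(real lam / real n) * (real n / (16 * c)) \<le> (real lam / real n) * ?\<kappa> ?A"
                by (intro mult_left_mono) auto
              then have "real lam / (16 * c) \<le> (real lam / real n) * ?\<kappa> ?A" using n by simp
              then have "exp (- (real lam / real n) * ?\<kappa> ?A) \<le> x1" by (simp add: x1_def)
              then show ?thesis using nn by linarith
            qed
          qed
          then show "of_bool (root K F u = v) * exp (- (real lam / real n) * ?\<kappa> ?A) \<le> x1 * of_bool (root K F u = v)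
             + of_bool (root K F u = v) * ?e1 ?A / (c * real n) + of_bool (root K F u = v) * ?e2 ?A * (8 / real n)"
            by simp
        qed
        also have "\<dots> = q * ?b u"
          by (simp only: EF_add EF_cmult EF_cmult2 divide_inverse)
        finally show ?thesis .
      qed
      then have "(\<Sum>u\<in>S m. EF K (\<lambda>F. of_bool (good v n K F u) * exp (- (real lam / real n) * ?\<kappa> (gam K F u)))) \<le> (\<Sum>u\<in>S m. q * ?b u)"
        by (rule sum_mono)
      then show "EF K (\<lambda>F. \<Sum>u\<in>S m. of_bool (good v n K F u) * exp (- (real lam / real n) * ?\<kappa> (gam K F u))) \<le> q * (\<Sum>u\<in>S m. ?b u)"
        by (simp add: EF_sum sum_distrib_left)
    qed
    finally show ?thesis .
  qed
  have B: "finite B" "B \<subseteq> gball v (2 * n)" "2 * n \<ge> 1" using K n by (auto simp: B_def)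
  have "(\<Sum>m\<in>{n<..2 * n}. EF K (\<lambda>F. of_bool (arm K F v (3 * n)))) \<le>
    (\<Sum>m\<in>{n<..2 * n}. D * real lam / real n + q * (\<Sum>u\<in>S m. ?b u))"
    by (rule sum_mono) (rule step, auto)
  moreover have "(\<Sum>m\<in>{n<..2 * n}. X) = real n * X" "(\<Sum>m\<in>{n<..2 * n}. Y + q * h m) = real n * Y + q * (\<Sum>m\<in>{n<..2 * n}. h m)" for X Y :: real and h
    by (simp_all add: sum.distrib sum_distrib_left)
  ultimately have "real n * EF K (\<lambda>F. of_bool (arm K F v (3 * n))) \<le>
    real n * (D * real lam / real n) + q * (\<Sum>m\<in>{n<..2 * n}. \<Sum>u\<in>S m. ?b u)"
    by simp
  also have "(\<Sum>m\<in>{n<..2 * n}. \<Sum>u\<in>S m. ?b u) = (\<Sum>u\<in>(\<Union>m\<in>{n<..2 * n}. S m). ?b u)"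
    by (rule sum.UNION_disjoint[symmetric]) (auto simp: S_def K)
  also have "\<dots> \<le> (\<Sum>u\<in>B. ?b u)"
    using B bn by (intro sum_mono2) (auto simp: S_def B_def gball_def)
  also have "\<dots> \<le> x1 * (D * C * real (2 * n)) + (8 * D ^ 4 * bub * C\<^sup>2 * (real (2 * n))\<^sup>2) / (c * real n)
     + (2 * D ^ 3 * bub * C * real (2 * n)) * (8 / real n)"
  proof -
    have "(\<Sum>u\<in>B. EF K (\<lambda>F. of_bool (root K F u = v))) \<le> D * C * real (2 * n)"
      by (rule order_trans[OF sum_mono energy1[OF B]]) (rule prob_root_le[OF K])
    moreover have "(\<Sum>u\<in>B. EF K (\<lambda>F. of_bool (root K F u = v) * ?e1 (gam K F u))) \<le> 8 * D ^ 4 * bub * C\<^sup>2 * (real (2 * n))\<^sup>2"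
      by (rule order_trans[OF sum_mono energy2[OF B K]]) (rule energy_gam_le[OF K v], auto simp: B_def)
    moreover have "(\<Sum>u\<in>B. EF K (\<lambda>F. of_bool (root K F u = v) * ?e2 (gam K F u))) \<le> 2 * D ^ 3 * bub * C * real (2 * n)"
      by (rule order_trans[OF sum_mono energy3[OF B K]]) (rule energy_gam_root_le[OF K v])
    ultimately show ?thesis
      unfolding sum.distrib sum_distrib_left[symmetric] sum_divide_distrib[symmetric] sum_distrib_right[symmetric]
      using c by (intro add_mono mult_left_mono divide_right_mono mult_right_mono) (auto simp: x1_def)
  qed
  finally have "real n * EF K (\<lambda>F. of_bool (arm K F v (3 * n))) \<le> real n * (D * real lam / real n) +
    q * (x1 * (D * C * real (2 * n)) + (8 * D ^ 4 * bub * C\<^sup>2 * (real (2 * n))\<^sup>2) / (c * real n)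
     + (2 * D ^ 3 * bub * C * real (2 * n)) * (8 / real n))"
    using q by (simp add: mult_left_mono)
  also have "\<dots> = real n * (D * real lam / real n + q * (2 * D * C * x1 + A2 / c + 8 * A3 / real n))"
    using n c by (simp add: A2_def A3_def power2_eq_square field_simps)
  finally show ?thesis using n by (simp add: x1_def)
qed

theorem one_arm:
  "\<exists>\<Lambda>>0. \<forall>n\<ge>1. \<forall>K v. finite K \<longrightarrow> v \<notin> K \<longrightarrow> EF K (\<lambda>F. of_bool (arm K F v n)) \<le> \<Lambda> / real n"
proof -
  \<comment> \<open>Each of the three error terms is allotted \<open>1 / 36\<close>, so that
    \<open>q\<close> gets the coefficient \<open>1 / 12\<close>.\<close>
  define c where "c = 36 * (A2 + 1)"
  have c: "c > 0" "A2 / c \<le> 1 / 36" using A2_nonneg by (auto simp: c_def field_simps)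
  have "\<exists>lam::nat. lam \<ge> 1 \<and> 2 * D * C * exp (- real lam / (16 * c)) \<le> 1 / 36"
  proof -
    define lam where "lam = nat \<lceil>16 * c * (72 * D * C)\<rceil> + 1"
    have "16 * c * (72 * D * C) \<le> real lam" unfolding lam_def by linarith
    then have y: "72 * D * C \<le> real lam / (16 * c)" using c by (simp add: field_simps)
    have "72 * D * C \<le> exp (real lam / (16 * c))"
      using y exp_ge_add_one_self[of "real lam / (16 * c)"] by linarith
    then have "2 * D * C * exp (- real lam / (16 * c)) \<le> 1 / 36"
      by (simp add: exp_minus field_simps)
    then show ?thesis by (intro exI[of _ lam]) (simp add: lam_def)
  qed
  then obtain lam where lam: "lam \<ge> 1" "2 * D * C * exp (- real lam / (16 * c)) \<le> 1 / 36" by auto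
  define n0 where "n0 = nat \<lceil>288 * A3\<rceil> + 1"
  have n0: "8 * A3 / real n \<le> 1 / 36" "n \<ge> 1" if "n \<ge> n0" for n
  proof -
    show "n \<ge> 1" using that by (simp add: n0_def)
    have "288 * A3 \<le> real n" using that by (simp add: n0_def) linarith
    then show "8 * A3 / real n \<le> 1 / 36" using \<open>n \<ge> 1\<close> by (simp add: field_simps)
  qed
  \<comment> \<open>The first entry makes the claim trivial for small \<open>n\<close>; the second
    makes \<open>D * lam\<close> at most a tenth of \<open>\<Lambda>\<close>.\<close>
  define \<Lambda> where "\<Lambda> = max (real (3 * n0 + 3)) (10 * D * real lam)"
  have L: "\<Lambda> \<ge> real (3 * n0 + 3)" "\<Lambda> \<ge> 10 * D * real lam" by (auto simp: \<Lambda>_def)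
  then have Lpos: "\<Lambda> > 0" by (smt (verit) of_nat_0_le_iff of_nat_add of_nat_numeral zero_less_numeral)
  have "\<forall>K v. finite K \<longrightarrow> v \<notin> K \<longrightarrow> EF K (\<lambda>F. of_bool (arm K F v n)) \<le> \<Lambda> / real n" if "n \<ge> 1" for n
    using that
  proof (induction n rule: less_induct)
    case (less n)
    show ?case
    proof (intro allI impI)
      fix K :: "'a set" and v assume K: "finite K" "v \<notin> K"
      show "EF K (\<lambda>F. of_bool (arm K F v n)) \<le> \<Lambda> / real n"
      proof (cases "n \<ge> 3 * n0 + 3")
        case False
        have "EF K (\<lambda>F. of_bool (arm K F v n)) \<le> EF K (\<lambda>_. 1)" by (intro EF_mono K) auto
        also have "\<dots> = 1" by (simp add: EF_const K)
        also have "1 \<le> \<Lambda> / real n" using False L less.prems by (simp add: field_simps)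
        finally show ?thesis .
      next
        case True
        define m where "m = n div 3"
        have m: "m \<ge> n0" "m \<ge> 1" "m < n" "3 * m \<le> n" using True by (auto simp: m_def)
        have m5: "n \<le> 5 * m" using m(2) div_mult_mod_eq[of n 3] mod_less_divisor[of 3 n] unfolding m_def by linarith
        have "EF K (\<lambda>F. of_bool (arm K F v n)) \<le> EF K (\<lambda>F. of_bool (arm K F v (3 * m)))"
          using m by (intro EF_mono K) (auto simp: arm_def intro: order_trans)
        also have "\<dots> \<le> D * real lam / real m + (\<Lambda> / real m) * (2 * D * C * exp (- real lam / (16 * c)) + A2 / c + 8 * A3 / real m)"
          using less.IH[OF m(3,2)] Lpos by (intro arm_recursion K m(2) lam(1) c(1)) auto
        also have "\<dots> \<le> D * real lam / real m + (\<Lambda> / real m) * (1 / 12)"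
        proof (intro add_left_mono mult_left_mono)
          show "2 * D * C * exp (- real lam / (16 * c)) + A2 / c + 8 * A3 / real m \<le> 1 / 12"
            using lam(2) c(2) n0(1)[OF m(1)] by linarith
        qed (use Lpos in auto)
        also have "\<dots> = (D * real lam + \<Lambda> / 12) / real m" by (simp add: add_divide_distrib)
        \<comment> \<open>1/10 + 1/12 is below 1/5, and \<open>n \<le> 5 * m\<close> pays for
          rounding \<open>n / 3\<close> down.\<close>
        also have "\<dots> \<le> (\<Lambda> / 5) / real m" using L(2) Lpos by (intro divide_right_mono) auto
        also have "\<dots> \<le> \<Lambda> / real n"
        proof -
          have "real n \<le> 5 * real m" using m5 by linarith
          then show ?thesis using m(2) less.prems Lpos by (simp add: field_simps mult_left_mono)
        qed
        finally show ?thesis .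
      qed
    qed
  qed
  then show ?thesis using Lpos by blast
qed

end

context sgraph
begin

section \<open>Finite random walk paths\<close>

text \<open>The expectation of a function of the first \<open>n\<close> steps; the list does not
  contain the starting point.\<close>

primrec wexp :: "nat \<Rightarrow> 'a \<Rightarrow> ('a list \<Rightarrow> real) \<Rightarrow> real" where
  "wexp 0 x f = f []"
| "wexp (Suc n) x f = PP (\<lambda>y. wexp n y (\<lambda>l. f (y # l))) x"

primrec gpath :: "'a \<Rightarrow> 'a list \<Rightarrow> bool" where
  "gpath x [] \<longleftrightarrow> True"
| "gpath x (y # l) \<longleftrightarrow> y \<in> N x \<and> gpath y l"

lemma wexp_mono:
  "(\<And>l. length l = n \<Longrightarrow> gpath x l \<Longrightarrow> f l \<le> h l) \<Longrightarrow> wexp n x f \<le> wexp n x h"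
proof (induction n arbitrary: x f h)
  case (Suc n)
  show ?case unfolding wexp.simps
    by (rule PP_mono, rule Suc.IH) (auto intro: Suc.prems)
qed simp

lemma wexp_cmult: "wexp n x (\<lambda>l. c * f l) = c * wexp n x f"
  by (induction n arbitrary: x f) (simp_all add: PP_cmult)

lemma wexp_add: "wexp n x (\<lambda>l. f l + h l) = wexp n x f + wexp n x h"
  by (induction n arbitrary: x f h) (simp_all add: PP_add)

lemma wexp_const: "wexp n x (\<lambda>_. c) = c"
  by (induction n arbitrary: x) (simp_all add: PP_const)

lemma wexp_sum: "wexp n x (\<lambda>l. \<Sum>i\<in>I. f i l) = (\<Sum>i\<in>I. wexp n x (f i))"
  by (induction n arbitrary: x f) (simp_all add: PP_sum)

lemma wexp_le1: "(\<And>l. f l \<le> 1) \<Longrightarrow> wexp n x f \<le> 1"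
  using wexp_mono[of n x f "\<lambda>_. 1"] by (simp add: wexp_const)

primrec visits :: "'a set \<Rightarrow> 'a set \<Rightarrow> 'a list \<Rightarrow> real" where
  "visits K S [] = 0"
| "visits K S (y # l) = (if y \<in> K then of_bool (y \<in> S) + visits K S l else 0)"

lemma visits_nonneg: "0 \<le> visits K S l" by (induction l) auto

text \<open>Asking for \<open>r\<close> further steps after distance \<open>2 * r\<close> is
  attained forces \<open>r\<close> visits to the annulus between the distances \<open>r\<close> and
  \<open>3 * r\<close>, whatever these steps are.\<close>

primrec reaches :: "'a \<Rightarrow> nat \<Rightarrow> 'a list \<Rightarrow> bool" where
  "reaches v r [] \<longleftrightarrow> False"
| "reaches v r (y # l) \<longleftrightarrow> 2 * r \<le> gdist G v y \<and> r \<le> length l \<or> reaches v r l"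

definition annulus :: "'a \<Rightarrow> nat \<Rightarrow> 'a set" where "annulus v r = gball v (3 * r) \<inter> {u. r \<le> gdist G v u}"

lemma visits_annulus_ge:
  assumes "gpath x l" "k \<le> length l" "r + k \<le> gdist G v x" "gdist G v x + k \<le> 3 * r"
    and "set l \<inter> A = {}" and "gball v (3 * r) - A \<subseteq> K"
  shows "real k \<le> visits K (annulus v r) l"
  using assms(1-5)
proof (induction l arbitrary: x k)
  case (Cons y l)
  show ?case
  proof (cases k)
    case 0
    then show ?thesis using visits_nonneg[of K "annulus v r" "y # l"] by simp
  next
    case (Suc k')
    have y: "y \<in> N x" using Cons.prems by simp
    have d: "gdist G v y \<le> Suc (gdist G v x)" "gdist G v x \<le> Suc (gdist G v y)"
      using gdist_edge[OF y] gdist_edge[of x y v] y N_sym by auto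
    have "y \<in> annulus v r" "y \<in> gball v (3 * r)" using d Suc Cons.prems by (auto simp: annulus_def gball_def)
    moreover have "y \<in> K" using calculation Cons.prems assms(6) by auto
    moreover have "real k' \<le> visits K (annulus v r) l"
      using Cons.prems d Suc by (intro Cons.IH[of y]) auto
    ultimately show ?thesis using Suc by simp
  qed
qed simp

lemma visits_ge:
  assumes "gpath x l" "reaches v r l" "gdist G v x < 2 * r"
    and "set l \<inter> A = {}" and K: "gball v (3 * r) - A \<subseteq> K"
  shows "real r \<le> visits K (annulus v r) l"
  using assms(1-4)
proof (induction l arbitrary: x)
  case (Cons y l)
  have y: "y \<in> N x" using Cons.prems by simp
  have d: "gdist G v y \<le> Suc (gdist G v x)" using gdist_edge[of x y v] y N_sym by auto
  then have yK: "y \<in> K" using Cons.prems K by (auto simp: gball_def)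
  have "real r \<le> visits K (annulus v r) l"
  proof (cases "2 * r \<le> gdist G v y \<and> r \<le> length l")
    case True
    then have "gdist G v y = 2 * r" using d Cons.prems by auto
    then show ?thesis using True Cons.prems by (intro visits_annulus_ge[OF _ _ _ _ _ K, of y]) auto
  next
    case False
    then have "reaches v r l" using Cons.prems by auto
    show ?thesis
    proof (cases "2 * r \<le> gdist G v y")
      case True
      then have "length l < r" using False by auto
      then have "\<not> reaches v r l" by (induction l) auto
      then show ?thesis using \<open>reaches v r l\<close> by simp
    next
      case False
      then show ?thesis using \<open>reaches v r l\<close> Cons.prems by (intro Cons.IH[of y]) auto
    qed
  qed
  then show ?case using yK by simp
qed simp

text \<open>At time \<open>k\<close> there are \<open>r\<close> steps left, so a walk that has not
  reached its goal must then still be in the ball of radius \<open>2 * r\<close>.\<close>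

lemma prob_not_reaches:
  assumes "gdist G v x \<le> 2 * r"
  shows "wexp (k + r) x (\<lambda>l. of_bool (\<not> reaches v r l)) \<le> (\<Sum>y\<in>gball v (2 * r). pn k x y)"
  using assms
proof (induction k arbitrary: x)
  case 0
  have "wexp (0 + r) x (\<lambda>l. of_bool (\<not> reaches v r l)) \<le> 1" by (rule wexp_le1) simp
  also have "1 = (\<Sum>y\<in>gball v (2 * r). of_bool (x = y) * (1::real))"
    unfolding sum_of_bool_eq[OF finite_gball] using 0 by (simp add: gball_def)
  finally show ?case by simp
next
  case (Suc k)
  have "wexp (Suc k + r) x (\<lambda>l. of_bool (\<not> reaches v r l)) = PP (\<lambda>y. wexp (k + r) y (\<lambda>l. of_bool (\<not> reaches v r (y # l)))) x"
    by simp
  also have "\<dots> \<le> PP (\<lambda>y. \<Sum>z\<in>gball v (2 * r). pn k y z) x"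
  proof (rule PP_mono)
    fix y
    show "wexp (k + r) y (\<lambda>l. of_bool (\<not> reaches v r (y # l))) \<le> (\<Sum>z\<in>gball v (2 * r). pn k y z)"
    proof (cases "2 * r \<le> gdist G v y")
      case True
      have "wexp (k + r) y (\<lambda>l. of_bool (\<not> reaches v r (y # l))) \<le> wexp (k + r) y (\<lambda>_. 0)"
        by (rule wexp_mono) (use True in auto)
      then show ?thesis using sum_nonneg[of "gball v (2 * r)" "pn k y"] pn_nonneg by (simp add: wexp_const)
    next
      case False
      have "wexp (k + r) y (\<lambda>l. of_bool (\<not> reaches v r (y # l))) \<le> wexp (k + r) y (\<lambda>l. of_bool (\<not> reaches v r l))"
        by (rule wexp_mono) auto
      also have "\<dots> \<le> (\<Sum>z\<in>gball v (2 * r). pn k y z)" using False by (intro Suc.IH) auto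
      finally show ?thesis .
    qed
  qed
  finally show ?case by (simp add: PP_sum)
qed

end

section \<open>The first moment in an annulus\<close>

context tgraph
begin

lemma wexp_visits_le: "finite K \<Longrightarrow> wexp n x (visits K S) \<le> PP (pot K (\<lambda>z. of_bool (z \<in> S))) x"
proof (induction n arbitrary: x)
  case 0
  then show ?case by (auto intro!: PP_nonneg pot_nonneg)
next
  case (Suc n)
  have "wexp (Suc n) x (visits K S) = PP (\<lambda>y. wexp n y (\<lambda>l. visits K S (y # l))) x" by simp
  also have "\<dots> \<le> PP (pot K (\<lambda>z. of_bool (z \<in> S))) x"
  proof (rule PP_mono)
    fix y
    show "wexp n y (\<lambda>l. visits K S (y # l)) \<le> pot K (\<lambda>z. of_bool (z \<in> S)) y"
      using Suc pot_eq[of K y "\<lambda>z. of_bool (z \<in> S)"] by (cases "y \<in> K") (simp_all add: wexp_add wexp_const pot_off)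
  qed
  finally show ?case .
qed

text \<open>By reversibility, leaving \<open>K\<close> at \<open>v\<close> from \<open>u\<close> is
  visiting \<open>u\<close> from \<open>v\<close> before leaving \<open>K\<close>, up to degrees.
  The sum over \<open>S\<close> becomes the expected number of visits to \<open>S\<close>.\<close>

lemma sum_hit_root_ge:
  assumes K: "finite K" and v: "v \<notin> K" and S: "S \<subseteq> K"
  shows "PP (pot K (\<lambda>z. of_bool (z \<in> S))) v / D \<le> (\<Sum>u\<in>S. HK K (\<lambda>t. of_bool (t = v)) u)"
proof -
  let ?f = "\<lambda>u. of_bool (u \<in> S) / dg u"
  have D: "D \<ge> 1" by (rule D_ge1)
  have "(\<Sum>u\<in>S. HK K (\<lambda>t. of_bool (t = v)) u) = (\<Sum>u\<in>K. of_bool (u \<in> S) * HK K (\<lambda>t. of_bool (t = v)) u)"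
    using S by (intro sum.mono_neutral_cong_left K) auto
  also have "\<dots> = (\<Sum>u\<in>K. dg u * ?f u * pot K (\<lambda>y. p y v) u)"
    using deg_pos by (intro sum.cong) (auto simp: HK_indicator_eq_pot[OF K _ v] less_imp_neq[symmetric])
  also have "\<dots> = (\<Sum>u\<in>K. dg u * p u v * pot K ?f u)" by (rule pot_sym[OF K])
  also have "\<dots> = dg v * (\<Sum>u\<in>K. p v u * pot K ?f u)"
    by (simp add: p_rev[of _ v] sum_distrib_left mult.assoc)
  also have "(\<Sum>u\<in>K. p v u * pot K ?f u) = (\<Sum>u\<in>K \<union> N v. p v u * pot K ?f u)"
    by (rule sum.mono_neutral_left) (auto simp: K pot_off)
  also have "\<dots> = PP (pot K ?f) v" by (rule PP_eq[symmetric]) (auto simp: K)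
  finally have eq: "(\<Sum>u\<in>S. HK K (\<lambda>t. of_bool (t = v)) u) = dg v * PP (pot K ?f) v" .
  have pm: "pot K (\<lambda>z. of_bool (z \<in> S)) x / D \<le> pot K ?f x" for x
  proof -
    have "pot K (\<lambda>z. of_bool (z \<in> S)) x / D = pot K (\<lambda>z. \<Sum>i\<in>{()}. (1 / D) * of_bool (z \<in> S)) x"
      by (subst pot_sum[OF K]) simp
    also have "\<dots> \<le> pot K ?f x"
    proof (rule pot_mono[OF K])
      fix x show "(\<Sum>i\<in>{()}. (1 / D) * of_bool (x \<in> S)) \<le> ?f x"
        using dg_le[of x] dg_ge1[of x] by (auto simp: divide_simps)
    qed
    finally show ?thesis .
  qed
  have "PP (pot K (\<lambda>z. of_bool (z \<in> S))) v / D = PP (\<lambda>x. (1 / D) * pot K (\<lambda>z. of_bool (z \<in> S)) x) v"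
    by (subst PP_cmult) simp
  also have "\<dots> \<le> PP (pot K ?f) v" using pm by (intro PP_mono) simp
  also have "\<dots> \<le> dg v * PP (pot K ?f) v"
    using dg_ge1[of v] PP_nonneg[of v "pot K ?f"] pot_nonneg[OF K, of ?f] by (simp add: mult_le_cancel_right1)
  finally show ?thesis using eq by simp
qed

text \<open>A walk avoiding \<open>v\<close> and \<open>A\<close> for \<open>n\<close> steps either
  has left \<open>K\<close> away from \<open>v\<close> before hitting \<open>A\<close>, or is in
  \<open>K\<close> at time \<open>n\<close>, which becomes unlikely.\<close>

lemma wexp_avoid_le:
  assumes K: "finite K"
  shows "wexp n x (\<lambda>l. of_bool ((insert x (set l)) \<inter> insert v A = {})) \<le>
    HK (K - A) (\<lambda>z. of_bool (z \<in> - (K \<union> A \<union> {v}))) x + (\<Sum>y\<in>K. pn n x y)"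
proof (induction n arbitrary: x)
  case 0
  have "(\<Sum>y\<in>K. pn 0 x y) = of_bool (x \<in> K)"
    using sum_of_bool_eq[OF K, of x "\<lambda>_. 1::real"] by simp
  moreover have "0 \<le> HK (K - A) (\<lambda>z. of_bool (z \<in> - (K \<union> A \<union> {v}))) x" by (rule HK_nonneg) (use K in auto)
  moreover have "HK (K - A) (\<lambda>z. of_bool (z \<in> - (K \<union> A \<union> {v}))) x = of_bool (x \<notin> A \<and> x \<noteq> v)" if "x \<notin> K"
    using that by (simp add: HK_off)
  ultimately show ?case by (cases "x \<in> K") auto
next
  case (Suc n)
  let ?h = "HK (K - A) (\<lambda>z. of_bool (z \<in> - (K \<union> A \<union> {v})))"
  have KA: "finite (K - A)" using K by auto
  have nn: "0 \<le> ?h x" by (rule HK_nonneg) (use K in auto)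
  have nn2: "0 \<le> (\<Sum>y\<in>K. pn (Suc n) x y)" by (intro sum_nonneg pn_nonneg)
  show ?case
  proof (cases "x \<in> insert v A")
    case True
    then have "wexp (Suc n) x (\<lambda>l. of_bool ((insert x (set l)) \<inter> insert v A = {})) = wexp (Suc n) x (\<lambda>l. 0)"
      by (intro arg_cong[where f = "wexp _ _"]) auto
    then show ?thesis using nn nn2 unfolding wexp_const by linarith
  next
    case x: False
    show ?thesis
    proof (cases "x \<in> K")
      case False
      then have "?h x = 1" using x by (simp add: HK_off)
      moreover have "wexp (Suc n) x (\<lambda>l. of_bool ((insert x (set l)) \<inter> insert v A = {})) \<le> 1" by (rule wexp_le1) simp
      ultimately show ?thesis using nn2 by linarith
    next
      case True
      have "wexp (Suc n) x (\<lambda>l. of_bool ((insert x (set l)) \<inter> insert v A = {})) \<le>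
         PP (\<lambda>y. wexp n y (\<lambda>l. of_bool ((insert y (set l)) \<inter> insert v A = {}))) x"
        unfolding wexp.simps by (intro PP_mono wexp_mono) auto
      also have "\<dots> \<le> PP (\<lambda>y. ?h y + (\<Sum>z\<in>K. pn n y z)) x" by (intro PP_mono Suc)
      also have "\<dots> = ?h x + (\<Sum>y\<in>K. pn (Suc n) x y)"
        using True x by (simp add: PP_add PP_sum HK_eq[OF KA, symmetric])
      finally show ?thesis .
    qed
  qed
qed

text \<open>In terms of the sandpile: the wave returns fewer than \<open>deg G v\<close> grains to
  \<open>v\<close>, so it is the last one.\<close>

definition miss :: "'a set \<Rightarrow> ('a \<Rightarrow> 'a) \<Rightarrow> 'a \<Rightarrow> bool" where
  "miss K F v \<longleftrightarrow> (\<exists>w\<in>N v. root K F w \<noteq> v)"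

text \<open>The walk started at \<open>w\<close> is first replaced with the forest path of
  \<open>w\<close>, which avoids the trace of the first walk even more easily. After exchanging the
  expectations, this path \<open>A\<close> is fixed and the walk from \<open>v\<close> has to avoid
  it; if it reaches far enough, it makes \<open>r\<close> visits to the annulus within
  \<open>K - A\<close>. Read backwards, these visits count the vertices with root \<open>v\<close>
  in the forest of \<open>K - A\<close>.\<close>

lemma first_moment_w:
  assumes K: "finite K" and v: "v \<notin> K" and w: "w \<in> K" and r: "r \<ge> 1"
    and B: "gball v (3 * r) \<subseteq> insert v K"
  defines "S \<equiv> annulus v r"
  shows "real r / D * wexp n v (\<lambda>l. of_bool (v \<notin> set l \<and> reaches v r l) * HK (K - set l) (\<lambda>z. of_bool (z \<in> - (K \<union> set l \<union> {v}))) w) \<le>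
    EF K (\<lambda>F. \<Sum>u\<in>S. of_bool (root K F u = v \<and> root K F w \<noteq> v))"
proof -
  have D: "D \<ge> 1" by (rule D_ge1)
  have S: "finite S" "S \<subseteq> K"
    using finite_gball[of v "3 * r"] B r by (auto simp: S_def annulus_def)
  let ?ok = "\<lambda>A l. of_bool (set l \<inter> insert v A = {} \<and> reaches v r l) :: real"
  have walk: "real r / D * wexp n v (?ok A) \<le> (\<Sum>u\<in>S - A. HK (K - A) (\<lambda>t. of_bool (t = v)) u)" for A
  proof -
    have KA: "finite (K - A)" "v \<notin> K - A" "S - A \<subseteq> K - A" using K v S by auto
    have "real r * wexp n v (?ok A) = wexp n v (\<lambda>l. real r * ?ok A l)" by (simp add: wexp_cmult)
    also have "\<dots> \<le> wexp n v (visits (K - A) (S - A))"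
    proof (rule wexp_mono)
      fix l assume l: "gpath v l"
      show "real r * ?ok A l \<le> visits (K - A) (S - A) l"
      proof (cases "set l \<inter> insert v A = {} \<and> reaches v r l")
        case True
        have "real r \<le> visits (K - A) S l"
          unfolding S_def by (rule visits_ge[OF l, where A = "insert v A"]) (use True r B in auto)
        also have "visits (K - A) S l = visits (K - A) (S - A) l"
          by (induction l) auto
        finally show ?thesis using True by simp
      next
        case False
        then show ?thesis using visits_nonneg by auto
      qed
    qed
    also have "\<dots> \<le> PP (pot (K - A) (\<lambda>z. of_bool (z \<in> S - A))) v" by (rule wexp_visits_le[OF KA(1)])
    finally have "real r / D * wexp n v (?ok A) \<le> PP (pot (K - A) (\<lambda>z. of_bool (z \<in> S - A))) v / D"
      using D by (simp add: divide_right_mono)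
    also have "\<dots> \<le> (\<Sum>u\<in>S - A. HK (K - A) (\<lambda>t. of_bool (t = v)) u)" by (rule sum_hit_root_ge[OF KA])
    finally show ?thesis .
  qed
  let ?C = "\<lambda>F. gam K F w"
  have "real r / D * wexp n v (\<lambda>l. of_bool (v \<notin> set l \<and> reaches v r l) * HK (K - set l) (\<lambda>z. of_bool (z \<in> - (K \<union> set l \<union> {v}))) w)
    \<le> real r / D * wexp n v (\<lambda>l. of_bool (v \<notin> set l \<and> reaches v r l) *
        EF K (\<lambda>F. of_bool (root K F w \<in> - (K \<union> set l \<union> {v}) \<and> ?C F \<inter> set l = {})))"
    using D by (intro mult_left_mono wexp_mono prob_path_avoids_ge K) auto
  also have "\<dots> \<le> real r / D * wexp n v (\<lambda>l. EF K (\<lambda>F. of_bool (root K F w \<noteq> v) * ?ok (?C F) l))"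
  proof (intro mult_left_mono wexp_mono)
    fix l
    have "of_bool (v \<notin> set l \<and> reaches v r l) * EF K (\<lambda>F. of_bool (root K F w \<in> - (K \<union> set l \<union> {v}) \<and> ?C F \<inter> set l = {})) =
      EF K (\<lambda>F. of_bool (v \<notin> set l \<and> reaches v r l) * of_bool (root K F w \<in> - (K \<union> set l \<union> {v}) \<and> ?C F \<inter> set l = {}))"
      by (rule EF_cmult[symmetric])
    also have "\<dots> \<le> EF K (\<lambda>F. of_bool (root K F w \<noteq> v) * ?ok (?C F) l)"
      by (rule EF_mono[OF K]) auto
    finally show "of_bool (v \<notin> set l \<and> reaches v r l) * EF K (\<lambda>F. of_bool (root K F w \<in> - (K \<union> set l \<union> {v}) \<and> ?C F \<inter> set l = {})) \<le> \<dots>" .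
  qed (use D in auto)
  also have "\<dots> = EF K (\<lambda>F. of_bool (root K F w \<noteq> v) * (real r / D * wexp n v (?ok (?C F))))"
  proof -
    have "wexp n v (\<lambda>l. EF K (\<lambda>F. h F l)) = EF K (\<lambda>F. wexp n v (h F))" for h
      unfolding EF_def by (simp add: wexp_sum wexp_cmult divide_inverse mult.commute[of _ "inverse _"])
    then show ?thesis by (simp add: wexp_cmult EF_cmult[symmetric] mult_ac)
  qed
  also have "\<dots> \<le> EF K (\<lambda>F. of_bool (root K F w \<noteq> v) * (\<Sum>u\<in>S - ?C F. HK (K - ?C F) (\<lambda>t. of_bool (t = v)) u))"
    by (intro EF_mono K mult_left_mono walk) auto
  also have "\<dots> \<le> EF K (\<lambda>F. EF (K - ?C F) (\<lambda>F'. \<Sum>u\<in>S. of_bool (root K (merge (?C F) F F') u = v \<and> root K (merge (?C F) F F') w \<noteq> v)))"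
  proof (rule EF_mono[OF K])
    fix F assume F: "F \<in> forests K"
    have L: "finite (K - ?C F)" using K by auto
    have wC: "w \<in> ?C F" using w by (auto simp: gam_def)
    have "of_bool (root K F w \<noteq> v) * (\<Sum>u\<in>S - ?C F. HK (K - ?C F) (\<lambda>t. of_bool (t = v)) u) =
      EF (K - ?C F) (\<lambda>F'. \<Sum>u\<in>S - ?C F. of_bool (root K F w \<noteq> v) * of_bool (root (K - ?C F) F' u = v))"
      by (simp add: EF_sum EF_cmult root_law1[OF L] sum_distrib_left)
    also have "\<dots> \<le> EF (K - ?C F) (\<lambda>F'. \<Sum>u\<in>S. of_bool (root K (merge (?C F) F F') u = v \<and> root K (merge (?C F) F F') w \<noteq> v))"
    proof (rule EF_mono[OF L])
      fix F' assume F': "F' \<in> forests (K - ?C F)"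
      note a = forestsD(1)[OF F] forestsD(1)[OF F']
      have "root (K - ?C F) F' w = w" by (rule root_off) (auto simp: wC)
      then have 1: "root K (merge (?C F) F F') w = root K F w" using root_merge(2)[OF a, of w] wC by simp
      have vC: "v \<notin> ?C F" using v by (auto simp: gam_def)
      have "(\<Sum>u\<in>S - ?C F. of_bool (root K F w \<noteq> v) * of_bool (root (K - ?C F) F' u = v) :: real) \<le>
        (\<Sum>u\<in>S - ?C F. of_bool (root K (merge (?C F) F F') u = v \<and> root K (merge (?C F) F F') w \<noteq> v))"
        using 1 root_merge(2)[OF a] vC by (intro sum_mono) auto
      also have "\<dots> \<le> (\<Sum>u\<in>S. of_bool (root K (merge (?C F) F F') u = v \<and> root K (merge (?C F) F F') w \<noteq> v))"
        using S by (intro sum_mono2) auto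
      finally show "(\<Sum>u\<in>S - ?C F. of_bool (root K F w \<noteq> v) * of_bool (root (K - ?C F) F' u = v) :: real) \<le> \<dots>" .
    qed
    finally show "of_bool (root K F w \<noteq> v) * (\<Sum>u\<in>S - ?C F. HK (K - ?C F) (\<lambda>t. of_bool (t = v)) u) \<le> \<dots>" .
  qed
  also have "\<dots> = EF K (\<lambda>F. \<Sum>u\<in>S. of_bool (root K F u = v \<and> root K F w \<noteq> v))"
    by (rule tower[OF K w, symmetric])
  finally show ?thesis .
qed

text \<open>Averaging over the neighbour \<open>w\<close> supplies the first step of the second
  walk. The errors, that the first walk fails to reach its goal within \<open>k + r\<close> steps or
  that the second one is in \<open>K\<close> after its steps, are multiples of \<open>nb\<close> and
  vanish for long walks; \<open>K\<close> is fixed meanwhile.\<close>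

lemma first_moment:
  assumes K: "finite K" and v: "v \<notin> K" and r: "r \<ge> 1" and B: "gball v (3 * r) \<subseteq> insert v K"
    and q: "\<And>n m. q \<le> wexp n v (\<lambda>l. wexp m v (\<lambda>l'. of_bool (v \<notin> set l \<and> v \<notin> set l' \<and> set l \<inter> set l' = {})))"
  shows "real r / D * q \<le> EF K (\<lambda>F. of_bool (miss K F v) * (\<Sum>u\<in>annulus v r. of_bool (root K F u = v)))"
    (is "_ \<le> ?M")
proof -
  have D: "D \<ge> 1" by (rule D_ge1)
  have NK: "w \<in> K" if "w \<in> N v" for w
  proof -
    have "gdist G v w \<le> 1" using gdist_le[of v w 1] that by (simp add: edge_rel_iff)
    then have "w \<in> gball v (3 * r)" using r by (auto simp: gball_def)
    moreover have "w \<noteq> v" using that no_loop by auto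
    ultimately show ?thesis using B by auto
  qed
  let ?hk = "\<lambda>l. HK (K - set l) (\<lambda>z. of_bool (z \<in> - (K \<union> set l \<union> {v})))"
  have main: "real r / D * (q - real (card (gball v (2 * r))) * nb k - real (card K) * nb m) \<le> ?M" for k m
  proof -
    let ?n = "k + r"
    have "q \<le> wexp ?n v (\<lambda>l. wexp (Suc m) v (\<lambda>l'. of_bool (v \<notin> set l \<and> v \<notin> set l' \<and> set l \<inter> set l' = {})))" by (rule q)
    also have "\<dots> \<le> wexp ?n v (\<lambda>l. of_bool (\<not> reaches v r l) + real (card K) * nb m
       + of_bool (v \<notin> set l \<and> reaches v r l) * PP (?hk l) v)"
    proof (rule wexp_mono)
      fix l
      show "wexp (Suc m) v (\<lambda>l'. of_bool (v \<notin> set l \<and> v \<notin> set l' \<and> set l \<inter> set l' = {})) \<le>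
        of_bool (\<not> reaches v r l) + real (card K) * nb m + of_bool (v \<notin> set l \<and> reaches v r l) * PP (?hk l) v"
      proof (cases "v \<notin> set l \<and> reaches v r l")
        case True
        have "wexp (Suc m) v (\<lambda>l'. of_bool (v \<notin> set l \<and> v \<notin> set l' \<and> set l \<inter> set l' = {})) \<le>
          PP (\<lambda>y. wexp m y (\<lambda>l'. of_bool ((insert y (set l')) \<inter> insert v (set l) = {}))) v"
          unfolding wexp.simps by (intro PP_mono wexp_mono) auto
        also have "\<dots> \<le> PP (\<lambda>y. ?hk l y + (\<Sum>z\<in>K. pn m y z)) v" by (intro PP_mono wexp_avoid_le K)
        also have "\<dots> \<le> PP (\<lambda>y. ?hk l y + real (card K) * nb m) v"
        proof (intro PP_mono add_left_mono)
          fix y show "(\<Sum>z\<in>K. pn m y z) \<le> real (card K) * nb m"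
            using sum_bounded_above[of K "pn m y" "nb m"] pn_le_nb by simp
        qed
        also have "\<dots> = PP (?hk l) v + real (card K) * nb m" by (simp add: PP_add PP_const)
        finally show ?thesis using True by simp
      next
        case False
        have "0 \<le> real (card K) * nb m" using nb_nonneg by simp
        show ?thesis
        proof (cases "v \<in> set l")
          case True
          then show ?thesis using \<open>0 \<le> real (card K) * nb m\<close> by (simp add: wexp_const PP_const)
        next
          case False2: False
          then have "\<not> reaches v r l" using False by auto
          moreover have "wexp (Suc m) v (\<lambda>l'. of_bool (v \<notin> set l \<and> v \<notin> set l' \<and> set l \<inter> set l' = {})) \<le> 1"
            by (rule wexp_le1) simp
          ultimately show ?thesis using \<open>0 \<le> real (card K) * nb m\<close> by simp
        qed
      qed
    qed
    also have "\<dots> \<le> (\<Sum>y\<in>gball v (2 * r). pn k v y) + real (card K) * nb m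
       + wexp ?n v (\<lambda>l. of_bool (v \<notin> set l \<and> reaches v r l) * PP (?hk l) v)"
      unfolding wexp_add wexp_const by (intro add_mono prob_not_reaches) auto
    also have "(\<Sum>y\<in>gball v (2 * r). pn k v y) \<le> real (card (gball v (2 * r))) * nb k"
      using sum_bounded_above[of "gball v (2 * r)" "pn k v" "nb k"] pn_le_nb by simp
    also have "wexp ?n v (\<lambda>l. of_bool (v \<notin> set l \<and> reaches v r l) * PP (?hk l) v) =
       PP (\<lambda>w. wexp ?n v (\<lambda>l. of_bool (v \<notin> set l \<and> reaches v r l) * ?hk l w)) v"
      unfolding PP_def by (simp add: wexp_sum[symmetric] wexp_cmult[symmetric] sum_distrib_left mult.left_commute)
    finally have "q - real (card (gball v (2 * r))) * nb k - real (card K) * nb m \<le>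
      PP (\<lambda>w. wexp ?n v (\<lambda>l. of_bool (v \<notin> set l \<and> reaches v r l) * ?hk l w)) v" by simp
    then have "real r / D * (q - real (card (gball v (2 * r))) * nb k - real (card K) * nb m) \<le>
      PP (\<lambda>w. real r / D * wexp ?n v (\<lambda>l. of_bool (v \<notin> set l \<and> reaches v r l) * ?hk l w)) v"
      unfolding PP_cmult using D by (intro mult_left_mono) auto
    also have "\<dots> \<le> PP (\<lambda>w. ?M) v"
    proof (rule PP_mono)
      fix w assume w: "w \<in> N v"
      have "real r / D * wexp ?n v (\<lambda>l. of_bool (v \<notin> set l \<and> reaches v r l) * ?hk l w) \<le>
        EF K (\<lambda>F. \<Sum>u\<in>annulus v r. of_bool (root K F u = v \<and> root K F w \<noteq> v))"
        by (rule first_moment_w[OF K v NK[OF w] r B])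
      also have "\<dots> \<le> ?M"
        unfolding sum_distrib_left by (intro EF_mono K sum_mono) (use w in \<open>auto simp: miss_def\<close>)
      finally show "real r / D * wexp ?n v (\<lambda>l. of_bool (v \<notin> set l \<and> reaches v r l) * ?hk l w) \<le> ?M" .
    qed
    finally show ?thesis by (simp add: PP_const)
  qed
  have "(\<lambda>k. real r / D * (q - real (card (gball v (2 * r))) * nb k - real (card K) * nb k)) \<longlonglongrightarrow>
      real r / D * (q - real (card (gball v (2 * r))) * 0 - real (card K) * 0)"
    by (intro tendsto_intros nb_tendsto)
  then show ?thesis using main by (intro LIMSEQ_le_const2[of _ "real r / D * q"]) auto
qed

end

section \<open>The second moment and lower bounds in finite volume\<close>

context bgraph
begin

text \<open>108 is 4 times the cube of 3, from \<open>sum_g_g\<close> at radius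
  \<open>3 * r\<close>; adding 1 makes the constant positive.\<close>

definition C2 :: real where "C2 = 108 * D ^ 3 * C ^ 3 + 1"

lemma C2_pos: "C2 > 0" using D_ge1 C_nonneg by (simp add: C2_def add_nonneg_pos)

text \<open>The paths of two vertices and their common path to \<open>v\<close> form a tripod. With
  all Green functions oriented away from \<open>v\<close>, the two legs beyond the branch point make
  up the square of a sum.\<close>

lemma second_moment:
  assumes K: "finite K" and v: "v \<notin> K" and S: "S \<subseteq> K" "S \<subseteq> gball v (3 * r)" and r: "r \<ge> 1"
  shows "EF K (\<lambda>F. (\<Sum>u\<in>S. of_bool (root K F u = v))\<^sup>2) \<le> C2 * (real r) ^ 3"
proof -
  have D: "D \<ge> 1" by (rule D_ge1)
  have fS: "finite S" using S K finite_subset by auto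
  have "EF K (\<lambda>F. (\<Sum>u\<in>S. of_bool (root K F u = v))\<^sup>2) =
    (\<Sum>u\<in>S. \<Sum>w\<in>S. EF K (\<lambda>F. of_bool (root K F u = v \<and> root K F w = v)))"
    by (simp add: power2_eq_square sum_product EF_sum of_bool_conj)
  also have "\<dots> \<le> (\<Sum>u\<in>S. \<Sum>w\<in>S. \<Sum>x\<in>insert v K. g w x * (g u x * g x v))"
    using S by (intro sum_mono prob_two_roots_le K v) auto
  also have "\<dots> \<le> (\<Sum>u\<in>S. \<Sum>w\<in>S. \<Sum>x\<in>insert v K. D ^ 3 * (g x w * (g x u * g v x)))"
  proof (intro sum_mono)
    fix u w x
    have "g w x * (g u x * g x v) \<le> (D * g x w) * ((D * g x u) * (D * g v x))"
      using D by (intro mult_mono g_rev_le) (auto intro!: mult_nonneg_nonneg g_nonneg)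
    then show "g w x * (g u x * g x v) \<le> D ^ 3 * (g x w * (g x u * g v x))"
      by (simp add: power3_eq_cube mult_ac)
  qed
  also have "\<dots> = D ^ 3 * (\<Sum>x\<in>insert v K. g v x * (\<Sum>u\<in>S. g x u)\<^sup>2)"
  proof -
    have "(\<Sum>u\<in>S. \<Sum>w\<in>S. \<Sum>x\<in>insert v K. D ^ 3 * (g x w * (g x u * g v x))) =
      (\<Sum>u\<in>S. \<Sum>x\<in>insert v K. \<Sum>w\<in>S. D ^ 3 * (g x w * (g x u * g v x)))"
      by (intro sum.cong refl sum.swap)
    also have "\<dots> = (\<Sum>x\<in>insert v K. \<Sum>u\<in>S. \<Sum>w\<in>S. D ^ 3 * (g x w * (g x u * g v x)))"
      by (rule sum.swap)
    also have "\<dots> = (\<Sum>x\<in>insert v K. D ^ 3 * (g v x * (\<Sum>u\<in>S. g x u)\<^sup>2))"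
    proof (rule sum.cong[OF refl])
      fix x
      have sq: "(\<Sum>u\<in>S. g x u)\<^sup>2 = (\<Sum>u\<in>S. \<Sum>w\<in>S. g x u * g x w)" by (simp add: power2_eq_square sum_product)
      show "(\<Sum>u\<in>S. \<Sum>w\<in>S. D ^ 3 * (g x w * (g x u * g v x))) = D ^ 3 * (g v x * (\<Sum>u\<in>S. g x u)\<^sup>2)"
        unfolding sq sum_distrib_left by (intro sum.cong refl) (simp only: mult_ac)
    qed
    finally show ?thesis by (simp only: sum_distrib_left)
  qed
  also have "\<dots> \<le> D ^ 3 * (4 * C ^ 3 * (real (3 * r)) ^ 3)"
    using K r D by (intro mult_left_mono sum_g_g fS S) auto
  also have "\<dots> = 108 * D ^ 3 * C ^ 3 * (real r) ^ 3" by (simp add: power_mult_distrib)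
  also have "\<dots> \<le> C2 * (real r) ^ 3" unfolding C2_def by (intro mult_right_mono) auto
  finally show ?thesis .
qed

text \<open>Take expectations in \<open>2 t x \<le> t\<^sup>2 x\<^sup>2 + 1\<close> with \<open>t = a / b\<close>.\<close>

lemma paley_zygmund:
  assumes K: "finite K" and a: "a \<le> EF K (\<lambda>F. of_bool (P F) * X F)" and a0: "0 \<le> a"
    and b: "EF K (\<lambda>F. (X F)\<^sup>2) \<le> b" and b0: "b > 0"
  shows "a\<^sup>2 / b \<le> EF K (\<lambda>F. of_bool (P F \<and> X F \<noteq> 0))"
proof -
  let ?t = "a / b" and ?p = "EF K (\<lambda>F. of_bool (P F \<and> X F \<noteq> 0))"
  have t: "0 \<le> ?t" using a0 b0 by simp
  have "2 * ?t * EF K (\<lambda>F. of_bool (P F) * X F) = EF K (\<lambda>F. 2 * ?t * (of_bool (P F) * X F))"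
    by (rule EF_cmult[symmetric])
  also have "\<dots> \<le> EF K (\<lambda>F. ?t\<^sup>2 * (X F)\<^sup>2 + of_bool (P F \<and> X F \<noteq> 0))"
  proof (rule EF_mono[OF K])
    fix F
    have "0 \<le> (?t * X F - 1)\<^sup>2" by simp
    then have "2 * ?t * X F \<le> ?t\<^sup>2 * (X F)\<^sup>2 + 1" by (simp add: power2_eq_square algebra_simps)
    moreover have "0 \<le> ?t\<^sup>2 * (X F)\<^sup>2" by simp
    ultimately show "2 * ?t * (of_bool (P F) * X F) \<le> ?t\<^sup>2 * (X F)\<^sup>2 + of_bool (P F \<and> X F \<noteq> 0)"
      by (cases "P F"; cases "X F = 0") auto
  qed
  also have "\<dots> = ?t\<^sup>2 * EF K (\<lambda>F. (X F)\<^sup>2) + ?p" by (simp add: EF_add EF_cmult)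
  also have "\<dots> \<le> ?t\<^sup>2 * b + ?p" using b by (intro add_right_mono mult_left_mono) auto
  finally have "2 * ?t * a - ?t\<^sup>2 * b \<le> ?p"
    using mult_left_mono[OF a, of "2 * ?t"] t by linarith
  moreover have "2 * ?t * a - ?t\<^sup>2 * b = a\<^sup>2 / b" using b0 by (simp add: power2_eq_square)
  ultimately show ?thesis by simp
qed

lemma arm_lower:
  assumes K: "finite K" and v: "v \<notin> K" and r: "r \<ge> 1" and B: "gball v (3 * r) \<subseteq> insert v K"
    and q: "\<And>n m. q \<le> wexp n v (\<lambda>l. wexp m v (\<lambda>l'. of_bool (v \<notin> set l \<and> v \<notin> set l' \<and> set l \<inter> set l' = {})))"
    and q0: "0 \<le> q"
  shows "1 / (D\<^sup>2 * C2) * q\<^sup>2 / real r \<le> EF K (\<lambda>F. of_bool (miss K F v \<and> arm K F v r))"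
proof -
  have D: "D \<ge> 1" by (rule D_ge1)
  let ?X = "\<lambda>F. \<Sum>u\<in>annulus v r. of_bool (root K F u = v) :: real"
  have S: "annulus v r \<subseteq> K" "annulus v r \<subseteq> gball v (3 * r)" using B r by (auto simp: annulus_def)
  have "1 / (D\<^sup>2 * C2) * q\<^sup>2 / real r = (real r / D * q)\<^sup>2 / (C2 * real r ^ 3)"
    using r by (simp add: power2_eq_square power3_eq_cube)
  also have "\<dots> \<le> EF K (\<lambda>F. of_bool (miss K F v \<and> ?X F \<noteq> 0))"
    using r D q0 C2_pos by (intro paley_zygmund[OF K first_moment[OF K v r B q] _ second_moment[OF K v S r]]) auto
  also have "\<dots> \<le> EF K (\<lambda>F. of_bool (miss K F v \<and> arm K F v r))"
  proof (rule EF_mono[OF K])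
    fix F
    have "arm K F v r" if X: "?X F \<noteq> 0"
    proof -
      obtain u where "u \<in> annulus v r" "root K F u = v"
      proof (rule ccontr)
        assume "\<not> thesis"
        then have "root K F u \<noteq> v" if "u \<in> annulus v r" for u using that \<open>\<And>u. u \<in> annulus v r \<Longrightarrow> root K F u = v \<Longrightarrow> thesis\<close> by blast
        then have "?X F = 0" by (intro sum.neutral) simp
        then show False using X by simp
      qed
      then show ?thesis using S by (auto simp: arm_def annulus_def)
    qed
    then show "of_bool (miss K F v \<and> ?X F \<noteq> 0) \<le> (of_bool (miss K F v \<and> arm K F v r) :: real)" by auto
  qed
  finally show ?thesis .
qed

text \<open>
  Components that reach distance \<open>r\<close> but have few vertices contribute little to the first moment,
  by the upper bound on the probability of reaching distance \<open>r\<close>.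
\<close>

lemma volume_lower:
  assumes K: "finite K" and v: "v \<notin> K" and r: "r \<ge> 1" and B: "gball v (3 * r) \<subseteq> insert v K"
    and q: "\<And>n m. q \<le> wexp n v (\<lambda>l. wexp m v (\<lambda>l'. of_bool (v \<notin> set l \<and> v \<notin> set l' \<and> set l \<inter> set l' = {})))"
    and q0: "0 \<le> q" and L: "EF K (\<lambda>F. of_bool (arm K F v r)) \<le> \<Lambda> / real r" "\<Lambda> > 0"
    and s: "0 \<le> s" "s \<le> (real r)\<^sup>2 * q / (2 * D * \<Lambda>)"
  shows "1 / (4 * D\<^sup>2 * C2) * q\<^sup>2 / real r \<le> EF K (\<lambda>F. of_bool (miss K F v \<and> s < real (card {u \<in> K. root K F u = v})))"
proof -
  have D: "D \<ge> 1" by (rule D_ge1)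
  let ?X = "\<lambda>F. \<Sum>u\<in>annulus v r. of_bool (root K F u = v) :: real"
  let ?Y = "\<lambda>F. ?X F * of_bool (s < ?X F)"
  have S: "annulus v r \<subseteq> K" "annulus v r \<subseteq> gball v (3 * r)" using B r by (auto simp: annulus_def)
  have fS: "finite (annulus v r)" using S K finite_subset by auto
  have X0: "0 \<le> ?X F" for F by (intro sum_nonneg) auto
  have arm: "arm K F v r" if X: "?X F \<noteq> 0" for F
  proof -
    obtain u where "u \<in> annulus v r" "root K F u = v"
    proof (rule ccontr)
      assume "\<not> thesis"
      then have "root K F u \<noteq> v" if "u \<in> annulus v r" for u using that \<open>\<And>u. u \<in> annulus v r \<Longrightarrow> root K F u = v \<Longrightarrow> thesis\<close> by blast
      then have "?X F = 0" by (intro sum.neutral) simp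
      then show False using X by simp
    qed
    then show ?thesis using S by (auto simp: arm_def annulus_def)
  qed
  have "real r / D * q \<le> EF K (\<lambda>F. of_bool (miss K F v) * ?X F)" by (rule first_moment[OF K v r B q])
  also have "\<dots> \<le> EF K (\<lambda>F. of_bool (miss K F v) * ?Y F + s * of_bool (arm K F v r))"
  proof (rule EF_mono[OF K])
    fix F
    show "of_bool (miss K F v) * ?X F \<le> of_bool (miss K F v) * ?Y F + s * of_bool (arm K F v r)"
      using arm[of F] X0[of F] s by (cases "miss K F v"; cases "s < ?X F"; cases "?X F = 0") auto
  qed
  also have "\<dots> \<le> EF K (\<lambda>F. of_bool (miss K F v) * ?Y F) + s * (\<Lambda> / real r)"
    unfolding EF_add EF_cmult using L s by (intro add_left_mono mult_left_mono) auto
  \<comment> \<open>The largest admissible \<open>s\<close> discards exactly half of the first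
    moment.\<close>
  also have "s * (\<Lambda> / real r) \<le> ((real r)\<^sup>2 * q / (2 * D * \<Lambda>)) * (\<Lambda> / real r)"
    using s L r by (intro mult_right_mono) auto
  also have "\<dots> = real r * q / (2 * D)" using L r by (simp add: power2_eq_square)
  finally have fm: "real r * q / (2 * D) \<le> EF K (\<lambda>F. of_bool (miss K F v) * ?Y F)"
    by (simp add: field_simps)
  have "EF K (\<lambda>F. (?Y F)\<^sup>2) \<le> EF K (\<lambda>F. (?X F)\<^sup>2)" by (rule EF_mono[OF K]) (auto simp: power_mult_distrib)
  also have "\<dots> \<le> C2 * real r ^ 3" by (rule second_moment[OF K v S r])
  finally have sm: "EF K (\<lambda>F. (?Y F)\<^sup>2) \<le> C2 * real r ^ 3" .
  have "1 / (4 * D\<^sup>2 * C2) * q\<^sup>2 / real r = (real r * q / (2 * D))\<^sup>2 / (C2 * real r ^ 3)"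
    using r by (simp add: power2_eq_square power3_eq_cube)
  also have "\<dots> \<le> EF K (\<lambda>F. of_bool (miss K F v \<and> ?Y F \<noteq> 0))"
    using r D q0 C2_pos by (intro paley_zygmund[OF K fm _ sm]) auto
  also have "\<dots> \<le> EF K (\<lambda>F. of_bool (miss K F v \<and> s < real (card {u \<in> K. root K F u = v})))"
  proof (rule EF_mono[OF K])
    fix F
    have "?X F = real (card {u \<in> annulus v r. root K F u = v})"
      using fS by (simp add: of_bool_def sum.If_cases Int_def)
    also have "\<dots> \<le> real (card {u \<in> K. root K F u = v})"
      using S K by (intro of_nat_mono card_mono) auto
    finally show "of_bool (miss K F v \<and> ?Y F \<noteq> 0) \<le> (of_bool (miss K F v \<and> s < real (card {u \<in> K. root K F u = v})) :: real)"
      by auto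
  qed
  finally show ?thesis .
qed

end

section \<open>Burning\<close>

text \<open>
  \<open>burnt m d K B \<xi>\<close> is the set of vertices of \<open>K\<close> that burn when the fire starts at \<open>B\<close>. It is the
  least set that is closed under burning.
\<close>

definition closed_burn :: "('a \<Rightarrow> 'a \<Rightarrow> nat) \<Rightarrow> ('a \<Rightarrow> nat) \<Rightarrow> 'a set \<Rightarrow> 'a set \<Rightarrow> ('a \<Rightarrow> nat) \<Rightarrow> 'a set \<Rightarrow> bool" where
  "closed_burn m d K B \<xi> A \<longleftrightarrow> A \<subseteq> K \<and> (\<forall>x\<in>K - A. \<xi> x + (\<Sum>y\<in>B \<union> A. m x y) < d x)"

definition burnt :: "('a \<Rightarrow> 'a \<Rightarrow> nat) \<Rightarrow> ('a \<Rightarrow> nat) \<Rightarrow> 'a set \<Rightarrow> 'a set \<Rightarrow> ('a \<Rightarrow> nat) \<Rightarrow> 'a set" where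
  "burnt m d K B \<xi> = \<Inter>{A. closed_burn m d K B \<xi> A}"

lemma closed_burn_K: "closed_burn m d K B \<xi> K" by (simp add: closed_burn_def)

lemma burnt_sub: "burnt m d K B \<xi> \<subseteq> K" unfolding burnt_def using closed_burn_K by (intro Inter_lower) simp

lemma burnt_least: "closed_burn m d K B \<xi> A \<Longrightarrow> burnt m d K B \<xi> \<subseteq> A" by (auto simp: burnt_def)

lemma closed_burnt:
  assumes "finite K" "finite B" shows "closed_burn m d K B \<xi> (burnt m d K B \<xi>)"
  unfolding closed_burn_def
proof (intro conjI burnt_sub ballI)
  fix x assume "x \<in> K - burnt m d K B \<xi>"
  then obtain A where A: "closed_burn m d K B \<xi> A" "x \<in> K - A" by (auto simp: burnt_def)
  have "finite A" using A assms finite_subset by (auto simp: closed_burn_def)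
  then have "(\<Sum>y\<in>B \<union> burnt m d K B \<xi>. m x y) \<le> (\<Sum>y\<in>B \<union> A. m x y)"
    using burnt_least[OF A(1)] assms by (intro sum_mono2) auto
  moreover have "\<xi> x + (\<Sum>y\<in>B \<union> A. m x y) < d x" using A by (auto simp: closed_burn_def)
  ultimately show "\<xi> x + (\<Sum>y\<in>B \<union> burnt m d K B \<xi>. m x y) < d x" by linarith
qed

lemma burnt_eq_iff:
  assumes "finite K" "finite B"
  shows "burnt m d K B \<xi> = A \<longleftrightarrow> closed_burn m d K B \<xi> A \<and> (\<forall>A'. closed_burn m d K B \<xi> A' \<longrightarrow> A \<subseteq> A')"
  using closed_burnt[OF assms] burnt_least by blast

lemma burnt_cong:
  assumes "\<And>A. closed_burn m d K B \<xi> A \<longleftrightarrow> closed_burn m' d' K B' \<xi>' A"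
  shows "burnt m d K B \<xi> = burnt m' d' K B' \<xi>'"
  by (simp add: burnt_def assms)

text \<open>A vertex that catches fire from \<open>B\<close> alone may be counted among the sources;
  its own height then ceases to matter.\<close>

lemma burnt_first:
  assumes K: "finite K" "finite B" "B \<inter> K = {}" and x: "x \<in> K" and b: "d x \<le> \<xi> x + (\<Sum>y\<in>B. m x y)"
    and \<xi>': "\<And>y. y \<in> K - {x} \<Longrightarrow> \<xi>' y = \<xi> y"
  shows "burnt m d K B \<xi> = insert x (burnt m d (K - {x}) (insert x B) \<xi>')"
proof -
  have cl: "closed_burn m d K B \<xi> A \<longleftrightarrow> x \<in> A \<and> closed_burn m d (K - {x}) (insert x B) \<xi>' (A - {x})" for A
  proof
    assume c: "closed_burn m d K B \<xi> A"
    then have fA: "finite A" using K finite_subset by (auto simp: closed_burn_def)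
    have xA: "x \<in> A"
    proof (rule ccontr)
      assume "x \<notin> A"
      then have "\<xi> x + (\<Sum>y\<in>B \<union> A. m x y) < d x" using c x by (auto simp: closed_burn_def)
      moreover have "(\<Sum>y\<in>B. m x y) \<le> (\<Sum>y\<in>B \<union> A. m x y)" using K fA by (intro sum_mono2) auto
      ultimately show False using b by linarith
    qed
    moreover have "insert x B \<union> (A - {x}) = B \<union> A" using xA by auto
    ultimately show "x \<in> A \<and> closed_burn m d (K - {x}) (insert x B) \<xi>' (A - {x})"
      using c \<xi>' by (auto simp: closed_burn_def)
  next
    assume c: "x \<in> A \<and> closed_burn m d (K - {x}) (insert x B) \<xi>' (A - {x})"
    then have "insert x B \<union> (A - {x}) = B \<union> A" by auto
    moreover have "K - {x} - (A - {x}) = K - A" using c by auto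
    ultimately show "closed_burn m d K B \<xi> A"
      using c \<xi>' x unfolding closed_burn_def by (smt (verit) Diff_iff insert_Diff_single insert_absorb insert_subset singletonD subset_insert_iff)
  qed
  have fin: "finite (K - {x})" "finite (insert x B)" using K by auto
  let ?b = "burnt m d (K - {x}) (insert x B) \<xi>'"
  have xb: "x \<notin> ?b" using burnt_sub[of m d "K - {x}" "insert x B" \<xi>'] by auto
  show ?thesis
    unfolding burnt_eq_iff[OF K(1,2)] cl
    using closed_burnt[OF fin, of m d \<xi>'] burnt_least[of m d "K - {x}" "insert x B" \<xi>'] xb by auto
qed

section \<open>Counting by deletion and contraction\<close>

text \<open>Multiplicities form an arbitrary matrix, and its row sums serve as degrees, so that a
  single edge can be deleted. This destroys the symmetry of the matrix, which is harmless because
  only rows of vertices in \<open>K\<close> enter.\<close>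

definition confs :: "('a \<Rightarrow> 'a \<Rightarrow> nat) \<Rightarrow> 'a set \<Rightarrow> 'a set \<Rightarrow> 'a set \<Rightarrow> 'a set \<Rightarrow> ('a \<Rightarrow> nat) set" where
  "confs m U K B A = {\<xi>. (\<forall>x. x \<notin> K \<longrightarrow> \<xi> x = 0) \<and> (\<forall>x\<in>K. \<xi> x < (\<Sum>y\<in>U. m x y)) \<and>
     burnt m (\<lambda>x. \<Sum>y\<in>U. m x y) K (U - K) \<xi> = K \<and> burnt m (\<lambda>x. \<Sum>y\<in>U. m x y) K B \<xi> = A}"

definition fsum :: "('a \<Rightarrow> 'a \<Rightarrow> nat) \<Rightarrow> 'a set \<Rightarrow> 'a set \<Rightarrow> 'a set \<Rightarrow> 'a set \<Rightarrow> nat" where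
  "fsum m U K B A = (\<Sum>F\<in>{F \<in> PiE K (\<lambda>_. U). acyc K F \<and> {x \<in> K. root K F x \<in> B} = A}. \<Prod>x\<in>K. m x (F x))"

lemma finite_confs: "finite K \<Longrightarrow> finite (confs m U K B A)"
proof -
  assume K: "finite K"
  have "confs m U K B A \<subseteq> {\<xi>. \<forall>x. (x \<in> K \<longrightarrow> \<xi> x \<in> {..<Max ((\<lambda>x. \<Sum>y\<in>U. m x y) ` K)}) \<and> (x \<notin> K \<longrightarrow> \<xi> x = 0)}"
    using K by (auto simp: confs_def intro: order_less_le_trans Max_ge)
  moreover have "finite \<dots>" by (rule finite_set_of_finite_funs) (use K in auto)
  ultimately show ?thesis by (rule finite_subset)
qed

text \<open>At maximal height a single edge to a source is enough for \<open>x\<close> to burn at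
  once, in the fire from \<open>B\<close> as well as in that from the whole complement. Its height
  being prescribed, \<open>x\<close> becomes another source: contraction of the edge.\<close>

lemma card_confs_contract:
  assumes U: "finite U" "K \<subseteq> U" "B \<subseteq> U - K" and x: "x \<in> K" and b: "b \<in> B" "0 < m x b"
  shows "card {\<xi> \<in> confs m U K B A. \<xi> x = (\<Sum>y\<in>U. m x y) - 1} =
    (if x \<in> A then card (confs m U (K - {x}) (insert x B) (A - {x})) else 0)"
proof -
  let ?d = "\<lambda>x. \<Sum>y\<in>U. m x y"
  have K: "finite K" "finite B" using U finite_subset[OF U(2,1)] finite_subset[of B U] by auto
  have mb: "m x b \<le> (\<Sum>y\<in>B. m x y)" using member_le_sum[OF b(1), of "m x"] K by auto
  have mU: "(\<Sum>y\<in>B. m x y) \<le> (\<Sum>y\<in>U - K. m x y)" "(\<Sum>y\<in>U - K. m x y) \<le> ?d x"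
    using U by (auto intro!: sum_mono2)
  have dx: "?d x \<ge> 1" using mb mU b by linarith
  have bi: "burnt m ?d K B' \<xi> = insert x (burnt m ?d (K - {x}) (insert x B') (\<xi>(x := 0)))"
    if "\<xi> x = ?d x - 1" "B' = B \<or> B' = U - K" for \<xi> B'
  proof (rule burnt_first)
    show "?d x \<le> \<xi> x + (\<Sum>y\<in>B'. m x y)" using that mb mU b dx by auto
  qed (use that K U x in auto)
  have UK: "insert x (U - K) = U - (K - {x})" using U x by auto
  have nx: "x \<notin> burnt m ?d (K - {x}) B' \<xi>" for B' \<xi> using burnt_sub[of m ?d "K - {x}"] by auto
  show ?thesis
  proof (cases "x \<in> A")
    case True
    have "bij_betw (\<lambda>\<xi>. \<xi>(x := 0)) {\<xi> \<in> confs m U K B A. \<xi> x = ?d x - 1} (confs m U (K - {x}) (insert x B) (A - {x}))"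
    proof (rule bij_betw_byWitness[where f' = "\<lambda>\<xi>. \<xi>(x := ?d x - 1)"])
      show "\<forall>\<xi>\<in>{\<xi> \<in> confs m U K B A. \<xi> x = ?d x - 1}. (\<xi>(x := 0))(x := ?d x - 1) = \<xi>" by (auto simp: fun_eq_iff)
      show "\<forall>\<xi>\<in>confs m U (K - {x}) (insert x B) (A - {x}). (\<xi>(x := ?d x - 1))(x := 0) = \<xi>" by (auto simp: confs_def fun_eq_iff)
      show "(\<lambda>\<xi>. \<xi>(x := 0)) ` {\<xi> \<in> confs m U K B A. \<xi> x = ?d x - 1} \<subseteq> confs m U (K - {x}) (insert x B) (A - {x})"
      proof
        fix \<zeta> assume "\<zeta> \<in> (\<lambda>\<xi>. \<xi>(x := 0)) ` {\<xi> \<in> confs m U K B A. \<xi> x = ?d x - 1}"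
        then obtain \<xi> where \<xi>: "\<zeta> = \<xi>(x := 0)" "\<xi> \<in> confs m U K B A" "\<xi> x = ?d x - 1" by auto
        have "insert x (burnt m ?d (K - {x}) (insert x B) \<zeta>) = A" "insert x (burnt m ?d (K - {x}) (insert x (U - K)) \<zeta>) = K"
          using bi[of \<xi> B] bi[of \<xi> "U - K"] \<xi> by (auto simp: confs_def)
        then have "burnt m ?d (K - {x}) (insert x B) \<zeta> = A - {x}" "burnt m ?d (K - {x}) (insert x (U - K)) \<zeta> = K - {x}"
          using nx by (metis Diff_insert_absorb)+
        then show "\<zeta> \<in> confs m U (K - {x}) (insert x B) (A - {x})" using \<xi> UK by (auto simp: confs_def)
      qed
      show "(\<lambda>\<xi>. \<xi>(x := ?d x - 1)) ` confs m U (K - {x}) (insert x B) (A - {x}) \<subseteq> {\<xi> \<in> confs m U K B A. \<xi> x = ?d x - 1}"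
      proof
        fix \<xi> assume "\<xi> \<in> (\<lambda>\<xi>. \<xi>(x := ?d x - 1)) ` confs m U (K - {x}) (insert x B) (A - {x})"
        then obtain \<zeta> where \<zeta>: "\<xi> = \<zeta>(x := ?d x - 1)" "\<zeta> \<in> confs m U (K - {x}) (insert x B) (A - {x})" by auto
        have "\<xi>(x := 0) = \<zeta>" "\<xi> x = ?d x - 1" using \<zeta> by (auto simp: confs_def fun_eq_iff)
        then have "burnt m ?d K B \<xi> = insert x (A - {x})" "burnt m ?d K (U - K) \<xi> = insert x (K - {x})"
          using bi[of \<xi> B] bi[of \<xi> "U - K"] \<zeta> UK by (auto simp: confs_def)
        then show "\<xi> \<in> {\<xi> \<in> confs m U K B A. \<xi> x = ?d x - 1}"
          using \<zeta> x True dx by (auto simp: confs_def insert_absorb)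
      qed
    qed
    then show ?thesis using True by (simp add: bij_betw_same_card)
  next
    case False
    have e: "{\<xi> \<in> confs m U K B A. \<xi> x = ?d x - 1} = {}"
      using bi[of _ B] False by (auto simp: confs_def)
    show ?thesis unfolding e using False by simp
  qed
qed

definition del_edge :: "('a \<Rightarrow> 'a \<Rightarrow> nat) \<Rightarrow> 'a \<Rightarrow> 'a \<Rightarrow> ('a \<Rightarrow> 'a \<Rightarrow> nat)" where
  "del_edge m x b = m(x := (m x)(b := m x b - 1))"

lemma sum_del_edge:
  assumes "finite S" "0 < m x b"
  shows "(\<Sum>y\<in>S. m z y) = (\<Sum>y\<in>S. del_edge m x b z y) + of_bool (z = x \<and> b \<in> S)"
proof (cases "z = x \<and> b \<in> S")
  case True
  then show ?thesis using assms by (simp add: del_edge_def sum.remove[of S b])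
next
  case False
  then have "(\<Sum>y\<in>S. m z y) = (\<Sum>y\<in>S. del_edge m x b z y)"
    by (intro sum.cong) (auto simp: del_edge_def)
  then show ?thesis using False by (simp only: of_bool_def if_False)
qed

text \<open>The edge from \<open>x\<close> to \<open>b\<close> is burnt from the start in both
  fires; deleting it lowers the degree and the burning sum of \<open>x\<close> by one each. The
  submaximal heights are the stable ones for the reduced degree.\<close>

lemma confs_delete:
  assumes U: "finite U" "K \<subseteq> U" "B \<subseteq> U - K" and x: "x \<in> K" and b: "b \<in> B" "0 < m x b"
  shows "{\<xi> \<in> confs m U K B A. \<xi> x \<noteq> (\<Sum>y\<in>U. m x y) - 1} = confs (del_edge m x b) U K B A"
proof -
  let ?m = "del_edge m x b"
  let ?d = "\<lambda>x. \<Sum>y\<in>U. m x y" and ?d' = "\<lambda>x. \<Sum>y\<in>U. ?m x y"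
  have bU: "b \<in> U" using b U by auto
  have d: "?d z = ?d' z + of_bool (z = x)" for z using sum_del_edge[where m = m and x = x and b = b, OF U(1) b(2), of z] bU by simp
  have cl: "closed_burn m ?d K B' \<xi> A' \<longleftrightarrow> closed_burn ?m ?d' K B' \<xi> A'" if "B' = B \<or> B' = U - K" for B' \<xi> A'
  proof -
    have "\<xi> z + (\<Sum>y\<in>B' \<union> A'. m z y) < ?d z \<longleftrightarrow> \<xi> z + (\<Sum>y\<in>B' \<union> A'. ?m z y) < ?d' z" if "A' \<subseteq> K" for z
    proof -
      have "finite (B' \<union> A')" "b \<in> B' \<union> A'" using that U b \<open>B' = B \<or> B' = U - K\<close> by (auto intro: finite_subset)
      then show ?thesis using sum_del_edge[of "B' \<union> A'" m x b z] d[of z] b by simp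
    qed
    then show ?thesis by (auto simp: closed_burn_def)
  qed
  have bu: "burnt m ?d K B' \<xi> = burnt ?m ?d' K B' \<xi>" if "B' = B \<or> B' = U - K" for B' \<xi>
    by (rule burnt_cong) (rule cl[OF that])
  have st: "(\<forall>z\<in>K. \<xi> z < ?d z) \<and> \<xi> x \<noteq> ?d x - 1 \<longleftrightarrow> (\<forall>z\<in>K. \<xi> z < ?d' z)" for \<xi>
  proof -
    have "\<xi> z < ?d z \<and> (z = x \<longrightarrow> \<xi> x \<noteq> ?d x - 1) \<longleftrightarrow> \<xi> z < ?d' z" for z using d[of z] by auto
    then show ?thesis using x by blast
  qed
  show ?thesis
    unfolding confs_def mem_Collect_eq bu[OF disjI1[OF refl]] bu[OF disjI2[OF refl]]
    by (rule Collect_cong) (use st in metis)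
qed

text \<open>One of the parallel edges from \<open>x\<close> to \<open>b\<close> is singled out. A
  forest using it sends \<open>x\<close> to a root in \<open>B\<close>, and forgetting it leaves a
  forest of \<open>K - {x}\<close> in which \<open>x\<close> is such a root.\<close>

lemma fsum_edge:
  assumes U: "finite U" "K \<subseteq> U" "B \<subseteq> U - K" and x: "x \<in> K" and b: "b \<in> B" "0 < m x b"
  shows "fsum m U K B A = fsum (del_edge m x b) U K B A + (if x \<in> A then fsum m U (K - {x}) (insert x B) (A - {x}) else 0)"
proof -
  let ?m = "del_edge m x b"
  let ?\<F> = "{F \<in> PiE K (\<lambda>_. U). acyc K F \<and> {y \<in> K. root K F y \<in> B} = A}"
  have K: "finite K" using U finite_subset by auto
  have fin: "finite ?\<F>" using K U by (auto intro!: finite_PiE)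
  have bK: "b \<notin> K" using b U by auto
  have pr: "(\<Prod>y\<in>K. m y (F y)) = (\<Prod>y\<in>K. ?m y (F y)) + of_bool (F x = b) * (\<Prod>y\<in>K - {x}. m y (F y))" for F
  proof -
    have "(\<Prod>y\<in>K - {x}. ?m y (F y)) = (\<Prod>y\<in>K - {x}. m y (F y))"
      by (rule prod.cong) (auto simp: del_edge_def)
    moreover have "m x (F x) = ?m x (F x) + of_bool (F x = b)" using b by (simp add: del_edge_def)
    ultimately show ?thesis by (simp add: prod.remove[OF K x] distrib_right)
  qed
  have "fsum m U K B A = (\<Sum>F\<in>?\<F>. (\<Prod>y\<in>K. ?m y (F y)) + of_bool (F x = b) * (\<Prod>y\<in>K - {x}. m y (F y)))"
    unfolding fsum_def by (simp only: pr)
  also have "\<dots> = fsum ?m U K B A + (\<Sum>F\<in>?\<F>. of_bool (F x = b) * (\<Prod>y\<in>K - {x}. m y (F y)))"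
    unfolding fsum_def sum.distrib ..
  also have "(\<Sum>F\<in>?\<F>. of_bool (F x = b) * (\<Prod>y\<in>K - {x}. m y (F y))) = (\<Sum>F\<in>{F \<in> ?\<F>. F x = b}. \<Prod>y\<in>K - {x}. m y (F y))"
    by (rule sum.mono_neutral_cong_right) (use fin in auto)
  also have "\<dots> = (if x \<in> A then fsum m U (K - {x}) (insert x B) (A - {x}) else 0)"
  proof -
    have props: "acyc K F \<longleftrightarrow> acyc (K - {x}) F" "acyc K F \<Longrightarrow> root K F x = b"
      "acyc K F \<Longrightarrow> y \<in> K - {x} \<Longrightarrow> root K F y \<in> B \<longleftrightarrow> root (K - {x}) F y \<in> insert x B" if "F x = b" for F y
    proof -
      have lb: "leads L F b t \<Longrightarrow> t = b" if "L \<subseteq> K" for L t using leads_off[of b t L F] bK that by auto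
      show ac: "acyc K F \<longleftrightarrow> acyc (K - {x}) F"
        using acyc_iff_minus[OF x, of F] lb[of "K - {x}" x] bK x that by auto
      have xb: "leads K F x b" using leads_step[OF x, of F b] that by auto
      then show "root K F x = b" using bK by (rule root_eqI)
      assume a: "acyc K F" and y: "y \<in> K - {x}"
      let ?r = "root (K - {x}) F y"
      have r: "?r \<notin> K - {x}" "leads (K - {x}) F y ?r" using acyc_root[of "K - {x}" F y] ac a by auto
      then have yr: "leads K F y ?r" using leads_mono[of y ?r "K - {x}" F K] by auto
      show "root K F y \<in> B \<longleftrightarrow> ?r \<in> insert x B"
      proof (cases "?r = x")
        case True
        then have "root K F y = b" using yr xb bK by (intro root_eqI) auto
        then show ?thesis using True b by simp
      next
        case False
        then have "root K F y = ?r" using yr r by (intro root_eqI) auto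
        then show ?thesis using False by simp
      qed
    qed
    show ?thesis
    proof (cases "x \<in> A")
      case True
      have "(\<Sum>F\<in>{F \<in> ?\<F>. F x = b}. \<Prod>y\<in>K - {x}. m y (F y)) = fsum m U (K - {x}) (insert x B) (A - {x})"
        unfolding fsum_def
      proof (rule sum.reindex_bij_witness[where i = "\<lambda>F. F(x := b)" and j = "\<lambda>F. F(x := undefined)"])
        fix F assume F: "F \<in> {F \<in> ?\<F>. F x = b}"
        then show "(F(x := undefined))(x := b) = F" by auto
        have fr: "frel (K - {x}) (F(x := undefined)) = frel (K - {x}) F" by (rule frel_cong) auto
        have "{y \<in> K - {x}. root (K - {x}) F y \<in> insert x B} = A - {x}" using F props[of F] by auto
        then show "F(x := undefined) \<in> {F \<in> PiE (K - {x}) (\<lambda>_. U). acyc (K - {x}) F \<and> {y \<in> K - {x}. root (K - {x}) F y \<in> insert x B} = A - {x}}"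
          using F props(1)[of F] fr by (auto simp: acyc_def root_def PiE_def Pi_def extensional_def)
        show "(\<Prod>y\<in>K - {x}. m y ((F(x := undefined)) y)) = (\<Prod>y\<in>K - {x}. m y (F y))" by (rule prod.cong) auto
      next
        fix F assume F: "F \<in> {F \<in> PiE (K - {x}) (\<lambda>_. U). acyc (K - {x}) F \<and> {y \<in> K - {x}. root (K - {x}) F y \<in> insert x B} = A - {x}}"
        then show "(F(x := b))(x := undefined) = F" by (auto simp: fun_eq_iff PiE_def extensional_def)
        let ?F = "F(x := b)"
        have fr: "frel (K - {x}) ?F = frel (K - {x}) F" by (rule frel_cong) auto
        then have e: "acyc (K - {x}) ?F" "root (K - {x}) ?F = root (K - {x}) F" using F by (auto simp: acyc_def root_def fun_eq_iff)
        then have a: "acyc K ?F" using props(1)[of ?F] by auto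
        have "{y \<in> K. root K ?F y \<in> B} = A"
        proof -
          have "y \<in> K \<and> root K ?F y \<in> B \<longleftrightarrow> y \<in> A" for y
          proof (cases "y = x")
            case True
            then show ?thesis using props(2)[of ?F] a x b \<open>x \<in> A\<close> by simp
          next
            case False
            then show ?thesis using props(3)[of ?F y] a F e by auto
          qed
          then show ?thesis by auto
        qed
        then show "?F \<in> {F \<in> ?\<F>. F x = b}"
          using F a b U x by (auto simp: PiE_def Pi_def extensional_def)
      qed
      then show ?thesis using True by simp
    next
      case False
      have e: "{F \<in> ?\<F>. F x = b} = {}" using props(2) x b False by auto
      show ?thesis unfolding e using False by simp
    qed
  qed
  finally show ?thesis .
qed

lemma card_confs_step:
  assumes U: "finite U" "K \<subseteq> U" "B \<subseteq> U - K" and x: "x \<in> K" and b: "b \<in> B" "0 < m x b"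
    and 1: "card (confs m U (K - {x}) (insert x B) (A - {x})) = fsum m U (K - {x}) (insert x B) (A - {x})"
    and 2: "card (confs (del_edge m x b) U K B A) = fsum (del_edge m x b) U K B A"
  shows "card (confs m U K B A) = fsum m U K B A"
proof -
  let ?P = "\<lambda>\<xi>. \<xi> x = (\<Sum>y\<in>U. m x y) - 1"
  have K: "finite K" using U finite_subset by auto
  have "card (confs m U K B A) = card {\<xi> \<in> confs m U K B A. ?P \<xi>} + card {\<xi> \<in> confs m U K B A. \<not> ?P \<xi>}"
    by (subst card_Un_disjoint[symmetric]) (auto simp: finite_confs K intro!: arg_cong[where f = card])
  then show ?thesis
    unfolding card_confs_contract[where m = m, OF U x b] confs_delete[where m = m, OF U x b] fsum_edge[where m = m, OF U x b]
    using 1 2 by simp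
qed

lemma del_edge_less:
  assumes "finite K" "finite S" "x \<in> K" "b \<in> S" "0 < m x b"
  shows "(\<Sum>z\<in>K. \<Sum>y\<in>S. del_edge m x b z y) < (\<Sum>z\<in>K. \<Sum>y\<in>S. m z y)"
proof -
  have "(\<Sum>z\<in>K. \<Sum>y\<in>S. m z y) = (\<Sum>z\<in>K. \<Sum>y\<in>S. del_edge m x b z y) + (\<Sum>z\<in>K. of_bool (z = x))"
    unfolding sum.distrib[symmetric] using sum_del_edge[where m = m and x = x and b = b, OF assms(2)] assms by (intro sum.cong) auto
  then show ?thesis using assms by (simp add: of_bool_def)
qed

lemma fsum_no_exit:
  assumes U: "finite U" "K \<subseteq> U" and B: "B \<subseteq> U - K" and F: "F \<in> PiE K (\<lambda>_. U)" "acyc K F" "x \<in> K" "root K F x \<in> B"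
    and no: "\<And>z b. z \<in> K \<Longrightarrow> b \<in> B \<Longrightarrow> m z b = 0"
  shows "(\<Prod>y\<in>K. m y (F y)) = (0::nat)"
proof -
  have K: "finite K" using U finite_subset by auto
  have "leads K F x (root K F x)" "root K F x \<noteq> x" using acyc_root[OF F(2), of x] F by auto
  then obtain t where "t \<in> K" "root K F x = F t" using leads_pred by metis
  then have "m t (F t) = 0" using no F by auto
  then show ?thesis using K \<open>t \<in> K\<close> by (auto simp: prod_zero_iff)
qed

text \<open>The case of a fire from the whole complement comes first, since the general count is
  reduced to it once no edge to \<open>B\<close> is left. If no edge leaves a nonempty
  \<open>K\<close>, both counts are 0.\<close>

lemma card_confs_total:
  "finite U \<Longrightarrow> K \<subseteq> U \<Longrightarrow> card (confs m U K (U - K) K) = fsum m U K (U - K) K"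
proof (induction "card K" arbitrary: K m rule: less_induct)
  case less
  note U = less.prems
  have K: "finite K" using U finite_subset by auto
  from less.hyps show ?case
  proof (induction "\<Sum>z\<in>K. \<Sum>y\<in>U - K. m z y" arbitrary: m rule: less_induct)
    case inner: less
    show ?case
    proof (cases "\<exists>x\<in>K. \<exists>b\<in>U - K. 0 < m x b")
      case True
      then obtain x b where xb: "x \<in> K" "b \<in> U - K" "0 < m x b" by auto
      have UK: "insert x (U - K) = U - (K - {x})" using xb U by auto
      show ?thesis
      proof (rule card_confs_step[where m = m, OF U order_refl xb])
        show "card (confs m U (K - {x}) (insert x (U - K)) (K - {x})) = fsum m U (K - {x}) (insert x (U - K)) (K - {x})"
          unfolding UK using inner.prems[of "K - {x}" m] U K xb(1) card_Diff1_less[OF K xb(1)] by auto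
        show "card (confs (del_edge m x b) U K (U - K) K) = fsum (del_edge m x b) U K (U - K) K"
          using del_edge_less[of K "U - K" x b m] K U xb inner.prems by (intro inner.hyps) auto
      qed
    next
      case False
      then have no: "m z b = 0" if "z \<in> K" "b \<in> U - K" for z b using that by auto
      show ?thesis
      proof (cases "K = {}")
        case True
        have "confs m U {} (U - {}) {} = {\<lambda>_. 0}" using burnt_sub[of m _ "{}"] by (auto simp: confs_def)
        then show ?thesis by (simp add: True fsum_def acyc_def)
      next
        case ne: False
        have "burnt m (\<lambda>x. \<Sum>y\<in>U. m x y) K (U - K) \<xi> = {}" if "\<forall>x\<in>K. \<xi> x < (\<Sum>y\<in>U. m x y)" for \<xi>
        proof -
          have "closed_burn m (\<lambda>x. \<Sum>y\<in>U. m x y) K (U - K) \<xi> {}"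
            using that no by (simp add: closed_burn_def)
          then show ?thesis using burnt_least by fastforce
        qed
        then have "confs m U K (U - K) K = {}" using ne by (auto simp: confs_def)
        moreover have "fsum m U K (U - K) K = 0"
          unfolding fsum_def
        proof (rule sum.neutral, rule ballI)
          fix F assume F: "F \<in> {F \<in> PiE K (\<lambda>_. U). acyc K F \<and> {x \<in> K. root K F x \<in> U - K} = K}"
          obtain x where "x \<in> K" using ne by auto
          then have "root K F x \<in> U - K" using F by blast
          then show "(\<Prod>x\<in>K. m x (F x)) = 0"
            using F \<open>x \<in> K\<close> no by (intro fsum_no_exit[OF U order_refl, of F x]) auto
        qed
        ultimately show ?thesis by simp
      qed
    qed
  qed
qed

text \<open>A double induction, on \<open>card K\<close> and then on the number of edges from
  \<open>K\<close> to \<open>B\<close>. When no such edge is left, the fire from \<open>B\<close>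
  burns nothing, and both sides count everything or nothing according to whether \<open>A\<close> is
  empty.\<close>

theorem card_confs:
  "finite U \<Longrightarrow> K \<subseteq> U \<Longrightarrow> B \<subseteq> U - K \<Longrightarrow> card (confs m U K B A) = fsum m U K B A"
proof (induction "card K" arbitrary: K m B A rule: less_induct)
  case less
  note U = less.prems
  have K: "finite K" "finite B" using U finite_subset[OF U(2,1)] finite_subset[of B U] by auto
  from less.hyps show ?case
  proof (induction "\<Sum>z\<in>K. \<Sum>y\<in>B. m z y" arbitrary: m rule: less_induct)
    case inner: less
    show ?case
    proof (cases "\<exists>x\<in>K. \<exists>b\<in>B. 0 < m x b")
      case True
      then obtain x b where xb: "x \<in> K" "b \<in> B" "0 < m x b" by auto
      show ?thesis
      proof (rule card_confs_step[where m = m, OF U xb])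
        show "card (confs m U (K - {x}) (insert x B) (A - {x})) = fsum m U (K - {x}) (insert x B) (A - {x})"
          using inner.prems[of "K - {x}" "insert x B" m "A - {x}"] U K xb(1) card_Diff1_less[OF K(1) xb(1)] by auto
        show "card (confs (del_edge m x b) U K B A) = fsum (del_edge m x b) U K B A"
          using del_edge_less[of K B x b m] K U xb inner.prems by (intro inner.hyps) auto
      qed
    next
      case False
      then have no: "m z b = 0" if "z \<in> K" "b \<in> B" for z b using that by auto
      have bu: "burnt m (\<lambda>x. \<Sum>y\<in>U. m x y) K B \<xi> = {}" if "\<forall>x\<in>K. \<xi> x < (\<Sum>y\<in>U. m x y)" for \<xi>
      proof -
        have "closed_burn m (\<lambda>x. \<Sum>y\<in>U. m x y) K B \<xi> {}"
          using that no by (simp add: closed_burn_def)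
        then show ?thesis using burnt_least by fastforce
      qed
      show ?thesis
      proof (cases "A = {}")
        case True
        have "confs m U K B A = confs m U K (U - K) K" using bu True by (auto simp: confs_def)
        then have "card (confs m U K B A) = fsum m U K (U - K) K" using card_confs_total[OF U(1,2)] by simp
        also have "\<dots> = fsum m U K B A"
          unfolding fsum_def
        proof (rule sum.mono_neutral_cong)
          show "(\<Prod>x\<in>K. m x (F x)) = 0" if F: "F \<in> {F \<in> PiE K (\<lambda>_. U). acyc K F \<and> {x \<in> K. root K F x \<in> U - K} = K} -
             {F \<in> PiE K (\<lambda>_. U). acyc K F \<and> {x \<in> K. root K F x \<in> B} = A}" for F
          proof -
            obtain x where "x \<in> K" "root K F x \<in> B" using F True by auto
            then show ?thesis using F no by (intro fsum_no_exit[OF U(1,2,3), of F x]) auto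
          qed
          show "(\<Prod>x\<in>K. m x (F x)) = 0" if F: "F \<in> {F \<in> PiE K (\<lambda>_. U). acyc K F \<and> {x \<in> K. root K F x \<in> B} = A} -
             {F \<in> PiE K (\<lambda>_. U). acyc K F \<and> {x \<in> K. root K F x \<in> U - K} = K}" for F
          proof -
            have "root K F x \<in> U - K" if "x \<in> K" for x
            proof -
              have *: "leads K F x (root K F x)" "root K F x \<notin> K" using acyc_root[of K F x] F by auto
              then obtain t where "t \<in> K" "root K F x = F t" using leads_pred[of x "root K F x" K F] \<open>x \<in> K\<close> by metis
              then show ?thesis using F * by auto
            qed
            then show ?thesis using F by auto
          qed
        qed (use K U in \<open>auto intro!: finite_PiE\<close>)
        finally show ?thesis .
      next
        case ne: False
        have "confs m U K B A = {}" using bu ne by (auto simp: confs_def)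
        moreover have "fsum m U K B A = 0"
          unfolding fsum_def
        proof (rule sum.neutral, rule ballI)
          fix F assume F: "F \<in> {F \<in> PiE K (\<lambda>_. U). acyc K F \<and> {x \<in> K. root K F x \<in> B} = A}"
          then obtain x where "x \<in> K" "root K F x \<in> B" using ne by auto
          then show "(\<Prod>x\<in>K. m x (F x)) = 0"
            using F no by (intro fsum_no_exit[OF U(1,2,3), of F x]) auto
        qed
        ultimately show ?thesis by simp
      qed
    qed
  qed
qed

section \<open>Sandpiles\<close>

lemma legal_append: "legal G K \<eta> (xs @ ys) \<longleftrightarrow> legal G K \<eta> xs \<and> legal G K (fold (topple G K) xs \<eta>) ys"
  by (induction xs arbitrary: \<eta>) auto

lemma legal_set: "legal G K \<eta> xs \<Longrightarrow> set xs \<subseteq> K"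
  by (induction xs arbitrary: \<eta>) auto

lemma fold_topple_off: "set xs \<subseteq> K \<Longrightarrow> x \<notin> K \<Longrightarrow> fold (topple G K) xs \<eta> x = \<eta> x"
  by (induction xs arbitrary: \<eta>) (auto simp: topple_def)

definition padd :: "('a \<Rightarrow> nat) \<Rightarrow> ('a \<Rightarrow> nat) \<Rightarrow> 'a \<Rightarrow> nat" where "padd \<eta> \<zeta> x = \<eta> x + \<zeta> x"

definition dl :: "'a \<Rightarrow> nat \<Rightarrow> 'a \<Rightarrow> nat" where "dl v k x = (if x = v then k else 0)"

lemma padd_assoc: "padd (padd \<eta> \<zeta>) \<kappa> = padd \<eta> (padd \<zeta> \<kappa>)" by (auto simp: padd_def)

lemma padd_comm: "padd \<eta> \<zeta> = padd \<zeta> \<eta>" by (auto simp: padd_def)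

lemma padd_zero: "padd \<eta> (\<lambda>_. 0) = \<eta>" by (auto simp: padd_def)

lemma add_grain_padd: "add_grain v \<eta> = padd \<eta> (dl v 1)" by (auto simp: add_grain_def padd_def dl_def)

lemma legal_padd:
  "legal G K \<eta> xs \<Longrightarrow> legal G K (padd \<eta> \<zeta>) xs \<and> fold (topple G K) xs (padd \<eta> \<zeta>) = padd (fold (topple G K) xs \<eta>) \<zeta>"
proof (induction xs arbitrary: \<eta>)
  case (Cons x xs)
  have "topple G K x (padd \<eta> \<zeta>) = padd (topple G K x \<eta>) \<zeta>"
    using Cons.prems by (auto simp: topple_def padd_def fun_eq_iff)
  moreover have "deg G x \<le> padd \<eta> \<zeta> x" using Cons.prems by (auto simp: padd_def)
  ultimately show ?case using Cons by simp
qed auto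

lemma legal_transfer_aux:
  assumes "K' \<subseteq> K"
  shows "(\<And>x. x \<in> K' \<Longrightarrow> \<eta> x = \<eta>' x) \<Longrightarrow> set xs \<subseteq> K' \<Longrightarrow> (legal G K' \<eta> xs \<longleftrightarrow> legal G K \<eta>' xs) \<and>
    (\<forall>x\<in>K'. fold (topple G K') xs \<eta> x = fold (topple G K) xs \<eta>' x)"
proof (induction xs arbitrary: \<eta> \<eta>')
  case (Cons t xs)
  have "topple G K' t \<eta> x = topple G K t \<eta>' x" if "x \<in> K'" for x
    using that Cons.prems assms by (auto simp: topple_def)
  then show ?case using Cons.IH[of "topple G K' t \<eta>" "topple G K t \<eta>'"] Cons.prems assms by auto
qed auto

text \<open>Whether topplings inside \<open>K'\<close> are legal depends only on the heights there.
  So avalanche events within a ball are cylinder events, the same in finite and infinite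
  volume.\<close>

lemma legal_transfer:
  assumes "K' \<subseteq> K" "\<And>x. x \<in> K' \<Longrightarrow> \<eta> x = \<eta>' x" "set xs \<subseteq> K'"
  shows "legal G K' \<eta> xs \<longleftrightarrow> legal G K \<eta>' xs"
    and "\<And>x. x \<in> K' \<Longrightarrow> fold (topple G K') xs \<eta> x = fold (topple G K) xs \<eta>' x"
  using legal_transfer_aux[OF assms(1), of \<eta> \<eta>' xs G] assms(2,3) by auto

lemma count_list_distinct: "distinct xs \<Longrightarrow> count_list xs x = of_bool (x \<in> set xs)"
  by (induction xs) auto

text \<open>The grains that \<open>K\<close> receives when every vertex of \<open>B\<close> topples
  once; for \<open>B = roots K\<close> this is Dhar's burning configuration.\<close>

definition bsum :: "'a mgraph \<Rightarrow> 'a set \<Rightarrow> 'a set \<Rightarrow> 'a \<Rightarrow> nat" where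
  "bsum G K B x = (if x \<in> K then \<Sum>y\<in>B. count (G x) y else 0)"

abbreviation bt :: "'a mgraph \<Rightarrow> 'a set \<Rightarrow> 'a set \<Rightarrow> ('a \<Rightarrow> nat) \<Rightarrow> 'a set" where
  "bt G K B \<xi> \<equiv> burnt (\<lambda>x y. count (G x) y) (deg G) K B \<xi>"

context sgraph
begin

abbreviation tp :: "'a set \<Rightarrow> 'a \<Rightarrow> ('a \<Rightarrow> nat) \<Rightarrow> 'a \<Rightarrow> nat" where "tp K \<equiv> topple G K"

lemma count_self: "count (G x) x = 0" using no_loop by (simp add: not_in_iff)

lemma fold_value:
  "legal G K \<eta> xs \<Longrightarrow> x \<in> K \<Longrightarrow>
     fold (tp K) xs \<eta> x + count_list xs x * deg G x = \<eta> x + (\<Sum>y\<leftarrow>xs. count (G y) x)"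
proof (induction xs arbitrary: \<eta>)
  case (Cons t xs)
  then have "fold (tp K) xs (tp K t \<eta>) x + count_list xs x * deg G x = tp K t \<eta> x + (\<Sum>y\<leftarrow>xs. count (G y) x)"
    by simp
  moreover have "tp K t \<eta> x + of_bool (t = x) * deg G x = \<eta> x + count (G t) x"
    using Cons.prems by (auto simp: topple_def count_self)
  ultimately show ?case by auto
qed auto

lemma sum_list_count: "finite S \<Longrightarrow> set xs \<subseteq> S \<Longrightarrow> (\<Sum>y\<leftarrow>xs. f y) = (\<Sum>y\<in>S. count_list xs y * (f y :: nat))"
  by (simp add: sum_list_map_eq_sum_count2)

text \<open>At the first excess, \<open>x\<close> would have toppled as often as in
  \<open>ys\<close> and its neighbours at most as often. Its height would then be at most the final
  height under \<open>ys\<close>, which is stable.\<close>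

lemma least_action:
  assumes "legal G K \<eta> xs" "legal G K \<eta> ys" "stable G K (fold (tp K) ys \<eta>)"
  shows "count_list xs u \<le> count_list ys u"
  using assms(1)
proof (induction xs arbitrary: u rule: rev_induct)
  case (snoc x xs)
  have xs: "legal G K \<eta> xs" "x \<in> K" "deg G x \<le> fold (tp K) xs \<eta> x" using snoc.prems by (auto simp: legal_append)
  show ?case
  proof (cases "u = x \<and> count_list xs x = count_list ys x")
    case True
    let ?S = "set xs \<union> set ys"
    have "(\<Sum>y\<leftarrow>xs. count (G y) x) = (\<Sum>y\<in>?S. count_list xs y * count (G y) x)"
      by (rule sum_list_count) auto
    also have "\<dots> \<le> (\<Sum>y\<in>?S. count_list ys y * count (G y) x)"
      using snoc.IH[OF xs(1)] by (intro sum_mono mult_right_mono) auto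
    also have "\<dots> = (\<Sum>y\<leftarrow>ys. count (G y) x)" by (rule sum_list_count[symmetric]) auto
    finally have "(\<Sum>y\<leftarrow>xs. count (G y) x) \<le> (\<Sum>y\<leftarrow>ys. count (G y) x)" .
    moreover have "count_list xs x * deg G x = count_list ys x * deg G x" using True by simp
    ultimately have "fold (tp K) xs \<eta> x \<le> fold (tp K) ys \<eta> x"
      using fold_value[OF xs(1,2)] fold_value[OF assms(2) xs(2)] by linarith
    also have "\<dots> < deg G x" using assms(3) xs(2) by (auto simp: stable_def)
    finally show ?thesis using xs(3) by simp
  next
    case False
    then show ?thesis using snoc.IH[OF xs(1), of u] by (auto simp: le_less)
  qed
qed auto

lemma stab_unique:
  assumes "legal G K \<eta> xs" "stable G K (fold (tp K) xs \<eta>)" "legal G K \<eta> ys" "stable G K (fold (tp K) ys \<eta>)"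
  shows "fold (tp K) xs \<eta> = fold (tp K) ys \<eta>"
proof
  fix x
  have c: "count_list xs u = count_list ys u" for u
    using least_action[OF assms(1,3,4)] least_action[OF assms(3,1,2)] by (rule order_antisym)
  show "fold (tp K) xs \<eta> x = fold (tp K) ys \<eta> x"
  proof (cases "x \<in> K")
    case True
    have "(\<Sum>y\<leftarrow>xs. count (G y) x) = (\<Sum>y\<leftarrow>ys. count (G y) x)"
      using sum_list_count[of "set xs \<union> set ys" xs "\<lambda>y. count (G y) x"] sum_list_count[of "set xs \<union> set ys" ys "\<lambda>y. count (G y) x"] c by simp
    moreover have "count_list xs x * deg G x = count_list ys x * deg G x" using c by simp
    ultimately show ?thesis using fold_value[OF assms(1) True] fold_value[OF assms(3) True] by linarith
  next
    case False
    then show ?thesis using fold_topple_off[OF legal_set[OF assms(1)] False] fold_topple_off[OF legal_set[OF assms(3)] False] by simp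
  qed
qed

lemma stabilizationI:
  assumes "legal G K \<eta> ys" "stable G K (fold (tp K) ys \<eta>)" shows "stabilization G K \<eta> = fold (tp K) ys \<eta>"
  unfolding stabilization_def using assms stab_unique by (intro the_equality) auto

definition roots :: "'a set \<Rightarrow> 'a set" where "roots K = (\<Union>x\<in>K. N x) - K"

text \<open>Recurrence in the form of the burning test; \<open>recurrent_eq_RC\<close> identifies it
  with the closed class of the chain.\<close>

definition RC :: "'a set \<Rightarrow> ('a \<Rightarrow> nat) set" where
  "RC K = {\<xi>. (\<forall>x. x \<notin> K \<longrightarrow> \<xi> x = 0) \<and> stable G K \<xi> \<and> bt G K (roots K) \<xi> = K}"

lemma finite_roots: "finite K \<Longrightarrow> finite (roots K)" by (auto simp: roots_def)

text \<open>A longest legal sequence without repetitions does both jobs: being maximal it topples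
  all that burns, and nothing topples twice because a vertex receives at most its degree from
  distinct neighbours.\<close>

lemma burn_list:
  assumes K: "finite K" "finite B" "B \<inter> K = {}" and \<xi>: "stable G K \<xi>"
  shows "\<exists>xs. legal G K (padd \<xi> (bsum G K B)) xs \<and> distinct xs \<and> set xs = bt G K B \<xi>
    \<and> stable G K (fold (tp K) xs (padd \<xi> (bsum G K B)))"
proof -
  let ?\<eta> = "padd \<xi> (bsum G K B)"
  let ?P = "\<lambda>xs. legal G K ?\<eta> xs \<and> distinct xs"
  have val: "fold (tp K) xs ?\<eta> x + of_bool (x \<in> set xs) * deg G x = \<xi> x + (\<Sum>y\<in>B \<union> set xs. count (G x) y)"
    if "?P xs" "x \<in> K" for xs x
  proof -
    have sx: "set xs \<subseteq> K" using that legal_set by metis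
    have "(\<Sum>y\<leftarrow>xs. count (G y) x) = (\<Sum>y\<in>set xs. count (G x) y)"
      using that by (simp add: sum_list_distinct_conv_sum_set count_sym[of _ x])
    moreover have "(\<Sum>y\<in>B \<union> set xs. count (G x) y) = (\<Sum>y\<in>B. count (G x) y) + (\<Sum>y\<in>set xs. count (G x) y)"
      using K sx by (intro sum.union_disjoint) auto
    moreover have "count_list xs x = of_bool (x \<in> set xs)" using that by (simp add: count_list_distinct)
    ultimately show ?thesis using fold_value[of K ?\<eta> xs x] that by (simp add: padd_def bsum_def)
  qed
  have bound: "length xs \<le> card K" if "?P xs" for xs
    using that legal_set[of G K ?\<eta> xs] card_mono[OF K(1), of "set xs"] by (auto simp: distinct_card)
  obtain xs where xs: "?P xs" "\<And>ys. ?P ys \<Longrightarrow> length ys \<le> length xs"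
    using ex_has_greatest_nat[of ?P "[]" length "Suc (card K)"] bound by (auto simp: less_Suc_eq_le)
  have sx: "set xs \<subseteq> K" using xs legal_set by metis
  have cl: "\<xi> x + (\<Sum>y\<in>B \<union> set xs. count (G x) y) < deg G x" if x: "x \<in> K - set xs" for x
  proof (rule ccontr)
    assume "\<not> \<xi> x + (\<Sum>y\<in>B \<union> set xs. count (G x) y) < deg G x"
    then have "?P (xs @ [x])" using val[OF xs(1), of x] x xs(1) by (auto simp: legal_append)
    then show False using xs(2)[of "xs @ [x]"] by simp
  qed
  then have c: "closed_burn (\<lambda>x y. count (G x) y) (deg G) K B \<xi> (set xs)" using sx by (auto simp: closed_burn_def)
  have "set ys \<subseteq> A" if A: "closed_burn (\<lambda>x y. count (G x) y) (deg G) K B \<xi> A" and ys: "?P ys" for A ys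
    using ys
  proof (induction ys rule: rev_induct)
    case (snoc y ys)
    then have y: "?P ys" "y \<in> K" "y \<notin> set ys" "deg G y \<le> fold (tp K) ys ?\<eta> y" "set ys \<subseteq> A" by (auto simp: legal_append)
    have "y \<in> A"
    proof (rule ccontr)
      assume "y \<notin> A"
      have "finite A" using A K finite_subset by (auto simp: closed_burn_def)
      then have "(\<Sum>z\<in>B \<union> set ys. count (G y) z) \<le> (\<Sum>z\<in>B \<union> A. count (G y) z)" using y K by (intro sum_mono2) auto
      moreover have "\<xi> y + (\<Sum>z\<in>B \<union> A. count (G y) z) < deg G y" using A y \<open>y \<notin> A\<close> by (auto simp: closed_burn_def)
      ultimately show False using val[OF y(1,2)] y by simp
    qed
    then show ?case using y by simp
  qed auto
  then have "set xs = bt G K B \<xi>" using burnt_eq_iff[OF K(1,2)] c xs(1) by metis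
  moreover have "stable G K (fold (tp K) xs ?\<eta>)"
    unfolding stable_def
  proof
    fix x assume x: "x \<in> K"
    have "(\<Sum>y\<in>B \<union> set xs. count (G x) y) \<le> deg G x"
    proof -
      have "(\<Sum>y\<in>B \<union> set xs. count (G x) y) = (\<Sum>y\<in>(B \<union> set xs) \<inter> N x. count (G x) y)"
        using K by (intro sum.mono_neutral_right) (auto simp: not_in_iff)
      also have "\<dots> \<le> (\<Sum>y\<in>N x. count (G x) y)" by (intro sum_mono2) auto
      finally show ?thesis by (simp add: deg_def size_multiset_overloaded_eq)
    qed
    then show "fold (tp K) xs ?\<eta> x < deg G x"
      using val[OF xs(1) x] cl[of x] \<xi> x by (cases "x \<in> set xs") (auto simp: stable_def)
  qed
  ultimately show ?thesis using xs(1) by blast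
qed

lemma stab_burn:
  assumes K: "finite K" "finite B" "B \<inter> K = {}" and \<xi>: "stable G K \<xi>" and x: "x \<in> K"
  shows "stabilization G K (padd \<xi> (bsum G K B)) x + of_bool (x \<in> bt G K B \<xi>) * deg G x
    = \<xi> x + (\<Sum>y\<in>B \<union> bt G K B \<xi>. count (G x) y)"
proof -
  obtain xs where xs: "legal G K (padd \<xi> (bsum G K B)) xs" "distinct xs" "set xs = bt G K B \<xi>"
    "stable G K (fold (tp K) xs (padd \<xi> (bsum G K B)))" using burn_list[OF K \<xi>] by auto
  have "(\<Sum>y\<leftarrow>xs. count (G y) x) = (\<Sum>y\<in>bt G K B \<xi>. count (G x) y)"
    using xs by (simp add: sum_list_distinct_conv_sum_set count_sym[of _ x])
  moreover have "(\<Sum>y\<in>B \<union> bt G K B \<xi>. count (G x) y) = (\<Sum>y\<in>B. count (G x) y) + (\<Sum>y\<in>bt G K B \<xi>. count (G x) y)"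
    using K burnt_sub[of "\<lambda>x y. count (G x) y" "deg G" K B \<xi>] by (intro sum.union_disjoint) (auto intro: finite_subset)
  moreover have "count_list xs x = of_bool (x \<in> bt G K B \<xi>)" using xs by (simp add: count_list_distinct)
  ultimately show ?thesis
    using fold_value[OF xs(1) x] stabilizationI[OF xs(1,4)] x by (simp add: padd_def bsum_def)
qed

lemma deg_eq_sum: "finite S \<Longrightarrow> N x \<subseteq> S \<Longrightarrow> (\<Sum>y\<in>S. count (G x) y) = deg G x"
  unfolding deg_def size_multiset_overloaded_eq by (rule sum.mono_neutral_right) (auto simp: not_in_iff)

text \<open>The form in which connectedness and infinity of the graph enter the sandpile arguments:
  a finite set of offending vertices always has an exit.\<close>

lemma no_isolated_finite: "finite S \<Longrightarrow> S \<noteq> {} \<Longrightarrow> \<exists>x\<in>S. \<exists>y. y \<notin> S \<and> y \<in> N x"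
  using no_isolated infinite_vertices by metis

text \<open>If everything burns, each vertex topples once and gets back what it lost. Conversely,
  with the heights unchanged, an unburnt vertex has no edge to the burnt set or to the roots; but
  the unburnt set has an exit.\<close>

lemma rec_iff:
  assumes K: "finite K" and \<xi>: "stable G K \<xi>" "\<And>x. x \<notin> K \<Longrightarrow> \<xi> x = 0"
  shows "bt G K (roots K) \<xi> = K \<longleftrightarrow> stabilization G K (padd \<xi> (bsum G K (roots K))) = \<xi>"
proof -
  let ?A = "bt G K (roots K) \<xi>" and ?s = "stabilization G K (padd \<xi> (bsum G K (roots K)))"
  have R: "finite (roots K)" "roots K \<inter> K = {}" using K by (auto simp: roots_def)
  note sb = stab_burn[OF K R \<xi>(1)]
  have off: "?s x = \<xi> x" if "x \<notin> K" for x
  proof -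
    obtain xs where xs: "legal G K (padd \<xi> (bsum G K (roots K))) xs" "stable G K (fold (tp K) xs (padd \<xi> (bsum G K (roots K))))"
      using burn_list[OF K R \<xi>(1)] by auto
    then show ?thesis using stabilizationI[OF xs] fold_topple_off[OF legal_set[OF xs(1)] that] that by (simp add: padd_def bsum_def)
  qed
  have AK: "?A \<subseteq> K" by (rule burnt_sub)
  then have fA: "finite (roots K \<union> ?A)" using K R finite_subset by auto
  show ?thesis
  proof
    assume A: "?A = K"
    show "?s = \<xi>"
    proof
      fix x show "?s x = \<xi> x"
      proof (cases "x \<in> K")
        case True
        have "(\<Sum>y\<in>roots K \<union> K. count (G x) y) = deg G x" using K R True by (intro deg_eq_sum) (auto simp: roots_def)
        then show ?thesis using sb[OF True] A True by simp
      qed (rule off)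
    qed
  next
    assume s: "?s = \<xi>"
    show "?A = K"
    proof (rule ccontr)
      assume "?A \<noteq> K"
      then have F: "K - ?A \<noteq> {}" "finite (K - ?A)" using AK K by auto
      then obtain x y where xy: "x \<in> K - ?A" "y \<notin> K - ?A" "y \<in> N x" using no_isolated_finite by meson
      have "(\<Sum>y\<in>roots K \<union> ?A. count (G x) y) = 0" using sb[of x] s xy by simp
      then have "count (G x) y = 0" if "y \<in> roots K \<union> ?A" for y using that fA by simp
      moreover have "y \<in> roots K \<union> ?A" using xy by (auto simp: roots_def)
      ultimately show False using xy by (metis count_eq_zero_iff)
    qed
  qed
qed

end

context tgraph
begin

text \<open>The heights weighted with the mean time spent in \<open>K\<close> form a Lyapunov
  function: a toppling at \<open>x\<close> lowers it by exactly \<open>dg x\<close>.\<close>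

lemma legal_length:
  assumes K: "finite K"
  shows "legal G K \<eta> xs \<Longrightarrow> real (length xs) \<le> (\<Sum>x\<in>K. pot K (\<lambda>_. 1) x * real (\<eta> x))"
proof (induction xs arbitrary: \<eta>)
  case Nil
  then show ?case by (auto intro!: sum_nonneg mult_nonneg_nonneg pot_nonneg K)
next
  case (Cons x xs)
  let ?t = "pot K (\<lambda>_. 1)"
  have x: "x \<in> K" "deg G x \<le> \<eta> x" using Cons.prems by auto
  have "real (tp K x \<eta> y) = real (\<eta> y) - of_bool (y = x) * dg x + real (count (G x) y)" if "y \<in> K" for y
    using that x by (auto simp: topple_def count_self of_nat_diff)
  then have "(\<Sum>y\<in>K. ?t y * real (tp K x \<eta> y)) = (\<Sum>y\<in>K. ?t y * (real (\<eta> y) - of_bool (y = x) * dg x + real (count (G x) y)))"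
    by (intro sum.cong) auto
  also have "\<dots> = (\<Sum>y\<in>K. ?t y * real (\<eta> y)) - (\<Sum>y\<in>K. of_bool (x = y) * (?t y * dg x)) + (\<Sum>y\<in>K. ?t y * real (count (G x) y))"
    unfolding sum_subtractf[symmetric] sum.distrib[symmetric] by (intro sum.cong) (auto simp: algebra_simps)
  also have "(\<Sum>y\<in>K. of_bool (x = y) * (?t y * dg x)) = ?t x * dg x"
    using sum_of_bool_eq[OF K, of x "\<lambda>y. ?t y * dg x"] x by simp
  also have "(\<Sum>y\<in>K. ?t y * real (count (G x) y)) = dg x * PP ?t x"
  proof -
    have "(\<Sum>y\<in>K. ?t y * real (count (G x) y)) = (\<Sum>y\<in>K \<union> N x. ?t y * real (count (G x) y))"
      by (rule sum.mono_neutral_left) (auto simp: K pot_off)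
    also have "\<dots> = dg x * PP ?t x"
      by (simp add: PP_eq[of "K \<union> N x"] K sum_distrib_left dg_p[symmetric] mult_ac)
    finally show ?thesis .
  qed
  finally have "(\<Sum>y\<in>K. ?t y * real (tp K x \<eta> y)) = (\<Sum>y\<in>K. ?t y * real (\<eta> y)) - dg x"
    using pot_eq[OF K x(1), of "\<lambda>_. 1"] by (simp add: algebra_simps)
  then show ?case using Cons dg_ge1[of x] by fastforce
qed

lemma stab_exists:
  assumes K: "finite K"
  shows "\<exists>xs. legal G K \<eta> xs \<and> stable G K (fold (tp K) xs \<eta>)"
proof -
  have "length xs \<le> nat \<lfloor>\<Sum>x\<in>K. pot K (\<lambda>_. 1) x * real (\<eta> x)\<rfloor>" if "legal G K \<eta> xs" for xs
    using legal_length[OF K that] by linarith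
  then obtain xs where xs: "legal G K \<eta> xs" "\<And>ys. legal G K \<eta> ys \<Longrightarrow> length ys \<le> length xs"
    using ex_has_greatest_nat[of "legal G K \<eta>" "[]" length "Suc (nat \<lfloor>\<Sum>x\<in>K. pot K (\<lambda>_. 1) x * real (\<eta> x)\<rfloor>)"]
    by (auto simp: less_Suc_eq_le)
  have "stable G K (fold (tp K) xs \<eta>)"
    unfolding stable_def
  proof (rule ballI, rule ccontr)
    fix x assume "x \<in> K" "\<not> fold (tp K) xs \<eta> x < deg G x"
    then have "legal G K \<eta> (xs @ [x])" using xs by (auto simp: legal_append)
    then show False using xs(2)[of "xs @ [x]"] by simp
  qed
  then show ?thesis using xs by blast
qed

abbreviation st :: "'a set \<Rightarrow> ('a \<Rightarrow> nat) \<Rightarrow> 'a \<Rightarrow> nat" where "st K \<equiv> stabilization G K"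

lemma st_stable: "finite K \<Longrightarrow> stable G K (st K \<eta>)"
  using stab_exists stabilizationI by metis

lemma st_off: "finite K \<Longrightarrow> x \<notin> K \<Longrightarrow> st K \<eta> x = \<eta> x"
  using stab_exists[of K \<eta>] stabilizationI fold_topple_off legal_set by metis

lemma st_id: "stable G K \<eta> \<Longrightarrow> st K \<eta> = \<eta>"
  using stabilizationI[of K \<eta> "[]"] by simp

lemma st_legal: "finite K \<Longrightarrow> legal G K \<eta> xs \<Longrightarrow> st K (fold (tp K) xs \<eta>) = st K \<eta>"
proof -
  assume K: "finite K" and xs: "legal G K \<eta> xs"
  obtain ys where ys: "legal G K (fold (tp K) xs \<eta>) ys" "stable G K (fold (tp K) ys (fold (tp K) xs \<eta>))"
    using stab_exists[OF K] by blast
  have "st K \<eta> = fold (tp K) (xs @ ys) \<eta>" by (rule stabilizationI) (use xs ys in \<open>auto simp: legal_append\<close>)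
  then show ?thesis using stabilizationI[OF ys] by simp
qed

lemma st_add: "finite K \<Longrightarrow> st K (padd (st K \<eta>) \<zeta>) = st K (padd \<eta> \<zeta>)"
proof -
  assume K: "finite K"
  obtain xs where xs: "legal G K \<eta> xs" "stable G K (fold (tp K) xs \<eta>)" using stab_exists[OF K] by blast
  then have "st K (padd (fold (tp K) xs \<eta>) \<zeta>) = st K (padd \<eta> \<zeta>)"
    using st_legal[OF K, of "padd \<eta> \<zeta>" xs] legal_padd[OF xs(1), of \<zeta>] by simp
  then show ?thesis using stabilizationI[OF xs] by simp
qed

lemma RC_iff:
  assumes "finite K"
  shows "\<xi> \<in> RC K \<longleftrightarrow> (\<forall>x. x \<notin> K \<longrightarrow> \<xi> x = 0) \<and> stable G K \<xi> \<and> st K (padd \<xi> (bsum G K (roots K))) = \<xi>"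
  using rec_iff[OF assms, of \<xi>] by (auto simp: RC_def)

lemma RC_add:
  assumes K: "finite K" and \<xi>: "\<xi> \<in> RC K" and \<zeta>: "\<And>x. x \<notin> K \<Longrightarrow> \<zeta> x = 0"
  shows "st K (padd \<xi> \<zeta>) \<in> RC K"
proof -
  let ?b = "bsum G K (roots K)"
  have "st K (padd (st K (padd \<xi> \<zeta>)) ?b) = st K (padd \<xi> (padd \<zeta> ?b))" by (simp add: st_add K padd_assoc)
  also have "\<dots> = st K (padd (padd \<xi> ?b) \<zeta>)" by (simp add: padd_assoc padd_comm[of \<zeta>])
  also have "\<dots> = st K (padd (st K (padd \<xi> ?b)) \<zeta>)" by (simp add: st_add K)
  also have "st K (padd \<xi> ?b) = \<xi>" using \<xi> RC_iff[OF K] by blast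
  finally have 1: "st K (padd (st K (padd \<xi> \<zeta>)) ?b) = st K (padd \<xi> \<zeta>)" .
  have "st K (padd \<xi> \<zeta>) x = 0" if "x \<notin> K" for x
    using st_off[OF K that, of "padd \<xi> \<zeta>"] \<xi> \<zeta>[OF that] that by (simp add: padd_def RC_def)
  then show ?thesis unfolding RC_iff[OF K] using 1 st_stable[OF K] by blast
qed

lemma inj_on_padd_left:
  assumes K: "finite K" and inj: "inj_on (\<lambda>\<eta>. st K (padd \<eta> (padd \<zeta> \<kappa>))) (RC K)"
  shows "inj_on (\<lambda>\<eta>. st K (padd \<eta> \<zeta>)) (RC K)"
proof (rule inj_onI)
  fix \<eta> \<eta>' assume *: "\<eta> \<in> RC K" "\<eta>' \<in> RC K" "st K (padd \<eta> \<zeta>) = st K (padd \<eta>' \<zeta>)"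
  have "st K (padd \<eta> (padd \<zeta> \<kappa>)) = st K (padd (st K (padd \<eta> \<zeta>)) \<kappa>)" for \<eta> by (simp add: st_add K padd_assoc)
  then have "st K (padd \<eta> (padd \<zeta> \<kappa>)) = st K (padd \<eta>' (padd \<zeta> \<kappa>))" using *(3) by simp
  then show "\<eta> = \<eta>'" using inj_onD[OF inj] * by blast
qed

lemma inj_on_padd:
  assumes K: "finite K" and 1: "inj_on (\<lambda>\<eta>. st K (padd \<eta> \<zeta>)) (RC K)" and 2: "inj_on (\<lambda>\<eta>. st K (padd \<eta> \<kappa>)) (RC K)"
    and \<zeta>: "\<And>x. x \<notin> K \<Longrightarrow> \<zeta> x = 0"
  shows "inj_on (\<lambda>\<eta>. st K (padd \<eta> (padd \<zeta> \<kappa>))) (RC K)"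
proof -
  have "(\<lambda>\<eta>. st K (padd \<eta> (padd \<zeta> \<kappa>))) = (\<lambda>\<eta>. st K (padd \<eta> \<kappa>)) \<circ> (\<lambda>\<eta>. st K (padd \<eta> \<zeta>))"
    by (auto simp: st_add K padd_assoc fun_eq_iff)
  moreover have "(\<lambda>\<eta>. st K (padd \<eta> \<zeta>)) ` RC K \<subseteq> RC K" using RC_add[OF K _ \<zeta>] by auto
  ultimately show ?thesis using comp_inj_on[OF 1 inj_on_subset[OF 2]] by simp
qed

lemma padd_split: "\<zeta> x \<ge> k \<Longrightarrow> \<zeta> = padd (dl x k) (\<lambda>y. \<zeta> y - dl x k y)"
  by (auto simp: padd_def dl_def fun_eq_iff)

text \<open>Adding the burning configuration is the identity on \<open>RC K\<close>, hence adding
  any part of it is injective; this settles the vertices with a neighbour outside \<open>K\<close>.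
  Adding \<open>deg G x\<close> grains at \<open>x\<close> amounts to adding its share to each
  neighbour, so injectivity passes to the neighbours in \<open>K\<close>. The set of remaining
  vertices would have no exit.\<close>

lemma inj_on_add_grain:
  assumes K: "finite K" and v: "v \<in> K"
  shows "inj_on (\<lambda>\<eta>. st K (padd \<eta> (dl v 1))) (RC K)"
proof -
  let ?good = "\<lambda>x. inj_on (\<lambda>\<eta>. st K (padd \<eta> (dl x 1))) (RC K)"
  let ?Bad = "{x \<in> K. \<not> ?good x}"
  have mult: "inj_on (\<lambda>\<eta>. st K (padd \<eta> (dl x k))) (RC K)" if "?good x" "x \<in> K" for x k
  proof (induction k)
    case 0
    have "st K (padd \<eta> (dl x 0)) = \<eta>" if "\<eta> \<in> RC K" for \<eta>
      using that st_id[of K \<eta>] by (simp add: dl_def[abs_def] padd_zero RC_def if_distrib cong: if_cong)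
    then show ?case by (auto simp: inj_on_def)
  next
    case (Suc k)
    have "dl x (Suc k) = padd (dl x 1) (dl x k)" by (auto simp: dl_def padd_def)
    moreover have "inj_on (\<lambda>\<eta>. st K (padd \<eta> (padd (dl x 1) (dl x k)))) (RC K)"
      by (rule inj_on_padd[OF K that(1) Suc]) (use that(2) in \<open>auto simp: dl_def\<close>)
    ultimately show ?case by simp
  qed
  have g1: "?good x" if "x \<in> K" "y \<in> N x" "y \<notin> K" for x y
  proof -
    let ?b = "bsum G K (roots K)"
    have "y \<in> roots K" using that by (auto simp: roots_def)
    then have "count (G x) y \<le> ?b x" using that member_le_sum[of y "roots K" "count (G x)"] finite_roots[OF K] by (simp add: bsum_def)
    then have "1 \<le> ?b x" using that by (meson count_greater_eq_one_iff order_trans)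
    moreover have "inj_on (\<lambda>\<eta>. st K (padd \<eta> ?b)) (RC K)"
      using RC_iff[OF K] by (auto simp: inj_on_def)
    ultimately show ?thesis using inj_on_padd_left[OF K, of "dl x 1"] padd_split[of 1 ?b x] by metis
  qed
  have g2: "?good y" if "?good x" "x \<in> K" "y \<in> K" "x \<in> N y" for x y
  proof -
    let ?z = "\<lambda>w. if w \<in> K then count (G x) w else 0"
    have "st K (padd \<eta> (dl x (deg G x))) = st K (padd \<eta> ?z)" for \<eta>
    proof -
      have "legal G K (padd \<eta> (dl x (deg G x))) [x]" using that by (auto simp: padd_def dl_def)
      moreover have "tp K x (padd \<eta> (dl x (deg G x))) = padd \<eta> ?z"
        using that by (auto simp: topple_def padd_def dl_def fun_eq_iff count_self)
      ultimately show ?thesis using st_legal[OF K, of _ "[x]"] by (metis fold.simps(1,2) id_apply o_apply)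
    qed
    then have "inj_on (\<lambda>\<eta>. st K (padd \<eta> ?z)) (RC K)" using mult[OF that(1,2), of "deg G x"] by simp
    moreover have "1 \<le> ?z y" using that N_sym[of x y] by simp
    ultimately show ?thesis using inj_on_padd_left[OF K, of "dl y 1"] padd_split[of 1 ?z y] by metis
  qed
  have "?Bad = {}"
  proof (rule ccontr)
    assume "?Bad \<noteq> {}"
    moreover have "finite ?Bad" using K by simp
    ultimately obtain x y where "x \<in> ?Bad" "y \<notin> ?Bad" "y \<in> N x" using no_isolated_finite by meson
    then show False using g1[of x y] g2[of y x] by blast
  qed
  then show ?thesis using v by auto
qed

lemma inj_on_add:
  assumes K: "finite K" and \<zeta>: "\<And>x. x \<notin> K \<Longrightarrow> \<zeta> x = 0"
  shows "inj_on (\<lambda>\<eta>. st K (padd \<eta> \<zeta>)) (RC K)"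
  using \<zeta>
proof (induction "\<Sum>x\<in>K. \<zeta> x" arbitrary: \<zeta>)
  case 0
  then have "\<zeta> = (\<lambda>_. 0)" using K by (metis sum_eq_0_iff ext)
  moreover have "st K \<eta> = \<eta>" if "\<eta> \<in> RC K" for \<eta> using that st_id by (auto simp: RC_def)
  ultimately show ?case by (auto simp: inj_on_def padd_zero)
next
  case (Suc n)
  obtain x where x: "x \<in> K" "1 \<le> \<zeta> x"
  proof (rule ccontr)
    assume "\<not> thesis"
    then have "\<zeta> x = 0" if "x \<in> K" for x using that \<open>\<And>x. x \<in> K \<Longrightarrow> 1 \<le> \<zeta> x \<Longrightarrow> thesis\<close> by (metis One_nat_def Suc_leI neq0_conv)
    then have "(\<Sum>x\<in>K. \<zeta> x) = 0" by simp
    then show False using Suc.hyps by simp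
  qed
  let ?\<zeta> = "\<lambda>y. \<zeta> y - dl x 1 y"
  have "(\<Sum>x\<in>K. \<zeta> x) = (\<Sum>y\<in>K. ?\<zeta> y) + (\<Sum>y\<in>K. dl x 1 y)"
    unfolding sum.distrib[symmetric] using x by (intro sum.cong) (auto simp: dl_def)
  also have "(\<Sum>y\<in>K. dl x 1 y) = 1" using K x by (simp add: dl_def)
  finally have "n = (\<Sum>y\<in>K. ?\<zeta> y)" using Suc.hyps(2) by simp
  then have "inj_on (\<lambda>\<eta>. st K (padd \<eta> ?\<zeta>)) (RC K)" using Suc.prems by (intro Suc.hyps(1)) auto
  then have "inj_on (\<lambda>\<eta>. st K (padd \<eta> (padd (dl x 1) ?\<zeta>))) (RC K)"
    using inj_on_add_grain[OF K x(1)] x(1) by (intro inj_on_padd K) (auto simp: dl_def)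
  then show ?case using padd_split[where \<zeta> = \<zeta> and x = x and k = 1, OF x(2)] by simp
qed

lemma finite_RC: "finite K \<Longrightarrow> finite (RC K)"
proof -
  assume K: "finite K"
  have "RC K \<subseteq> {\<xi>. \<forall>x. (x \<in> K \<longrightarrow> \<xi> x \<in> {..<Max (deg G ` K)}) \<and> (x \<notin> K \<longrightarrow> \<xi> x = 0)}"
    using K by (auto simp: RC_def stable_def intro: order_less_le_trans Max_ge)
  moreover have "finite \<dots>" by (rule finite_set_of_finite_funs) (use K in auto)
  ultimately show ?thesis by (rule finite_subset)
qed

lemma surj_add:
  assumes K: "finite K" and \<zeta>: "\<And>x. x \<notin> K \<Longrightarrow> \<zeta> x = 0" and \<xi>: "\<xi> \<in> RC K"
  shows "\<exists>\<eta>\<in>RC K. st K (padd \<eta> \<zeta>) = \<xi>"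
proof -
  have "(\<lambda>\<eta>. st K (padd \<eta> \<zeta>)) ` RC K = RC K"
    by (rule endo_inj_surj[OF finite_RC[OF K] _ inj_on_add[OF K \<zeta>]]) (use RC_add[OF K _ \<zeta>] in auto)
  then show ?thesis using \<xi> by (metis (no_types, lifting) imageE)
qed

section \<open>Recurrent configurations\<close>

definition maxc :: "'a set \<Rightarrow> 'a \<Rightarrow> nat" where "maxc K x = (if x \<in> K then deg G x - 1 else 0)"

lemma maxc_RC: "finite K \<Longrightarrow> maxc K \<in> RC K"
proof -
  assume K: "finite K"
  have s: "stable G K (maxc K)" using deg_pos by (auto simp: stable_def maxc_def)
  have "A = K" if A: "closed_burn (\<lambda>x y. count (G x) y) (deg G) K (roots K) (maxc K) A" for A
  proof (rule ccontr)
    assume "A \<noteq> K"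
    then have "K - A \<noteq> {}" "finite (K - A)" using A K by (auto simp: closed_burn_def)
    then obtain x y where xy: "x \<in> K - A" "y \<notin> K - A" "y \<in> N x" using no_isolated_finite by meson
    have "finite A" using A K finite_subset by (auto simp: closed_burn_def)
    moreover have "y \<in> roots K \<union> A" using xy by (auto simp: roots_def)
    ultimately have "count (G x) y \<le> (\<Sum>y\<in>roots K \<union> A. count (G x) y)"
      using finite_roots[OF K] by (intro member_le_sum) auto
    moreover have "count (G x) y \<ge> 1" using xy by simp
    moreover have "deg G x - 1 + (\<Sum>y\<in>roots K \<union> A. count (G x) y) < deg G x"
      using A xy(1) by (auto simp: closed_burn_def maxc_def)
    ultimately show False by linarith
  qed
  then have "bt G K (roots K) (maxc K) = K" using closed_burnt[OF K finite_roots[OF K]] by metis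
  then show ?thesis using s by (auto simp: RC_def maxc_def)
qed

lemma accessible_step:
  assumes "finite K" "x \<in> K" shows "(\<eta>, st K (padd \<eta> (dl x 1))) \<in> accessible G K"
proof -
  have "st K (padd \<eta> (dl x 1)) \<in> set_pmf (sandpile_chain G K \<eta>)"
  proof -
    have "K \<noteq> {}" using assms by auto
    then show ?thesis using assms by (auto simp: sandpile_chain_def add_grain_padd)
  qed
  then show ?thesis by (auto simp: accessible_def)
qed

lemma accessible_induct[consumes 2, case_names refl step]:
  assumes "(\<eta>, \<eta>') \<in> accessible G K" "finite K" "P \<eta>"
    and "\<And>\<zeta> x. (\<eta>, \<zeta>) \<in> accessible G K \<Longrightarrow> P \<zeta> \<Longrightarrow> x \<in> K \<Longrightarrow> P (st K (padd \<zeta> (dl x 1)))" and "K \<noteq> {}"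
  shows "P \<eta>'"
  using assms(1) unfolding accessible_def
proof (induction rule: rtrancl_induct)
  case (step y z)
  then obtain x where "x \<in> K" "z = st K (padd y (dl x 1))"
    using assms(2,5) by (auto simp: sandpile_chain_def add_grain_padd set_pmf_of_set)
  then show ?case using step assms(4) by (auto simp: accessible_def)
qed (rule assms(3))

lemma accessible_maxc:
  assumes K: "finite K" and "\<eta> \<in> stable_sandpiles G K"
  shows "(\<eta>, maxc K) \<in> accessible G K"
  using assms(2)
proof (induction "\<Sum>x\<in>K. deg G x - \<eta> x" arbitrary: \<eta> rule: less_induct)
  case less
  have \<eta>: "\<And>x. x \<notin> K \<Longrightarrow> \<eta> x = 0" "\<And>x. x \<in> K \<Longrightarrow> \<eta> x < deg G x"
    using less.prems by (auto simp: stable_sandpiles_def stable_def)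
  show ?case
  proof (cases "\<eta> = maxc K")
    case True
    then show ?thesis by (simp add: accessible_def)
  next
    case False
    then obtain x where x: "\<eta> x \<noteq> maxc K x" by auto
    then have xK: "x \<in> K" "\<eta> x + 1 < deg G x" using \<eta>[of x] by (auto simp: maxc_def split: if_splits)
    let ?\<eta> = "padd \<eta> (dl x 1)"
    have s: "?\<eta> \<in> stable_sandpiles G K" using \<eta> xK by (auto simp: stable_sandpiles_def stable_def padd_def dl_def)
    then have "st K ?\<eta> = ?\<eta>" by (intro st_id) (auto simp: stable_sandpiles_def)
    then have "(\<eta>, ?\<eta>) \<in> accessible G K" using accessible_step[OF K xK(1), of \<eta>] by simp
    moreover have "(?\<eta>, maxc K) \<in> accessible G K"
    proof (rule less.hyps[OF _ s])
      show "(\<Sum>y\<in>K. deg G y - ?\<eta> y) < (\<Sum>y\<in>K. deg G y - \<eta> y)"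
        using K xK by (intro sum_strict_mono_ex1) (auto simp: padd_def dl_def intro!: bexI[of _ x])
    qed
    ultimately show ?thesis unfolding accessible_def by (rule rtrancl_trans)
  qed
qed

lemma cycle_of_inj:
  assumes "finite S" "inj_on f S" "f ` S \<subseteq> S" "x \<in> S"
  shows "\<exists>n. (f ^^ n) (f x) = x"
proof -
  have im: "(f ^^ n) x \<in> S" for n using assms(3,4) by (induction n) auto
  have "\<not> inj (\<lambda>n. (f ^^ n) x)"
    using assms(1) im finite_subset[of "range (\<lambda>n. (f ^^ n) x)" S] finite_imageD[of "\<lambda>n. (f ^^ n) x" UNIV] by auto
  then obtain i j where "i < j" "(f ^^ i) x = (f ^^ j) x"
    unfolding inj_def by (metis linorder_neqE_nat)
  then have "\<exists>k>0. (f ^^ i) x = (f ^^ (i + k)) x" by (intro exI[of _ "j - i"]) auto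
  then obtain k where k: "k > 0" "(f ^^ i) x = (f ^^ (i + k)) x" by auto
  have "x = (f ^^ k) x"
    using k(2)
  proof (induction i)
    case (Suc i)
    then have "f ((f ^^ i) x) = f ((f ^^ (i + k)) x)" by simp
    then have "(f ^^ i) x = (f ^^ (i + k)) x" using inj_onD[OF assms(2)] im by blast
    then show ?case by (rule Suc.IH)
  qed simp
  then have "(f ^^ (k - 1)) (f x) = x" using k(1) by (cases k) (auto simp: funpow_swap1)
  then show ?thesis by blast
qed

text \<open>Adding a grain at a fixed vertex permutes the finite set \<open>RC K\<close>, so each
  step of the chain is undone by repeating it often enough.\<close>

lemma accessible_RC:
  assumes K: "finite K" "K \<noteq> {}" and \<eta>: "\<eta> \<in> RC K" and a: "(\<eta>, \<eta>') \<in> accessible G K"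
  shows "\<eta>' \<in> RC K \<and> (\<eta>', \<eta>) \<in> accessible G K"
  using a K(1)
proof (induction rule: accessible_induct)
  case refl
  then show ?case using \<eta> by (simp add: accessible_def)
next
  case (step \<zeta> x)
  let ?f = "\<lambda>\<eta>. st K (padd \<eta> (dl x 1))"
  have im: "?f \<xi> \<in> RC K" if "\<xi> \<in> RC K" for \<xi> by (rule RC_add[OF K(1) that]) (use step in \<open>auto simp: dl_def\<close>)
  then obtain n where n: "(?f ^^ n) (?f \<zeta>) = \<zeta>"
    using cycle_of_inj[OF finite_RC[OF K(1)] inj_on_add_grain[OF K(1) step.hyps(2)], of \<zeta>] step by blast
  have "(\<xi>, (?f ^^ n) \<xi>) \<in> accessible G K" for n \<xi>
  proof (induction n)
    case (Suc n)
    then show ?case using accessible_step[OF K(1) step.hyps(2), of "(?f ^^ n) \<xi>"]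
      unfolding accessible_def by simp
  qed (simp add: accessible_def)
  then have "(?f \<zeta>, \<zeta>) \<in> accessible G K" using n by metis
  then show ?case using step im unfolding accessible_def by (meson rtrancl_trans)
qed (rule K)

text \<open>The maximal configuration is accessible from every stable one, so it lies in each closed
  class; the configurations accessible from it are exactly those of \<open>RC K\<close>.\<close>

theorem recurrent_eq_RC:
  assumes K: "finite K" "K \<noteq> {}" shows "recurrent G K = RC K"
proof -
  have sub: "RC K \<subseteq> stable_sandpiles G K" by (auto simp: RC_def stable_sandpiles_def)
  have from_max: "(maxc K, \<eta>) \<in> accessible G K \<longleftrightarrow> \<eta> \<in> RC K" for \<eta>
    using accessible_RC[OF K maxc_RC[OF K(1)]] accessible_RC[OF K _ accessible_maxc[OF K(1)]] sub by blast
  have iff: "(\<eta>, \<eta>') \<in> accessible G K \<longleftrightarrow> \<eta>' \<in> RC K" if "\<eta> \<in> RC K" for \<eta> \<eta>'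
  proof
    assume "\<eta>' \<in> RC K"
    then have "(\<eta>, maxc K) \<in> accessible G K" "(maxc K, \<eta>') \<in> accessible G K"
      using accessible_maxc[OF K(1)] that sub from_max by auto
    then show "(\<eta>, \<eta>') \<in> accessible G K" unfolding accessible_def by (rule rtrancl_trans)
  qed (use accessible_RC[OF K that] in blast)
  have "closed_communicating_class G K (RC K)"
    using maxc_RC[OF K(1)] sub iff by (auto simp: closed_communicating_class_def)
  moreover have "C = RC K" if C: "closed_communicating_class G K C" for C
  proof -
    obtain \<eta> where \<eta>: "\<eta> \<in> C" "\<eta> \<in> stable_sandpiles G K" using C by (auto simp: closed_communicating_class_def)
    then have "maxc K \<in> C" using accessible_maxc[OF K(1)] C unfolding closed_communicating_class_def by blast
    then show ?thesis using from_max C unfolding closed_communicating_class_def by blast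
  qed
  ultimately show ?thesis unfolding recurrent_def by blast
qed

end

context tgraph
begin

section \<open>Recurrent configurations and forests\<close>

definition DG :: "'a set \<Rightarrow> real" where "DG K = (\<Prod>x\<in>K. dg x)"

lemma confs_eq_RC:
  assumes K: "finite K" and B: "finite B" "B \<inter> K = {}"
  defines "U \<equiv> K \<union> (\<Union>x\<in>K. N x) \<union> B"
  shows "confs (\<lambda>x y. count (G x) y) U K B A = {\<xi> \<in> RC K. bt G K B \<xi> = A}"
proof -
  have U: "finite U" using K B by (auto simp: U_def)
  have d: "(\<Sum>y\<in>U. count (G x) y) = deg G x" if "x \<in> K" for x
    using that U by (intro deg_eq_sum) (auto simp: U_def)
  have b1: "burnt (\<lambda>x y. count (G x) y) (\<lambda>x. \<Sum>y\<in>U. count (G x) y) K B' \<xi> = bt G K B' \<xi>" for B' \<xi>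
    by (rule burnt_cong) (auto simp: closed_burn_def d)
  have b2: "bt G K (U - K) \<xi> = bt G K (roots K) \<xi>" for \<xi>
  proof (rule burnt_cong)
    fix A'
    have "(\<Sum>y\<in>U - K \<union> A'. count (G x) y) = (\<Sum>y\<in>roots K \<union> A'. count (G x) y)" if "x \<in> K" "A' \<subseteq> K" for x
      using that U K finite_subset[OF that(2) K]
      by (intro sum.mono_neutral_right) (auto simp: U_def roots_def not_in_iff)
    then show "closed_burn (\<lambda>x y. count (G x) y) (deg G) K (U - K) \<xi> A' \<longleftrightarrow> closed_burn (\<lambda>x y. count (G x) y) (deg G) K (roots K) \<xi> A'"
      by (auto simp: closed_burn_def)
  qed
  show ?thesis unfolding confs_def RC_def b1 b2 stable_def using d by auto
qed

lemma fsum_eq_EF: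
  assumes K: "finite K" and B: "finite B" "B \<inter> K = {}"
  defines "U \<equiv> K \<union> (\<Union>x\<in>K. N x) \<union> B"
  shows "real (fsum (\<lambda>x y. count (G x) y) U K B A) = DG K * Z K * EF K (\<lambda>F. of_bool ({x \<in> K. root K F x \<in> B} = A))"
proof -
  have U: "finite U" using K B by (auto simp: U_def)
  let ?P = "\<lambda>F. {x \<in> K. root K F x \<in> B} = A"
  have "real (fsum (\<lambda>x y. count (G x) y) U K B A) = (\<Sum>F\<in>{F \<in> PiE K (\<lambda>_. U). acyc K F \<and> ?P F}. \<Prod>x\<in>K. real (count (G x) (F x)))"
    by (simp add: fsum_def)
  also have "\<dots> = (\<Sum>F\<in>forests K. DG K * (wt K F * of_bool (?P F)))"
  proof (rule sum.mono_neutral_cong)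
    fix F assume F: "F \<in> {F \<in> PiE K (\<lambda>_. U). acyc K F \<and> ?P F} - forests K"
    then obtain x where "x \<in> K" "F x \<notin> N x" by (auto simp: forests_def PiE_iff)
    then show "(\<Prod>x\<in>K. real (count (G x) (F x))) = 0" using K by (auto simp: not_in_iff prod_zero_iff)
  next
    fix F assume F: "F \<in> forests K - {F \<in> PiE K (\<lambda>_. U). acyc K F \<and> ?P F}"
    then have "F \<in> PiE K (\<lambda>_. U)" by (auto simp: forests_def PiE_iff U_def)
    then have "\<not> ?P F" using F by (auto simp: forests_def)
    then show "DG K * (wt K F * of_bool (?P F)) = 0" by simp
  next
    fix F assume F: "F \<in> {F \<in> PiE K (\<lambda>_. U). acyc K F \<and> ?P F} \<inter> forests K"
    then show "(\<Prod>x\<in>K. real (count (G x) (F x))) = DG K * (wt K F * of_bool (?P F))"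
      by (simp add: DG_def wt_def prod.distrib[symmetric] dg_p)
  qed (use K U in \<open>auto intro!: finite_PiE simp: finite_forests\<close>)
  also have "\<dots> = DG K * Z K * EF K (\<lambda>F. of_bool (?P F))"
    unfolding EF_def sum_distrib_left[symmetric] using Z_pos[OF K] by simp
  finally show ?thesis .
qed

text \<open>Under the uniform law on \<open>RC K\<close>, the set burnt from \<open>B\<close> has
  the law of the union of the forest components rooted in \<open>B\<close>. For constant
  \<open>\<phi>\<close> this is the matrix-tree count of recurrent configurations.\<close>

lemma sum_RC:
  assumes K: "finite K" and B: "finite B" "B \<inter> K = {}"
  shows "(\<Sum>\<xi>\<in>RC K. \<phi> (bt G K B \<xi>)) = DG K * Z K * EF K (\<lambda>F. \<phi> {x \<in> K. root K F x \<in> B})"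
proof -
  let ?U = "K \<union> (\<Union>x\<in>K. N x) \<union> B"
  have c: "real (card {\<xi> \<in> RC K. bt G K B \<xi> = A}) = DG K * Z K * EF K (\<lambda>F. of_bool ({x \<in> K. root K F x \<in> B} = A))" for A
    unfolding confs_eq_RC[OF K B, symmetric] fsum_eq_EF[OF K B, symmetric]
    using K B by (subst card_confs) auto
  have sel: "\<phi> A0 = (\<Sum>A\<in>Pow K. of_bool (A0 = A) * \<phi> A)" if "A0 \<subseteq> K" for A0
    using that K sum_of_bool_eq[of "Pow K" A0 \<phi>] by simp
  have "(\<Sum>\<xi>\<in>RC K. \<phi> (bt G K B \<xi>)) = (\<Sum>\<xi>\<in>RC K. \<Sum>A\<in>Pow K. of_bool (bt G K B \<xi> = A) * \<phi> A)"
    by (intro sum.cong refl sel burnt_sub)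
  also have "\<dots> = (\<Sum>A\<in>Pow K. real (card {\<xi> \<in> RC K. bt G K B \<xi> = A}) * \<phi> A)"
    by (subst sum.swap) (simp add: sum_distrib_right[symmetric] finite_RC[OF K] of_bool_def sum.If_cases Int_def)
  also have "\<dots> = DG K * Z K * (\<Sum>A\<in>Pow K. EF K (\<lambda>F. of_bool ({x \<in> K. root K F x \<in> B} = A) * \<phi> A))"
    unfolding c EF_cmult2 sum_distrib_left by (intro sum.cong refl) (simp only: mult_ac)
  also have "\<dots> = DG K * Z K * EF K (\<lambda>F. \<phi> {x \<in> K. root K F x \<in> B})"
    unfolding EF_sum[symmetric] by (intro arg_cong2[where f = "(*)"] refl EF_cong sel[symmetric]) auto
  finally show ?thesis .
qed

lemma card_RC: "finite K \<Longrightarrow> real (card (RC K)) = DG K * Z K"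
  using sum_RC[of K "{}" "\<lambda>_. 1"] by (simp add: EF_const)

lemma card_RC_pos: "finite K \<Longrightarrow> card (RC K) > 0"
  using maxc_RC finite_RC by (auto simp: card_gt_0_iff)

lemma card_RC_minus:
  assumes K: "finite K" "v \<in> K"
  shows "DG (K - {v}) * Z (K - {v}) = real (card (RC K)) * (pot K (\<lambda>z. of_bool (z = v)) v / dg v)"
proof -
  have "DG K = dg v * DG (K - {v})" unfolding DG_def by (rule prod.remove[OF K])
  then show ?thesis using deg_pos[of v] by (simp add: card_RC K Z_minus)
qed

section \<open>Waves\<close>

text \<open>
  The avalanche started at \<open>v\<close> is decomposed into waves. Before a wave, \<open>v\<close> is the only unstable
  vertex and has exactly \<open>deg G v\<close> grains; the configuration off \<open>v\<close> is \<open>\<xi>\<close>, the vertices that topple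
  together with \<open>v\<close> are \<open>wv K v \<xi>\<close>, and the wave leads to \<open>wstep K v \<xi>\<close> off \<open>v\<close> and to \<open>wval K v \<xi>\<close> at \<open>v\<close>.
\<close>

definition wv :: "'a set \<Rightarrow> 'a \<Rightarrow> ('a \<Rightarrow> nat) \<Rightarrow> 'a set" where
  "wv K v \<xi> = bt G (K - {v}) {v} \<xi>"

definition wstep :: "'a set \<Rightarrow> 'a \<Rightarrow> ('a \<Rightarrow> nat) \<Rightarrow> 'a \<Rightarrow> nat" where
  "wstep K v \<xi> = st (K - {v}) (padd \<xi> (bsum G (K - {v}) {v}))"

definition wval :: "'a set \<Rightarrow> 'a \<Rightarrow> ('a \<Rightarrow> nat) \<Rightarrow> nat" where
  "wval K v \<xi> = (\<Sum>y\<in>wv K v \<xi>. count (G v) y)"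

definition off_stable :: "'a set \<Rightarrow> ('a \<Rightarrow> nat) \<Rightarrow> bool" where
  "off_stable K \<xi> \<longleftrightarrow> stable G K \<xi> \<and> (\<forall>x. x \<notin> K \<longrightarrow> \<xi> x = 0)"

lemma wv_sub: "wv K v \<xi> \<subseteq> K - {v}" unfolding wv_def by (rule burnt_sub)

lemma wval_le:
  assumes "finite K" shows "wval K v \<xi> \<le> deg G v"
proof -
  have f: "finite (wv K v \<xi>)" using wv_sub assms finite_subset by (metis finite_Diff)
  have "wval K v \<xi> \<le> (\<Sum>y\<in>wv K v \<xi> \<union> N v. count (G v) y)" unfolding wval_def using f by (intro sum_mono2) auto
  also have "\<dots> = deg G v" using f by (intro deg_eq_sum) auto
  finally show ?thesis .
qed

lemma wstep_off_stable:
  assumes "finite K" "off_stable (K - {v}) \<xi>" shows "off_stable (K - {v}) (wstep K v \<xi>)"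
proof -
  have f: "finite (K - {v})" using assms by auto
  have "wstep K v \<xi> x = 0" if "x \<notin> K - {v}" for x
    using st_off[OF f that] assms(2) that unfolding wstep_def by (auto simp: padd_def bsum_def off_stable_def)
  then show ?thesis using st_stable[OF f] by (auto simp: off_stable_def wstep_def)
qed

text \<open>Once \<open>v\<close> has toppled, the rest of the wave is a fire with source
  \<open>v\<close>, in which each vertex topples at most once and sends its grains back to
  \<open>v\<close>.\<close>

lemma wave_list:
  assumes K: "finite K" and v: "v \<in> K" and \<xi>: "off_stable (K - {v}) \<xi>"
  shows "\<exists>ys. legal G K (padd \<xi> (dl v (deg G v))) ys \<and>
    fold (tp K) ys (padd \<xi> (dl v (deg G v))) = padd (wstep K v \<xi>) (dl v (wval K v \<xi>)) \<and>
    (\<forall>u. count_list ys u = of_bool (u = v) + of_bool (u \<in> wv K v \<xi>))"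
proof -
  let ?K = "K - {v}" and ?\<eta> = "padd \<xi> (dl v (deg G v))"
  have f: "finite ?K" "finite {v}" "{v} \<inter> ?K = {}" using K by auto
  obtain xs where xs: "legal G ?K (padd \<xi> (bsum G ?K {v})) xs" "distinct xs" "set xs = wv K v \<xi>"
    "stable G ?K (fold (tp ?K) xs (padd \<xi> (bsum G ?K {v})))"
    using burn_list[OF f, of \<xi>] \<xi> by (auto simp: off_stable_def wv_def)
  let ?\<eta>1 = "tp K v ?\<eta>"
  have ag: "padd \<xi> (bsum G ?K {v}) x = ?\<eta>1 x" if "x \<in> ?K" for x
    using that by (auto simp: padd_def bsum_def topple_def dl_def count_sym[of x v])
  have sx: "set xs \<subseteq> ?K" using xs wv_sub by metis
  note tr = legal_transfer[where K' = ?K and K = K and \<eta> = "padd \<xi> (bsum G ?K {v})" and \<eta>' = ?\<eta>1 and xs = xs and G = G, OF _ ag sx]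
  have l1: "legal G K ?\<eta>1 xs" using tr(1) xs(1) by auto
  have l: "legal G K ?\<eta> (v # xs)" using l1 v by (auto simp: padd_def dl_def)
  have ws: "wstep K v \<xi> = fold (tp ?K) xs (padd \<xi> (bsum G ?K {v}))"
    unfolding wstep_def by (rule stabilizationI[OF xs(1,4)])
  have "fold (tp K) (v # xs) ?\<eta> x = padd (wstep K v \<xi>) (dl v (wval K v \<xi>)) x" for x
  proof -
    consider "x \<in> ?K" | "x = v" | "x \<notin> K" using v by blast
    then show ?thesis
    proof cases
      case 1
      have "fold (tp ?K) xs (padd \<xi> (bsum G ?K {v})) x = fold (tp K) xs ?\<eta>1 x" by (rule tr(2)) (use 1 in auto)
      moreover have "padd (wstep K v \<xi>) (dl v (wval K v \<xi>)) x = wstep K v \<xi> x" using 1 by (simp add: padd_def dl_def)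
      ultimately show ?thesis using ws by simp
    next
      case 2
      have "\<xi> v = 0" using \<xi> by (auto simp: off_stable_def)
      then have "?\<eta>1 v = 0" by (auto simp: topple_def padd_def dl_def)
      moreover have "count_list xs v = 0" using sx by (auto simp: count_list_0_iff)
      moreover have "(\<Sum>y\<leftarrow>xs. count (G y) v) = wval K v \<xi>"
        using xs(2,3) by (simp add: sum_list_distinct_conv_sum_set wval_def count_sym[of _ v])
      ultimately have "fold (tp K) xs ?\<eta>1 v = wval K v \<xi>" using fold_value[OF l1 v] by simp
      moreover have "wstep K v \<xi> v = 0" using wstep_off_stable[OF K \<xi>] by (auto simp: off_stable_def)
      ultimately show ?thesis using 2 by (simp add: padd_def dl_def)
    next
      case 3
      have "fold (tp K) (v # xs) ?\<eta> x = ?\<eta> x" by (rule fold_topple_off[OF legal_set[OF l] 3])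
      moreover have "\<xi> x = 0" "wstep K v \<xi> x = 0" using wstep_off_stable[OF K \<xi>] \<xi> 3 by (auto simp: off_stable_def)
      ultimately show ?thesis using 3 v by (auto simp: padd_def dl_def)
    qed
  qed
  then have "fold (tp K) (v # xs) ?\<eta> = padd (wstep K v \<xi>) (dl v (wval K v \<xi>))" by blast
  moreover have "count_list (v # xs) u = of_bool (u = v) + of_bool (u \<in> wv K v \<xi>)" for u
    using xs(2,3) sx by (auto simp: count_list_distinct)
  ultimately show ?thesis using l by blast
qed

definition wit :: "'a set \<Rightarrow> 'a \<Rightarrow> nat \<Rightarrow> ('a \<Rightarrow> nat) \<Rightarrow> 'a \<Rightarrow> nat" where
  "wit K v i \<xi> = (wstep K v ^^ i) \<xi>"

lemma wit_0[simp]: "wit K v 0 \<xi> = \<xi>" and wit_Suc: "wit K v (Suc i) \<xi> = wstep K v (wit K v i \<xi>)"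
  by (simp_all add: wit_def)

lemma wit_add: "wit K v (i + j) \<xi> = wit K v i (wit K v j \<xi>)" by (simp add: wit_def funpow_add)

lemma wit_off_stable: "finite K \<Longrightarrow> off_stable (K - {v}) \<xi> \<Longrightarrow> off_stable (K - {v}) (wit K v i \<xi>)"
  by (induction i) (auto simp: wit_Suc intro: wstep_off_stable)

lemma waves_list:
  assumes K: "finite K" and v: "v \<in> K" and \<xi>: "off_stable (K - {v}) \<xi>"
  shows "(\<And>j. j < i \<Longrightarrow> wval K v (wit K v j \<xi>) = deg G v) \<Longrightarrow> \<exists>xs. legal G K (padd \<xi> (dl v (deg G v))) xs \<and>
    fold (tp K) xs (padd \<xi> (dl v (deg G v))) = padd (wit K v i \<xi>) (dl v (deg G v)) \<and>
    (\<forall>u. count_list xs u = (\<Sum>j<i. of_bool (u = v) + of_bool (u \<in> wv K v (wit K v j \<xi>))))"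
proof (induction i)
  case 0
  show ?case by (intro exI[of _ "[]"]) auto
next
  case (Suc i)
  then obtain xs where xs: "legal G K (padd \<xi> (dl v (deg G v))) xs"
    "fold (tp K) xs (padd \<xi> (dl v (deg G v))) = padd (wit K v i \<xi>) (dl v (deg G v))"
    "\<And>u. count_list xs u = (\<Sum>j<i. of_bool (u = v) + of_bool (u \<in> wv K v (wit K v j \<xi>)))" by fastforce
  obtain ys where ys: "legal G K (padd (wit K v i \<xi>) (dl v (deg G v))) ys"
    "fold (tp K) ys (padd (wit K v i \<xi>) (dl v (deg G v))) = padd (wstep K v (wit K v i \<xi>)) (dl v (wval K v (wit K v i \<xi>)))"
    "\<And>u. count_list ys u = of_bool (u = v) + of_bool (u \<in> wv K v (wit K v i \<xi>))"
    using wave_list[OF K v wit_off_stable[OF K \<xi>]] by metis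
  show ?case
    by (intro exI[of _ "xs @ ys"]) (use xs ys Suc.prems[of i] in \<open>auto simp: legal_append wit_Suc count_list_append\<close>)
qed

text \<open>Waves are numbered from 0 and this is the number of the last one: the first that does
  not return \<open>deg G v\<close> grains to \<open>v\<close>. There are
  \<open>nw K v \<xi> + 1\<close> waves.\<close>

definition nw :: "'a set \<Rightarrow> 'a \<Rightarrow> ('a \<Rightarrow> nat) \<Rightarrow> nat" where
  "nw K v \<xi> = (LEAST i. wval K v (wit K v i \<xi>) < deg G v)"

lemma nw_props:
  assumes K: "finite K" and v: "v \<in> K" and \<xi>: "off_stable (K - {v}) \<xi>"
  shows "wval K v (wit K v (nw K v \<xi>) \<xi>) < deg G v"
    and "j < nw K v \<xi> \<Longrightarrow> wval K v (wit K v j \<xi>) = deg G v"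
proof -
  have "\<exists>i. wval K v (wit K v i \<xi>) < deg G v"
  proof (rule ccontr)
    assume "\<nexists>i. wval K v (wit K v i \<xi>) < deg G v"
    then have eq: "wval K v (wit K v i \<xi>) = deg G v" for i using wval_le[OF K] by (meson le_neq_implies_less)
    define b where "b = nat \<lceil>\<Sum>x\<in>K. pot K (\<lambda>_. 1) x * real (padd \<xi> (dl v (deg G v)) x)\<rceil>"
    obtain xs where xs: "legal G K (padd \<xi> (dl v (deg G v))) xs"
      "count_list xs v = (\<Sum>j<Suc b. of_bool (v = v) + of_bool (v \<in> wv K v (wit K v j \<xi>)))"
      using waves_list[OF K v \<xi>, of "Suc b"] eq by metis
    have "(\<Sum>j<Suc b. 1) \<le> count_list xs v" unfolding xs(2) by (intro sum_mono) simp
    also have "\<dots> \<le> length xs" by (rule count_le_length)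
    finally show False using legal_length[OF K xs(1)] by (simp add: b_def) linarith
  qed
  then show "wval K v (wit K v (nw K v \<xi>) \<xi>) < deg G v" unfolding nw_def by (rule LeastI_ex)
  show "wval K v (wit K v j \<xi>) = deg G v" if "j < nw K v \<xi>"
    using not_less_Least[OF that[unfolded nw_def]] wval_le[OF K] by (meson le_neq_implies_less)
qed

definition wset :: "'a set \<Rightarrow> 'a \<Rightarrow> ('a \<Rightarrow> nat) \<Rightarrow> ('a \<Rightarrow> nat) set" where
  "wset K v \<xi> = (\<lambda>j. wit K v j \<xi>) ` {..nw K v \<xi>}"

text \<open>A repetition would make the configuration of the last wave occur at an earlier index,
  where \<open>v\<close> still gets all of its grains back.\<close>

lemma wit_inj:
  assumes K: "finite K" and v: "v \<in> K" and \<xi>: "off_stable (K - {v}) \<xi>"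
  shows "inj_on (\<lambda>j. wit K v j \<xi>) {..nw K v \<xi>}"
proof -
  have "False" if "i < j" "j \<le> nw K v \<xi>" "wit K v i \<xi> = wit K v j \<xi>" for i j
  proof -
    let ?k = "nw K v \<xi> - j"
    have "wit K v (?k + i) \<xi> = wit K v (?k + j) \<xi>" unfolding wit_add that(3) ..
    then have "wit K v (?k + i) \<xi> = wit K v (nw K v \<xi>) \<xi>" using that by simp
    moreover have "?k + i < nw K v \<xi>" using that by linarith
    ultimately show False using nw_props(1)[OF K v \<xi>] nw_props(2)[OF K v \<xi>, of "?k + i"] by simp
  qed
  then show ?thesis unfolding inj_on_def by (metis atMost_iff linorder_neqE_nat)
qed

lemma avalanche_list:
  assumes K: "finite K" and v: "v \<in> K" and \<xi>: "off_stable (K - {v}) \<xi>"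
  shows "\<exists>xs. legal G K (padd \<xi> (dl v (deg G v))) xs \<and> stable G K (fold (tp K) xs (padd \<xi> (dl v (deg G v)))) \<and>
    (\<forall>x\<in>K - {v}. fold (tp K) xs (padd \<xi> (dl v (deg G v))) x = wstep K v (wit K v (nw K v \<xi>) \<xi>) x) \<and>
    (\<forall>u. count_list xs u = (\<Sum>\<zeta>\<in>wset K v \<xi>. of_bool (u = v) + of_bool (u \<in> wv K v \<zeta>)))"
proof -
  let ?n = "nw K v \<xi>" and ?d = "dl v (deg G v)"
  obtain xs where xs: "legal G K (padd \<xi> ?d) xs" "fold (tp K) xs (padd \<xi> ?d) = padd (wit K v ?n \<xi>) ?d"
    "\<And>u. count_list xs u = (\<Sum>j<?n. of_bool (u = v) + of_bool (u \<in> wv K v (wit K v j \<xi>)))"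
    using waves_list[OF K v \<xi>, of ?n] nw_props(2)[OF K v \<xi>] by metis
  obtain ys where ys: "legal G K (padd (wit K v ?n \<xi>) ?d) ys"
    "fold (tp K) ys (padd (wit K v ?n \<xi>) ?d) = padd (wstep K v (wit K v ?n \<xi>)) (dl v (wval K v (wit K v ?n \<xi>)))"
    "\<And>u. count_list ys u = of_bool (u = v) + of_bool (u \<in> wv K v (wit K v ?n \<xi>))"
    using wave_list[OF K v wit_off_stable[OF K \<xi>]] by metis
  have os: "off_stable (K - {v}) (wstep K v (wit K v ?n \<xi>))" by (intro wstep_off_stable wit_off_stable K \<xi>)
  have st: "stable G K (padd (wstep K v (wit K v ?n \<xi>)) (dl v (wval K v (wit K v ?n \<xi>))))"
    using os nw_props(1)[OF K v \<xi>] by (auto simp: stable_def off_stable_def padd_def dl_def)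
  have e: "(\<Sum>\<zeta>\<in>wset K v \<xi>. of_bool (u = v) + of_bool (u \<in> wv K v \<zeta>)) =
    (\<Sum>j\<le>?n. of_bool (u = v) + of_bool (u \<in> wv K v (wit K v j \<xi>)) :: nat)" for u
    unfolding wset_def by (subst sum.reindex[OF wit_inj[OF K v \<xi>]]) simp
  have "count_list (xs @ ys) u = (\<Sum>\<zeta>\<in>wset K v \<xi>. of_bool (u = v) + of_bool (u \<in> wv K v \<zeta>))" for u
    by (simp only: e count_list_append xs(3) ys(3) lessThan_Suc_atMost[symmetric] sum.lessThan_Suc)
  then show ?thesis
    by (intro exI[of _ "xs @ ys"]) (use xs ys st in \<open>auto simp: legal_append padd_def dl_def\<close>)
qed

lemma finite_wset: "finite (wset K v \<xi>)" by (simp add: wset_def)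

lemma RC_off_stable: "\<xi> \<in> RC K \<Longrightarrow> off_stable K \<xi>" by (simp add: RC_def off_stable_def)

text \<open>With \<open>v\<close> outside the set, the fire starts with \<open>v\<close> already
  burnt and so consumes at least what it consumed before.\<close>

lemma remove_RC:
  assumes K: "finite K" and v: "v \<in> K" and \<eta>: "\<eta> \<in> RC K"
  shows "\<eta>(v := 0) \<in> RC (K - {v})"
proof -
  let ?K = "K - {v}"
  have "A = ?K" if A: "closed_burn (\<lambda>x y. count (G x) y) (deg G) ?K (roots ?K) (\<eta>(v := 0)) A" for A
  proof -
    have fA: "finite A" "A \<subseteq> ?K" using A K finite_subset by (auto simp: closed_burn_def)
    have "closed_burn (\<lambda>x y. count (G x) y) (deg G) K (roots K) \<eta> (insert v A)"
      unfolding closed_burn_def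
    proof (intro conjI ballI)
      show "insert v A \<subseteq> K" using fA v by auto
      fix x assume x: "x \<in> K - insert v A"
      have fr: "finite (roots ?K \<union> A)" using fA finite_roots K by auto
      have "(\<Sum>y\<in>roots K \<union> insert v A. count (G x) y) = (\<Sum>y\<in>(roots K \<union> insert v A) \<inter> N x. count (G x) y)"
        using fA finite_roots[OF K] by (intro sum.mono_neutral_right) (auto simp: not_in_iff)
      also have "\<dots> \<le> (\<Sum>y\<in>roots ?K \<union> A. count (G x) y)"
        using fr x by (intro sum_mono2) (auto simp: roots_def)
      finally show "\<eta> x + (\<Sum>y\<in>roots K \<union> insert v A. count (G x) y) < deg G x"
        using A x by (force simp: closed_burn_def)
    qed
    then have "bt G K (roots K) \<eta> \<subseteq> insert v A" by (rule burnt_least)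
    moreover have "bt G K (roots K) \<eta> = K" using \<eta> by (auto simp: RC_def)
    ultimately show ?thesis using fA by auto
  qed
  then have "bt G ?K (roots ?K) (\<eta>(v := 0)) = ?K" using closed_burnt[of ?K "roots ?K"] K finite_roots[of ?K] by simp
  then show ?thesis using \<eta> by (auto simp: RC_def stable_def)
qed

lemma wit_RC:
  assumes K: "finite K" and \<xi>: "\<xi> \<in> RC (K - {v})" shows "wit K v i \<xi> \<in> RC (K - {v})"
proof (induction i)
  case (Suc i)
  show ?case unfolding wit_Suc wstep_def by (rule RC_add[OF _ Suc]) (use K in \<open>auto simp: bsum_def\<close>)
qed (simp add: \<xi>)

lemma grain_eq:
  assumes "\<eta> v = deg G v - 1" shows "padd \<eta> (dl v 1) = padd (\<eta>(v := 0)) (dl v (deg G v))"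
  using assms deg_pos[of v] by (auto simp: padd_def dl_def fun_eq_iff)

text \<open>Continuing from any of its waves leads to the result of the whole avalanche; so a wave
  knows the outcome.\<close>

lemma wset_st:
  assumes K: "finite K" and v: "v \<in> K" and \<eta>: "\<eta> \<in> RC K" "\<eta> v = deg G v - 1" and \<xi>: "\<xi> \<in> wset K v (\<eta>(v := 0))"
  shows "st K (padd \<xi> (dl v (deg G v))) = st K (padd \<eta> (dl v 1))"
proof -
  let ?\<xi> = "\<eta>(v := 0)"
  have os: "off_stable (K - {v}) ?\<xi>" using remove_RC[OF K v \<eta>(1)] RC_off_stable by blast
  obtain j where j: "\<xi> = wit K v j ?\<xi>" "j \<le> nw K v ?\<xi>" using \<xi> by (auto simp: wset_def)
  obtain xs where xs: "legal G K (padd ?\<xi> (dl v (deg G v))) xs"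
    "fold (tp K) xs (padd ?\<xi> (dl v (deg G v))) = padd (wit K v j ?\<xi>) (dl v (deg G v))"
    using waves_list[OF K v os, of j] nw_props(2)[OF K v os] j by (metis order_less_le_trans)
  show ?thesis unfolding j(1) grain_eq[where \<eta> = \<eta> and v = v, OF \<eta>(2)] using st_legal[OF K xs(1)] xs(2) by simp
qed

definition active :: "'a set \<Rightarrow> 'a \<Rightarrow> ('a \<Rightarrow> nat) set" where
  "active K v = {\<eta> \<in> RC K. \<eta> v = deg G v - 1}"

text \<open>Adding a grain is injective on \<open>RC K\<close>, so by \<open>wset_st\<close>
  different configurations share no wave, and counting waves is counting recurrent configurations
  off \<open>v\<close>.\<close>

lemma sum_waves_le:
  fixes \<phi> :: "('a \<Rightarrow> nat) \<Rightarrow> real"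
  assumes K: "finite K" and v: "v \<in> K" and \<phi>: "\<And>\<xi>. 0 \<le> \<phi> \<xi>"
  shows "(\<Sum>\<eta>\<in>active K v. \<Sum>\<xi>\<in>wset K v (\<eta>(v := 0)). \<phi> \<xi>) \<le> (\<Sum>\<xi>\<in>RC (K - {v}). \<phi> \<xi>)"
proof -
  have disj: "wset K v (\<eta>(v := 0)) \<inter> wset K v (\<eta>'(v := 0)) = {}"
    if "\<eta> \<in> active K v" "\<eta>' \<in> active K v" "\<eta> \<noteq> \<eta>'" for \<eta> \<eta>'
  proof (rule ccontr)
    assume "wset K v (\<eta>(v := 0)) \<inter> wset K v (\<eta>'(v := 0)) \<noteq> {}"
    then obtain \<xi> where "\<xi> \<in> wset K v (\<eta>(v := 0))" "\<xi> \<in> wset K v (\<eta>'(v := 0))" by blast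
    then have "st K (padd \<eta> (dl v 1)) = st K (padd \<eta>' (dl v 1))"
      using wset_st[OF K v, of \<eta> \<xi>] wset_st[OF K v, of \<eta>' \<xi>] that by (auto simp: active_def)
    then show False using inj_onD[OF inj_on_add_grain[OF K v]] that by (auto simp: active_def)
  qed
  have "(\<Sum>\<eta>\<in>active K v. \<Sum>\<xi>\<in>wset K v (\<eta>(v := 0)). \<phi> \<xi>) = (\<Sum>\<xi>\<in>(\<Union>\<eta>\<in>active K v. wset K v (\<eta>(v := 0))). \<phi> \<xi>)"
    using disj finite_RC[OF K] finite_wset by (intro sum.UNION_disjoint[symmetric]) (auto simp: active_def)
  also have "\<dots> \<le> (\<Sum>\<xi>\<in>RC (K - {v}). \<phi> \<xi>)"
    using finite_RC K \<phi> wit_RC[OF K remove_RC[OF K v]] by (intro sum_mono2) (auto simp: active_def wset_def)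
  finally show ?thesis .
qed

text \<open>
  A configuration whose wave misses a neighbour of \<open>v\<close> is the last wave of some recurrent configuration:
  the result of the wave is recurrent, as can be seen by burning first the complement of the wave, then
  \<open>v\<close>, and then the wave.
\<close>

lemma last_wave_RC:
  assumes K: "finite K" and v: "v \<in> K" and \<xi>: "\<xi> \<in> RC (K - {v})" and h: "wval K v \<xi> < deg G v"
  shows "padd (wstep K v \<xi>) (dl v (wval K v \<xi>)) \<in> RC K"
    and "\<eta> \<in> RC K \<Longrightarrow> padd \<eta> (dl v 1) \<noteq> padd (wstep K v \<xi>) (dl v (wval K v \<xi>))"
proof -
  let ?K = "K - {v}" and ?A0 = "wv K v \<xi>" and ?\<zeta> = "padd (wstep K v \<xi>) (dl v (wval K v \<xi>))"
  let ?c = "\<lambda>x S. \<Sum>y\<in>S. count (G x) y"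
  let ?R = "roots K" and ?C = "K - {v} - wv K v \<xi>"
  have f: "finite ?K" "finite {v}" "{v} \<inter> ?K = {}" "finite ?R" "?R \<inter> K = {}" using K finite_roots[OF K] by (auto simp: roots_def)
  have A0: "?A0 \<subseteq> ?K" "finite ?A0" using wv_sub K finite_subset by (blast, metis finite_Diff wv_sub finite_subset)
  have os: "off_stable ?K \<xi>" using RC_off_stable[OF \<xi>] .
  have osw: "off_stable ?K (wstep K v \<xi>)" by (rule wstep_off_stable[OF K os])
  have val: "wstep K v \<xi> x + of_bool (x \<in> ?A0) * deg G x = \<xi> x + ?c x ({v} \<union> ?A0)" if "x \<in> ?K" for x
    using stab_burn[OF f(1-3) _ that, of \<xi>] os by (auto simp: off_stable_def wv_def wstep_def)
  have zv: "?\<zeta> v = wval K v \<xi>" and zx: "x \<in> ?K \<Longrightarrow> ?\<zeta> x = wstep K v \<xi> x" for x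
    using osw by (auto simp: padd_def dl_def off_stable_def)
  have all: "?c x ({v} \<union> ?A0) + ?c x (?R \<union> ?C) = deg G x" if "x \<in> K" for x
  proof -
    have "?c x ({v} \<union> ?A0) + ?c x (?R \<union> ?C) = ?c x (({v} \<union> ?A0) \<union> (?R \<union> ?C))"
      using A0 f v by (intro sum.union_disjoint[symmetric]) auto
    also have "\<dots> = deg G x" using A0 f that v by (intro deg_eq_sum) (auto simp: roots_def)
    finally show ?thesis .
  qed
  have cv: "?c v ({v} \<union> ?A0) = wval K v \<xi>"
  proof -
    have "v \<notin> ?A0" using A0 by auto
    then show ?thesis using A0 by (simp add: wval_def count_self)
  qed
  have mono: "?c x S \<le> ?c x T" if "S \<subseteq> T" "finite T" for x S T using that by (intro sum_mono2) auto
  have un: "?c x (S \<union> T) \<le> ?c x S + ?c x T" if "finite S" "finite T" for x S T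
    using sum_Un_nat[OF that, of "count (G x)"] by simp
  have "A = K" if A: "closed_burn (\<lambda>x y. count (G x) y) (deg G) K ?R ?\<zeta> A" for A
  proof -
    have AK: "A \<subseteq> K" "finite A" using A K finite_subset by (auto simp: closed_burn_def)
    have cl: "?\<zeta> x + ?c x (?R \<union> A) < deg G x" if "x \<in> K - A" for x using A that by (auto simp: closed_burn_def)
    have 1: "?C \<subseteq> A"
    proof -
      let ?A1 = "?A0 \<union> (A \<inter> ?C)"
      have "closed_burn (\<lambda>x y. count (G x) y) (deg G) ?K (roots ?K) \<xi> ?A1"
        unfolding closed_burn_def
      proof (intro conjI ballI)
        show "?A1 \<subseteq> ?K" using A0 by auto
        fix x assume x: "x \<in> ?K - ?A1"
        have fr: "finite (roots ?K)" using finite_roots[OF f(1)] .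
        have "?c x (roots ?K \<union> ?A1) = ?c x ((roots ?K \<union> ?A1) \<inter> N x)"
          using fr A0 AK by (intro sum.mono_neutral_right) (auto simp: not_in_iff)
        also have "\<dots> \<le> ?c x (({v} \<union> ?A0) \<union> (?R \<union> A))"
          using A0 AK f x by (intro mono) (auto simp: roots_def)
        also have "\<dots> \<le> ?c x ({v} \<union> ?A0) + ?c x (?R \<union> A)" using A0 AK f by (intro un) auto
        finally show "\<xi> x + ?c x (roots ?K \<union> ?A1) < deg G x"
          using val[of x] cl[of x] zx[of x] x by auto
      qed
      then have "bt G ?K (roots ?K) \<xi> \<subseteq> ?A1" by (rule burnt_least)
      then show ?thesis using \<xi> by (auto simp: RC_def)
    qed
    have 2: "v \<in> A"
    proof (rule ccontr)
      assume "v \<notin> A"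
      then have "wval K v \<xi> + ?c v (?R \<union> A) < deg G v" using cl[of v] v zv by simp
      moreover have "?c v (?R \<union> ?C) \<le> ?c v (?R \<union> A)" using 1 AK f by (intro mono) auto
      ultimately show False using all[OF v] cv by linarith
    qed
    have 3: "?A0 \<subseteq> A"
    proof -
      have c0: "closed_burn (\<lambda>x y. count (G x) y) (deg G) ?K {v} \<xi> ?A0"
        using closed_burnt[OF f(1,2)] unfolding wv_def .
      have "closed_burn (\<lambda>x y. count (G x) y) (deg G) ?K {v} \<xi> (A \<inter> ?A0)"
        unfolding closed_burn_def
      proof (intro conjI ballI)
        show "A \<inter> ?A0 \<subseteq> ?K" using A0 by auto
        fix x assume x: "x \<in> ?K - A \<inter> ?A0"
        show "\<xi> x + ?c x ({v} \<union> A \<inter> ?A0) < deg G x"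
        proof (cases "x \<in> ?A0")
          case False
          then have "\<xi> x + ?c x ({v} \<union> ?A0) < deg G x" using c0 x by (auto simp: closed_burn_def)
          moreover have "?c x ({v} \<union> A \<inter> ?A0) \<le> ?c x ({v} \<union> ?A0)" using A0 by (intro mono) auto
          ultimately show ?thesis by linarith
        next
          case True
          then have xA: "x \<in> K - A" "x \<in> ?K" using x by auto
          have "?c x (?R \<union> ?C) + ?c x ({v} \<union> A \<inter> ?A0) = ?c x ((?R \<union> ?C) \<union> ({v} \<union> A \<inter> ?A0))"
            using A0 f v by (intro sum.union_disjoint[symmetric]) auto
          also have "\<dots> \<le> ?c x (?R \<union> A)" using 1 2 AK f by (intro mono) auto
          finally show ?thesis using cl[OF xA(1)] val[OF xA(2)] zx[OF xA(2)] all[of x] True xA by auto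
        qed
      qed
      then have "?A0 \<subseteq> A \<inter> ?A0" unfolding wv_def by (rule burnt_least)
      then show ?thesis by auto
    qed
    show ?thesis using 1 2 3 AK v by blast
  qed
  then have "bt G K ?R ?\<zeta> = K" using closed_burnt[OF K f(4)] by blast
  moreover have "stable G K ?\<zeta>"
    unfolding stable_def
  proof
    fix x assume "x \<in> K"
    then show "?\<zeta> x < deg G x"
      using osw h zv zx[of x] by (cases "x = v") (simp_all add: off_stable_def stable_def)
  qed
  moreover have "?\<zeta> x = 0" if "x \<notin> K" for x using that osw v by (auto simp: padd_def dl_def off_stable_def)
  ultimately show "?\<zeta> \<in> RC K" by (auto simp: RC_def)
  show "padd \<eta> (dl v 1) \<noteq> ?\<zeta>" if \<eta>: "\<eta> \<in> RC K"
  proof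
    assume e: "padd \<eta> (dl v 1) = ?\<zeta>"
    have ev: "\<eta> v + 1 = wval K v \<xi>" using fun_cong[OF e, of v] zv by (simp add: padd_def dl_def)
    have ex: "\<eta> x = wstep K v \<xi> x" if "x \<in> ?K" for x
      using fun_cong[OF e, of x] zx[OF that] that by (simp add: padd_def dl_def)
    \<comment> \<open>With one grain less at \<open>v\<close> the fire is too weak by exactly one
      there, and neither \<open>v\<close> nor the wave ever burns.\<close>
    have "closed_burn (\<lambda>x y. count (G x) y) (deg G) K ?R \<eta> ?C"
      unfolding closed_burn_def
    proof (intro conjI ballI)
      fix x assume x: "x \<in> K - ?C"
      show "\<eta> x + ?c x (?R \<union> ?C) < deg G x"
      proof (cases "x = v")
        case True
        then show ?thesis using ev all[OF v] cv by simp
      next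
        case False
        then have xA: "x \<in> ?A0" "x \<in> ?K" using x by auto
        have "\<xi> x < deg G x" using os xA by (auto simp: off_stable_def stable_def)
        then show ?thesis using val[OF xA(2)] ex[OF xA(2)] all[of x] xA by auto
      qed
    qed auto
    then have "bt G K ?R \<eta> \<subseteq> ?C" by (rule burnt_least)
    then show False using \<eta> v by (auto simp: RC_def)
  qed
qed

text \<open>Adding a grain at \<open>v\<close> is surjective, so the result of the wave comes from
  some \<open>\<eta>\<close>. It cannot arise without a toppling by the second part of
  \<open>last_wave_RC\<close>. The last wave of this avalanche has the same result off
  \<open>v\<close>, and the wave map is injective on recurrent configurations.\<close>

lemma last_wave:
  assumes K: "finite K" and v: "v \<in> K" and \<xi>: "\<xi> \<in> RC (K - {v})" and h: "wval K v \<xi> < deg G v"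
  shows "\<exists>\<eta>\<in>active K v. \<xi> = wit K v (nw K v (\<eta>(v := 0))) (\<eta>(v := 0))"
proof -
  let ?K = "K - {v}" and ?\<zeta> = "padd (wstep K v \<xi>) (dl v (wval K v \<xi>))"
  note lw = last_wave_RC[OF K v \<xi> h]
  obtain \<eta> where \<eta>: "\<eta> \<in> RC K" "st K (padd \<eta> (dl v 1)) = ?\<zeta>"
  proof -
    have "\<exists>\<eta>\<in>RC K. st K (padd \<eta> (dl v 1)) = ?\<zeta>" by (rule surj_add[OF K _ lw(1)]) (use v in \<open>auto simp: dl_def\<close>)
    then show ?thesis using that by blast
  qed
  have "\<eta> v = deg G v - 1"
  proof (rule ccontr)
    assume "\<eta> v \<noteq> deg G v - 1"
    moreover have "\<eta> v < deg G v" using \<eta> v by (auto simp: RC_def stable_def)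
    ultimately have "stable G K (padd \<eta> (dl v 1))" using \<eta> by (auto simp: RC_def stable_def padd_def dl_def)
    then have "padd \<eta> (dl v 1) = ?\<zeta>" using st_id \<eta>(2) by simp
    then show False using lw(2)[OF \<eta>(1)] by simp
  qed
  then have act: "\<eta> \<in> active K v" using \<eta> by (auto simp: active_def)
  let ?\<xi> = "\<eta>(v := 0)"
  have R: "?\<xi> \<in> RC ?K" by (rule remove_RC[OF K v \<eta>(1)])
  have os: "off_stable ?K ?\<xi>" by (rule RC_off_stable[OF R])
  let ?w = "wit K v (nw K v ?\<xi>) ?\<xi>"
  obtain xs where xs: "legal G K (padd ?\<xi> (dl v (deg G v))) xs" "stable G K (fold (tp K) xs (padd ?\<xi> (dl v (deg G v))))"
    "\<And>x. x \<in> ?K \<Longrightarrow> fold (tp K) xs (padd ?\<xi> (dl v (deg G v))) x = wstep K v ?w x"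
    using avalanche_list[OF K v os] by blast
  have "st K (padd \<eta> (dl v 1)) = fold (tp K) xs (padd ?\<xi> (dl v (deg G v)))"
    using stabilizationI[OF xs(1,2)] grain_eq[of \<eta> v] act by (auto simp: active_def)
  then have "wstep K v ?w x = wstep K v \<xi> x" if "x \<in> ?K" for x
    using xs(3)[OF that] \<eta>(2) that by (simp add: padd_def dl_def)
  moreover have "wstep K v ?w x = wstep K v \<xi> x" if "x \<notin> ?K" for x
    using wstep_off_stable[OF K wit_off_stable[OF K os]] wstep_off_stable[OF K RC_off_stable[OF \<xi>]] that by (auto simp: off_stable_def)
  ultimately have "wstep K v ?w = wstep K v \<xi>" by blast
  moreover have "inj_on (\<lambda>\<eta>. st ?K (padd \<eta> (bsum G ?K {v}))) (RC ?K)"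
    by (rule inj_on_add) (use K in \<open>auto simp: bsum_def\<close>)
  ultimately have "?w = \<xi>" using wit_RC[OF K R] \<xi> unfolding wstep_def by (auto dest: inj_onD)
  then show ?thesis using act by auto
qed

lemma card_last_waves_le:
  assumes K: "finite K" and v: "v \<in> K"
  shows "card {\<xi> \<in> RC (K - {v}). wval K v \<xi> < deg G v \<and> P \<xi>} \<le>
    card {\<eta> \<in> active K v. \<exists>\<xi>\<in>wset K v (\<eta>(v := 0)). P \<xi>}"
proof (rule surj_card_le)
  show "finite {\<eta> \<in> active K v. \<exists>\<xi>\<in>wset K v (\<eta>(v := 0)). P \<xi>}" using finite_RC[OF K] by (auto simp: active_def)
  show "{\<xi> \<in> RC (K - {v}). wval K v \<xi> < deg G v \<and> P \<xi>} \<subseteq>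
    (\<lambda>\<eta>. wit K v (nw K v (\<eta>(v := 0))) (\<eta>(v := 0))) ` {\<eta> \<in> active K v. \<exists>\<xi>\<in>wset K v (\<eta>(v := 0)). P \<xi>}"
  proof
    fix \<xi> assume \<xi>: "\<xi> \<in> {\<xi> \<in> RC (K - {v}). wval K v \<xi> < deg G v \<and> P \<xi>}"
    then obtain \<eta> where \<eta>: "\<eta> \<in> active K v" "\<xi> = wit K v (nw K v (\<eta>(v := 0))) (\<eta>(v := 0))"
      using last_wave[OF K v] by blast
    then have "\<xi> \<in> wset K v (\<eta>(v := 0))" by (auto simp: wset_def)
    then show "\<xi> \<in> (\<lambda>\<eta>. wit K v (nw K v (\<eta>(v := 0))) (\<eta>(v := 0))) ` {\<eta> \<in> active K v. \<exists>\<xi>\<in>wset K v (\<eta>(v := 0)). P \<xi>}"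
      using \<eta> \<xi> by blast
  qed
qed

end

context bgraph
begin

section \<open>Finite volume estimates\<close>

text \<open>By \<open>card_RC_minus\<close> the quotient is the number of recurrent configurations
  on \<open>K - {v}\<close> divided by that on \<open>K\<close>, the factor between the law of waves
  and the forest law.\<close>

lemma wave_factor_bounds:
  assumes K: "finite K" "v \<in> K"
  shows "1 / D \<le> pot K (\<lambda>z. of_bool (z = v)) v / dg v" "pot K (\<lambda>z. of_bool (z = v)) v / dg v \<le> gmax"
proof -
  let ?p = "pot K (\<lambda>z. of_bool (z = v)) v"
  have p1: "1 \<le> ?p" using pot_eq[OF K, of "\<lambda>z. of_bool (z = v)"] PP_nonneg[of v "pot K (\<lambda>z. of_bool (z = v))"]
    by (simp add: pot_nonneg K)
  have pm: "?p \<le> gmax" using pot_le_g[OF K(1), of v v] g_le[of v v] by linarith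
  have "1 / D \<le> 1 / dg v" using dg_ge1[of v] dg_le[of v] by (intro divide_left_mono) auto
  also have "\<dots> \<le> ?p / dg v" using p1 dg_ge1[of v] by (intro divide_right_mono) auto
  finally show "1 / D \<le> ?p / dg v" .
  have "?p / dg v \<le> ?p / 1" using p1 dg_ge1[of v] by (intro divide_left_mono) auto
  then show "?p / dg v \<le> gmax" using pm by simp
qed

lemma sum_waves_EF:
  fixes \<phi> :: "'a set \<Rightarrow> real"
  assumes K: "finite K" "v \<in> K"
  shows "(\<Sum>\<xi>\<in>RC (K - {v}). \<phi> (wv K v \<xi>)) =
    real (card (RC K)) * (pot K (\<lambda>z. of_bool (z = v)) v / dg v) * EF (K - {v}) (\<lambda>F. \<phi> {x \<in> K - {v}. root (K - {v}) F x = v})"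
  unfolding wv_def using sum_RC[of "K - {v}" "{v}" \<phi>] K card_RC_minus[OF K] by simp

lemma legal_count_le:
  assumes K: "finite K" "v \<in> K" and \<eta>: "\<eta> \<in> RC K" and xs: "legal G K (padd \<eta> (dl v 1)) xs" "xs \<noteq> []"
  shows "\<eta> \<in> active K v" "count_list xs u \<le> (\<Sum>\<xi>\<in>wset K v (\<eta>(v := 0)). of_bool (u = v) + of_bool (u \<in> wv K v \<xi>))"
proof -
  show a: "\<eta> \<in> active K v"
  proof (rule ccontr)
    assume "\<eta> \<notin> active K v"
    then have "\<eta> v < deg G v - 1" using \<eta> K by (force simp: active_def RC_def stable_def)
    then have "stable G K (padd \<eta> (dl v 1))" using \<eta> by (auto simp: RC_def stable_def padd_def dl_def)
    then have "legal G K (padd \<eta> (dl v 1)) []" "stable G K (fold (tp K) [] (padd \<eta> (dl v 1)))" by auto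
    from least_action[OF xs(1) this, of "hd xs"] show False using xs(2) by (cases xs) auto
  qed
  have os: "off_stable (K - {v}) (\<eta>(v := 0))" using remove_RC[OF K \<eta>] RC_off_stable by blast
  obtain ys where ys: "legal G K (padd \<eta> (dl v 1)) ys" "stable G K (fold (tp K) ys (padd \<eta> (dl v 1)))"
    "\<And>u. count_list ys u = (\<Sum>\<xi>\<in>wset K v (\<eta>(v := 0)). of_bool (u = v) + of_bool (u \<in> wv K v \<xi>))"
    using avalanche_list[OF K os] grain_eq[of \<eta> v] a by (auto simp: active_def)
  show "count_list xs u \<le> (\<Sum>\<xi>\<in>wset K v (\<eta>(v := 0)). of_bool (u = v) + of_bool (u \<in> wv K v \<xi>))"
    using least_action[OF xs(1) ys(1,2), of u] ys(3) by simp
qed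

lemma wave_toppled:
  assumes K: "finite K" "v \<in> K" and \<eta>: "\<eta> \<in> active K v" and \<xi>: "\<xi> \<in> wset K v (\<eta>(v := 0))"
  shows "\<exists>xs. legal G K (padd \<eta> (dl v 1)) xs \<and> insert v (wv K v \<xi>) \<subseteq> set xs"
proof -
  have os: "off_stable (K - {v}) (\<eta>(v := 0))" using remove_RC[OF K] RC_off_stable \<eta> by (auto simp: active_def)
  obtain ys where ys: "legal G K (padd \<eta> (dl v 1)) ys"
    "\<And>u. count_list ys u = (\<Sum>\<xi>\<in>wset K v (\<eta>(v := 0)). of_bool (u = v) + of_bool (u \<in> wv K v \<xi>))"
    using avalanche_list[OF K os] grain_eq[of \<eta> v] \<eta> by (auto simp: active_def)
  have "u \<in> set ys" if "u \<in> insert v (wv K v \<xi>)" for u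
  proof -
    have "1 \<le> of_bool (u = v) + (of_bool (u \<in> wv K v \<xi>) :: nat)" using that by auto
    also have "\<dots> \<le> count_list ys u" unfolding ys(2) using \<xi> finite_wset
      by (intro member_le_sum[of _ _ "\<lambda>\<xi>. of_bool (u = v) + of_bool (u \<in> wv K v \<xi>)"]) auto
    finally show ?thesis by (metis count_list_0_iff not_one_le_zero)
  qed
  then show ?thesis using ys(1) by blast
qed

text \<open>Events are phrased as the existence of a legal sequence with property \<open>R\<close>,
  without reference to a final state; this form makes sense in infinite volume, too.\<close>

definition ev :: "'a set \<Rightarrow> 'a \<Rightarrow> ('a list \<Rightarrow> bool) \<Rightarrow> ('a \<Rightarrow> nat) \<Rightarrow> bool" where
  "ev K v R \<eta> \<longleftrightarrow> (\<exists>xs. legal G K (padd \<eta> (dl v 1)) xs \<and> R xs)"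

lemma card_as_sum: "finite S \<Longrightarrow> real (card {x \<in> S. P x}) = (\<Sum>x\<in>S. of_bool (P x))"
  by (simp add: of_bool_def sum.If_cases Int_def)

lemma radius_upper:
  assumes K: "finite K" "v \<in> K" and r: "r \<ge> 1"
    and \<Lambda>: "EF (K - {v}) (\<lambda>F. of_bool (arm (K - {v}) F v r)) \<le> \<Lambda> / real r"
  shows "real (card {\<eta> \<in> RC K. ev K v (\<lambda>xs. \<exists>u\<in>set xs. r \<le> gdist G v u) \<eta>}) \<le> real (card (RC K)) * (gmax * \<Lambda> / real r)"
proof -
  let ?P = "\<lambda>A. \<exists>u\<in>A. r \<le> gdist G v u"
  have sub: "{\<eta> \<in> RC K. ev K v (\<lambda>xs. ?P (set xs)) \<eta>} \<subseteq> {\<eta> \<in> active K v. \<exists>\<xi>\<in>wset K v (\<eta>(v := 0)). ?P (wv K v \<xi>)}"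
  proof
    fix \<eta> assume "\<eta> \<in> {\<eta> \<in> RC K. ev K v (\<lambda>xs. ?P (set xs)) \<eta>}"
    then obtain xs u where *: "\<eta> \<in> RC K" "legal G K (padd \<eta> (dl v 1)) xs" "u \<in> set xs" "r \<le> gdist G v u" by (auto simp: ev_def)
    then have ne: "xs \<noteq> []" by auto
    have uv: "u \<noteq> v" using *(4) r gdist_self[of v] by (metis not_one_le_zero order_trans)
    have "0 < count_list xs u" using *(3) count_list_0_iff[of xs u] by (metis gr0I)
    then have "0 < (\<Sum>\<xi>\<in>wset K v (\<eta>(v := 0)). of_bool (u = v) + (of_bool (u \<in> wv K v \<xi>) :: nat))"
      using legal_count_le(2)[OF K *(1,2) ne, of u] by linarith
    then obtain \<xi> where "\<xi> \<in> wset K v (\<eta>(v := 0))" "u \<in> wv K v \<xi>"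
      using uv by (auto elim!: sum.not_neutral_contains_not_neutral[OF less_imp_neq[symmetric]])
    then show "\<eta> \<in> {\<eta> \<in> active K v. \<exists>\<xi>\<in>wset K v (\<eta>(v := 0)). ?P (wv K v \<xi>)}"
      using legal_count_le(1)[OF K *(1,2) ne] *(4) by auto
  qed
  have fA: "finite (active K v)" using finite_RC[OF K(1)] by (auto simp: active_def)
  have "real (card {\<eta> \<in> RC K. ev K v (\<lambda>xs. ?P (set xs)) \<eta>}) \<le> real (card {\<eta> \<in> active K v. \<exists>\<xi>\<in>wset K v (\<eta>(v := 0)). ?P (wv K v \<xi>)})"
    using fA by (intro of_nat_mono card_mono sub) auto
  also have "\<dots> = (\<Sum>\<eta>\<in>active K v. of_bool (\<exists>\<xi>\<in>wset K v (\<eta>(v := 0)). ?P (wv K v \<xi>)))" by (rule card_as_sum[OF fA])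
  also have "\<dots> \<le> (\<Sum>\<eta>\<in>active K v. \<Sum>\<xi>\<in>wset K v (\<eta>(v := 0)). of_bool (?P (wv K v \<xi>)))"
  proof (rule sum_mono)
    fix \<eta>
    show "of_bool (\<exists>\<xi>\<in>wset K v (\<eta>(v := 0)). ?P (wv K v \<xi>)) \<le> (\<Sum>\<xi>\<in>wset K v (\<eta>(v := 0)). of_bool (?P (wv K v \<xi>)) :: real)"
    proof (cases "\<exists>\<xi>\<in>wset K v (\<eta>(v := 0)). ?P (wv K v \<xi>)")
      case True
      then obtain \<xi> where "\<xi> \<in> wset K v (\<eta>(v := 0))" "?P (wv K v \<xi>)" by blast
      then show ?thesis using member_le_sum[of \<xi> "wset K v (\<eta>(v := 0))" "\<lambda>\<xi>. of_bool (?P (wv K v \<xi>)) :: real"] finite_wset by auto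
    qed (simp add: sum_nonneg)
  qed
  also have "\<dots> \<le> (\<Sum>\<xi>\<in>RC (K - {v}). of_bool (?P (wv K v \<xi>)))" by (rule sum_waves_le[OF K]) simp
  also have "\<dots> = real (card (RC K)) * (pot K (\<lambda>z. of_bool (z = v)) v / dg v) *
      EF (K - {v}) (\<lambda>F. of_bool (?P {x \<in> K - {v}. root (K - {v}) F x = v}))"
    by (rule sum_waves_EF[OF K])
  also have "(\<lambda>F. of_bool (?P {x \<in> K - {v}. root (K - {v}) F x = v})) = (\<lambda>F. of_bool (arm (K - {v}) F v r) :: real)"
    unfolding arm_def by (intro ext arg_cong[where f=of_bool]) blast
  also have "real (card (RC K)) * (pot K (\<lambda>z. of_bool (z = v)) v / dg v) * EF (K - {v}) (\<lambda>F. of_bool (arm (K - {v}) F v r))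
    \<le> real (card (RC K)) * gmax * (\<Lambda> / real r)"
    using \<Lambda> wave_factor_bounds[OF K] gmax_ge1 K D_ge1 order_trans[OF _ wave_factor_bounds(1)[OF K], of 0]
    by (intro mult_mono) (auto intro!: EF_nonneg)
  finally show ?thesis by (simp add: mult.assoc)
qed

text \<open>The functional \<open>?\<phi>\<close> sums to at least 1 over the waves of a large
  avalanche: some wave leaves the ball, or the waves inside the ball, each with one toppling of
  \<open>v\<close>, add up to \<open>s\<close> topplings. Summing over waves takes care of
  multiplicities, so one estimate covers toppled vertices and topplings.\<close>

lemma volume_upper:
  assumes K: "finite K" "v \<in> K" and r: "r \<ge> 1" and s: "s \<ge> 1"
    and \<Lambda>: "EF (K - {v}) (\<lambda>F. of_bool (arm (K - {v}) F v r)) \<le> \<Lambda> / real r"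
  shows "real (card {\<eta> \<in> RC K. ev K v (\<lambda>xs. s \<le> length xs) \<eta>}) \<le>
    real (card (RC K)) * (gmax * (\<Lambda> / real r + (1 + D * C * real r) / real s))"
proof -
  let ?P = "\<lambda>A. \<exists>u\<in>A. r \<le> gdist G v u" and ?B = "gball v r"
  let ?\<phi> = "\<lambda>A. of_bool (?P A) + (1 + real (card (A \<inter> ?B))) / real s"
  let ?W = "\<lambda>\<eta>. wset K v (\<eta>(v := 0))"
  have fA: "finite (active K v)" using finite_RC[OF K(1)] by (auto simp: active_def)
  have \<phi>0: "0 \<le> ?\<phi> A" for A by simp
  have key: "\<eta> \<in> active K v \<and> 1 \<le> (\<Sum>\<xi>\<in>?W \<eta>. ?\<phi> (wv K v \<xi>))" if e: "\<eta> \<in> RC K" "ev K v (\<lambda>xs. s \<le> length xs) \<eta>" for \<eta>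
  proof -
    obtain xs where xs: "legal G K (padd \<eta> (dl v 1)) xs" "s \<le> length xs" using e(2) by (auto simp: ev_def)
    then have ne: "xs \<noteq> []" using s by auto
    note lc = legal_count_le[OF K e(1) xs(1) ne]
    have fw: "finite (wv K v \<xi>)" for \<xi> using wv_sub[of K v \<xi>] K finite_subset by blast
    have "1 \<le> (\<Sum>\<xi>\<in>?W \<eta>. ?\<phi> (wv K v \<xi>))"
    proof (cases "\<exists>\<xi>\<in>?W \<eta>. ?P (wv K v \<xi>)")
      case True
      then obtain \<xi> where \<xi>: "\<xi> \<in> ?W \<eta>" "?P (wv K v \<xi>)" by blast
      have "1 \<le> ?\<phi> (wv K v \<xi>)" using \<xi>(2) by simp
      also have "\<dots> \<le> (\<Sum>\<xi>\<in>?W \<eta>. ?\<phi> (wv K v \<xi>))"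
        using member_le_sum[OF \<xi>(1), of "\<lambda>\<xi>. ?\<phi> (wv K v \<xi>)"] finite_wset by auto
      finally show ?thesis .
    next
      case False
      have "length xs = (\<Sum>u\<in>K. count_list xs u)"
        using legal_set[OF xs(1)] K sum_count_set[of xs K] by simp
      also have "\<dots> \<le> (\<Sum>u\<in>K. \<Sum>\<xi>\<in>?W \<eta>. of_bool (u = v) + of_bool (u \<in> wv K v \<xi>))"
        by (rule sum_mono[OF lc(2)])
      also have "\<dots> = (\<Sum>\<xi>\<in>?W \<eta>. \<Sum>u\<in>K. of_bool (u = v) + of_bool (u \<in> wv K v \<xi>))" by (rule sum.swap)
      also have "\<dots> = (\<Sum>\<xi>\<in>?W \<eta>. 1 + card (wv K v \<xi> \<inter> ?B))"
      proof (rule sum.cong[OF refl])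
        fix \<xi> assume "\<xi> \<in> ?W \<eta>"
        then have "wv K v \<xi> \<inter> ?B = wv K v \<xi>" using False by (force simp: gball_def not_le)
        moreover have "(\<Sum>u\<in>K. of_bool (u \<in> wv K v \<xi>)) = card (wv K v \<xi>)"
        proof -
          have "K \<inter> wv K v \<xi> = wv K v \<xi>" using wv_sub by blast
          then show ?thesis using K by (simp add: of_bool_def sum.If_cases)
        qed
        moreover have "(\<Sum>u\<in>K. of_bool (u = v)) = (1::nat)" using K by (simp add: of_bool_def)
        ultimately show "(\<Sum>u\<in>K. of_bool (u = v) + of_bool (u \<in> wv K v \<xi>)) = 1 + card (wv K v \<xi> \<inter> ?B)"
          by (simp only: sum.distrib)
      qed
      finally have "real s \<le> real (\<Sum>\<xi>\<in>?W \<eta>. 1 + card (wv K v \<xi> \<inter> ?B))" using xs(2) of_nat_mono order_trans by blast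
      then have "1 \<le> (\<Sum>\<xi>\<in>?W \<eta>. 1 + real (card (wv K v \<xi> \<inter> ?B))) / real s" using s by simp
      also have "\<dots> = (\<Sum>\<xi>\<in>?W \<eta>. (1 + real (card (wv K v \<xi> \<inter> ?B))) / real s)" by (rule sum_divide_distrib)
      also have "\<dots> \<le> (\<Sum>\<xi>\<in>?W \<eta>. ?\<phi> (wv K v \<xi>))" by (rule sum_mono) simp
      finally show ?thesis .
    qed
    then show ?thesis using lc(1) by blast
  qed
  have "real (card {\<eta> \<in> RC K. ev K v (\<lambda>xs. s \<le> length xs) \<eta>}) \<le> real (card {\<eta> \<in> active K v. 1 \<le> (\<Sum>\<xi>\<in>?W \<eta>. ?\<phi> (wv K v \<xi>))})"
    using fA key by (intro of_nat_mono card_mono) auto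
  also have "\<dots> = (\<Sum>\<eta>\<in>active K v. of_bool (1 \<le> (\<Sum>\<xi>\<in>?W \<eta>. ?\<phi> (wv K v \<xi>))))" by (rule card_as_sum[OF fA])
  also have "\<dots> \<le> (\<Sum>\<eta>\<in>active K v. \<Sum>\<xi>\<in>?W \<eta>. ?\<phi> (wv K v \<xi>))"
  proof (rule sum_mono)
    fix \<eta>
    have "0 \<le> (\<Sum>\<xi>\<in>?W \<eta>. ?\<phi> (wv K v \<xi>))" by (intro sum_nonneg \<phi>0)
    then show "of_bool (1 \<le> (\<Sum>\<xi>\<in>?W \<eta>. ?\<phi> (wv K v \<xi>))) \<le> (\<Sum>\<xi>\<in>?W \<eta>. ?\<phi> (wv K v \<xi>))"
      by (cases "1 \<le> (\<Sum>\<xi>\<in>?W \<eta>. ?\<phi> (wv K v \<xi>))") simp_all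
  qed
  also have "\<dots> \<le> (\<Sum>\<xi>\<in>RC (K - {v}). ?\<phi> (wv K v \<xi>))" by (rule sum_waves_le[OF K]) (rule \<phi>0)
  also have "\<dots> = real (card (RC K)) * (pot K (\<lambda>z. of_bool (z = v)) v / dg v) *
      EF (K - {v}) (\<lambda>F. ?\<phi> {x \<in> K - {v}. root (K - {v}) F x = v})"
    by (rule sum_waves_EF[OF K])
  also have "\<dots> \<le> real (card (RC K)) * gmax * (\<Lambda> / real r + (1 + D * C * real r) / real s)"
  proof (intro mult_mono)
    let ?L = "K - {v}"
    have L: "finite ?L" using K by auto
    have e: "EF ?L (\<lambda>F. real (card ({x \<in> ?L. root ?L F x = v} \<inter> ?B))) \<le> D * C * real r"
    proof -
      have "real (card ({x \<in> ?L. root ?L F x = v} \<inter> ?B)) = (\<Sum>u\<in>?L \<inter> ?B. of_bool (root ?L F u = v))" for F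
      proof -
        have "{x \<in> ?L. root ?L F x = v} \<inter> ?B = {x \<in> ?L \<inter> ?B. root ?L F x = v}" by auto
        then show ?thesis using card_as_sum[of "?L \<inter> ?B" "\<lambda>u. root ?L F u = v"] L by simp
      qed
      then have "EF ?L (\<lambda>F. real (card ({x \<in> ?L. root ?L F x = v} \<inter> ?B))) = (\<Sum>u\<in>?L \<inter> ?B. EF ?L (\<lambda>F. of_bool (root ?L F u = v)))"
        by (simp add: EF_sum)
      also have "\<dots> \<le> (\<Sum>u\<in>?L \<inter> ?B. g u v)" by (intro sum_mono prob_root_le L)
      also have "\<dots> \<le> D * C * real r" using L r by (intro energy1) auto
      finally show ?thesis .
    qed
    have arm: "(\<lambda>F. of_bool (?P {x \<in> ?L. root ?L F x = v})) = (\<lambda>F. of_bool (arm ?L F v r) :: real)"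
      unfolding arm_def by (intro ext arg_cong[where f=of_bool]) blast
    have "EF ?L (\<lambda>F. ?\<phi> {x \<in> ?L. root ?L F x = v}) =
      EF ?L (\<lambda>F. of_bool (?P {x \<in> ?L. root ?L F x = v})) + (1 + EF ?L (\<lambda>F. real (card ({x \<in> ?L. root ?L F x = v} \<inter> ?B)))) / real s"
      unfolding divide_inverse by (simp add: EF_add EF_cmult2 EF_const[OF L])
    also have "\<dots> \<le> \<Lambda> / real r + (1 + D * C * real r) / real s"
      unfolding arm using \<Lambda> e by (intro add_mono divide_right_mono) auto
    finally show "EF ?L (\<lambda>F. ?\<phi> {x \<in> ?L. root ?L F x = v}) \<le> \<Lambda> / real r + (1 + D * C * real r) / real s" .
    show "0 \<le> EF ?L (\<lambda>F. ?\<phi> {x \<in> ?L. root ?L F x = v})" by (rule EF_nonneg[OF L \<phi>0])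
    have "0 \<le> 1 / D" using D_ge1 by simp
    then show "0 \<le> pot K (\<lambda>z. of_bool (z = v)) v / dg v" using wave_factor_bounds(1)[OF K] by (rule order_trans)
  qed (use wave_factor_bounds[OF K] gmax_ge1 in auto)
  finally show ?thesis by (simp add: mult.assoc)
qed

lemma wval_miss:
  assumes K: "finite K" "v \<in> K"
  shows "(\<Sum>y\<in>{x \<in> K - {v}. root (K - {v}) F x = v}. count (G v) y) < deg G v \<longleftrightarrow> miss (K - {v}) F v"
proof -
  let ?T = "{x \<in> K - {v}. root (K - {v}) F x = v}"
  have T: "finite ?T" using K by auto
  have mem: "w \<in> ?T \<longleftrightarrow> root (K - {v}) F w = v" if "w \<in> N v" for w
  proof -
    have "w \<noteq> v" using that no_loop by auto
    then show ?thesis using root_off[of w "K - {v}" F] by (cases "w \<in> K - {v}") auto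
  qed
  have tot: "(\<Sum>y\<in>?T \<union> N v. count (G v) y) = deg G v" using T by (intro deg_eq_sum) auto
  have spl: "(\<Sum>y\<in>?T \<union> N v. count (G v) y) = (\<Sum>y\<in>?T. count (G v) y) + (\<Sum>y\<in>N v - ?T. count (G v) y)"
    using T sum.union_disjoint[of ?T "N v - ?T" "count (G v)"] by simp
  have "count (G v) a \<noteq> 0" if "a \<in> N v" for a using that by (simp add: not_in_iff)
  moreover have "(\<Sum>y\<in>N v - ?T. count (G v) y) = 0 \<longleftrightarrow> (\<forall>y\<in>N v - ?T. count (G v) y = 0)" by (rule sum_eq_0_iff) simp
  ultimately have "(\<Sum>y\<in>N v - ?T. count (G v) y) = 0 \<longleftrightarrow> N v \<subseteq> ?T" by blast
  then have "(\<Sum>y\<in>?T. count (G v) y) < deg G v \<longleftrightarrow> \<not> N v \<subseteq> ?T" using tot spl by linarith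
  also have "\<dots> \<longleftrightarrow> miss (K - {v}) F v" using mem unfolding miss_def by blast
  finally show ?thesis .
qed

lemma last_wave_lower:
  assumes K: "finite K" "v \<in> K" and R: "\<And>xs A. P A \<Longrightarrow> insert v A \<subseteq> set xs \<Longrightarrow> R xs"
  shows "real (card (RC K)) * (1 / D * EF (K - {v}) (\<lambda>F. of_bool (miss (K - {v}) F v \<and> P {x \<in> K - {v}. root (K - {v}) F x = v})))
    \<le> real (card {\<eta> \<in> RC K. ev K v R \<eta>})"
proof -
  let ?L = "K - {v}" and ?T = "\<lambda>F. {x \<in> K - {v}. root (K - {v}) F x = v}"
  let ?Q = "\<lambda>A. (\<Sum>y\<in>A. count (G v) y) < deg G v \<and> P A"
  have L: "finite ?L" using K by auto
  let ?E = "EF ?L (\<lambda>F. of_bool (miss ?L F v \<and> P (?T F)))"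
  have E0: "0 \<le> ?E" by (rule EF_nonneg[OF L]) simp
  have "real (card (RC K)) * (1 / D * ?E) \<le> real (card (RC K)) * (pot K (\<lambda>z. of_bool (z = v)) v / dg v * ?E)"
    using wave_factor_bounds[OF K] E0 by (intro mult_left_mono mult_right_mono) auto
  also have "\<dots> = real (card (RC K)) * (pot K (\<lambda>z. of_bool (z = v)) v / dg v) * EF ?L (\<lambda>F. of_bool (?Q (?T F)))"
    by (simp only: wval_miss[OF K] mult.assoc)
  also have "\<dots> = (\<Sum>\<xi>\<in>RC ?L. of_bool (?Q (wv K v \<xi>)))" by (rule sum_waves_EF[OF K, symmetric])
  also have "\<dots> = real (card {\<xi> \<in> RC ?L. wval K v \<xi> < deg G v \<and> P (wv K v \<xi>)})"
    unfolding wval_def by (rule card_as_sum[symmetric]) (rule finite_RC[OF L])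
  also have "\<dots> \<le> real (card {\<eta> \<in> active K v. \<exists>\<xi>\<in>wset K v (\<eta>(v := 0)). P (wv K v \<xi>)})"
    by (intro of_nat_mono card_last_waves_le K)
  also have "\<dots> \<le> real (card {\<eta> \<in> RC K. ev K v R \<eta>})"
  proof (intro of_nat_mono card_mono)
    show "finite {\<eta> \<in> RC K. ev K v R \<eta>}" using finite_RC[OF K(1)] by auto
    show "{\<eta> \<in> active K v. \<exists>\<xi>\<in>wset K v (\<eta>(v := 0)). P (wv K v \<xi>)} \<subseteq> {\<eta> \<in> RC K. ev K v R \<eta>}"
    proof
      fix \<eta> assume "\<eta> \<in> {\<eta> \<in> active K v. \<exists>\<xi>\<in>wset K v (\<eta>(v := 0)). P (wv K v \<xi>)}"
      then obtain \<xi> where *: "\<eta> \<in> active K v" "\<xi> \<in> wset K v (\<eta>(v := 0))" "P (wv K v \<xi>)" by auto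
      obtain xs where "legal G K (padd \<eta> (dl v 1)) xs" "insert v (wv K v \<xi>) \<subseteq> set xs" using wave_toppled[OF K *(1,2)] by blast
      then show "\<eta> \<in> {\<eta> \<in> RC K. ev K v R \<eta>}" using R[OF *(3)] *(1) by (auto simp: ev_def active_def)
    qed
  qed
  finally show ?thesis .
qed

end

context sgraph
begin

section \<open>Avalanches in infinite volume\<close>

text \<open>The legal sequences are directed, by the comparison behind the least action principle.
  Suprema over sequences can therefore be realised at finitely many vertices by a single
  sequence.\<close>

lemma legal_merge:
  assumes "legal G K \<eta> xs" "legal G K \<eta> ys"
  shows "\<exists>zs. legal G K \<eta> zs \<and> (\<forall>u. count_list xs u \<le> count_list zs u \<and> count_list ys u \<le> count_list zs u)"
  using assms(2)
proof (induction ys rule: rev_induct)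
  case Nil
  then show ?case using assms(1) by auto
next
  case (snoc y ys)
  then have y: "legal G K \<eta> ys" "y \<in> K" "deg G y \<le> fold (tp K) ys \<eta> y" by (auto simp: legal_append)
  obtain zs where zs: "legal G K \<eta> zs" "\<And>u. count_list xs u \<le> count_list zs u" "\<And>u. count_list ys u \<le> count_list zs u"
    using snoc.IH[OF y(1)] by auto
  show ?case
  proof (cases "count_list ys y < count_list zs y")
    case True
    then have "count_list (ys @ [y]) u \<le> count_list zs u" for u using zs(3)[of u] by (cases "u = y") auto
    then show ?thesis using zs by blast
  next
    case False
    then have eq: "count_list ys y = count_list zs y" using zs(3)[of y] by simp
    let ?S = "set ys \<union> set zs"
    have "(\<Sum>t\<leftarrow>ys. count (G t) y) \<le> (\<Sum>t\<leftarrow>zs. count (G t) y)"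
      using sum_list_count[of ?S ys "\<lambda>t. count (G t) y"] sum_list_count[of ?S zs "\<lambda>t. count (G t) y"] zs(3)
      by (simp add: sum_mono)
    moreover have "count_list ys y * deg G y = count_list zs y * deg G y" using eq by simp
    ultimately have "fold (tp K) ys \<eta> y \<le> fold (tp K) zs \<eta> y"
      using fold_value[OF y(1,2)] fold_value[OF zs(1) y(2)] by linarith
    then have "legal G K \<eta> (zs @ [y])" using zs(1) y by (auto simp: legal_append)
    moreover have "count_list (ys @ [y]) u \<le> count_list (zs @ [y]) u" "count_list xs u \<le> count_list (zs @ [y]) u" for u
      using zs(2,3)[of u] by (auto simp: le_SucI)
    ultimately show ?thesis by blast
  qed
qed

lemma legal_merge_finite:
  assumes "finite F" "\<And>u. u \<in> F \<Longrightarrow> \<exists>xs. legal G K \<eta> xs \<and> k u \<le> count_list xs u"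
  shows "\<exists>zs. legal G K \<eta> zs \<and> (\<forall>u\<in>F. k u \<le> count_list zs u)"
  using assms
proof (induction F rule: finite_induct)
  case empty
  show ?case by (intro exI[of _ "[]"]) auto
next
  case (insert u F)
  then obtain zs where zs: "legal G K \<eta> zs" "\<And>w. w \<in> F \<Longrightarrow> k w \<le> count_list zs w" by auto
  obtain xs where xs: "legal G K \<eta> xs" "k u \<le> count_list xs u" using insert.prems by blast
  obtain ws where "legal G K \<eta> ws" "\<And>w. count_list xs w \<le> count_list ws w" "\<And>w. count_list zs w \<le> count_list ws w"
    using legal_merge[OF xs(1) zs(1)] by blast
  then show ?case using xs(2) zs(2) by (intro exI[of _ ws]) (auto intro: order_trans)
qed

definition aval :: "'a \<Rightarrow> ('a list \<Rightarrow> bool) \<Rightarrow> ('a \<Rightarrow> nat) \<Rightarrow> bool" where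
  "aval v R \<eta> \<longleftrightarrow> (\<exists>xs. legal G UNIV (padd \<eta> (dl v 1)) xs \<and> R xs)"

lemma Av_ge_iff: "1 \<le> k \<Longrightarrow> enat k \<le> Av G v \<eta> u \<longleftrightarrow> aval v (\<lambda>xs. k \<le> count_list xs u) \<eta>"
proof
  assume k: "1 \<le> k" "enat k \<le> Av G v \<eta> u"
  show "aval v (\<lambda>xs. k \<le> count_list xs u) \<eta>"
  proof (rule ccontr)
    assume "\<not> aval v (\<lambda>xs. k \<le> count_list xs u) \<eta>"
    then have "count_list xs u \<le> k - 1" if "legal G UNIV (add_grain v \<eta>) xs" for xs
      using that by (auto simp: aval_def add_grain_padd not_le)
    then have "Av G v \<eta> u \<le> enat (k - 1)" unfolding Av_def by (intro SUP_least) auto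
    with k(2) have "enat k \<le> enat (k - 1)" by (rule order_trans)
    then show False using k(1) by simp
  qed
next
  assume "aval v (\<lambda>xs. k \<le> count_list xs u) \<eta>"
  then obtain xs where xs: "legal G UNIV (add_grain v \<eta>) xs" "k \<le> count_list xs u" by (auto simp: aval_def add_grain_padd)
  then have "enat k \<le> enat (count_list xs u)" by simp
  also have "\<dots> \<le> Av G v \<eta> u" unfolding Av_def using xs(1) by (intro SUP_upper) auto
  finally show "enat k \<le> Av G v \<eta> u" .
qed

lemma AvC_iff: "u \<in> AvC G v \<eta> \<longleftrightarrow> aval v (\<lambda>xs. u \<in> set xs) \<eta>"
proof -
  have "(1::enat) \<le> Av G v \<eta> u \<longleftrightarrow> enat 1 \<le> Av G v \<eta> u" by (simp add: one_enat_def)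
  also have "\<dots> \<longleftrightarrow> aval v (\<lambda>xs. 1 \<le> count_list xs u) \<eta>" by (rule Av_ge_iff) simp
  also have "(\<lambda>xs. 1 \<le> count_list xs u) = (\<lambda>xs. u \<in> set xs)"
    using count_list_0_iff[of _ u] by (metis One_nat_def Suc_le_eq neq0_conv)
  finally show ?thesis by (simp add: AvC_def)
qed

lemma AvC_finite_list:
  assumes "finite F" "F \<subseteq> AvC G v \<eta>"
  shows "\<exists>zs. legal G UNIV (padd \<eta> (dl v 1)) zs \<and> F \<subseteq> set zs"
proof -
  have "\<exists>xs. legal G UNIV (padd \<eta> (dl v 1)) xs \<and> 1 \<le> count_list xs u" if u: "u \<in> F" for u
  proof -
    obtain xs where "legal G UNIV (padd \<eta> (dl v 1)) xs" "u \<in> set xs" using u assms(2) AvC_iff[of u v \<eta>] by (auto simp: aval_def)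
    then show ?thesis using count_list_0_iff[of xs u] by (intro exI[of _ xs]) auto
  qed
  then obtain zs where zs: "legal G UNIV (padd \<eta> (dl v 1)) zs" "\<forall>u\<in>F. 1 \<le> count_list zs u"
    using legal_merge_finite[OF assms(1), of UNIV "padd \<eta> (dl v 1)" "\<lambda>_. 1"] by blast
  then have "F \<subseteq> set zs" using count_list_0_iff by (metis not_one_le_zero subsetI)
  then show ?thesis using zs by blast
qed

lemma diam_ge_iff:
  assumes n: "n \<ge> 1"
  shows "enat n \<le> diam_ext G (AvC G v \<eta>) \<longleftrightarrow> aval v (\<lambda>xs. \<exists>u\<in>set xs. \<exists>w\<in>set xs. n \<le> gdist G u w) \<eta>"
proof
  assume a: "enat n \<le> diam_ext G (AvC G v \<eta>)"
  have "\<exists>u\<in>AvC G v \<eta>. \<exists>w\<in>AvC G v \<eta>. n \<le> gdist G u w"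
  proof (rule ccontr)
    assume "\<not> ?thesis"
    then have "diam_ext G (AvC G v \<eta>) \<le> enat (n - 1)" unfolding diam_ext_def
      by (intro SUP_least) (metis enat_ord_simps(1) not_le Suc_pred' less_Suc_eq_le n One_nat_def Suc_le_lessD)
    with a have "enat n \<le> enat (n - 1)" by (rule order_trans)
    then show False using n by simp
  qed
  then obtain u w where uw: "u \<in> AvC G v \<eta>" "w \<in> AvC G v \<eta>" "n \<le> gdist G u w" by blast
  then obtain zs where "legal G UNIV (padd \<eta> (dl v 1)) zs" "{u, w} \<subseteq> set zs" using AvC_finite_list[of "{u, w}" v \<eta>] by auto
  then show "aval v (\<lambda>xs. \<exists>u\<in>set xs. \<exists>w\<in>set xs. n \<le> gdist G u w) \<eta>" using uw(3) by (auto simp: aval_def)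
next
  assume "aval v (\<lambda>xs. \<exists>u\<in>set xs. \<exists>w\<in>set xs. n \<le> gdist G u w) \<eta>"
  then obtain u w where "u \<in> AvC G v \<eta>" "w \<in> AvC G v \<eta>" "n \<le> gdist G u w" by (auto simp: AvC_iff aval_def)
  then show "enat n \<le> diam_ext G (AvC G v \<eta>)" unfolding diam_ext_def
    by (intro SUP_upper2[of u] SUP_upper2[of w]) auto
qed

lemma AvC_size_ge_iff: "of_nat n \<le> AvC_size G v \<eta> \<longleftrightarrow> aval v (\<lambda>xs. n \<le> card (set xs)) \<eta>"
proof
  assume a: "of_nat n \<le> AvC_size G v \<eta>"
  have "\<exists>F. finite F \<and> F \<subseteq> AvC G v \<eta> \<and> card F = n"
  proof (cases "finite (AvC G v \<eta>)")
    case True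
    then have "of_nat n \<le> (of_nat (card (AvC G v \<eta>)) :: ennreal)" using a by (simp add: AvC_size_def)
    then have "n \<le> card (AvC G v \<eta>)" by simp
    then show ?thesis using obtain_subset_with_card_n by metis
  next
    case False
    then show ?thesis using infinite_arbitrarily_large by metis
  qed
  then obtain F where F: "finite F" "F \<subseteq> AvC G v \<eta>" "card F = n" by auto
  then obtain zs where "legal G UNIV (padd \<eta> (dl v 1)) zs" "F \<subseteq> set zs" using AvC_finite_list[of F v \<eta>] by auto
  then show "aval v (\<lambda>xs. n \<le> card (set xs)) \<eta>" using F card_mono[of "set zs" F] by (auto simp: aval_def)
next
  assume "aval v (\<lambda>xs. n \<le> card (set xs)) \<eta>"
  then obtain xs where xs: "legal G UNIV (padd \<eta> (dl v 1)) xs" "n \<le> card (set xs)" by (auto simp: aval_def)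
  have "of_nat n \<le> (of_nat (card (set xs)) :: ennreal)" using xs by simp
  also have "\<dots> = emeasure (count_space UNIV) (set xs)" by simp
  also have "\<dots> \<le> AvC_size G v \<eta>" unfolding AvC_size_def using xs(1) by (intro emeasure_mono) (auto simp: AvC_iff aval_def)
  finally show "of_nat n \<le> AvC_size G v \<eta>" .
qed

text \<open>If no sequence has \<open>n\<close> topplings, all multiplicities are finite and those
  on a finite set are realised together by one sequence, of length below \<open>n\<close>; the
  infinite sum is the supremum of such finite sums.\<close>

lemma Av_size_ge_iff:
  assumes n: "n \<ge> 1"
  shows "of_nat n \<le> Av_size G v \<eta> \<longleftrightarrow> aval v (\<lambda>xs. n \<le> length xs) \<eta>"
proof -
  have SUP: "Av_size G v \<eta> = (SUP F\<in>{F. finite F \<and> F \<subseteq> UNIV}. \<Sum>u\<in>F. ennreal_of_enat (Av G v \<eta> u))"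
    unfolding Av_size_def by (rule nonneg_infsum_complete) auto
  show ?thesis
  proof
    assume a: "of_nat n \<le> Av_size G v \<eta>"
    show "aval v (\<lambda>xs. n \<le> length xs) \<eta>"
    proof (rule ccontr)
      assume no: "\<not> aval v (\<lambda>xs. n \<le> length xs) \<eta>"
      have "(\<Sum>u\<in>F. ennreal_of_enat (Av G v \<eta> u)) \<le> of_nat (n - 1)" if F: "finite F" for F
      proof -
        have "\<exists>k. Av G v \<eta> u = enat k" for u
        proof (cases "Av G v \<eta> u")
          case infinity
          then have "aval v (\<lambda>xs. n \<le> count_list xs u) \<eta>" using Av_ge_iff[OF n, of v \<eta> u] by simp
          then show ?thesis using no count_le_length[of _ u] order_trans unfolding aval_def by blast
        qed auto
        then obtain k where k: "\<And>u. Av G v \<eta> u = enat (k u)" by metis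
        have "\<exists>xs. legal G UNIV (padd \<eta> (dl v 1)) xs \<and> k u \<le> count_list xs u" for u
        proof (cases "k u = 0")
          case True
          then show ?thesis by (intro exI[of _ "[]"]) auto
        next
          case False
          then show ?thesis using Av_ge_iff[of "k u" v \<eta> u] k by (auto simp: aval_def)
        qed
        then obtain zs where zs: "legal G UNIV (padd \<eta> (dl v 1)) zs" "\<And>u. u \<in> F \<Longrightarrow> k u \<le> count_list zs u"
          using legal_merge_finite[OF F, of UNIV "padd \<eta> (dl v 1)" k] by blast
        have "(\<Sum>u\<in>F. k u) \<le> (\<Sum>u\<in>F. count_list zs u)" by (rule sum_mono[OF zs(2)])
        also have "\<dots> \<le> (\<Sum>u\<in>F \<union> set zs. count_list zs u)" using F by (intro sum_mono2) auto
        also have "\<dots> = length zs" using F by (intro sum_count_set) auto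
        also have "\<dots> \<le> n - 1" using no zs(1) by (auto simp: aval_def not_le)
        finally have "(of_nat (\<Sum>u\<in>F. k u) :: ennreal) \<le> of_nat (n - 1)" by (rule of_nat_mono)
        then show ?thesis by (simp add: k ennreal_of_enat_enat)
      qed
      then have "Av_size G v \<eta> \<le> of_nat (n - 1)" unfolding SUP by (intro SUP_least) auto
      then have "(of_nat n :: ennreal) \<le> of_nat (n - 1)" using a by (rule order_trans[rotated])
      then show False using n by (simp only: of_nat_le_iff)
    qed
  next
    assume "aval v (\<lambda>xs. n \<le> length xs) \<eta>"
    then obtain xs where xs: "legal G UNIV (padd \<eta> (dl v 1)) xs" "n \<le> length xs" by (auto simp: aval_def)
    have "(of_nat n :: ennreal) \<le> of_nat (length xs)" using xs(2) by (rule of_nat_mono)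
    also have "\<dots> = of_nat (\<Sum>u\<in>set xs. count_list xs u)" by (subst sum_count_set) auto
    also have "\<dots> = (\<Sum>u\<in>set xs. of_nat (count_list xs u))" by simp
    also have "\<dots> \<le> (\<Sum>u\<in>set xs. ennreal_of_enat (Av G v \<eta> u))"
    proof (rule sum_mono)
      fix u
      have "enat (count_list xs u) \<le> Av G v \<eta> u" unfolding Av_def using xs(1) by (intro SUP_upper) (auto simp: add_grain_padd)
      then have "ennreal_of_enat (enat (count_list xs u)) \<le> ennreal_of_enat (Av G v \<eta> u)" by (simp only: ennreal_of_enat_le_iff)
      then show "of_nat (count_list xs u) \<le> ennreal_of_enat (Av G v \<eta> u)" by simp
    qed
    also have "\<dots> \<le> Av_size G v \<eta>" unfolding SUP by (intro SUP_upper) auto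
    finally show "of_nat n \<le> Av_size G v \<eta>" .
  qed
qed

end

section \<open>The infinite volume limit\<close>

lemma open_cylinder:
  fixes Q :: "('a \<Rightarrow> nat) \<Rightarrow> bool"
  assumes S: "finite S" and Q: "\<And>\<eta> \<eta>'. \<forall>x\<in>S. \<eta> x = \<eta>' x \<Longrightarrow> Q \<eta> \<Longrightarrow> Q \<eta>'"
  shows "open {\<eta>. Q \<eta>}"
proof (subst open_subopen, intro ballI)
  fix \<eta> assume e: "\<eta> \<in> {\<eta>. Q \<eta>}"
  let ?X = "\<lambda>x. if x \<in> S then {\<eta> x} else UNIV"
  have "open (Pi\<^sub>E UNIV ?X)"
  proof (rule open_PiE)
    show "open (?X x)" for x by (simp add: Topological_Spaces.open_discrete)
    show "finite {x. ?X x \<noteq> UNIV}" by (rule finite_subset[OF _ S]) auto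
  qed
  moreover have "\<eta> \<in> Pi\<^sub>E UNIV ?X" by (auto simp: PiE_iff)
  moreover have "Pi\<^sub>E UNIV ?X \<subseteq> {\<eta>. Q \<eta>}"
  proof
    fix \<eta>' assume "\<eta>' \<in> Pi\<^sub>E UNIV ?X"
    then have "\<eta> x = \<eta>' x" if "x \<in> S" for x using that by (simp add: PiE_iff) (metis singletonD)
    then show "\<eta>' \<in> {\<eta>. Q \<eta>}" using Q[of \<eta> \<eta>'] e by auto
  qed
  ultimately show "\<exists>T. open T \<and> \<eta> \<in> T \<and> T \<subseteq> {\<eta>. Q \<eta>}" by blast
qed

lemma continuous_cylinder:
  fixes Q :: "('a \<Rightarrow> nat) \<Rightarrow> bool"
  assumes S: "finite S" and Q: "\<And>\<eta> \<eta>'. \<forall>x\<in>S. \<eta> x = \<eta>' x \<Longrightarrow> Q \<eta> \<Longrightarrow> Q \<eta>'"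
  shows "continuous_on UNIV (\<lambda>\<eta>. of_bool (Q \<eta>) :: real)"
proof -
  have "open ((\<lambda>\<eta>. of_bool (Q \<eta>) :: real) -` B)" for B
  proof -
    have "open {\<eta>. (of_bool (Q \<eta>) :: real) \<in> B}"
    proof (rule open_cylinder[where S = S, OF S])
      fix \<eta> \<eta>' :: "'a \<Rightarrow> nat"
      assume *: "\<forall>x\<in>S. \<eta> x = \<eta>' x" "(of_bool (Q \<eta>) :: real) \<in> B"
      then have "Q \<eta> \<longleftrightarrow> Q \<eta>'" using Q[of \<eta> \<eta>'] Q[of \<eta>' \<eta>] by metis
      then show "(of_bool (Q \<eta>') :: real) \<in> B" using *(2) by simp
    qed
    then show ?thesis by (simp add: vimage_def)
  qed
  then show ?thesis by (simp add: continuous_on_open_vimage)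
qed

context bgraph
begin

lemma gball_mono: "L \<le> j \<Longrightarrow> gball v L \<subseteq> gball v j" by (auto simp: gball_def)

lemma center_in_gball: "v \<in> gball v j" by (simp add: gball_def gdist_def Least_eq_0)

lemma gball_UN: "(\<Union>j. gball v j) = UNIV" by (auto simp: gball_def)

text \<open>The indicator of a cylinder event is continuous, so weak convergence along balls gives
  convergence of its probability.\<close>

lemma law_limit:
  assumes \<mu>: "uniform_recurrent_sandpile_law G \<mu>"
    and S: "finite S" and Q: "\<And>\<eta> \<eta>'. \<forall>x\<in>S. \<eta> x = \<eta>' x \<Longrightarrow> Q \<eta> \<Longrightarrow> Q \<eta>'"
  shows "(\<lambda>j. real (card {\<eta> \<in> RC (gball v j). Q \<eta>}) / real (card (RC (gball v j)))) \<longlonglongrightarrow> measure \<mu> {\<eta>. Q \<eta>}"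
proof -
  interpret prob_space \<mu> using \<mu> by (simp add: uniform_recurrent_sandpile_law_def)
  have sets: "sets \<mu> = sets borel" using \<mu> by (simp add: uniform_recurrent_sandpile_law_def)
  then have space: "space \<mu> = UNIV" using sets_eq_imp_space_eq by fastforce
  let ?f = "\<lambda>\<eta>. of_bool (Q \<eta>) :: real"
  have cont: "continuous_on UNIV ?f"
    by (rule continuous_cylinder[where Q = Q, OF S]) (erule Q, assumption)
  have "converges_weakly (\<lambda>j. uniform_recurrent G (gball v j)) \<mu>"
  proof -
    have "incseq (gball v)" using gball_mono by (auto simp: incseq_def)
    then show ?thesis using \<mu> gball_UN[of v] finite_gball[of v] by (simp add: uniform_recurrent_sandpile_law_def)
  qed
  moreover have "bounded (range ?f)" by (rule boundedI[of _ 1]) auto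
  ultimately have "(\<lambda>j. \<integral>\<eta>. ?f \<eta> \<partial>uniform_recurrent G (gball v j)) \<longlonglongrightarrow> (\<integral>\<eta>. ?f \<eta> \<partial>\<mu>)"
    using cont unfolding converges_weakly_def by blast
  moreover have "(\<integral>\<eta>. ?f \<eta> \<partial>uniform_recurrent G (gball v j)) =
    real (card {\<eta> \<in> RC (gball v j). Q \<eta>}) / real (card (RC (gball v j)))" for j
  proof -
    have rec: "recurrent G (gball v j) = RC (gball v j)"
      using recurrent_eq_RC[OF finite_gball] center_in_gball by blast
    have ne: "RC (gball v j) \<noteq> {}" using card_RC_pos[OF finite_gball, of v j] by auto
    have "(\<integral>\<eta>. ?f \<eta> \<partial>uniform_recurrent G (gball v j)) = (\<integral>\<eta>. ?f \<eta> \<partial>measure_pmf (pmf_of_set (RC (gball v j))))"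
      unfolding uniform_recurrent_def rec
      by (rule integral_distr) (auto intro: borel_measurable_continuous_onI cont)
    also have "\<dots> = (\<Sum>\<eta>\<in>RC (gball v j). ?f \<eta>) / real (card (RC (gball v j)))"
      by (rule integral_pmf_of_set[OF ne finite_RC[OF finite_gball]])
    finally show ?thesis using card_as_sum[OF finite_RC[OF finite_gball], of v j Q] by simp
  qed
  moreover have "(\<integral>\<eta>. ?f \<eta> \<partial>\<mu>) = measure \<mu> {\<eta>. Q \<eta>}"
  proof -
    have "?f = indicator {\<eta>. Q \<eta>}" by (auto simp: indicator_def)
    then show ?thesis by (simp add: space)
  qed
  ultimately show ?thesis by simp
qed

text \<open>Confining the topplings to a ball makes the event depend on finitely many heights, and
  it increases with the radius.\<close>

definition avalL :: "'a \<Rightarrow> nat \<Rightarrow> ('a list \<Rightarrow> bool) \<Rightarrow> ('a \<Rightarrow> nat) \<Rightarrow> bool" where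
  "avalL v L R \<eta> \<longleftrightarrow> (\<exists>xs. set xs \<subseteq> gball v L \<and> legal G UNIV (padd \<eta> (dl v 1)) xs \<and> R xs)"

lemma avalL_cylinder:
  assumes "\<forall>x\<in>gball v L. \<eta> x = \<eta>' x" "avalL v L R \<eta>"
  shows "avalL v L R \<eta>'"
proof -
  obtain xs where xs: "set xs \<subseteq> gball v L" "legal G UNIV (padd \<eta> (dl v 1)) xs" "R xs" using assms(2) by (auto simp: avalL_def)
  have "legal G (gball v L) (padd \<eta>' (dl v 1)) xs \<longleftrightarrow> legal G UNIV (padd \<eta> (dl v 1)) xs"
    using assms(1) by (intro legal_transfer(1) xs) (auto simp: padd_def)
  moreover have "legal G (gball v L) (padd \<eta>' (dl v 1)) xs \<longleftrightarrow> legal G UNIV (padd \<eta>' (dl v 1)) xs"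
    by (intro legal_transfer(1) xs) auto
  ultimately show ?thesis using xs by (auto simp: avalL_def)
qed

lemma avalL_iff_ev:
  assumes "L \<le> j"
  shows "avalL v L R \<eta> \<longleftrightarrow> ev (gball v j) v (\<lambda>xs. R xs \<and> set xs \<subseteq> gball v L) \<eta>"
proof -
  have "legal G (gball v j) (padd \<eta> (dl v 1)) xs \<longleftrightarrow> legal G UNIV (padd \<eta> (dl v 1)) xs" if "set xs \<subseteq> gball v L" for xs
    by (intro legal_transfer(1)) (use that gball_mono[OF assms, of v] in auto)
  then show ?thesis unfolding avalL_def ev_def by blast
qed

lemma aval_UN: "{\<eta>. aval v R \<eta>} = (\<Union>L. {\<eta>. avalL v L R \<eta>})"
proof -
  have "\<exists>L. set xs \<subseteq> gball v L" for xs
  proof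
    show "set xs \<subseteq> gball v (Max (insert 0 (gdist G v ` set xs)))" by (auto simp: gball_def intro!: Max_ge)
  qed
  then show ?thesis unfolding aval_def avalL_def by blast
qed

lemma measure_avalL_le:
  assumes \<mu>: "uniform_recurrent_sandpile_law G \<mu>"
  shows "measure \<mu> {\<eta>. avalL v L R \<eta>} \<le> measure \<mu> {\<eta>. aval v R \<eta>}"
    and "(\<lambda>L. measure \<mu> {\<eta>. avalL v L R \<eta>}) \<longlonglongrightarrow> measure \<mu> {\<eta>. aval v R \<eta>}"
proof -
  interpret prob_space \<mu> using \<mu> by (simp add: uniform_recurrent_sandpile_law_def)
  have sets: "sets \<mu> = sets borel" using \<mu> by (simp add: uniform_recurrent_sandpile_law_def)
  have m: "{\<eta>. avalL v L R \<eta>} \<in> sets \<mu>" for L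
    unfolding sets by (rule borel_open, rule open_cylinder[OF finite_gball[of v L]], rule avalL_cylinder)
  have mU: "{\<eta>. aval v R \<eta>} \<in> sets \<mu>" unfolding aval_UN using m by auto
  show "measure \<mu> {\<eta>. avalL v L R \<eta>} \<le> measure \<mu> {\<eta>. aval v R \<eta>}"
    by (rule finite_measure_mono[OF _ mU]) (use aval_UN in blast)
  have "incseq (\<lambda>L. {\<eta>. avalL v L R \<eta>})"
    unfolding incseq_def avalL_def using gball_mono[of _ _ v] by blast
  from finite_Lim_measure_incseq[OF _ this] m
  show "(\<lambda>L. measure \<mu> {\<eta>. avalL v L R \<eta>}) \<longlonglongrightarrow> measure \<mu> {\<eta>. aval v R \<eta>}" unfolding aval_UN by blast
qed

lemma law_upper:
  assumes \<mu>: "uniform_recurrent_sandpile_law G \<mu>"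
    and b: "\<And>j. real (card {\<eta> \<in> RC (gball v j). ev (gball v j) v R \<eta>}) \<le> real (card (RC (gball v j))) * b"
  shows "measure \<mu> {\<eta>. aval v R \<eta>} \<le> b"
proof (rule LIMSEQ_le_const2[OF measure_avalL_le(2)[OF \<mu>]], intro exI allI impI)
  fix L :: nat
  have "(\<lambda>j. real (card {\<eta> \<in> RC (gball v j). avalL v L R \<eta>}) / real (card (RC (gball v j)))) \<longlonglongrightarrow> measure \<mu> {\<eta>. avalL v L R \<eta>}"
    by (rule law_limit[OF \<mu> finite_gball[of v L]], rule avalL_cylinder)
  then show "measure \<mu> {\<eta>. avalL v L R \<eta>} \<le> b"
  proof (rule LIMSEQ_le_const2, intro exI allI impI)
    fix j assume "L \<le> j"
    have "real (card {\<eta> \<in> RC (gball v j). avalL v L R \<eta>}) \<le> real (card {\<eta> \<in> RC (gball v j). ev (gball v j) v R \<eta>})"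
      unfolding avalL_iff_ev[OF \<open>L \<le> j\<close>]
      by (intro of_nat_mono card_mono) (auto simp: ev_def finite_RC[OF finite_gball])
    also note b[of j]
    finally show "real (card {\<eta> \<in> RC (gball v j). avalL v L R \<eta>}) / real (card (RC (gball v j))) \<le> b"
      using card_RC_pos[OF finite_gball, of v j] by (simp add: divide_le_eq mult.commute)
  qed
qed

text \<open>In a finite volume the event may rely on topplings far away, which the confined events
  do not see. The hypothesis \<open>far\<close> bounds their probability uniformly in the volume, so
  that the limit in \<open>j\<close> can be taken before that in \<open>L\<close>.\<close>

lemma law_lower:
  assumes \<mu>: "uniform_recurrent_sandpile_law G \<mu>"
    and a: "\<And>j. J \<le> j \<Longrightarrow> real (card (RC (gball v j))) * a \<le> real (card {\<eta> \<in> RC (gball v j). ev (gball v j) v R \<eta>})"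
    and far: "\<And>j r. r \<ge> 1 \<Longrightarrow> real (card {\<eta> \<in> RC (gball v j). ev (gball v j) v (\<lambda>xs. \<exists>u\<in>set xs. r \<le> gdist G v u) \<eta>})
      \<le> real (card (RC (gball v j))) * (\<Gamma> / real r)"
  shows "a \<le> measure \<mu> {\<eta>. aval v R \<eta>}"
proof -
  have *: "a - \<Gamma> / real (Suc L) \<le> measure \<mu> {\<eta>. aval v R \<eta>}" for L
  proof -
    have "(\<lambda>j. real (card {\<eta> \<in> RC (gball v j). avalL v L R \<eta>}) / real (card (RC (gball v j)))) \<longlonglongrightarrow> measure \<mu> {\<eta>. avalL v L R \<eta>}"
      by (rule law_limit[OF \<mu> finite_gball[of v L]], rule avalL_cylinder)
    then have "a - \<Gamma> / real (Suc L) \<le> measure \<mu> {\<eta>. avalL v L R \<eta>}"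
    proof (rule LIMSEQ_le_const, intro exI allI impI)
      fix j assume "max L J \<le> j"
      then have j: "L \<le> j" "J \<le> j" by auto
      let ?K = "gball v j"
      let ?A = "{\<eta> \<in> RC ?K. ev ?K v (\<lambda>xs. \<exists>u\<in>set xs. Suc L \<le> gdist G v u) \<eta>}"
      have f: "finite (RC ?K)" by (rule finite_RC[OF finite_gball])
      have "{\<eta> \<in> RC ?K. ev ?K v R \<eta>} \<subseteq> {\<eta> \<in> RC ?K. avalL v L R \<eta>} \<union> ?A"
      proof
        fix \<eta> assume "\<eta> \<in> {\<eta> \<in> RC ?K. ev ?K v R \<eta>}"
        then obtain xs where xs: "\<eta> \<in> RC ?K" "legal G ?K (padd \<eta> (dl v 1)) xs" "R xs" by (auto simp: ev_def)
        show "\<eta> \<in> {\<eta> \<in> RC ?K. avalL v L R \<eta>} \<union> ?A"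
        proof (cases "set xs \<subseteq> gball v L")
          case True
          then have "ev ?K v (\<lambda>xs. R xs \<and> set xs \<subseteq> gball v L) \<eta>" using xs by (auto simp: ev_def)
          then show ?thesis using xs(1) avalL_iff_ev[OF j(1)] by blast
        next
          case False
          then have "\<exists>u\<in>set xs. \<not> gdist G v u \<le> L" by (auto simp: gball_def subset_iff)
          then obtain u where "u \<in> set xs" "Suc L \<le> gdist G v u" by (auto simp: not_le Suc_le_eq)
          then have "ev ?K v (\<lambda>xs. \<exists>u\<in>set xs. Suc L \<le> gdist G v u) \<eta>" using xs(2) unfolding ev_def by blast
          then show ?thesis using xs(1) by blast
        qed
      qed
      then have "card {\<eta> \<in> RC ?K. ev ?K v R \<eta>} \<le> card ({\<eta> \<in> RC ?K. avalL v L R \<eta>} \<union> ?A)" by (intro card_mono) (auto simp: f)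
      also have "\<dots> \<le> card {\<eta> \<in> RC ?K. avalL v L R \<eta>} + card ?A" by (rule card_Un_le)
      finally have "real (card {\<eta> \<in> RC ?K. ev ?K v R \<eta>}) \<le> real (card {\<eta> \<in> RC ?K. avalL v L R \<eta>}) + real (card ?A)" by linarith
      then have "real (card (RC ?K)) * a - real (card (RC ?K)) * (\<Gamma> / real (Suc L)) \<le> real (card {\<eta> \<in> RC ?K. avalL v L R \<eta>})"
        using a[OF j(2)] far[of "Suc L" j] by linarith
      then show "a - \<Gamma> / real (Suc L) \<le> real (card {\<eta> \<in> RC ?K. avalL v L R \<eta>}) / real (card (RC ?K))"
        using card_RC_pos[OF finite_gball, of v j] by (simp only: pos_le_divide_eq of_nat_0_less_iff left_diff_distrib mult.commute[of "real (card (RC ?K))"])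
    qed
    also note measure_avalL_le(1)[OF \<mu>]
    finally show ?thesis .
  qed
  have "(\<lambda>L. a - \<Gamma> * inverse (real (Suc L))) \<longlonglongrightarrow> a - \<Gamma> * 0"
    by (intro tendsto_intros LIMSEQ_inverse_real_of_nat)
  then have "(\<lambda>L. a - \<Gamma> / real (Suc L)) \<longlonglongrightarrow> a" by (simp only: divide_inverse mult_zero_right diff_zero)
  then show ?thesis by (rule LIMSEQ_le_const2) (use * in blast)
qed

end

section \<open>The six bounds in infinite volume\<close>

context bgraph
begin

lemma card_ev_mono:
  assumes "finite K" "\<And>xs. R xs \<Longrightarrow> R' xs"
  shows "real (card {\<eta> \<in> RC K. ev K v R \<eta>}) \<le> real (card {\<eta> \<in> RC K. ev K v R' \<eta>})"
  using finite_RC[OF assms(1)] by (intro of_nat_mono card_mono) (auto simp: ev_def intro: assms(2))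

lemma minus_half_powr: "real n powr (-1/2) = 1 / sqrt (real n)"
  by (simp add: powr_minus_divide powr_half_sqrt)

lemma diam_upper:
  assumes \<mu>: "uniform_recurrent_sandpile_law G \<mu>" and n: "n \<ge> 1"
    and \<Lambda>: "\<And>n K v. n \<ge> 1 \<Longrightarrow> finite K \<Longrightarrow> v \<notin> K \<Longrightarrow> EF K (\<lambda>F. of_bool (arm K F v n)) \<le> \<Lambda> / real n" "\<Lambda> > 0"
  shows "measure \<mu> {\<eta>. aval v (\<lambda>xs. \<exists>u\<in>set xs. \<exists>w\<in>set xs. n \<le> gdist G u w) \<eta>} \<le> 2 * gmax * \<Lambda> / real n"
proof (rule law_upper[OF \<mu>])
  fix j
  \<comment> \<open>Of two vertices at distance at least \<open>n\<close>, one has distance at least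
    half of \<open>n\<close>, rounded up, from \<open>v\<close>.\<close>
  let ?K = "gball v j" and ?r = "(n + 1) div 2"
  have K: "finite ?K" "v \<in> ?K" by (rule finite_gball, rule center_in_gball)
  have r: "?r \<ge> 1" "real n \<le> 2 * real ?r" using n by linarith+
  have "real (card {\<eta> \<in> RC ?K. ev ?K v (\<lambda>xs. \<exists>u\<in>set xs. \<exists>w\<in>set xs. n \<le> gdist G u w) \<eta>})
    \<le> real (card {\<eta> \<in> RC ?K. ev ?K v (\<lambda>xs. \<exists>u\<in>set xs. ?r \<le> gdist G v u) \<eta>})"
  proof (rule card_ev_mono[OF K(1)])
    fix xs assume "\<exists>u\<in>set xs. \<exists>w\<in>set xs. n \<le> gdist G u w"
    then obtain u w where uw: "u \<in> set xs" "w \<in> set xs" "n \<le> gdist G u w" by blast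
    have "gdist G u w \<le> gdist G v u + gdist G v w" using gdist_triangle[of u w v] gdist_sym[of u v] by simp
    then have "?r \<le> gdist G v u \<or> ?r \<le> gdist G v w" using uw(3) by linarith
    then show "\<exists>u\<in>set xs. ?r \<le> gdist G v u" using uw by blast
  qed
  also have "\<dots> \<le> real (card (RC ?K)) * (gmax * \<Lambda> / real ?r)"
    using K by (intro radius_upper r \<Lambda>) auto
  also have "\<dots> \<le> real (card (RC ?K)) * (2 * gmax * \<Lambda> / real n)"
  proof (intro mult_left_mono)
    have "gmax * \<Lambda> * real n \<le> gmax * \<Lambda> * (2 * real ?r)" using r gmax_ge1 \<Lambda>(2) by (intro mult_left_mono) auto
    then show "gmax * \<Lambda> / real ?r \<le> 2 * gmax * \<Lambda> / real n" using r n by (simp add: field_simps)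
  qed simp
  finally show "real (card {\<eta> \<in> RC ?K. ev ?K v (\<lambda>xs. \<exists>u\<in>set xs. \<exists>w\<in>set xs. n \<le> gdist G u w) \<eta>})
    \<le> real (card (RC ?K)) * (2 * gmax * \<Lambda> / real n)" .
qed

lemma size_upper:
  assumes \<mu>: "uniform_recurrent_sandpile_law G \<mu>" and n: "n \<ge> 1"
    and \<Lambda>: "\<And>n K v. n \<ge> 1 \<Longrightarrow> finite K \<Longrightarrow> v \<notin> K \<Longrightarrow> EF K (\<lambda>F. of_bool (arm K F v n)) \<le> \<Lambda> / real n" "\<Lambda> > 0"
    and R: "\<And>xs. R xs \<Longrightarrow> n \<le> length xs"
  shows "measure \<mu> {\<eta>. aval v R \<eta>} \<le> gmax * (\<Lambda> + 1 + 2 * D * C) * real n powr (-1/2)"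
proof (rule law_upper[OF \<mu>])
  fix j
  let ?K = "gball v j"
  define r where "r = nat \<lceil>sqrt (real n)\<rceil>"
  have K: "finite ?K" "v \<in> ?K" by (rule finite_gball, rule center_in_gball)
  have s1: "sqrt (real n) \<ge> 1" using n by simp
  have r: "r \<ge> 1" "sqrt (real n) \<le> real r" "real r \<le> 2 * sqrt (real n)" using s1 unfolding r_def by linarith+
  have rs: "0 < real r * sqrt (real n)" using r s1 by (intro mult_pos_pos) linarith+
  have sq: "real n = sqrt (real n) * sqrt (real n)" by simp
  have "real (card {\<eta> \<in> RC ?K. ev ?K v R \<eta>}) \<le> real (card {\<eta> \<in> RC ?K. ev ?K v (\<lambda>xs. n \<le> length xs) \<eta>})"
    by (rule card_ev_mono[OF K(1) R])
  also have "\<dots> \<le> real (card (RC ?K)) * (gmax * (\<Lambda> / real r + (1 + D * C * real r) / real n))"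
    using K by (intro volume_upper r n \<Lambda>) auto
  also have "\<dots> \<le> real (card (RC ?K)) * (gmax * ((\<Lambda> + 1 + 2 * D * C) / sqrt (real n)))"
  proof (intro mult_left_mono)
    have 1: "\<Lambda> / real r \<le> \<Lambda> / sqrt (real n)" using r \<Lambda>(2) rs by (intro divide_left_mono) (linarith, linarith, metis mult.commute)
    have "D * C * real r \<le> D * C * (2 * sqrt (real n))" using D_ge1 C_nonneg r by (intro mult_left_mono) auto
    then have "1 + D * C * real r \<le> (1 + 2 * D * C) * sqrt (real n)" using s1 distrib_right[of 1 "2 * D * C" "sqrt (real n)"] by linarith
    then have "(1 + D * C * real r) / real n \<le> (1 + 2 * D * C) * sqrt (real n) / real n" by (intro divide_right_mono) auto
    also have "\<dots> = (1 + 2 * D * C) / sqrt (real n)" unfolding divide_inverse[of "1 + 2 * D * C"] sqrt_divide_self_eq[OF of_nat_0_le_iff, symmetric] by simp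
    finally show "\<Lambda> / real r + (1 + D * C * real r) / real n \<le> (\<Lambda> + 1 + 2 * D * C) / sqrt (real n)"
      using 1 by (simp add: add_divide_distrib)
  qed (use gmax_ge1 in auto)
  finally show "real (card {\<eta> \<in> RC ?K. ev ?K v R \<eta>}) \<le> real (card (RC ?K)) * (gmax * (\<Lambda> + 1 + 2 * D * C) * real n powr (-1/2))"
    unfolding minus_half_powr by simp
qed

lemma law_lower_last_wave:
  assumes \<mu>: "uniform_recurrent_sandpile_law G \<mu>"
    and \<Lambda>: "\<And>n K v. n \<ge> 1 \<Longrightarrow> finite K \<Longrightarrow> v \<notin> K \<Longrightarrow> EF K (\<lambda>F. of_bool (arm K F v n)) \<le> \<Lambda> / real n"
    and R: "\<And>xs A. P A \<Longrightarrow> insert v A \<subseteq> set xs \<Longrightarrow> R xs"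
    and a: "\<And>K. finite K \<Longrightarrow> v \<notin> K \<Longrightarrow> gball v J \<subseteq> insert v K \<Longrightarrow>
      a \<le> EF K (\<lambda>F. of_bool (miss K F v \<and> P {x \<in> K. root K F x = v}))"
  shows "1 / D * a \<le> measure \<mu> {\<eta>. aval v R \<eta>}"
proof (rule law_lower[OF \<mu>, where J = J and \<Gamma> = "gmax * \<Lambda>"])
  fix j
  have K: "finite (gball v j)" "v \<in> gball v j" by (rule finite_gball, rule center_in_gball)
  show "real (card {\<eta> \<in> RC (gball v j). ev (gball v j) v (\<lambda>xs. \<exists>u\<in>set xs. r \<le> gdist G v u) \<eta>})
      \<le> real (card (RC (gball v j))) * (gmax * \<Lambda> / real r)" if "r \<ge> 1" for r
    using K that by (intro radius_upper \<Lambda>) auto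
  assume j: "J \<le> j"
  let ?L = "gball v j - {v}"
  have "a \<le> EF ?L (\<lambda>F. of_bool (miss ?L F v \<and> P {x \<in> ?L. root ?L F x = v}))"
    using K gball_mono[OF j, of v] by (intro a) auto
  then have "1 / D * a \<le> 1 / D * EF ?L (\<lambda>F. of_bool (miss ?L F v \<and> P {x \<in> ?L. root ?L F x = v}))"
    using D_ge1 by (intro mult_left_mono) auto
  then have "real (card (RC (gball v j))) * (1 / D * a) \<le>
    real (card (RC (gball v j))) * (1 / D * EF ?L (\<lambda>F. of_bool (miss ?L F v \<and> P {x \<in> ?L. root ?L F x = v})))"
    by (rule mult_left_mono) simp
  also have "\<dots> \<le> real (card {\<eta> \<in> RC (gball v j). ev (gball v j) v R \<eta>})"
    by (rule last_wave_lower[where P = P, OF K]) (rule R)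
  finally show "real (card (RC (gball v j))) * (1 / D * a) \<le> real (card {\<eta> \<in> RC (gball v j). ev (gball v j) v R \<eta>})" .
qed

text \<open>The estimates use the nonintersection probability only through finite walks, so
  trajectory measures stay out of them until the end.\<close>

definition nonint :: "'a \<Rightarrow> real \<Rightarrow> bool" where
  "nonint v q \<longleftrightarrow> 0 \<le> q \<and> (\<forall>n m. q \<le> wexp n v (\<lambda>l. wexp m v (\<lambda>l'. of_bool (v \<notin> set l \<and> v \<notin> set l' \<and> set l \<inter> set l' = {}))))"

lemma nonint_le1: "nonint v q \<Longrightarrow> q \<le> 1"
  unfolding nonint_def using order_trans[OF _ wexp_le1[of "\<lambda>l. wexp 0 v (\<lambda>l'. of_bool (v \<notin> set l \<and> v \<notin> set l' \<and> set l \<inter> set l' = {}))" 0 v], of q]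
  by fastforce

lemma diam_lower:
  assumes \<mu>: "uniform_recurrent_sandpile_law G \<mu>" and n: "n \<ge> 1" and q: "nonint v q"
    and \<Lambda>: "\<And>n K v. n \<ge> 1 \<Longrightarrow> finite K \<Longrightarrow> v \<notin> K \<Longrightarrow> EF K (\<lambda>F. of_bool (arm K F v n)) \<le> \<Lambda> / real n"
  shows "1 / D * (1 / (D\<^sup>2 * C2)) * q\<^sup>2 / real n \<le> measure \<mu> {\<eta>. aval v (\<lambda>xs. \<exists>u\<in>set xs. \<exists>w\<in>set xs. n \<le> gdist G u w) \<eta>}"
proof -
  have "1 / D * (1 / (D\<^sup>2 * C2) * q\<^sup>2 / real n) \<le> measure \<mu> {\<eta>. aval v (\<lambda>xs. \<exists>u\<in>set xs. \<exists>w\<in>set xs. n \<le> gdist G u w) \<eta>}"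
  proof (rule law_lower_last_wave[OF \<mu> \<Lambda>, where J = "3 * n" and P = "\<lambda>A. \<exists>u\<in>A. n \<le> gdist G v u"])
    fix K assume K: "finite K" "v \<notin> K" "gball v (3 * n) \<subseteq> insert v K"
    have eq: "(\<exists>u\<in>{x \<in> K. root K F x = v}. n \<le> gdist G v u) \<longleftrightarrow> arm K F v n" for F unfolding arm_def by blast
    show "1 / (D\<^sup>2 * C2) * q\<^sup>2 / real n \<le> EF K (\<lambda>F. of_bool (miss K F v \<and> (\<exists>u\<in>{x \<in> K. root K F x = v}. n \<le> gdist G v u)))"
      unfolding eq using q by (intro arm_lower[OF K(1,2) n K(3)]) (auto simp: nonint_def)
  qed auto
  then show ?thesis by simp
qed

lemma size_lower:
  assumes \<mu>: "uniform_recurrent_sandpile_law G \<mu>" and n: "n \<ge> 1" and q: "nonint v q"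
    and \<Lambda>: "\<And>n K v. n \<ge> 1 \<Longrightarrow> finite K \<Longrightarrow> v \<notin> K \<Longrightarrow> EF K (\<lambda>F. of_bool (arm K F v n)) \<le> \<Lambda> / real n" "\<Lambda> \<ge> 1"
    and R: "\<And>xs. n \<le> card (set xs) \<Longrightarrow> R xs"
  shows "1 / D * (1 / (8 * D\<^sup>2 * C2 * sqrt (2 * D * \<Lambda>))) * q powr (5/2) * real n powr (-1/2) \<le> measure \<mu> {\<eta>. aval v R \<eta>}"
proof (cases "q = 0")
  case True
  then show ?thesis by simp
next
  case False
  have D: "D \<ge> 1" by (rule D_ge1)
  have q01: "0 < q" "q \<le> 1" using False q nonint_le1 by (auto simp: nonint_def)
  \<comment> \<open>The radius of order \<open>sqrt x\<close> is the smallest for which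
    \<open>volume_lower\<close> admits the threshold \<open>n\<close>. As \<open>sqrt x\<close> is
    proportional to sqrt(n / q), the bound \<open>q\<^sup>2 / r\<close> takes the form in which 5/2
    appears.\<close>
  define x where "x = 2 * D * \<Lambda> * real n / q"
  define r where "r = nat \<lceil>sqrt x\<rceil>"
  have "1 * 1 * 1 \<le> 2 * D * \<Lambda> * real n" using D \<Lambda>(2) n by (intro mult_mono) auto
  then have x1: "1 \<le> x" using q01 unfolding x_def by (simp add: le_divide_eq)
  then have s1: "sqrt x \<ge> 1" by simp
  have r: "r \<ge> 1" "sqrt x \<le> real r" "real r \<le> 2 * sqrt x" using s1 unfolding r_def by linarith+
  have rs: "0 < real r * (2 * sqrt x)" using r s1 by (intro mult_pos_pos) linarith+
  have "(sqrt x)\<^sup>2 \<le> (real r)\<^sup>2" using r s1 by (intro power_mono) auto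
  then have "x \<le> (real r)\<^sup>2" using x1 by simp
  then have sn: "real n \<le> (real r)\<^sup>2 * q / (2 * D * \<Lambda>)" using q01 D \<Lambda>(2) unfolding x_def by (simp add: field_simps)
  have sx: "sqrt x = sqrt (2 * D * \<Lambda>) * sqrt (real n) / sqrt q"
    unfolding x_def by (simp add: real_sqrt_mult real_sqrt_divide)
  have qp: "q powr (5/2) = q\<^sup>2 * sqrt q"
  proof -
    have "q powr (5/2) = q powr (2 + 1/2)" by simp
    also have "\<dots> = q\<^sup>2 * sqrt q" using q01 by (subst powr_add) (simp add: powr_half_sqrt)
    finally show ?thesis .
  qed
  have "1 / (8 * D\<^sup>2 * C2 * sqrt (2 * D * \<Lambda>)) * q powr (5/2) * real n powr (-1/2) = 1 / (4 * D\<^sup>2 * C2) * q\<^sup>2 / (2 * sqrt x)"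
    unfolding sx qp minus_half_powr using q01 by simp
  also have "\<dots> \<le> 1 / (4 * D\<^sup>2 * C2) * q\<^sup>2 / real r"
    proof (rule divide_left_mono)
    show "0 \<le> 1 / (4 * D\<^sup>2 * C2) * q\<^sup>2" using C2_pos by simp
  qed (use r rs in \<open>simp_all add: mult.commute\<close>)
  finally have ar: "1 / D * (1 / (8 * D\<^sup>2 * C2 * sqrt (2 * D * \<Lambda>)) * q powr (5/2) * real n powr (-1/2)) \<le> 1 / D * (1 / (4 * D\<^sup>2 * C2) * q\<^sup>2 / real r)"
    using D by (intro mult_left_mono) auto
  also have "\<dots> \<le> measure \<mu> {\<eta>. aval v R \<eta>}"
  proof (rule law_lower_last_wave[OF \<mu> \<Lambda>(1), where J = "3 * r" and P = "\<lambda>A. finite A \<and> n \<le> card A"])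
    fix K assume K: "finite K" "v \<notin> K" "gball v (3 * r) \<subseteq> insert v K"
    have "1 / (4 * D\<^sup>2 * C2) * q\<^sup>2 / real r \<le> EF K (\<lambda>F. of_bool (miss K F v \<and> real n < real (card {u \<in> K. root K F u = v})))"
      using q \<Lambda>(2) sn K(1,2) r(1) by (intro volume_lower[OF K(1,2) r(1) K(3), where \<Lambda> = \<Lambda>] \<Lambda>(1)) (auto simp: nonint_def)
    also have "\<dots> \<le> EF K (\<lambda>F. of_bool (miss K F v \<and> finite {x \<in> K. root K F x = v} \<and> n \<le> card {x \<in> K. root K F x = v}))"
      using K by (intro EF_mono) auto
    finally show "1 / (4 * D\<^sup>2 * C2) * q\<^sup>2 / real r \<le> \<dots>" .
  next
    fix xs A assume A: "finite A \<and> n \<le> card A" "insert v A \<subseteq> set xs"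
    then show "R xs" using card_mono[of "set xs" A] by (intro R) auto
  qed
  finally show ?thesis by (simp only: mult.assoc)
qed

theorem avalanche_bounds:
  "\<exists>a A :: real. 0 < a \<and> a \<le> A \<and> (\<forall>\<mu>. uniform_recurrent_sandpile_law G \<mu> \<longrightarrow> (\<forall>v n q. n \<ge> 1 \<longrightarrow> nonint v q \<longrightarrow>
       a * q ^ 2 / real n \<le> measure \<mu> {\<eta>. diam_ext G (AvC G v \<eta>) \<ge> enat n} \<and>
       measure \<mu> {\<eta>. diam_ext G (AvC G v \<eta>) \<ge> enat n} \<le> A / real n \<and>
       a * q powr (5/2) * real n powr (-1/2) \<le> measure \<mu> {\<eta>. AvC_size G v \<eta> \<ge> of_nat n} \<and>
       measure \<mu> {\<eta>. AvC_size G v \<eta> \<ge> of_nat n} \<le> A * real n powr (-1/2) \<and>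
       a * q powr (5/2) * real n powr (-1/2) \<le> measure \<mu> {\<eta>. Av_size G v \<eta> \<ge> of_nat n} \<and>
       measure \<mu> {\<eta>. Av_size G v \<eta> \<ge> of_nat n} \<le> A * real n powr (-1/2)))"
proof -
  obtain \<Lambda>0 where \<Lambda>0: "\<Lambda>0 > 0" "\<And>n K v. n \<ge> 1 \<Longrightarrow> finite K \<Longrightarrow> v \<notin> K \<Longrightarrow> EF K (\<lambda>F. of_bool (arm K F v n)) \<le> \<Lambda>0 / real n"
    using one_arm by blast
  define \<Lambda> where "\<Lambda> = max \<Lambda>0 1"
  have \<Lambda>1: "\<Lambda> \<ge> 1" "\<Lambda> > 0" by (auto simp: \<Lambda>_def)
  have \<Lambda>: "EF K (\<lambda>F. of_bool (arm K F v n)) \<le> \<Lambda> / real n" if "n \<ge> 1" "finite K" "v \<notin> K" for n K v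
    using order_trans[OF \<Lambda>0(2)[OF that], of "\<Lambda> / real n"] that(1) by (simp add: \<Lambda>_def divide_right_mono)
  have D: "D \<ge> 1" by (rule D_ge1)
  define a1 where "a1 = 1 / D * (1 / (D\<^sup>2 * C2))"
  define a2 where "a2 = 1 / D * (1 / (8 * D\<^sup>2 * C2 * sqrt (2 * D * \<Lambda>)))"
  define A1 where "A1 = 2 * gmax * \<Lambda>"
  define A2 where "A2 = gmax * (\<Lambda> + 1 + 2 * D * C)"
  have pos: "0 < a1" "0 < a2" using D C2_pos \<Lambda>1 by (auto simp: a1_def a2_def)
  define a where "a = min a1 a2"
  define A where "A = Max {a, A1, A2}"
  have aa: "0 < a" "a \<le> a1" "a \<le> a2" "a \<le> A" "A1 \<le> A" "A2 \<le> A" using pos by (auto simp: a_def A_def)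
  show ?thesis
  proof (rule exI[of _ a], rule exI[of _ A], intro conjI allI impI)
    fix \<mu> :: "('a \<Rightarrow> nat) measure" and v :: 'a and n :: nat and q :: real
    assume \<mu>: "uniform_recurrent_sandpile_law G \<mu>" and n: "1 \<le> n" and q: "nonint v q"
    have q0: "0 \<le> q" using q by (simp add: nonint_def)
    have eqs: "{\<eta>. diam_ext G (AvC G v \<eta>) \<ge> enat n} = {\<eta>. aval v (\<lambda>xs. \<exists>u\<in>set xs. \<exists>w\<in>set xs. n \<le> gdist G u w) \<eta>}"
      "{\<eta>. AvC_size G v \<eta> \<ge> of_nat n} = {\<eta>. aval v (\<lambda>xs. n \<le> card (set xs)) \<eta>}"
      "{\<eta>. Av_size G v \<eta> \<ge> of_nat n} = {\<eta>. aval v (\<lambda>xs. n \<le> length xs) \<eta>}"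
      using diam_ge_iff[OF n] AvC_size_ge_iff Av_size_ge_iff[OF n] by auto
    have cl: "n \<le> card (set xs) \<Longrightarrow> n \<le> length xs" for xs :: "'a list" using card_length[of xs] by linarith
    have "a * q ^ 2 / real n \<le> a1 * q ^ 2 / real n" using aa by (intro divide_right_mono mult_right_mono) auto
    also have "\<dots> \<le> measure \<mu> {\<eta>. diam_ext G (AvC G v \<eta>) \<ge> enat n}"
      unfolding eqs a1_def by (rule diam_lower[OF \<mu> n q \<Lambda>])
    finally show "a * q ^ 2 / real n \<le> measure \<mu> {\<eta>. diam_ext G (AvC G v \<eta>) \<ge> enat n}" .
    have "measure \<mu> {\<eta>. diam_ext G (AvC G v \<eta>) \<ge> enat n} \<le> A1 / real n"
      unfolding eqs A1_def by (rule diam_upper[OF \<mu> n \<Lambda> \<Lambda>1(2)])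
    also have "\<dots> \<le> A / real n" using aa by (intro divide_right_mono) auto
    finally show "measure \<mu> {\<eta>. diam_ext G (AvC G v \<eta>) \<ge> enat n} \<le> A / real n" .
    have l: "a * q powr (5/2) * real n powr (-1/2) \<le> a2 * q powr (5/2) * real n powr (-1/2)" using aa by (intro mult_right_mono) auto
    have u: "A2 * real n powr (-1/2) \<le> A * real n powr (-1/2)" using aa by (intro mult_right_mono) auto
    show "a * q powr (5/2) * real n powr (-1/2) \<le> measure \<mu> {\<eta>. AvC_size G v \<eta> \<ge> of_nat n}"
      unfolding eqs by (rule order_trans[OF l]) (unfold a2_def, rule size_lower[OF \<mu> n q \<Lambda> \<Lambda>1(1)])
    show "measure \<mu> {\<eta>. AvC_size G v \<eta> \<ge> of_nat n} \<le> A * real n powr (-1/2)"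
      unfolding eqs by (rule order_trans[OF _ u]) (unfold A2_def, rule size_upper[OF \<mu> n \<Lambda> \<Lambda>1(2) cl])
    show "a * q powr (5/2) * real n powr (-1/2) \<le> measure \<mu> {\<eta>. Av_size G v \<eta> \<ge> of_nat n}"
      unfolding eqs by (rule order_trans[OF l]) (unfold a2_def, rule size_lower[OF \<mu> n q \<Lambda> \<Lambda>1(1) cl])
    show "measure \<mu> {\<eta>. Av_size G v \<eta> \<ge> of_nat n} \<le> A * real n powr (-1/2)"
      unfolding eqs by (rule order_trans[OF _ u]) (unfold A2_def, rule size_upper[OF \<mu> n \<Lambda> \<Lambda>1(2)])
  qed (use aa in auto)
qed

end

section \<open>The law of the walk and the path expectations\<close>

lemma coordinate_event: "{X. X i = y} \<in> sets (srw (G :: 'a mgraph) v)"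
proof -
  have "(\<lambda>X. X i) -` {y} \<inter> space (PiM UNIV (\<lambda>_. count_space UNIV)) \<in> sets (PiM UNIV (\<lambda>_. count_space (UNIV :: 'a set)))"
    by (rule measurable_sets[OF measurable_component_singleton]) auto
  then show ?thesis by (simp add: sets_srw space_PiM vimage_def)
qed

text \<open>The sets \<open>A i\<close> cover the space up to a null set only. The sums bound the
  probabilities of \<open>T\<close> and of its complement from below and add up to 1, hence both
  bounds are equalities.\<close>

lemma (in prob_space) prob_eq_sum_partition:
  assumes I: "finite I" and A: "\<And>i. i \<in> I \<Longrightarrow> A i \<in> events" "disjoint_family_on A I" "(\<Sum>i\<in>I. prob (A i)) = 1"
    and T: "T \<in> events" and q: "\<And>i x. i \<in> I \<Longrightarrow> x \<in> A i \<Longrightarrow> x \<in> T \<longleftrightarrow> q i"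
  shows "prob T = (\<Sum>i\<in>I. prob (A i) * of_bool (q i))"
proof -
  have le: "(\<Sum>i\<in>I. prob (A i) * of_bool (Q i)) \<le> prob S"
    if S: "S \<in> events" and Q: "\<And>i x. i \<in> I \<Longrightarrow> x \<in> A i \<Longrightarrow> Q i \<Longrightarrow> x \<in> S" for S Q
  proof -
    have "(\<Sum>i\<in>I. prob (A i) * of_bool (Q i)) = (\<Sum>i\<in>{i \<in> I. Q i}. prob (A i))"
      using I by (intro sum.mono_neutral_cong_right) auto
    also have "\<dots> = prob (\<Union>i\<in>{i \<in> I. Q i}. A i)"
      using I A(1,2) by (intro finite_measure_finite_Union[symmetric]) (auto simp: disjoint_family_on_def)
    also have "\<dots> \<le> prob S" using Q by (intro finite_measure_mono S) auto
    finally show ?thesis .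
  qed
  have 1: "(\<Sum>i\<in>I. prob (A i) * of_bool (q i)) \<le> prob T" by (rule le[OF T]) (use q in blast)
  have "(\<Sum>i\<in>I. prob (A i) * of_bool (\<not> q i)) \<le> prob (space M - T)"
  proof (rule le)
    show "space M - T \<in> events" using T by auto
    fix i x assume i: "i \<in> I" "x \<in> A i" "\<not> q i"
    then show "x \<in> space M - T" using q[OF i(1,2)] A(1)[OF i(1)] sets.sets_into_space by blast
  qed
  then have 2: "(\<Sum>i\<in>I. prob (A i) * of_bool (\<not> q i)) \<le> 1 - prob T" using prob_compl[OF T] by simp
  have "prob (A i) * of_bool (q i) + prob (A i) * of_bool (\<not> q i) = prob (A i)" for i by simp
  then have "(\<Sum>i\<in>I. prob (A i) * of_bool (q i)) + (\<Sum>i\<in>I. prob (A i) * of_bool (\<not> q i)) = 1"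
    using A(3) by (simp add: sum.distrib[symmetric])
  then show ?thesis using 1 2 by linarith
qed

context sgraph
begin

primrec paths :: "nat \<Rightarrow> 'a \<Rightarrow> 'a list set" where
  "paths 0 x = {[]}"
| "paths (Suc n) x = (\<Union>y\<in>N x. (#) y ` paths n y)"

primrec pw :: "'a \<Rightarrow> 'a list \<Rightarrow> real" where
  "pw x [] = 1"
| "pw x (y # l) = p x y * pw y l"

lemma finite_paths: "finite (paths n x)"
  by (induction n arbitrary: x) auto

lemma length_paths: "l \<in> paths n x \<Longrightarrow> length l = n"
  by (induction n arbitrary: x l) auto

lemma wexp_paths: "wexp n x f = (\<Sum>l\<in>paths n x. pw x l * f l)"
proof (induction n arbitrary: x f)
  case (Suc n)
  have "(\<Sum>l\<in>paths (Suc n) x. pw x l * f l) = (\<Sum>y\<in>N x. \<Sum>l\<in>(#) y ` paths n y. pw x l * f l)"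
    unfolding paths.simps by (rule sum.UNION_disjoint) (auto simp: finite_paths)
  also have "\<dots> = (\<Sum>y\<in>N x. p x y * (\<Sum>l\<in>paths n y. pw y l * f (y # l)))"
    by (intro sum.cong) (auto simp: sum.reindex sum_distrib_left mult.assoc)
  finally show ?case by (simp add: Suc.IH PP_def)
qed simp

lemma pw_prod: "pw x l = (\<Prod>i<length l. p ((x # l) ! i) ((x # l) ! Suc i))"
proof (induction l arbitrary: x)
  case (Cons y l)
  have "(\<Prod>i<length (y # l). p ((x # y # l) ! i) ((x # y # l) ! Suc i)) =
    p x y * (\<Prod>i<length l. p ((y # l) ! i) ((y # l) ! Suc i))"
    by (simp only: length_Cons prod.lessThan_Suc_shift) simp
  then show ?case using Cons by simp
qed simp

definition hist :: "nat \<Rightarrow> (nat \<Rightarrow> 'a) \<Rightarrow> 'a list" where "hist n X = map X [0..<Suc n]"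

lemma hist_eq_iff: "length l = n \<Longrightarrow> hist n X = x # l \<longleftrightarrow> (\<forall>i\<le>n. X i = (x # l) ! i)"
proof
  assume l: "length l = n"
  { assume "hist n X = x # l"
    then have "hist n X ! i = (x # l) ! i" for i by simp
    then show "\<forall>i\<le>n. X i = (x # l) ! i" by (auto simp: hist_def nth_append less_Suc_eq_le simp del: upt_Suc) (metis add_0 diff_zero le_imp_less_Suc nth_map_upt) }
  { assume "\<forall>i\<le>n. X i = (x # l) ! i"
    then show "hist n X = x # l" using l by (intro nth_equalityI) (auto simp: hist_def less_Suc_eq_le simp del: upt_Suc) }
qed

lemma countable_vertices: "countable (UNIV :: 'a set)"
  using countable_UN[of UNIV "gball undefined"] countable_finite[OF finite_gball]
  by (metis UNIV_I countable_subset[of UNIV] gball_def mem_Collect_eq order_refl subsetI UN_I countableI_type)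

lemma hist_single: "{X. hist n X = ys} \<in> sets (srw G v)"
proof -
  have "{X. hist n X = ys} = (if length ys = Suc n then (\<Inter>i\<in>{..n}. {X. X i = ys ! i}) else {})"
  proof (cases "length ys = Suc n")
    case True
    then obtain x l where "ys = x # l" "length l = n" by (metis length_Suc_conv)
    then show ?thesis using hist_eq_iff[of l n _ x] by auto
  qed (auto simp: hist_def)
  then show ?thesis using coordinate_event[of _ _ G v] by auto
qed

lemma hist_event: "{X. E (hist n X)} \<in> sets (srw G v)"
proof -
  have "{X. E (hist n X)} = (\<Union>ys\<in>{ys \<in> lists UNIV. E ys}. {X. hist n X = ys})" by auto
  moreover have "countable {ys \<in> lists (UNIV :: 'a set). E ys}"
    by (rule countable_subset[OF _ countable_lists[OF countable_vertices]]) auto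
  ultimately show ?thesis using hist_single by (simp only:) (rule sets.countable_UN'')
qed

lemma hist_path_prob:
  assumes "length l = n" shows "measure (srw G v) {X. hist n X = v # l} = pw v l"
proof -
  have "emeasure (srw G v) {X. hist n X = v # l} = ennreal (pw v l)"
    using emeasure_srw_cylinder[of G v n "\<lambda>i. (v # l) ! i"] assms
    by (simp add: hist_eq_iff pw_prod p_pmf)
  moreover have "pw v l \<ge> 0" by (simp add: pw_prod prod_nonneg p_nonneg)
  ultimately show ?thesis by (simp add: measure_def)
qed

lemma sum_pw: "(\<Sum>l\<in>paths n v. pw v l) = 1"
  using wexp_paths[of n v "\<lambda>_. 1"] wexp_const[of n v 1] by simp

lemma prob_hist: "measure (srw G v) {X. E (hist n X)} = wexp n v (\<lambda>l. of_bool (E (v # l)))"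
proof -
  interpret prob_space "srw G v" by (rule prob_space_srw)
  have "prob {X. E (hist n X)} = (\<Sum>l\<in>paths n v. prob {X. hist n X = v # l} * of_bool (E (v # l)))"
  proof (rule prob_eq_sum_partition[OF finite_paths])
    show "(\<Sum>l\<in>paths n v. prob {X. hist n X = v # l}) = 1"
      using sum_pw[where n = n and v = v] by (simp add: hist_path_prob length_paths cong: sum.cong)
  qed (auto simp: hist_single hist_event disjoint_family_on_def)
  also have "\<dots> = wexp n v (\<lambda>l. of_bool (E (v # l)))"
    unfolding wexp_paths by (intro sum.cong) (auto simp: hist_path_prob length_paths)
  finally show ?thesis .
qed

lemma prob_hist2:
  "measure (srw G v \<Otimes>\<^sub>M srw G v) {(X, Y). E (hist n X) (hist m Y)} =
    wexp n v (\<lambda>l. wexp m v (\<lambda>l'. of_bool (E (v # l) (v # l'))))"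
  and hist2_event: "{(X, Y). E (hist n X) (hist m Y)} \<in> sets (srw G v \<Otimes>\<^sub>M srw G v)"
proof -
  interpret S: prob_space "srw G v" by (rule prob_space_srw)
  interpret P: pair_prob_space "srw G v" "srw G v" ..
  let ?A = "\<lambda>(l, l'). {X. hist n X = l} \<times> {Y. hist m Y = l'}"
  have rect: "{X. hist n X = l} \<times> {Y. hist m Y = l'} \<in> sets (srw G v \<Otimes>\<^sub>M srw G v)" for l l'
    by (intro pair_measureI hist_single)
  let ?I = "{(l, l'). (l, l') \<in> lists UNIV \<times> lists (UNIV :: 'a set) \<and> E l l'}"
  have "{(X, Y). E (hist n X) (hist m Y)} = (\<Union>z\<in>?I. ?A z)" by auto
  moreover have "countable ?I"
    by (rule countable_subset[OF _ countable_SIGMA[OF countable_lists[OF countable_vertices] countable_lists[OF countable_vertices]]]) auto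
  ultimately show T: "{(X, Y). E (hist n X) (hist m Y)} \<in> sets (srw G v \<Otimes>\<^sub>M srw G v)"
    using rect by (simp only:) (rule sets.countable_UN'', auto)
  let ?J = "paths n v \<times> paths m v"
  let ?B = "\<lambda>(l, l'). {X. hist n X = v # l} \<times> {Y. hist m Y = v # l'}"
  have B: "P.prob ({X. hist n X = v # l} \<times> {Y. hist m Y = v # l'}) = pw v l * pw v l'" if "l \<in> paths n v" "l' \<in> paths m v" for l l'
  proof -
    have "P.prob ({X. hist n X = v # l} \<times> {Y. hist m Y = v # l'}) = S.prob {X. hist n X = v # l} * S.prob {Y. hist m Y = v # l'}"
      by (simp add: measure_def S.emeasure_pair_measure_Times hist_single enn2real_mult)
    then show ?thesis using that by (simp add: hist_path_prob length_paths)
  qed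
  have "P.prob {(X, Y). E (hist n X) (hist m Y)} = (\<Sum>z\<in>?J. P.prob (?B z) * of_bool (E (v # fst z) (v # snd z)))"
  proof (rule P.prob_eq_sum_partition)
    have "(\<Sum>z\<in>?J. P.prob (?B z)) = (\<Sum>l\<in>paths n v. \<Sum>l'\<in>paths m v. pw v l * pw v l')"
      by (subst sum.cartesian_product) (auto intro!: sum.cong simp: B)
    also have "\<dots> = 1" by (simp add: sum_distrib_left[symmetric] sum_pw)
    finally show "(\<Sum>z\<in>?J. P.prob (?B z)) = 1" .
  qed (auto simp: finite_paths T intro: rect simp: disjoint_family_on_def)
  also have "\<dots> = (\<Sum>l\<in>paths n v. \<Sum>l'\<in>paths m v. pw v l * pw v l' * of_bool (E (v # l) (v # l')))"
    by (subst sum.cartesian_product) (auto intro!: sum.cong simp: B)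
  also have "\<dots> = wexp n v (\<lambda>l. wexp m v (\<lambda>l'. of_bool (E (v # l) (v # l'))))"
    unfolding wexp_paths by (simp add: sum_distrib_left mult.assoc)
  finally show "measure (srw G v \<Otimes>\<^sub>M srw G v) {(X, Y). E (hist n X) (hist m Y)} =
    wexp n v (\<lambda>l. wexp m v (\<lambda>l'. of_bool (E (v # l) (v # l'))))" .
qed

lemma hist_nth: "i \<le> n \<Longrightarrow> hist n X ! i = X i"
  by (simp add: hist_def less_Suc_eq_le del: upt_Suc)

lemma trans_prob_eq: "trans_prob G n v y = pn n v y"
proof -
  have "trans_prob G n v y = measure (srw G v) {X. hist n X ! n = y}"
    by (simp add: trans_prob_def space_srw hist_nth)
  also have "\<dots> = wexp n v (\<lambda>l. of_bool ((v # l) ! n = y))" by (rule prob_hist)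
  also have "\<dots> = pn n v y" by (induction n arbitrary: v) auto
  finally show ?thesis .
qed

lemma nonint_prob_le:
  "nonint_prob G v \<le> wexp n v (\<lambda>l. wexp m v (\<lambda>l'. of_bool (v \<notin> set l \<and> v \<notin> set l' \<and> set l \<inter> set l' = {})))"
proof -
  interpret S: prob_space "srw G v" by (rule prob_space_srw)
  interpret P: pair_prob_space "srw G v" "srw G v" ..
  let ?E = "\<lambda>l l'. v \<notin> set (tl l) \<and> v \<notin> set (tl l') \<and> set (tl l) \<inter> set (tl l') = {}"
  have tl: "set (tl (hist k X)) \<subseteq> X ` {0<..}" for k and X :: "nat \<Rightarrow> 'a"
    by (auto simp: hist_def upt_conv_Cons simp del: upt_Suc)
  have "nonint_prob G v \<le> P.prob {(X, Y). ?E (hist n X) (hist m Y)}"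
    unfolding nonint_prob_def
  proof (rule P.finite_measure_mono[OF _ hist2_event[of ?E]], rule subsetI)
    fix z assume z: "z \<in> {(X, Y) \<in> space (srw G v \<Otimes>\<^sub>M srw G v). X ` {0<..} \<inter> Y ` {0<..} = {} \<and> v \<notin> X ` {0<..} \<and> v \<notin> Y ` {0<..}}"
    obtain X Y where XY: "z = (X, Y)" by (cases z)
    have "X ` {0<..} \<inter> Y ` {0<..} = {}" "v \<notin> X ` {0<..}" "v \<notin> Y ` {0<..}" using z unfolding XY by blast+
    then have "?E (hist n X) (hist m Y)" using tl[of n X] tl[of m Y] by blast
    then show "z \<in> {(X, Y). ?E (hist n X) (hist m Y)}" unfolding XY by simp
  qed
  also have "\<dots> = wexp n v (\<lambda>l. wexp m v (\<lambda>l'. of_bool (?E (v # l) (v # l'))))" by (rule prob_hist2)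
  finally show ?thesis by simp
qed

lemma wexp_hit: "wexp n' x (\<lambda>l. of_bool (\<exists>y\<in>set (x # l). y \<in> B)) = hitB B n' x"
proof (induction n' arbitrary: x)
  case (Suc n')
  show ?case
  proof (cases "x \<in> B")
    case True
    then show ?thesis using wexp_const[of "Suc n'" x 1] by simp
  next
    case False
    have "wexp (Suc n') x (\<lambda>l. of_bool (\<exists>y\<in>set (x # l). y \<in> B)) = PP (\<lambda>z. wexp n' z (\<lambda>l. of_bool (\<exists>y\<in>set (z # l). y \<in> B))) x"
      using False by simp
    then show ?thesis unfolding Suc.IH using False by simp
  qed
qed simp

lemma wexp_hit_after: "wexp (n + n') x (\<lambda>l. of_bool (\<exists>y\<in>set (drop n (x # l)). y \<in> B)) = (PP ^^ n) (hitB B n') x"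
proof (induction n arbitrary: x)
  case 0
  show ?case using wexp_hit[of n' x B] by simp
next
  case (Suc n)
  have "wexp (Suc n + n') x (\<lambda>l. of_bool (\<exists>y\<in>set (drop (Suc n) (x # l)). y \<in> B)) =
    PP (\<lambda>z. wexp (n + n') z (\<lambda>l. of_bool (\<exists>y\<in>set (drop n (z # l)). y \<in> B))) x" by simp
  then show ?case unfolding Suc.IH by simp
qed

text \<open>If the ball is visited between times \<open>n\<close> and \<open>n + n'\<close>, its
  last visit is not before \<open>n\<close>. For \<open>n \<ge> 1\<close> these events therefore
  number at most the time of the last visit; the term \<open>n = 0\<close> contributes the
  1.\<close>

lemma ballistic_bound:
  assumes C: "(\<integral>\<^sup>+X. ennreal_of_enat (last_visit G v (real r) X) \<partial>srw G v) \<le> ennreal c" and c: "0 \<le> c"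
  shows "(\<Sum>n<L. (PP ^^ n) (hitB (gball v r) n') v) \<le> 1 + c"
proof -
  interpret prob_space "srw G v" by (rule prob_space_srw)
  let ?H = "\<lambda>n. {X. \<exists>y\<in>set (drop n (hist (n + n') X)). y \<in> gball v r}"
  have H: "?H n \<in> events" for n by (rule hist_event)
  have pH: "prob (?H n) = (PP ^^ n) (hitB (gball v r) n') v" for n
    unfolding wexp_hit_after[symmetric] by (rule prob_hist)
  have late: "enat n \<le> last_visit G v (real r) X" if h: "X \<in> ?H n" for n X
  proof -
    obtain y where y: "y \<in> set (drop n (hist (n + n') X))" "y \<in> gball v r" using h by auto
    have "drop n (hist (n + n') X) = map X [n..<Suc (n + n')]" by (simp add: hist_def drop_map del: upt_Suc)
    then obtain k where k: "n \<le> k" "y = X k" using y(1) by (auto simp del: upt_Suc)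
    then have "enat n \<le> enat k" by simp
    also have "\<dots> \<le> last_visit G v (real r) X"
      unfolding last_visit_def using y(2) k by (intro SUP_upper) (auto simp: gball_def)
    finally show ?thesis .
  qed
  have pt: "(\<Sum>n\<in>{1..<L}. indicator (?H n) X) \<le> ennreal_of_enat (last_visit G v (real r) X)" for X
  proof (cases "last_visit G v (real r) X")
    case (enat k)
    have "(\<Sum>n\<in>{1..<L}. indicator (?H n) X :: ennreal) \<le> (\<Sum>n\<in>{1..<L}. of_bool (n \<in> {1..k}))"
    proof (rule sum_mono)
      fix n assume "n \<in> {1..<L}"
      then show "indicator (?H n) X \<le> (of_bool (n \<in> {1..k}) :: ennreal)"
        using late[of X n] enat by (cases "X \<in> ?H n") (auto simp del: set_drop_subset)
    qed
    also have "\<dots> = (\<Sum>n\<in>{1..<L} \<inter> {1..k}. 1)"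
      by (rule sum.mono_neutral_cong_right) auto
    also have "\<dots> = of_nat (card ({1..<L} \<inter> {1..k}))" by simp
    also have "\<dots> \<le> of_nat (card {1..k})" by (intro of_nat_mono card_mono) auto
    finally show ?thesis using enat by simp
  qed simp
  have "ennreal (\<Sum>n\<in>{1..<L}. prob (?H n)) = (\<Sum>n\<in>{1..<L}. emeasure (srw G v) (?H n))"
    unfolding emeasure_eq_measure by (rule sum_ennreal[symmetric]) simp
  also have "\<dots> = (\<integral>\<^sup>+X. (\<Sum>n\<in>{1..<L}. indicator (?H n) X) \<partial>srw G v)"
    using H by (subst nn_integral_sum) auto
  also have "\<dots> \<le> (\<integral>\<^sup>+X. ennreal_of_enat (last_visit G v (real r) X) \<partial>srw G v)" by (intro nn_integral_mono pt)
  also note C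
  finally have 1: "(\<Sum>n\<in>{1..<L}. prob (?H n)) \<le> c" using c by simp
  have "(\<Sum>n<L. prob (?H n)) \<le> prob (?H 0) + (\<Sum>n\<in>{1..<L}. prob (?H n))"
  proof (cases L)
    case (Suc k)
    have "{..<L} = insert 0 {1..<L}" using Suc by auto
    then show ?thesis by simp
  qed simp
  also have "\<dots> \<le> 1 + c" using 1 prob_le_1 by (intro add_mono) auto
  finally show ?thesis unfolding pH .
qed

end

section \<open>From the assumptions on the graph to the conclusion\<close>

lemma trans_prob_sum:
  assumes "finite (UNIV :: 'a set)"
  shows "(\<Sum>y\<in>UNIV. trans_prob (G :: 'a mgraph) n v y) = 1"
proof -
  interpret prob_space "srw G v" by (rule prob_space_srw)
  have "(\<Sum>y\<in>UNIV. prob {X. X n = y}) = prob (\<Union>y\<in>UNIV. {X. X n = y})"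
    using assms coordinate_event by (intro finite_measure_finite_Union[symmetric]) (auto simp: disjoint_family_on_def)
  also have "(\<Union>y\<in>UNIV. {X. X n = y}) = space (srw G v)" by (auto simp: space_srw)
  also have "prob (space (srw G v)) = 1" by (rule prob_space)
  finally show ?thesis by (simp add: trans_prob_def space_srw)
qed

lemma trans_prob_le_norm: "trans_prob G n u v \<le> enn2real (norm_1_inf G n)"
  and norm_1_inf_finite: "norm_1_inf G n < \<top>"
proof -
  have "trans_prob G n u v \<le> 1" for u v
  proof -
    interpret prob_space "srw G u" by (rule prob_space_srw)
    show ?thesis by (simp add: trans_prob_def)
  qed
  then have "norm_1_inf G n \<le> 1" unfolding norm_1_inf_def by (intro SUP_least) simp
  then show f: "norm_1_inf G n < \<top>" using ennreal_one_less_top by (rule order_le_less_trans)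
  have "ennreal (trans_prob G n u v) \<le> norm_1_inf G n"
    unfolding norm_1_inf_def by (intro SUP_upper2[of u] SUP_upper2[of v]) auto
  then have "enn2real (ennreal (trans_prob G n u v)) \<le> enn2real (norm_1_inf G n)" using f by (rule enn2real_mono)
  then show "trans_prob G n u v \<le> enn2real (norm_1_inf G n)" by (simp add: trans_prob_def)
qed

lemma summable_bubble:
  assumes "bubble_norm G < \<infinity>" shows "summable (\<lambda>n. real (n + 1) * enn2real (norm_1_inf G n))"
proof (rule summable_suminf_not_top)
  have "ennreal (real (n + 1) * enn2real (norm_1_inf G n)) = of_nat (n + 1) * norm_1_inf G n" for n
    using norm_1_inf_finite[of G n] by (simp add: ennreal_mult ennreal_of_nat_eq_real_of_nat del: of_nat_add of_nat_Suc)
  then show "(\<Sum>n. ennreal (real (n + 1) * enn2real (norm_1_inf G n))) \<noteq> \<top>"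
    using assms by (simp add: bubble_norm_def)
qed auto

text \<open>On finitely many vertices some transition probability is at least the reciprocal of
  their number at every time, and the series diverges.\<close>

lemma infinite_of_bubble:
  assumes "bubble_norm (G :: 'a mgraph) < \<infinity>" shows "infinite (UNIV :: 'a set)"
proof
  assume f: "finite (UNIV :: 'a set)"
  let ?c = "1 / real (card (UNIV :: 'a set))"
  have c: "0 < ?c" using f by (simp add: card_gt_0_iff)
  have "?c \<le> real (n + 1) * enn2real (norm_1_inf G n)" for n
  proof -
    have "1 = (\<Sum>y\<in>UNIV. trans_prob G n undefined y)" using trans_prob_sum[OF f] by simp
    also have "\<dots> \<le> (\<Sum>y\<in>(UNIV :: 'a set). enn2real (norm_1_inf G n))" by (intro sum_mono trans_prob_le_norm)
    also have "\<dots> = real (card (UNIV :: 'a set)) * enn2real (norm_1_inf G n)" by simp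
    finally have "?c \<le> enn2real (norm_1_inf G n)" using c by (simp add: field_simps)
    also have "\<dots> \<le> real (n + 1) * enn2real (norm_1_inf G n)" using mult_right_mono[of 1 "real (n + 1)" "enn2real (norm_1_inf G n)"] by simp
    finally show ?thesis .
  qed
  then have "summable (\<lambda>n::nat. ?c)"
    using c by (intro summable_comparison_test'[OF summable_bubble[OF assms], of 0]) auto
  then show False using c by (simp add: summable_const_iff)
qed

lemma connected_boundary:
  assumes G: "connected_graph G" and S: "S \<noteq> {}" "S \<noteq> UNIV"
  shows "\<exists>x\<in>S. \<exists>y. y \<notin> S \<and> y \<in># G x"
proof (rule ccontr)
  assume no: "\<not> ?thesis"
  obtain a b where ab: "a \<in> S" "b \<notin> S" using S by blast
  have "(a, b) \<in> (edge_rel G)\<^sup>*" using G by (simp add: connected_graph_def)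
  then have "b \<in> S" by (induction rule: rtrancl_induct) (use no ab in \<open>auto simp: edge_rel_def\<close>)
  then show False using ab by simp
qed

theorem theorem1p9:
  fixes G :: "'a mgraph"
  assumes "connected_graph G"
    and "bounded_degree G"
    and "uniformly_ballistic G"
    and "bubble_norm G < \<infinity>"
  shows "\<exists>a A :: real. 0 < a \<and> a \<le> A \<and>
    (\<forall>\<mu>. uniform_recurrent_sandpile_law G \<mu> \<longrightarrow> (\<forall>(v::'a) (n::nat). n \<ge> 1 \<longrightarrow>
       a * nonint_prob G v ^ 2 / real n
         \<le> measure \<mu> {\<eta> \<in> space \<mu>. diam_ext G (AvC G v \<eta>) \<ge> enat n} \<and>
       measure \<mu> {\<eta> \<in> space \<mu>. diam_ext G (AvC G v \<eta>) \<ge> enat n} \<le> A / real n \<and>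
       a * nonint_prob G v powr (5/2) * real n powr (-1/2)
         \<le> measure \<mu> {\<eta> \<in> space \<mu>. AvC_size G v \<eta> \<ge> of_nat n} \<and>
       measure \<mu> {\<eta> \<in> space \<mu>. AvC_size G v \<eta> \<ge> of_nat n} \<le> A * real n powr (-1/2) \<and>
       a * nonint_prob G v powr (5/2) * real n powr (-1/2)
         \<le> measure \<mu> {\<eta> \<in> space \<mu>. Av_size G v \<eta> \<ge> of_nat n} \<and>
       measure \<mu> {\<eta> \<in> space \<mu>. Av_size G v \<eta> \<ge> of_nat n} \<le> A * real n powr (-1/2)))"
proof -
  interpret sgraph G
  proof
    show "count (G x) y = count (G y) x" "x \<notin># G x" for x y using assms(1) by (auto simp: connected_graph_def)
    show "\<exists>x\<in>S. \<exists>y. y \<notin> S \<and> y \<in># G x" if "S \<noteq> {}" "S \<noteq> UNIV" for S by (rule connected_boundary[OF assms(1) that])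
    show "infinite (UNIV :: 'a set)" by (rule infinite_of_bubble[OF assms(4)])
  qed
  obtain D where D: "\<And>x. deg G x \<le> D" using assms(2) by (auto simp: bounded_degree_def)
  obtain C where C: "\<And>r. r \<ge> 1 \<Longrightarrow> (SUP v. \<integral>\<^sup>+X. ennreal_of_enat (last_visit G v r X) \<partial>srw G v) \<le> ennreal (C * r)"
    using assms(3) by (auto simp: uniformly_ballistic_def)
  \<comment> \<open>The summand 1 pays for time 0, using \<open>r \<ge> 1\<close>; the given
    constant may be negative, hence the maximum.\<close>
  interpret bgraph G "\<lambda>n. enn2real (norm_1_inf G n)" "real D" "1 + max C 0"
  proof
    show "pn n x y \<le> enn2real (norm_1_inf G n)" for n x y using trans_prob_le_norm[of G n x y] by (simp add: trans_prob_eq)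
    show "summable (\<lambda>n. real (n + 1) * enn2real (norm_1_inf G n))" by (rule summable_bubble[OF assms(4)])
    show "real (deg G x) \<le> real D" for x using D by simp
    fix r L n' :: nat and v assume r: "r \<ge> 1"
    have "(\<integral>\<^sup>+X. ennreal_of_enat (last_visit G v (real r) X) \<partial>srw G v) \<le> ennreal (C * real r)"
      using order_trans[OF SUP_upper[OF UNIV_I] C[of "real r"]] r by simp
    also have "\<dots> \<le> ennreal (max C 0 * real r)" by (intro ennreal_leI mult_right_mono) auto
    finally have "(\<Sum>n<L. (PP ^^ n) (hitB (gball v r) n') v) \<le> 1 + max C 0 * real r" by (rule ballistic_bound) simp
    also have "\<dots> \<le> (1 + max C 0) * real r" using r by (simp add: distrib_right)
    finally show "(\<Sum>n<L. (PP ^^ n) (hitB (gball v r) n') v) \<le> (1 + max C 0) * real r" .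
  qed
  have q: "nonint v (nonint_prob G v)" for v
    unfolding nonint_def using nonint_prob_le by (auto simp: nonint_prob_def)
  have sp: "space \<mu> = UNIV" if "uniform_recurrent_sandpile_law G \<mu>" for \<mu>
  proof -
    have "sets \<mu> = sets borel" using that by (simp add: uniform_recurrent_sandpile_law_def)
    from sets_eq_imp_space_eq[OF this] show ?thesis by simp
  qed
  obtain a A where aA: "0 < a" "a \<le> A" and bd: "\<forall>\<mu>. uniform_recurrent_sandpile_law G \<mu> \<longrightarrow> (\<forall>v n q. n \<ge> 1 \<longrightarrow> nonint v q \<longrightarrow>
       a * q ^ 2 / real n \<le> measure \<mu> {\<eta>. diam_ext G (AvC G v \<eta>) \<ge> enat n} \<and>
       measure \<mu> {\<eta>. diam_ext G (AvC G v \<eta>) \<ge> enat n} \<le> A / real n \<and>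
       a * q powr (5/2) * real n powr (-1/2) \<le> measure \<mu> {\<eta>. AvC_size G v \<eta> \<ge> of_nat n} \<and>
       measure \<mu> {\<eta>. AvC_size G v \<eta> \<ge> of_nat n} \<le> A * real n powr (-1/2) \<and>
       a * q powr (5/2) * real n powr (-1/2) \<le> measure \<mu> {\<eta>. Av_size G v \<eta> \<ge> of_nat n} \<and>
       measure \<mu> {\<eta>. Av_size G v \<eta> \<ge> of_nat n} \<le> A * real n powr (-1/2))"
    using avalanche_bounds by blast
  show ?thesis
  proof (rule exI[of _ a], rule exI[of _ A], rule conjI[OF aA(1) conjI[OF aA(2)]], intro allI impI)
    fix \<mu> :: "('a \<Rightarrow> nat) measure" and v :: 'a and n :: nat
    assume \<mu>: "uniform_recurrent_sandpile_law G \<mu>" and n: "1 \<le> n"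
    have c: "{\<eta> \<in> space \<mu>. Q \<eta>} = {\<eta>. Q \<eta>}" for Q using sp[OF \<mu>] by auto
    show "a * nonint_prob G v ^ 2 / real n
         \<le> measure \<mu> {\<eta> \<in> space \<mu>. diam_ext G (AvC G v \<eta>) \<ge> enat n} \<and>
       measure \<mu> {\<eta> \<in> space \<mu>. diam_ext G (AvC G v \<eta>) \<ge> enat n} \<le> A / real n \<and>
       a * nonint_prob G v powr (5/2) * real n powr (-1/2)
         \<le> measure \<mu> {\<eta> \<in> space \<mu>. AvC_size G v \<eta> \<ge> of_nat n} \<and>
       measure \<mu> {\<eta> \<in> space \<mu>. AvC_size G v \<eta> \<ge> of_nat n} \<le> A * real n powr (-1/2) \<and>
       a * nonint_prob G v powr (5/2) * real n powr (-1/2)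
         \<le> measure \<mu> {\<eta> \<in> space \<mu>. Av_size G v \<eta> \<ge> of_nat n} \<and>
       measure \<mu> {\<eta> \<in> space \<mu>. Av_size G v \<eta> \<ge> of_nat n} \<le> A * real n powr (-1/2)"
      unfolding c by (rule bd[rule_format, OF \<mu> n q])
  qed
qed

end
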